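(* Let $X_{\Delta_0}=\bigcup_{\sigma\in\Delta_0}A_\sigma$ be the complex toric variety defined by a fan $\Delta_0$ in $N_{\mathbb R}$, let $M^2\subset M$ be any sublattice, with associated group $G=\operatorname{Hom}_{\mathbb Z}(M/M^2,\mathbb C^* )\subset \operatorname{Hom}_{\mathbb Z}(M,\mathbb C^* )$ and map $\pi^\vee:N\to N^2$. Let $\Delta\subset\Delta_0$ be a subset of cones such that $U=\bigcup_{\sigma\in\Delta}A_\sigma$ is an open subset of $X_{\Delta_0}$. Then: (1) $U$ has a categorical quotient $U/\!/G$ by the action of $G$ if $\Delta$ is a locally coherent costring of the projection $\pi^\vee$ and every cone in $\pi^\vee(\Delta)=\{\pi^\vee(\sigma)\mid\sigma\in\Delta\}$ is strongly convex. In this case the quotient $U/\!/G$ is isomorphic to $X_{\pi^\vee(\Delta)}$, the toric variety defined by the induced fan $\pi^\vee(\Delta)$ in $N^2_{\mathbb R}$. (2) (In the situation of (1)) $U/\!/G$ is a geometric quotient if and only if $\dim\pi^\vee(\sigma)=\dim\sigma$ for all $\sigma\in\Delta$.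
   Context: $M\cong\mathbb Z^d$ is a lattice, $N=\operatorname{Hom}_{\mathbb Z}(M,\mathbb Z)$, $N_{\mathbb R}=N\otimes\mathbb R$. $\Delta_0$ is a finite fan of strongly convex rational polyhedral cones in $N_{\mathbb R}$ (not assumed complete or quasi-projective), $\sigma^\vee=\{v\in M_{\mathbb R}:\langle v,\sigma\rangle\ge0\}$ and $A_\sigma=\operatorname{Spec}\mathbb C[\sigma^\vee\cap M]$ is the affine open subset of $X_{\Delta_0}$ attached to $\sigma$. The torus $T=\operatorname{Hom}_{\mathbb Z}(M,\mathbb C^* )$ acts on $X_{\Delta_0}$. For a sublattice $M^2\subset M$, put $M^1=M/M^2$ (possibly with torsion); $G=\operatorname{Hom}_{\mathbb Z}(M^1,\mathbb C^* )$ is the kernel of $T\to\operatorname{Hom}_{\mathbb Z}(M^2,\mathbb C^* )$ (a torus times a finite group). $N^2=\operatorname{Hom}_{\mathbb Z}(M^2,\mathbb Z)$, and $\pi^\vee:N\to N^2$ is the map dual to the inclusion $M^2\subset M$; the same symbol denotes its $\mathbb R$-linear extension $N_{\mathbb R}\to N^2_{\mathbb R}$. A subcollection $\Delta\subset\Delta_0$ is a locally coherent costring of $\pi^\vee$ if: (i) the cones $\pi^\vee(\sigma)$, $\sigma\in\Delta$, form a cone subdivision of $\pi^\vee(|\Delta_0|)$ without repetition, i.e. they form a fan (closed under taking faces, any two meeting in a common face; cones not required a priori to be strongly convex) with union $\pi^\vee(|\Delta_0|)$, and distinct members of $\Delta$ have distinct images; (ii) for $\sigma,\sigma'\in\Delta$,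 $\pi^\vee(\sigma)\subset\pi^\vee(\sigma')$ if and only if $\sigma=(\pi^\vee)^{-1}(\pi^\vee(\sigma))\cap\sigma'$. Here $|\Delta_0|$ is the union of the cones of $\Delta_0$. *)

theory Defs
  imports
    "HOL-Analysis.Analysis"
    "HOL-Library.Function_Algebras"
    "HOL-Library.Poly_Mapping"
begin

section \<open>Complex algebraic prevarieties as spaces with functions\<close>

text \<open>
  Varieties are treated classically, through their complex points: a space with its Zariski
  topology and, for each open set \<open>W\<close>, the regular functions on \<open>W\<close>. Functions are total;
  only their values on \<open>W\<close> matter.
\<close>

record 'a fspace =
  fs_top :: "'a topology"
  fs_reg :: "'a set \<Rightarrow> ('a \<Rightarrow> complex) set"

abbreviation pts :: "'a fspace \<Rightarrow> 'a set" where
  "pts X \<equiv> topspace (fs_top X)"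

definition space_with_functions :: "'a fspace \<Rightarrow> bool" where
  "space_with_functions X \<longleftrightarrow>
     (\<forall>W. openin (fs_top X) W \<longrightarrow>
        (\<forall>c. (\<lambda>_. c) \<in> fs_reg X W) \<and>
        (\<forall>h\<in>fs_reg X W. \<forall>k\<in>fs_reg X W.
           (\<lambda>x. h x + k x) \<in> fs_reg X W \<and> (\<lambda>x. h x * k x) \<in> fs_reg X W) \<and>
        (\<forall>h\<in>fs_reg X W. \<forall>k. (\<forall>x\<in>W. k x = h x) \<longrightarrow> k \<in> fs_reg X W) \<and>
        (\<forall>h\<in>fs_reg X W. \<forall>V. openin (fs_top X) V \<and> V \<subseteq> W \<longrightarrow> h \<in> fs_reg X V) \<and>
        (\<forall>h. (\<forall>x\<in>W. \<exists>V. openin (fs_top X) V \<and> x \<in> V \<and> V \<subseteq> W \<and> h \<in> fs_reg X V)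
              \<longrightarrow> h \<in> fs_reg X W))"

definition morphism :: "'a fspace \<Rightarrow> 'b fspace \<Rightarrow> ('a \<Rightarrow> 'b) \<Rightarrow> bool" where
  "morphism X Y f \<longleftrightarrow>
     continuous_map (fs_top X) (fs_top Y) f \<and>
     (\<forall>V. openin (fs_top Y) V \<longrightarrow>
        (\<forall>h\<in>fs_reg Y V. (\<lambda>x. h (f x)) \<in> fs_reg X {x \<in> pts X. f x \<in> V}))"

definition isomorphic :: "'a fspace \<Rightarrow> 'b fspace \<Rightarrow> bool" where
  "isomorphic X Y \<longleftrightarrow>
     (\<exists>f g. morphism X Y f \<and> morphism Y X g \<and>
            (\<forall>x\<in>pts X. g (f x) = x) \<and> (\<forall>y\<in>pts Y. f (g y) = y))"

text \<open>The open subspace on an open set \<open>W\<close>.\<close>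

definition open_sub :: "'a fspace \<Rightarrow> 'a set \<Rightarrow> 'a fspace" where
  "open_sub X W = \<lparr>fs_top = subtopology (fs_top X) W, fs_reg = fs_reg X\<rparr>"

text \<open>
  The space with functions determined by a set \<open>X\<close> and an algebra \<open>A\<close> of functions on it:
  closed sets are the zero loci of subsets of \<open>A\<close>, regular functions are locally
  quotients of elements of \<open>A\<close>.
\<close>

definition zariski_open :: "'a set \<Rightarrow> ('a \<Rightarrow> complex) set \<Rightarrow> 'a set \<Rightarrow> bool" where
  "zariski_open X A W \<longleftrightarrow>
     W \<subseteq> X \<and> (\<exists>B\<subseteq>A. X - W = {x \<in> X. \<forall>f\<in>B. f x = 0})"

definition zariski :: "'a set \<Rightarrow> ('a \<Rightarrow> complex) set \<Rightarrow> 'a fspace" where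
  "zariski X A =
     \<lparr>fs_top = topology (zariski_open X A),
      fs_reg = (\<lambda>W. {h. \<forall>x\<in>W. \<exists>V. zariski_open X A V \<and> x \<in> V \<and> V \<subseteq> W \<and>
                  (\<exists>a\<in>A. \<exists>b\<in>A. \<forall>y\<in>V. b y \<noteq> 0 \<and> h y = a y / b y)})\<rparr>"

lemma zariski_openI:
  "W \<subseteq> X \<Longrightarrow> B \<subseteq> A \<Longrightarrow> X - W = {x \<in> X. \<forall>f\<in>B. f x = 0} \<Longrightarrow> zariski_open X A W"
  unfolding zariski_open_def by blast

lemma istopology_zariski_open:
  assumes mult: "\<And>f g. f \<in> A \<Longrightarrow> g \<in> A \<Longrightarrow> (\<lambda>x. f x * g x) \<in> A"
  shows "istopology (zariski_open X A)"
  unfolding istopology_def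
proof (intro conjI allI impI)
  fix S T assume "zariski_open X A S" "zariski_open X A T"
  then obtain B C where B: "B \<subseteq> A" "X - S = {x \<in> X. \<forall>f\<in>B. f x = 0}"
    and C: "C \<subseteq> A" "X - T = {x \<in> X. \<forall>f\<in>C. f x = 0}" and S: "S \<subseteq> X"
    unfolding zariski_open_def by blast
  let ?D = "(\<lambda>(f, g) x. f x * g x) ` (B \<times> C)"
  have "x \<in> X - S \<inter> T \<longleftrightarrow> x \<in> {x \<in> X. \<forall>h\<in>?D. h x = 0}" for x
  proof -
    have "x \<in> X - S \<inter> T \<longleftrightarrow> x \<in> X - S \<or> x \<in> X - T" by blast
    then show ?thesis unfolding B C by auto
  qed
  then have eq: "X - S \<inter> T = {x \<in> X. \<forall>h\<in>?D. h x = 0}" by (rule set_eqI)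
  have sub: "?D \<subseteq> A"
    using B(1) C(1) by (auto intro!: mult)
  show "zariski_open X A (S \<inter> T)"
    using S sub eq by (intro zariski_openI[of _ _ ?D] le_infI1)
next
  fix K assume "\<forall>W\<in>K. zariski_open X A W"
  then have sub: "\<forall>W\<in>K. W \<subseteq> X"
    and ex: "\<forall>W\<in>K. \<exists>B. B \<subseteq> A \<and> X - W = {x \<in> X. \<forall>f\<in>B. f x = 0}"
    unfolding zariski_open_def by auto
  from bchoice[OF ex] obtain B
    where B: "\<forall>W\<in>K. B W \<subseteq> A \<and> X - W = {x \<in> X. \<forall>f\<in>B W. f x = 0}" by (rule exE)
  have "x \<in> X - \<Union>K \<longleftrightarrow> x \<in> {x \<in> X. \<forall>f\<in>\<Union>(B ` K). f x = 0}" for x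
  proof -
    have "x \<in> X - \<Union>K \<longleftrightarrow> x \<in> X \<and> (\<forall>W\<in>K. x \<in> X - W)" by blast
    also have "\<dots> \<longleftrightarrow> x \<in> X \<and> (\<forall>W\<in>K. x \<in> {x \<in> X. \<forall>f\<in>B W. f x = 0})"
      using B by (intro conj_cong ball_cong refl) simp
    finally show ?thesis by blast
  qed
  then have eq: "X - \<Union>K = {x \<in> X. \<forall>f\<in>\<Union>(B ` K). f x = 0}" by (rule set_eqI)
  have "\<Union>(B ` K) \<subseteq> A" using B by (simp add: UN_least)
  moreover have "\<Union>K \<subseteq> X" using sub by (simp add: Sup_least)
  ultimately show "zariski_open X A (\<Union>K)" using eq by (intro zariski_openI[of _ _ "\<Union>(B ` K)"])
qed

text \<open>Affine \<open>n\<close>-space is the set of sequences vanishing from index \<open>n\<close> on.\<close>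

definition affine_space :: "nat \<Rightarrow> (nat \<Rightarrow> complex) set" where
  "affine_space n = {z. \<forall>i\<ge>n. z i = 0}"

inductive_set polyfun :: "nat \<Rightarrow> ((nat \<Rightarrow> complex) \<Rightarrow> complex) set" for n where
  const: "(\<lambda>_. c) \<in> polyfun n"
| coord: "i < n \<Longrightarrow> (\<lambda>z. z i) \<in> polyfun n"
| add: "p \<in> polyfun n \<Longrightarrow> q \<in> polyfun n \<Longrightarrow> (\<lambda>z. p z + q z) \<in> polyfun n"
| mult: "p \<in> polyfun n \<Longrightarrow> q \<in> polyfun n \<Longrightarrow> (\<lambda>z. p z * q z) \<in> polyfun n"

definition affine_variety :: "'a fspace \<Rightarrow> bool" where
  "affine_variety X \<longleftrightarrow>
     (\<exists>n P. P \<subseteq> polyfun n \<and>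
        isomorphic X (zariski {z \<in> affine_space n. \<forall>p\<in>P. p z = 0} (polyfun n)))"

definition prevariety :: "'a fspace \<Rightarrow> bool" where
  "prevariety X \<longleftrightarrow> space_with_functions X \<and>
     (\<exists>\<U>. finite \<U> \<and> \<Union>\<U> = pts X \<and>
        (\<forall>W\<in>\<U>. openin (fs_top X) W \<and> affine_variety (open_sub X W)))"


section \<open>Quotients\<close>

definition invariant_on :: "'g set \<Rightarrow> ('g \<Rightarrow> 'a \<Rightarrow> 'a) \<Rightarrow> 'a set \<Rightarrow> ('a \<Rightarrow> 'b) \<Rightarrow> bool" where
  "invariant_on G act W f \<longleftrightarrow> (\<forall>g\<in>G. \<forall>x\<in>W. f (act g x) = f x)"

text \<open>
  A prevariety is a finite union of affine pieces, so it injects into \<open>nat \<times> (nat \<Rightarrow> complex)\<close>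
  (number of a piece, coordinates on that piece) and is isomorphic to one carried by that type.
  Hence testing against prevarieties with points in this type tests against all of them, and in
  particular against all separated ones.
\<close>

type_synonym test_point = "nat \<times> (nat \<Rightarrow> complex)"

text \<open>
  The uniqueness clause concerns the factorization as a map on the points of \<open>Y\<close>, hence the
  normalisation by \<^const>\<open>extensional\<close>.
\<close>

definition categorical_quotient ::
  "'g set \<Rightarrow> ('g \<Rightarrow> 'a \<Rightarrow> 'a) \<Rightarrow> 'a fspace \<Rightarrow> 'b fspace \<Rightarrow> ('a \<Rightarrow> 'b) \<Rightarrow> bool" where
  "categorical_quotient G act X Y p \<longleftrightarrow>
     prevariety X \<and> prevariety Y \<and> morphism X Y p \<and> invariant_on G act (pts X) p \<and>
     (\<forall>(Z :: test_point fspace) f.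
        prevariety Z \<and> morphism X Z f \<and> invariant_on G act (pts X) f \<longrightarrow>
        (\<exists>!h. h \<in> extensional (pts Y) \<and> morphism Y Z h \<and> (\<forall>x\<in>pts X. h (p x) = f x)))"

text \<open>
  Mumford's conditions: invariance; surjectivity, with the orbits as fibres; submersiveness;
  and the regular functions of \<open>Y\<close> are the invariant regular functions of \<open>X\<close>.
\<close>

definition geometric_quotient ::
  "'g set \<Rightarrow> ('g \<Rightarrow> 'a \<Rightarrow> 'a) \<Rightarrow> 'a fspace \<Rightarrow> 'b fspace \<Rightarrow> ('a \<Rightarrow> 'b) \<Rightarrow> bool" where
  "geometric_quotient G act X Y p \<longleftrightarrow>
     prevariety X \<and> prevariety Y \<and> morphism X Y p \<and> invariant_on G act (pts X) p \<and>
     p ` pts X = pts Y \<and>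
     (\<forall>x\<in>pts X. \<forall>x'\<in>pts X. p x = p x' \<longleftrightarrow> (\<exists>g\<in>G. x' = act g x)) \<and>
     (\<forall>V\<subseteq>pts Y. openin (fs_top Y) V \<longleftrightarrow> openin (fs_top X) {x \<in> pts X. p x \<in> V}) \<and>
     (\<forall>V. openin (fs_top Y) V \<longrightarrow>
        (\<forall>k\<in>fs_reg X {x \<in> pts X. p x \<in> V}.
           invariant_on G act {x \<in> pts X. p x \<in> V} k \<longrightarrow>
           (\<exists>h\<in>fs_reg Y V. \<forall>x\<in>pts X. p x \<in> V \<longrightarrow> k x = h (p x))))"


section \<open>Lattices, cones and fans\<close>

instantiation "fun" :: (type, real_vector) real_vector
begin

definition scaleR_fun :: "real \<Rightarrow> ('a \<Rightarrow> 'b) \<Rightarrow> 'a \<Rightarrow> 'b" where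
  "scaleR_fun c f = (\<lambda>x. c *\<^sub>R f x)"

instance
  by standard (simp_all add: scaleR_fun_def fun_eq_iff scaleR_add_right scaleR_add_left)

end

text \<open>A lattice is a subset of an abelian group, isomorphic to some \<open>\<int>\<^sup>d\<close>.\<close>

definition lattice_set :: "'m::ab_group_add set \<Rightarrow> bool" where
  "lattice_set M \<longleftrightarrow>
     (\<exists>d \<phi>. bij_betw \<phi> {c :: nat \<Rightarrow> int. \<forall>i\<ge>d. c i = 0} M \<and>
        (\<forall>a b. (\<forall>i\<ge>d. a i = 0) \<and> (\<forall>i\<ge>d. b i = 0) \<longrightarrow> \<phi> (a + b) = \<phi> a + \<phi> b))"

definition sublattice :: "'m::ab_group_add set \<Rightarrow> 'm set \<Rightarrow> bool" where
  "sublattice L M \<longleftrightarrow> L \<subseteq> M \<and> 0 \<in> L \<and> (\<forall>a\<in>L. \<forall>b\<in>L. a - b \<in> L)"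

text \<open>
  For \<open>N = Hom(M, \<int>)\<close> the space \<open>N \<otimes> \<real>\<close> is \<open>Hom(M, \<real>)\<close>; its elements are extended by \<open>0\<close>
  outside \<open>M\<close>, so that linear operations are pointwise. With these conventions the map dual
  to an inclusion of lattices is restriction of functions.
\<close>

definition N_real :: "'m::ab_group_add set \<Rightarrow> ('m \<Rightarrow> real) set" where
  "N_real M = {u. (\<forall>a\<in>M. \<forall>b\<in>M. u (a + b) = u a + u b) \<and> (\<forall>a. a \<notin> M \<longrightarrow> u a = 0)}"

definition N_int :: "'m::ab_group_add set \<Rightarrow> ('m \<Rightarrow> real) set" where
  "N_int M = {u \<in> N_real M. \<forall>a\<in>M. u a \<in> \<int>}"

definition dual_proj :: "'m set \<Rightarrow> ('m \<Rightarrow> real) \<Rightarrow> ('m \<Rightarrow> real)" where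
  "dual_proj L u = (\<lambda>a. if a \<in> L then u a else 0)"

definition rational_cone :: "'m::ab_group_add set \<Rightarrow> ('m \<Rightarrow> real) set \<Rightarrow> bool" where
  "rational_cone M \<sigma> \<longleftrightarrow>
     (\<exists>S. finite S \<and> S \<subseteq> N_int M \<and>
          \<sigma> = {(\<Sum>u\<in>S. c u *\<^sub>R u) |c. \<forall>u\<in>S. 0 \<le> c u})"

definition strongly_convex :: "('m \<Rightarrow> real) set \<Rightarrow> bool" where
  "strongly_convex \<sigma> \<longleftrightarrow> \<sigma> \<inter> uminus ` \<sigma> = {0}"

text \<open>
  An element of \<open>M \<otimes> \<real>\<close> is given by a formal real combination \<open>v\<close> of elements of \<open>M\<close>;
  \<open>pairing v\<close> is the linear form it defines.
\<close>

definition pairing :: "('m \<Rightarrow>\<^sub>0 real) \<Rightarrow> ('m \<Rightarrow> real) \<Rightarrow> real" where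
  "pairing v u = (\<Sum>a\<in>Poly_Mapping.keys v. Poly_Mapping.lookup v a * u a)"

definition dual_cone :: "'m set \<Rightarrow> ('m \<Rightarrow> real) set \<Rightarrow> ('m \<Rightarrow>\<^sub>0 real) set" where
  "dual_cone M \<sigma> = {v. Poly_Mapping.keys v \<subseteq> M \<and> (\<forall>u\<in>\<sigma>. 0 \<le> pairing v u)}"

definition cone_face :: "'m set \<Rightarrow> ('m \<Rightarrow> real) set \<Rightarrow> ('m \<Rightarrow> real) set \<Rightarrow> bool" where
  "cone_face M \<tau> \<sigma> \<longleftrightarrow> (\<exists>v\<in>dual_cone M \<sigma>. \<tau> = {u \<in> \<sigma>. pairing v u = 0})"

text \<open>The cones are not required to be strongly convex here.\<close>

definition generalized_fan :: "'m::ab_group_add set \<Rightarrow> ('m \<Rightarrow> real) set set \<Rightarrow> bool" where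
  "generalized_fan M \<Delta> \<longleftrightarrow> finite \<Delta> \<and>
     (\<forall>\<sigma>\<in>\<Delta>. rational_cone M \<sigma>) \<and>
     (\<forall>\<sigma>\<in>\<Delta>. \<forall>\<tau>. cone_face M \<tau> \<sigma> \<longrightarrow> \<tau> \<in> \<Delta>) \<and>
     (\<forall>\<sigma>\<in>\<Delta>. \<forall>\<tau>\<in>\<Delta>. cone_face M (\<sigma> \<inter> \<tau>) \<sigma> \<and> cone_face M (\<sigma> \<inter> \<tau>) \<tau>)"

definition fan :: "'m::ab_group_add set \<Rightarrow> ('m \<Rightarrow> real) set set \<Rightarrow> bool" where
  "fan M \<Delta> \<longleftrightarrow> generalized_fan M \<Delta> \<and> (\<forall>\<sigma>\<in>\<Delta>. strongly_convex \<sigma>)"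

definition image_cones :: "'m set \<Rightarrow> ('m \<Rightarrow> real) set set \<Rightarrow> ('m \<Rightarrow> real) set set" where
  "image_cones L \<Delta> = (\<lambda>\<sigma>. dual_proj L ` \<sigma>) ` \<Delta>"

definition locally_coherent_costring ::
  "'m::ab_group_add set \<Rightarrow> 'm set \<Rightarrow> ('m \<Rightarrow> real) set set \<Rightarrow> ('m \<Rightarrow> real) set set \<Rightarrow> bool" where
  "locally_coherent_costring M L \<Delta>\<^sub>0 \<Delta> \<longleftrightarrow> \<Delta> \<subseteq> \<Delta>\<^sub>0 \<and>
     generalized_fan L (image_cones L \<Delta>) \<and>
     \<Union>(image_cones L \<Delta>) = dual_proj L ` \<Union>\<Delta>\<^sub>0 \<and>
     inj_on (\<lambda>\<sigma>. dual_proj L ` \<sigma>) \<Delta> \<and>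
     (\<forall>\<sigma>\<in>\<Delta>. \<forall>\<sigma>'\<in>\<Delta>. dual_proj L ` \<sigma> \<subseteq> dual_proj L ` \<sigma>' \<longleftrightarrow>
        \<sigma> = {u \<in> N_real M. dual_proj L u \<in> dual_proj L ` \<sigma>} \<inter> \<sigma>')"


section \<open>Toric varieties\<close>

text \<open>The monoid \<open>\<sigma>\<^sup>\<or> \<inter> M\<close>, and the monoid algebra \<open>\<complex>[S]\<close> inside \<open>'m \<Rightarrow>\<^sub>0 complex\<close>.\<close>

definition cone_monoid :: "'m set \<Rightarrow> ('m \<Rightarrow> real) set \<Rightarrow> 'm set" where
  "cone_monoid M \<sigma> = {m \<in> M. \<forall>u\<in>\<sigma>. 0 \<le> u m}"

definition monoid_algebra :: "'m set \<Rightarrow> ('m \<Rightarrow>\<^sub>0 complex) set" where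
  "monoid_algebra S = {f. Poly_Mapping.keys f \<subseteq> S}"

text \<open>
  Complex points of \<open>Spec \<complex>[S]\<close>: homomorphisms of \<open>\<complex>\<close>-algebras \<open>\<complex>[S] \<rightarrow> \<complex>\<close>, extended by \<open>0\<close>.
\<close>

type_synonym 'm alg_point = "('m \<Rightarrow>\<^sub>0 complex) \<Rightarrow> complex"

definition spec_points :: "'m::ab_group_add set \<Rightarrow> 'm alg_point set" where
  "spec_points S = {\<phi>.
     (\<forall>f\<in>monoid_algebra S. \<forall>g\<in>monoid_algebra S.
        \<phi> (f + g) = \<phi> f + \<phi> g \<and> \<phi> (f * g) = \<phi> f * \<phi> g) \<and>
     (\<forall>c. \<phi> (Poly_Mapping.single 0 c) = c) \<and>
     (\<forall>f. f \<notin> monoid_algebra S \<longrightarrow> \<phi> f = 0)}"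

definition restrict_point :: "'m set \<Rightarrow> 'm alg_point \<Rightarrow> 'm alg_point" where
  "restrict_point S \<phi> = (\<lambda>f. if f \<in> monoid_algebra S then \<phi> f else 0)"

definition affine_toric :: "'m::ab_group_add set \<Rightarrow> ('m \<Rightarrow> real) set \<Rightarrow> 'm alg_point fspace" where
  "affine_toric M \<sigma> =
     zariski (spec_points (cone_monoid M \<sigma>))
             ((\<lambda>f \<phi>. \<phi> f) ` monoid_algebra (cone_monoid M \<sigma>))"

text \<open>
  The charts of \<open>\<sigma>\<close> and \<open>\<tau>\<close> are glued along the chart of \<open>\<sigma> \<inter> \<tau>\<close>, which maps to both by
  restriction of homomorphisms.
\<close>

definition chart_points ::
  "'m::ab_group_add set \<Rightarrow> ('m \<Rightarrow> real) set set \<Rightarrow> (('m \<Rightarrow> real) set \<times> 'm alg_point) set" where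
  "chart_points M \<Delta> = (SIGMA \<sigma>:\<Delta>. spec_points (cone_monoid M \<sigma>))"

definition glue_rel ::
  "'m::ab_group_add set \<Rightarrow> ('m \<Rightarrow> real) set set \<Rightarrow>
     ((('m \<Rightarrow> real) set \<times> 'm alg_point) \<times> (('m \<Rightarrow> real) set \<times> 'm alg_point)) set" where
  "glue_rel M \<Delta> = {((\<sigma>, \<phi>), (\<tau>, \<psi>)) |\<sigma> \<phi> \<tau> \<psi>.
     (\<sigma>, \<phi>) \<in> chart_points M \<Delta> \<and> (\<tau>, \<psi>) \<in> chart_points M \<Delta> \<and>
     (\<exists>\<omega>\<in>spec_points (cone_monoid M (\<sigma> \<inter> \<tau>)).
        \<phi> = restrict_point (cone_monoid M \<sigma>) \<omega> \<and> \<psi> = restrict_point (cone_monoid M \<tau>) \<omega>)}"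

type_synonym 'm toric_point = "(('m \<Rightarrow> real) set \<times> 'm alg_point) set"

definition chart ::
  "'m::ab_group_add set \<Rightarrow> ('m \<Rightarrow> real) set set \<Rightarrow> ('m \<Rightarrow> real) set \<Rightarrow> 'm alg_point
     \<Rightarrow> 'm toric_point" where
  "chart M \<Delta> \<sigma> \<phi> = glue_rel M \<Delta> `` {(\<sigma>, \<phi>)}"

definition chart_preimage ::
  "'m::ab_group_add set \<Rightarrow> ('m \<Rightarrow> real) set set \<Rightarrow> ('m \<Rightarrow> real) set \<Rightarrow> 'm toric_point set
     \<Rightarrow> 'm alg_point set" where
  "chart_preimage M \<Delta> \<sigma> W = {\<phi> \<in> spec_points (cone_monoid M \<sigma>). chart M \<Delta> \<sigma> \<phi> \<in> W}"

definition toric_open_set ::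
  "'m::ab_group_add set \<Rightarrow> ('m \<Rightarrow> real) set set \<Rightarrow> 'm toric_point set \<Rightarrow> bool" where
  "toric_open_set M \<Delta> W \<longleftrightarrow>
     W \<subseteq> chart_points M \<Delta> // glue_rel M \<Delta> \<and>
     (\<forall>\<sigma>\<in>\<Delta>. openin (fs_top (affine_toric M \<sigma>)) (chart_preimage M \<Delta> \<sigma> W))"

definition toric_variety ::
  "'m::ab_group_add set \<Rightarrow> ('m \<Rightarrow> real) set set \<Rightarrow> 'm toric_point fspace" where
  "toric_variety M \<Delta> =
     \<lparr>fs_top = topology (toric_open_set M \<Delta>),
      fs_reg = (\<lambda>W. {h. \<forall>\<sigma>\<in>\<Delta>. (\<lambda>\<phi>. h (chart M \<Delta> \<sigma> \<phi>))
                            \<in> fs_reg (affine_toric M \<sigma>) (chart_preimage M \<Delta> \<sigma> W)})\<rparr>"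

lemma istopology_toric_open_set: "istopology (toric_open_set M \<Delta>)"
proof -
  have Int: "chart_preimage M \<Delta> \<sigma> (S \<inter> T) = chart_preimage M \<Delta> \<sigma> S \<inter> chart_preimage M \<Delta> \<sigma> T"
    for \<sigma> S T by (auto simp: chart_preimage_def)
  have Un: "chart_preimage M \<Delta> \<sigma> (\<Union>K) = (\<Union>S\<in>K. chart_preimage M \<Delta> \<sigma> S)" for \<sigma> K
    by (auto simp: chart_preimage_def)
  show ?thesis
    unfolding istopology_def toric_open_set_def Int Un
    by (intro conjI allI impI) (auto intro!: openin_Int openin_Union)
qed

text \<open>For \<open>\<Delta> \<subseteq> \<Delta>\<^sub>0\<close>, the union of the affine charts of the members of \<open>\<Delta>\<close>.\<close>

definition chart_union ::
  "'m::ab_group_add set \<Rightarrow> ('m \<Rightarrow> real) set set \<Rightarrow> ('m \<Rightarrow> real) set set \<Rightarrow> 'm toric_point set" where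
  "chart_union M \<Delta>\<^sub>0 \<Delta> = (\<Union>\<sigma>\<in>\<Delta>. chart M \<Delta>\<^sub>0 \<sigma> ` spec_points (cone_monoid M \<sigma>))"

text \<open>
  The torus \<open>Hom(M, \<complex>\<^sup>*)\<close>, its elements extended by \<open>1\<close> outside \<open>M\<close>; the subgroup
  \<open>Hom(M/L, \<complex>\<^sup>*)\<close> consists of the elements trivial on \<open>L\<close>.
\<close>

definition torus :: "'m::ab_group_add set \<Rightarrow> ('m \<Rightarrow> complex) set" where
  "torus M = {t. (\<forall>a\<in>M. \<forall>b\<in>M. t (a + b) = t a * t b) \<and> (\<forall>a\<in>M. t a \<noteq> 0) \<and>
                 (\<forall>a. a \<notin> M \<longrightarrow> t a = 1)}"

definition quotient_group :: "'m::ab_group_add set \<Rightarrow> 'm set \<Rightarrow> ('m \<Rightarrow> complex) set" where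
  "quotient_group M L = {t \<in> torus M. \<forall>a\<in>L. t a = 1}"

text \<open>\<open>t\<close> acts on a point \<open>\<phi>\<close> of a chart by \<open>(t \<cdot> \<phi>)(\<chi>\<^sup>m) = t(m) \<phi>(\<chi>\<^sup>m)\<close>.\<close>

definition twist :: "('m \<Rightarrow> complex) \<Rightarrow> ('m \<Rightarrow>\<^sub>0 complex) \<Rightarrow> ('m \<Rightarrow>\<^sub>0 complex)" where
  "twist t f = (\<Sum>m\<in>Poly_Mapping.keys f. Poly_Mapping.single m (t m * Poly_Mapping.lookup f m))"

definition torus_act :: "('m \<Rightarrow> complex) \<Rightarrow> 'm toric_point \<Rightarrow> 'm toric_point" where
  "torus_act t x = (\<lambda>(\<sigma>, \<phi>). (\<sigma>, \<lambda>f. \<phi> (twist t f))) ` x"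

end

theory Submission
  imports Defs
begin

text \<open>
  Write \<open>S\<^sub>\<sigma> = \<sigma>\<^sup>\<or> \<inter> M\<close> and \<open>\<pi>\<close> for the restriction of linear forms from \<open>M\<close> to \<open>L\<close> (the lattice
  \<open>M2\<close> of the theorem). A point of a chart is a monoid homomorphism \<open>S\<^sub>\<sigma> \<rightarrow> \<complex>\<close>, and everything is
  argued with such homomorphisms.

  \<^emph>\<open>One chart.\<close> The exponents \<open>m\<close> whose monomial is \<open>G\<close>-invariant are those of \<open>L\<close>, and
  \<open>S\<^sub>\<sigma> \<inter> L\<close> is the monoid of the cone \<open>\<pi> \<sigma>\<close>; so restriction to \<open>S\<^sub>\<sigma> \<inter> L\<close> should be the quotient
  map. A point of the smaller spectrum is nonzero on a face \<open>F\<close> of \<open>S\<^sub>\<sigma> \<inter> L\<close>. It extends to the face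
  of \<open>S\<^sub>\<sigma>\<close> generated by \<open>F\<close>, because \<open>\<complex>\<^sup>*\<close> is divisible, and by zero outside. Such polystable points
  represent the closed orbits; each fibre contains exactly one orbit of them (\<open>polystable_lift\<close>,
  \<open>polystable_orbit\<close>). At a polystable point a nonzero function can be multiplied by a monomial so
  that its \<open>G\<close>-invariant part is still nonzero there, and relations with \<open>G\<close>-invariant coefficients
  pass to invariant parts (\<open>shift_part_nonzero\<close>, \<open>shift_part_relation\<close>). This takes the place of
  the Nullstellensatz: it separates invariant closed sets from polystable points by invariant
  functions, and writes invariant regular functions as quotients of invariant functions.

  \<^emph>\<open>Gluing.\<close> Coherence says that \<open>\<pi> (\<sigma> \<inter> \<sigma>') = \<pi> \<sigma> \<inter> \<pi> \<sigma>'\<close> and that an element of \<open>L\<close> cutting out the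
  face \<open>\<pi> \<sigma> \<inter> \<pi> \<sigma>'\<close> also cuts out \<open>\<sigma> \<inter> \<sigma>'\<close> (\<open>coherent_meet\<close>). Hence the chart maps glue to a
  morphism \<open>quot\<close>, and the preimage of the chart of \<open>\<pi> \<sigma>\<close> is the chart of \<open>\<sigma>\<close>
  (\<open>quot_preimage_piece\<close>): the morphism is affine, and the results on one chart apply. An
  invariant morphism to a prevariety maps a polystable point into an affine piece, and a whole
  neighbourhood of the fibre goes there too; its coordinates are invariant functions, so it is
  constant on the fibre and factors through \<open>quot\<close> (\<open>categorical_quotient_quot\<close>).

  \<^emph>\<open>Geometric quotients.\<close> All of Mumford's conditions hold for \<open>quot\<close> except that fibres be
  orbits. The dimensions agree iff \<open>\<pi>\<close> is injective on the span of \<open>\<sigma>\<close>. In that case every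
  \<open>m \<in> M\<close> has a multiple that agrees on \<open>\<sigma>\<close> with an element of \<open>L\<close>, so every point is polystable and
  each fibre is a single orbit. Otherwise a vector of the span killed by \<open>\<pi>\<close> leads from the interior
  of \<open>\<sigma>\<close> to a proper face with the same image, and the distinguished points of \<open>\<sigma>\<close> and of that face
  lie in one fibre but not in one orbit (\<open>injective_if_orbits\<close>).

  Finally, two categorical quotients are isomorphic over \<open>X\<close>, and the isomorphism transports
  Mumford's conditions, so the criterion holds for every categorical quotient.

  Real cones are tied to the lattice by simultaneous Dirichlet approximation
  (\<open>lattice_approximation\<close>): a real solution of finitely many integral equations and strict
  inequalities can be multiplied and moved to an integral one, since a small integer is \<open>0\<close>.
\<close>

section \<open>Zariski spaces of algebras of functions\<close>

text \<open>Closure is only required up to equality on \<open>X\<close>: evaluation functions on the points of a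
  spectrum are additive and multiplicative on those points only.\<close>

definition function_algebra :: "'a set \<Rightarrow> ('a \<Rightarrow> complex) set \<Rightarrow> bool" where
  "function_algebra X A \<longleftrightarrow>
     (\<forall>c. \<exists>h\<in>A. \<forall>x\<in>X. h x = c) \<and>
     (\<forall>f\<in>A. \<forall>g\<in>A. (\<exists>h\<in>A. \<forall>x\<in>X. h x = f x + g x) \<and> (\<exists>h\<in>A. \<forall>x\<in>X. h x = f x * g x))"

lemma
  assumes "function_algebra X A"
  shows function_algebra_const: "\<exists>h\<in>A. \<forall>x\<in>X. h x = c"
    and function_algebra_add: "f \<in> A \<Longrightarrow> g \<in> A \<Longrightarrow> \<exists>h\<in>A. \<forall>x\<in>X. h x = f x + g x"
    and function_algebra_mult: "f \<in> A \<Longrightarrow> g \<in> A \<Longrightarrow> \<exists>h\<in>A. \<forall>x\<in>X. h x = f x * g x"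
  using assms unfolding function_algebra_def by simp_all

lemma zariski_open_iff:
  "zariski_open X A W \<longleftrightarrow>
     W \<subseteq> X \<and> (\<forall>x\<in>W. \<exists>f\<in>A. f x \<noteq> 0 \<and> (\<forall>y\<in>X. f y \<noteq> 0 \<longrightarrow> y \<in> W))"
proof
  assume "zariski_open X A W"
  then obtain B where W: "W \<subseteq> X" and B: "B \<subseteq> A" "X - W = {x \<in> X. \<forall>f\<in>B. f x = 0}"
    unfolding zariski_open_def by blast
  show "W \<subseteq> X \<and> (\<forall>x\<in>W. \<exists>f\<in>A. f x \<noteq> 0 \<and> (\<forall>y\<in>X. f y \<noteq> 0 \<longrightarrow> y \<in> W))"
  proof (intro conjI ballI W)
    fix x assume x: "x \<in> W"
    then have "x \<notin> {x \<in> X. \<forall>f\<in>B. f x = 0}" unfolding B(2)[symmetric] by simp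
    then obtain f where f: "f \<in> B" "f x \<noteq> 0" using x W by blast
    have "f y = 0" if "y \<in> X - W" for y using that f(1) unfolding B(2) by blast
    then have "\<forall>y\<in>X. f y \<noteq> 0 \<longrightarrow> y \<in> W" by blast
    then show "\<exists>f\<in>A. f x \<noteq> 0 \<and> (\<forall>y\<in>X. f y \<noteq> 0 \<longrightarrow> y \<in> W)" using f B(1) by blast
  qed
next
  assume r: "W \<subseteq> X \<and> (\<forall>x\<in>W. \<exists>f\<in>A. f x \<noteq> 0 \<and> (\<forall>y\<in>X. f y \<noteq> 0 \<longrightarrow> y \<in> W))"
  let ?B = "{f \<in> A. \<forall>y\<in>X - W. f y = 0}"
  have "X - W = {x \<in> X. \<forall>f\<in>?B. f x = 0}"
  proof (intro equalityI subsetI)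
    fix x assume x: "x \<in> {x \<in> X. \<forall>f\<in>?B. f x = 0}"
    have "x \<notin> W"
    proof
      assume "x \<in> W"
      then obtain f where "f \<in> A" "f x \<noteq> 0" "\<forall>y\<in>X. f y \<noteq> 0 \<longrightarrow> y \<in> W" using r by blast
      then have "f \<in> ?B" by blast
      then show False using x \<open>f x \<noteq> 0\<close> by blast
    qed
    then show "x \<in> X - W" using x by blast
  qed blast
  then show "zariski_open X A W" using r by (intro zariski_openI[of _ _ ?B]) simp_all
qed

lemma istopology_zariski:
  assumes "function_algebra X A"
  shows "istopology (zariski_open X A)"
  unfolding istopology_def zariski_open_iff
proof (intro conjI allI impI ballI)
  fix S T x
  assume S: "S \<subseteq> X \<and> (\<forall>x\<in>S. \<exists>f\<in>A. f x \<noteq> 0 \<and> (\<forall>y\<in>X. f y \<noteq> 0 \<longrightarrow> y \<in> S))"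
    and T: "T \<subseteq> X \<and> (\<forall>x\<in>T. \<exists>f\<in>A. f x \<noteq> 0 \<and> (\<forall>y\<in>X. f y \<noteq> 0 \<longrightarrow> y \<in> T))"
  show "S \<inter> T \<subseteq> X" using S by blast
  assume x: "x \<in> S \<inter> T"
  obtain f where f: "f \<in> A" "f x \<noteq> 0" "\<forall>y\<in>X. f y \<noteq> 0 \<longrightarrow> y \<in> S"
    using conjunct2[OF S] IntD1[OF x] by meson
  obtain g where g: "g \<in> A" "g x \<noteq> 0" "\<forall>y\<in>X. g y \<noteq> 0 \<longrightarrow> y \<in> T"
    using conjunct2[OF T] IntD2[OF x] by meson
  obtain h where h: "h \<in> A" "\<forall>x\<in>X. h x = f x * g x"
    using function_algebra_mult[OF assms f(1) g(1)] by blast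
  have "x \<in> X" using x S by blast
  then show "\<exists>f\<in>A. f x \<noteq> 0 \<and> (\<forall>y\<in>X. f y \<noteq> 0 \<longrightarrow> y \<in> S \<inter> T)"
    using h f g by (intro bexI[of _ h]) auto
next
  fix K
  assume K: "\<forall>W\<in>K. W \<subseteq> X \<and> (\<forall>x\<in>W. \<exists>f\<in>A. f x \<noteq> 0 \<and> (\<forall>y\<in>X. f y \<noteq> 0 \<longrightarrow> y \<in> W))"
  show "\<Union>K \<subseteq> X" using K by blast
  fix x assume "x \<in> \<Union>K"
  then obtain W where W: "W \<in> K" "x \<in> W" by blast
  then obtain f where "f \<in> A" "f x \<noteq> 0" "\<forall>y\<in>X. f y \<noteq> 0 \<longrightarrow> y \<in> W" using K by meson
  then show "\<exists>f\<in>A. f x \<noteq> 0 \<and> (\<forall>y\<in>X. f y \<noteq> 0 \<longrightarrow> y \<in> \<Union>K)" using W by blast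
qed

lemma openin_zariski:
  assumes "function_algebra X A"
  shows "openin (fs_top (zariski X A)) W \<longleftrightarrow>
     W \<subseteq> X \<and> (\<forall>x\<in>W. \<exists>f\<in>A. f x \<noteq> 0 \<and> (\<forall>y\<in>X. f y \<noteq> 0 \<longrightarrow> y \<in> W))"
  using istopology_zariski[OF assms] by (simp add: zariski_def topology_inverse' zariski_open_iff)

lemma pts_zariski:
  assumes "function_algebra X A"
  shows "pts (zariski X A) = X"
proof -
  obtain h where h: "h \<in> A" "\<forall>x\<in>X. h x = 1" using function_algebra_const[OF assms] by blast
  have "openin (fs_top (zariski X A)) X"
    unfolding openin_zariski[OF assms] using h by (auto intro!: bexI[of _ h])
  moreover have "W \<subseteq> X" if "openin (fs_top (zariski X A)) W" for W
    using that unfolding openin_zariski[OF assms] by blast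
  ultimately show ?thesis by (metis openin_subset openin_topspace subset_antisym)
qed

text \<open>A local quotient \<open>a / b\<close> on a principal open set \<open>{f \<noteq> 0}\<close> can be rewritten as
  \<open>(f a) / (f b)\<close>; the identity \<open>(f b) h = f a\<close> then holds on all of \<open>W\<close>, as both sides vanish
  where \<open>f\<close> does. So denominators may be cleared globally.\<close>

lemma fs_reg_zariski:
  assumes alg: "function_algebra X A" and W: "openin (fs_top (zariski X A)) W"
  shows "h \<in> fs_reg (zariski X A) W \<longleftrightarrow>
     (\<forall>x\<in>W. \<exists>a\<in>A. \<exists>b\<in>A. b x \<noteq> 0 \<and> (\<forall>y\<in>W. b y * h y = a y))"
proof
  assume "h \<in> fs_reg (zariski X A) W"
  then have r: "\<forall>x\<in>W. \<exists>V. zariski_open X A V \<and> x \<in> V \<and> V \<subseteq> W \<and>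
                  (\<exists>a\<in>A. \<exists>b\<in>A. \<forall>y\<in>V. b y \<noteq> 0 \<and> h y = a y / b y)"
    by (simp add: zariski_def)
  have WX: "W \<subseteq> X" using W unfolding openin_zariski[OF alg] by blast
  show "\<forall>x\<in>W. \<exists>a\<in>A. \<exists>b\<in>A. b x \<noteq> 0 \<and> (\<forall>y\<in>W. b y * h y = a y)"
  proof
    fix x assume x: "x \<in> W"
    from bspec[OF r x] obtain V a b where V: "zariski_open X A V" "x \<in> V" "V \<subseteq> W" and ab: "a \<in> A" "b \<in> A"
      "\<forall>y\<in>V. b y \<noteq> 0 \<and> h y = a y / b y"
      by (elim bexE exE conjE)
    then obtain f where f: "f \<in> A" "f x \<noteq> 0" "\<forall>y\<in>X. f y \<noteq> 0 \<longrightarrow> y \<in> V"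
      unfolding zariski_open_iff by meson
    obtain a' where a': "a' \<in> A" "\<forall>x\<in>X. a' x = f x * a x"
      using function_algebra_mult[OF alg f(1) ab(1)] by blast
    obtain b' where b': "b' \<in> A" "\<forall>x\<in>X. b' x = f x * b x"
      using function_algebra_mult[OF alg f(1) ab(2)] by blast
    have "b' x \<noteq> 0" using b' f V ab WX by auto
    moreover have "b' y * h y = a' y" if "y \<in> W" for y
    proof (cases "f y = 0")
      case True
      then show ?thesis using that WX a' b' by auto
    next
      case False
      then show ?thesis using that WX a' b' ab(3) f(3) by auto
    qed
    ultimately show "\<exists>a\<in>A. \<exists>b\<in>A. b x \<noteq> 0 \<and> (\<forall>y\<in>W. b y * h y = a y)"
      by (intro bexI[OF _ a'(1)] bexI[OF _ b'(1)]) simp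
  qed
next
  assume r: "\<forall>x\<in>W. \<exists>a\<in>A. \<exists>b\<in>A. b x \<noteq> 0 \<and> (\<forall>y\<in>W. b y * h y = a y)"
  have "\<exists>V. zariski_open X A V \<and> x \<in> V \<and> V \<subseteq> W \<and>
                  (\<exists>a\<in>A. \<exists>b\<in>A. \<forall>y\<in>V. b y \<noteq> 0 \<and> h y = a y / b y)" if x: "x \<in> W" for x
  proof -
    from bspec[OF r x] obtain a b where ab: "a \<in> A" "b \<in> A" "b x \<noteq> 0" "\<forall>y\<in>W. b y * h y = a y"
      by (elim bexE conjE)
    let ?V = "W \<inter> {y \<in> X. b y \<noteq> 0}"
    have "openin (fs_top (zariski X A)) {y \<in> X. b y \<noteq> 0}"
      unfolding openin_zariski[OF alg] using ab(2) by blast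
    then have "openin (fs_top (zariski X A)) ?V" using W by blast
    then have "zariski_open X A ?V" unfolding openin_zariski[OF alg] zariski_open_iff .
    moreover have "x \<in> ?V" using x ab W unfolding openin_zariski[OF alg] by blast
    moreover have "\<forall>y\<in>?V. b y \<noteq> 0 \<and> h y = a y / b y" using ab(4) by (auto simp: field_simps)
    ultimately show ?thesis using ab(1,2) by blast
  qed
  then show "h \<in> fs_reg (zariski X A) W" by (simp add: zariski_def)
qed

lemma space_with_functions_zariski:
  assumes alg: "function_algebra X A"
  shows "space_with_functions (zariski X A)"
  unfolding space_with_functions_def
proof (intro allI impI conjI ballI)
  fix W assume W: "openin (fs_top (zariski X A)) W"
  then have WX: "W \<subseteq> X" unfolding openin_zariski[OF alg] by blast
  note reg = fs_reg_zariski[OF alg W]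
  obtain one where one: "one \<in> A" "\<forall>x\<in>X. one x = 1"
    using function_algebra_const[OF alg] by blast
  show "(\<lambda>_. c) \<in> fs_reg (zariski X A) W" for c
  proof -
    obtain h where h: "h \<in> A" "\<forall>x\<in>X. h x = c"
      using function_algebra_const[OF alg] by blast
    show ?thesis unfolding reg using h one WX
      by (intro ballI bexI[OF _ h(1)] bexI[OF _ one(1)]) auto
  qed
  show "k \<in> fs_reg (zariski X A) W"
    if "h \<in> fs_reg (zariski X A) W" "\<forall>x\<in>W. k x = h x" for h k
    using that unfolding reg by simp
  show "h \<in> fs_reg (zariski X A) V"
    if h: "h \<in> fs_reg (zariski X A) W" and V: "openin (fs_top (zariski X A)) V \<and> V \<subseteq> W" for h V
    unfolding fs_reg_zariski[OF alg conjunct1[OF V]]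
  proof
    fix x assume "x \<in> V"
    then have "x \<in> W" using V by blast
    from bspec[OF h[unfolded reg] this] obtain a b
      where ab: "a \<in> A" "b \<in> A" "b x \<noteq> 0" "\<forall>y\<in>W. b y * h y = a y" by (elim bexE conjE)
    have "\<forall>y\<in>V. b y * h y = a y" using ab(4) V by (simp add: subset_iff)
    then show "\<exists>a\<in>A. \<exists>b\<in>A. b x \<noteq> 0 \<and> (\<forall>y\<in>V. b y * h y = a y)"
      using ab(3) by (intro bexI[OF _ ab(1)] bexI[OF _ ab(2)] conjI)
  qed
  show "h \<in> fs_reg (zariski X A) W"
    if *: "\<forall>x\<in>W. \<exists>V. openin (fs_top (zariski X A)) V \<and> x \<in> V \<and> V \<subseteq> W \<and> h \<in> fs_reg (zariski X A) V"
    for h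
  proof -
    have "\<exists>V. zariski_open X A V \<and> x \<in> V \<and> V \<subseteq> W \<and>
                  (\<exists>a\<in>A. \<exists>b\<in>A. \<forall>y\<in>V. b y \<noteq> 0 \<and> h y = a y / b y)" if x: "x \<in> W" for x
    proof -
      from bspec[OF * x] obtain V where V: "x \<in> V" "V \<subseteq> W" "h \<in> fs_reg (zariski X A) V"
        by (elim exE conjE)
      from V(3) have "\<forall>x\<in>V. \<exists>V'. zariski_open X A V' \<and> x \<in> V' \<and> V' \<subseteq> V \<and>
                  (\<exists>a\<in>A. \<exists>b\<in>A. \<forall>y\<in>V'. b y \<noteq> 0 \<and> h y = a y / b y)"
        by (simp add: zariski_def)
      from bspec[OF this V(1)] obtain V' where "zariski_open X A V'" "x \<in> V'" "V' \<subseteq> V"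
        "\<exists>a\<in>A. \<exists>b\<in>A. \<forall>y\<in>V'. b y \<noteq> 0 \<and> h y = a y / b y"
        by (elim exE conjE)
      with V(2) show ?thesis by (intro exI[of _ V'] conjI) (auto intro: order_trans)
    qed
    then show ?thesis by (simp add: zariski_def)
  qed
  fix h k assume h: "h \<in> fs_reg (zariski X A) W" and k: "k \<in> fs_reg (zariski X A) W"
  note plus = function_algebra_add[OF alg]
  note times = function_algebra_mult[OF alg]
  have ex: thesis
    if x: "x \<in> W" and that: "\<And>a b c d. a \<in> A \<Longrightarrow> b \<in> A \<Longrightarrow> c \<in> A \<Longrightarrow> d \<in> A \<Longrightarrow> b x \<noteq> 0 \<Longrightarrow> d x \<noteq> 0
      \<Longrightarrow> \<forall>y\<in>W. b y * h y = a y \<and> d y * k y = c y \<Longrightarrow> thesis" for x thesis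
  proof -
    from bspec[OF h[unfolded reg] x] obtain a b
      where 1: "a \<in> A" "b \<in> A" "b x \<noteq> 0" "\<forall>y\<in>W. b y * h y = a y" by (elim bexE conjE)
    from bspec[OF k[unfolded reg] x] obtain c d
      where 2: "c \<in> A" "d \<in> A" "d x \<noteq> 0" "\<forall>y\<in>W. d y * k y = c y" by (elim bexE conjE)
    show thesis using 1 2 by (intro that[of a b c d]) simp_all
  qed
  show "(\<lambda>x. h x + k x) \<in> fs_reg (zariski X A) W" unfolding reg
  proof
    fix x assume x: "x \<in> W"
    obtain a b c d where abcd: "a \<in> A" "b \<in> A" "c \<in> A" "d \<in> A" "b x \<noteq> 0" "d x \<noteq> 0"
      "\<forall>y\<in>W. b y * h y = a y \<and> d y * k y = c y" by (rule ex[OF x])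
    obtain bd where bd: "bd \<in> A" "\<forall>x\<in>X. bd x = b x * d x"
      using times[OF abcd(2) abcd(4)] by blast
    obtain ad where ad: "ad \<in> A" "\<forall>x\<in>X. ad x = a x * d x"
      using times[OF abcd(1) abcd(4)] by blast
    obtain bc where bc: "bc \<in> A" "\<forall>x\<in>X. bc x = b x * c x"
      using times[OF abcd(2) abcd(3)] by blast
    obtain s where s: "s \<in> A" "\<forall>x\<in>X. s x = ad x + bc x" using plus[OF ad(1) bc(1)] by blast
    have "bd y * (h y + k y) = s y" if y: "y \<in> W" for y
    proof -
      have "y \<in> X" using y WX by blast
      then have "s y = a y * d y + b y * c y" "bd y = b y * d y" using s ad bc bd by auto
      moreover have "a y = b y * h y" "c y = d y * k y" using abcd(7) y by auto
      ultimately show ?thesis by (simp add: algebra_simps)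
    qed
    moreover have "bd x \<noteq> 0" using x WX bd abcd by auto
    ultimately show "\<exists>a\<in>A. \<exists>b\<in>A. b x \<noteq> 0 \<and> (\<forall>y\<in>W. b y * (h y + k y) = a y)"
      by (intro bexI[OF _ s(1)] bexI[OF _ bd(1)]) simp
  qed
  show "(\<lambda>x. h x * k x) \<in> fs_reg (zariski X A) W" unfolding reg
  proof
    fix x assume x: "x \<in> W"
    obtain a b c d where abcd: "a \<in> A" "b \<in> A" "c \<in> A" "d \<in> A" "b x \<noteq> 0" "d x \<noteq> 0"
      "\<forall>y\<in>W. b y * h y = a y \<and> d y * k y = c y" by (rule ex[OF x])
    obtain bd where bd: "bd \<in> A" "\<forall>x\<in>X. bd x = b x * d x"
      using times[OF abcd(2) abcd(4)] by blast
    obtain ac where ac: "ac \<in> A" "\<forall>x\<in>X. ac x = a x * c x"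
      using times[OF abcd(1) abcd(3)] by blast
    have "bd y * (h y * k y) = ac y" if y: "y \<in> W" for y
    proof -
      have "y \<in> X" using y WX by blast
      then have "ac y = a y * c y" "bd y = b y * d y" using ac bd by auto
      moreover have "a y = b y * h y" "c y = d y * k y" using abcd(7) y by auto
      ultimately show ?thesis by (simp add: algebra_simps)
    qed
    moreover have "bd x \<noteq> 0" using x WX bd abcd by auto
    ultimately show "\<exists>a\<in>A. \<exists>b\<in>A. b x \<noteq> 0 \<and> (\<forall>y\<in>W. b y * (h y * k y) = a y)"
      by (intro bexI[OF _ ac(1)] bexI[OF _ bd(1)]) simp
  qed
qed

lemma morphism_zariski:
  assumes A: "function_algebra X A" and B: "function_algebra Y B"
    and F: "\<And>x. x \<in> X \<Longrightarrow> F x \<in> Y"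
    and pull: "\<And>b. b \<in> B \<Longrightarrow> \<exists>a\<in>A. \<forall>x\<in>X. a x = b (F x)"
  shows "morphism (zariski X A) (zariski Y B) F"
proof -
  have op: "openin (fs_top (zariski X A)) {x \<in> X. F x \<in> V}" if V: "openin (fs_top (zariski Y B)) V" for V
    unfolding openin_zariski[OF A]
  proof (intro conjI ballI)
    fix x assume "x \<in> {x \<in> X. F x \<in> V}"
    then have x: "x \<in> X" "F x \<in> V" by auto
    then obtain b where b: "b \<in> B" "b (F x) \<noteq> 0" "\<forall>y\<in>Y. b y \<noteq> 0 \<longrightarrow> y \<in> V"
      using V unfolding openin_zariski[OF B] by meson
    obtain a where "a \<in> A" "\<forall>x\<in>X. a x = b (F x)" using pull[OF b(1)] by blast
    then show "\<exists>f\<in>A. f x \<noteq> 0 \<and> (\<forall>y\<in>X. f y \<noteq> 0 \<longrightarrow> y \<in> {x \<in> X. F x \<in> V})"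
      using b x F by (intro bexI[of _ a]) auto
  qed blast
  show ?thesis unfolding morphism_def pts_zariski[OF A]
  proof (intro conjI allI impI ballI)
    show "continuous_map (fs_top (zariski X A)) (fs_top (zariski Y B)) F"
      unfolding continuous_map_def pts_zariski[OF A] pts_zariski[OF B] using op F by auto
    fix V h assume V: "openin (fs_top (zariski Y B)) V" and h: "h \<in> fs_reg (zariski Y B) V"
    show "(\<lambda>x. h (F x)) \<in> fs_reg (zariski X A) {x \<in> X. F x \<in> V}"
      unfolding fs_reg_zariski[OF A op[OF V]]
    proof
      fix x assume "x \<in> {x \<in> X. F x \<in> V}"
      then have x: "x \<in> X" "F x \<in> V" by auto
      from bspec[OF h[unfolded fs_reg_zariski[OF B V]] x(2)] obtain a b
        where ab: "a \<in> B" "b \<in> B" "b (F x) \<noteq> 0" "\<forall>y\<in>V. b y * h y = a y" by (elim bexE conjE)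
      obtain a' where a': "a' \<in> A" "\<forall>x\<in>X. a' x = a (F x)" using pull[OF ab(1)] by blast
      obtain b' where b': "b' \<in> A" "\<forall>x\<in>X. b' x = b (F x)" using pull[OF ab(2)] by blast
      show "\<exists>a\<in>A. \<exists>b\<in>A. b x \<noteq> 0 \<and> (\<forall>y\<in>{x \<in> X. F x \<in> V}. b y * h (F y) = a y)"
        using a' b' ab x by (intro bexI[OF _ a'(1)] bexI[OF _ b'(1)]) auto
    qed
  qed
qed

section \<open>Morphisms, open subspaces and transport of structure\<close>

lemma
  assumes X: "space_with_functions X" and W: "openin (fs_top X) W"
  shows swf_const: "(\<lambda>_. c) \<in> fs_reg X W"
    and swf_add: "h \<in> fs_reg X W \<Longrightarrow> k \<in> fs_reg X W \<Longrightarrow> (\<lambda>x. h x + k x) \<in> fs_reg X W"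
    and swf_mult: "h \<in> fs_reg X W \<Longrightarrow> k \<in> fs_reg X W \<Longrightarrow> (\<lambda>x. h x * k x) \<in> fs_reg X W"
    and swf_cong: "h \<in> fs_reg X W \<Longrightarrow> (\<And>x. x \<in> W \<Longrightarrow> k x = h x) \<Longrightarrow> k \<in> fs_reg X W"
    and swf_restrict: "h \<in> fs_reg X W \<Longrightarrow> openin (fs_top X) V \<Longrightarrow> V \<subseteq> W \<Longrightarrow> h \<in> fs_reg X V"
    and swf_local: "(\<And>x. x \<in> W \<Longrightarrow> \<exists>V. openin (fs_top X) V \<and> x \<in> V \<and> V \<subseteq> W \<and> h \<in> fs_reg X V)
      \<Longrightarrow> h \<in> fs_reg X W"
proof -
  note all = mp[OF spec[OF X[unfolded space_with_functions_def], of W] W]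
  note sum_prod = bspec[OF bspec[OF conjunct1[OF conjunct2[OF all]]]]
  note cong = conjunct1[OF conjunct2[OF conjunct2[OF all]]]
  note restrict = conjunct1[OF conjunct2[OF conjunct2[OF conjunct2[OF all]]]]
  note loc = conjunct2[OF conjunct2[OF conjunct2[OF conjunct2[OF all]]]]
  show "(\<lambda>_. c) \<in> fs_reg X W" by (rule spec[OF conjunct1[OF all]])
  show "(\<lambda>x. h x + k x) \<in> fs_reg X W" if "h \<in> fs_reg X W" "k \<in> fs_reg X W"
    by (rule conjunct1[OF sum_prod[OF that]])
  show "(\<lambda>x. h x * k x) \<in> fs_reg X W" if "h \<in> fs_reg X W" "k \<in> fs_reg X W"
    by (rule conjunct2[OF sum_prod[OF that]])
  show "k \<in> fs_reg X W" if "h \<in> fs_reg X W" "\<And>x. x \<in> W \<Longrightarrow> k x = h x"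
    by (rule mp[OF spec[OF bspec[OF cong that(1)]]]) (use that(2) in blast)
  show "h \<in> fs_reg X V" if "h \<in> fs_reg X W" "openin (fs_top X) V" "V \<subseteq> W"
    by (rule mp[OF spec[OF bspec[OF restrict that(1)]]]) (use that in blast)
  show "h \<in> fs_reg X W" if "\<And>x. x \<in> W \<Longrightarrow> \<exists>V. openin (fs_top X) V \<and> x \<in> V \<and> V \<subseteq> W \<and> h \<in> fs_reg X V"
    by (rule mp[OF spec[OF loc]]) (rule ballI[OF that])
qed

lemma morphism_pts: "morphism X Y f \<Longrightarrow> x \<in> pts X \<Longrightarrow> f x \<in> pts Y"
  unfolding morphism_def continuous_map_def by auto

lemma morphism_open:
  "morphism X Y f \<Longrightarrow> openin (fs_top Y) V \<Longrightarrow> openin (fs_top X) {x \<in> pts X. f x \<in> V}"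
  unfolding morphism_def continuous_map_def by auto

lemma morphism_reg:
  "morphism X Y f \<Longrightarrow> openin (fs_top Y) V \<Longrightarrow> h \<in> fs_reg Y V
    \<Longrightarrow> (\<lambda>x. h (f x)) \<in> fs_reg X {x \<in> pts X. f x \<in> V}"
  unfolding morphism_def by auto

lemma morphismI:
  assumes "\<And>x. x \<in> pts X \<Longrightarrow> f x \<in> pts Y"
    and "\<And>V. openin (fs_top Y) V \<Longrightarrow> openin (fs_top X) {x \<in> pts X. f x \<in> V}"
    and "\<And>V h. openin (fs_top Y) V \<Longrightarrow> h \<in> fs_reg Y V
          \<Longrightarrow> (\<lambda>x. h (f x)) \<in> fs_reg X {x \<in> pts X. f x \<in> V}"
  shows "morphism X Y f"
  using assms unfolding morphism_def continuous_map_def by auto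

lemma morphism_comp:
  assumes f: "morphism X Y f" and g: "morphism Y Z g"
  shows "morphism X Z (\<lambda>x. g (f x))"
proof (rule morphismI)
  have eq: "{x \<in> pts X. g (f x) \<in> V} = {x \<in> pts X. f x \<in> {y \<in> pts Y. g y \<in> V}}" for V
    using morphism_pts[OF f] by auto
  show "g (f x) \<in> pts Z" if "x \<in> pts X" for x using that morphism_pts f g by metis
  fix V assume V: "openin (fs_top Z) V"
  show "openin (fs_top X) {x \<in> pts X. g (f x) \<in> V}"
    unfolding eq by (intro morphism_open[OF f] morphism_open[OF g] V)
  fix h assume h: "h \<in> fs_reg Z V"
  show "(\<lambda>x. h (g (f x))) \<in> fs_reg X {x \<in> pts X. g (f x) \<in> V}"
    unfolding eq by (rule morphism_reg[OF f morphism_open[OF g V] morphism_reg[OF g V h]])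
qed

lemma morphism_cong:
  assumes f: "morphism X Y f" and X: "space_with_functions X" and fg: "\<And>x. x \<in> pts X \<Longrightarrow> g x = f x"
  shows "morphism X Y g"
proof (rule morphismI)
  have eq: "{x \<in> pts X. g x \<in> V} = {x \<in> pts X. f x \<in> V}" for V using fg by auto
  show "g x \<in> pts Y" if "x \<in> pts X" for x using that fg morphism_pts[OF f] by simp
  fix V assume V: "openin (fs_top Y) V"
  show "openin (fs_top X) {x \<in> pts X. g x \<in> V}" unfolding eq by (rule morphism_open[OF f V])
  fix h assume "h \<in> fs_reg Y V"
  from swf_cong[OF X morphism_open[OF f V] morphism_reg[OF f V this]]
  show "(\<lambda>x. h (g x)) \<in> fs_reg X {x \<in> pts X. g x \<in> V}" unfolding eq by (simp add: fg)
qed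

lemma isomorphic_trans:
  assumes "isomorphic X Y" "isomorphic Y Z"
  shows "isomorphic X Z"
proof -
  obtain f g where f: "morphism X Y f" "morphism Y X g" "\<forall>x\<in>pts X. g (f x) = x" "\<forall>y\<in>pts Y. f (g y) = y"
    using assms(1) unfolding isomorphic_def by blast
  obtain h k where h: "morphism Y Z h" "morphism Z Y k" "\<forall>x\<in>pts Y. k (h x) = x" "\<forall>y\<in>pts Z. h (k y) = y"
    using assms(2) unfolding isomorphic_def by blast
  show ?thesis unfolding isomorphic_def
    using morphism_comp[OF f(1) h(1)] morphism_comp[OF h(2) f(2)] f(3,4) h(3,4)
      morphism_pts[OF f(1)] morphism_pts[OF h(2)]
    by (intro exI[of _ "\<lambda>x. h (f x)"] exI[of _ "\<lambda>x. g (k x)"]) auto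
qed

lemma affine_variety_isomorphic: "isomorphic X Y \<Longrightarrow> affine_variety Y \<Longrightarrow> affine_variety X"
  unfolding affine_variety_def using isomorphic_trans by blast

lemma openin_open_sub:
  "openin (fs_top X) W \<Longrightarrow> openin (fs_top (open_sub X W)) V \<longleftrightarrow> openin (fs_top X) V \<and> V \<subseteq> W"
  by (simp add: open_sub_def openin_open_subtopology)

lemma fs_reg_open_sub: "fs_reg (open_sub X W) = fs_reg X"
  by (simp add: open_sub_def)

lemma pts_open_sub: "openin (fs_top X) W \<Longrightarrow> pts (open_sub X W) = W"
  by (simp add: open_sub_def openin_subset Int_absorb1)

lemma open_sub_open_sub: "V \<subseteq> W \<Longrightarrow> open_sub (open_sub X W) V = open_sub X V"
  by (simp add: open_sub_def subtopology_subtopology Int_absorb1)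

lemma space_with_functions_open_sub:
  assumes X: "space_with_functions X" and W: "openin (fs_top X) W"
  shows "space_with_functions (open_sub X W)"
proof -
  show ?thesis
    unfolding space_with_functions_def openin_open_sub[OF W] fs_reg_open_sub
  proof (intro allI impI conjI ballI)
    fix V assume V: "openin (fs_top X) V \<and> V \<subseteq> W"
    note V' = conjunct1[OF V]
    show "(\<lambda>_. c) \<in> fs_reg X V" for c by (rule swf_const[OF X V'])
    show "(\<lambda>x. h x + k x) \<in> fs_reg X V" if "h \<in> fs_reg X V" "k \<in> fs_reg X V" for h k
      by (rule swf_add[OF X V' that(1) that(2)])
    show "(\<lambda>x. h x * k x) \<in> fs_reg X V" if "h \<in> fs_reg X V" "k \<in> fs_reg X V" for h k
      by (rule swf_mult[OF X V' that(1) that(2)])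
    show "k \<in> fs_reg X V" if "h \<in> fs_reg X V" "\<forall>x\<in>V. k x = h x" for h k
      by (rule swf_cong[OF X V' that(1)]) (use that(2) in simp)
    show "h \<in> fs_reg X V'"
      if "h \<in> fs_reg X V" "(openin (fs_top X) V' \<and> V' \<subseteq> W) \<and> V' \<subseteq> V" for h V'
      by (rule swf_restrict[OF X V' that(1)]) (use that(2) in simp_all)
    show "h \<in> fs_reg X V"
      if "\<forall>x\<in>V. \<exists>V'. (openin (fs_top X) V' \<and> V' \<subseteq> W) \<and> x \<in> V' \<and> V' \<subseteq> V \<and> h \<in> fs_reg X V'" for h
    proof (rule swf_local[OF X V'])
      fix x assume "x \<in> V"
      from bspec[OF that this] show "\<exists>V'. openin (fs_top X) V' \<and> x \<in> V' \<and> V' \<subseteq> V \<and> h \<in> fs_reg X V'"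
        by (elim ex_forward) simp
    qed
  qed
qed

lemma morphism_restrict:
  assumes f: "morphism X Y f" and X: "space_with_functions X" and W: "openin (fs_top X) W" and V: "openin (fs_top Y) V"
    and im: "\<And>x. x \<in> W \<Longrightarrow> f x \<in> V"
  shows "morphism (open_sub X W) (open_sub Y V) f"
proof (rule morphismI)
  have eq: "{x \<in> W. f x \<in> U} = {x \<in> pts X. f x \<in> U} \<inter> W" for U
    using openin_subset[OF W] by auto
  show "f x \<in> pts (open_sub Y V)" if "x \<in> pts (open_sub X W)" for x
    using that im by (simp add: pts_open_sub W V)
  fix U assume "openin (fs_top (open_sub Y V)) U"
  then have U: "openin (fs_top Y) U" unfolding openin_open_sub[OF V] by blast
  have op: "openin (fs_top X) {x \<in> W. f x \<in> U}" unfolding eq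
    by (intro openin_Int morphism_open[OF f] U W)
  then show "openin (fs_top (open_sub X W)) {x \<in> pts (open_sub X W). f x \<in> U}"
    unfolding openin_open_sub[OF W] pts_open_sub[OF W] by blast
  fix h assume h: "h \<in> fs_reg (open_sub Y V) U"
  show "(\<lambda>x. h (f x)) \<in> fs_reg (open_sub X W) {x \<in> pts (open_sub X W). f x \<in> U}"
    unfolding fs_reg_open_sub pts_open_sub[OF W]
    using h openin_subset[OF W] unfolding fs_reg_open_sub
    by (intro swf_restrict[OF X morphism_open[OF f U] morphism_reg[OF f U] op]) auto
qed

definition transport :: "('a \<Rightarrow> 'b) \<Rightarrow> 'a fspace \<Rightarrow> 'b fspace" where
  "transport j X = \<lparr>fs_top = topology (\<lambda>W. W \<subseteq> j ` pts X \<and> openin (fs_top X) {x \<in> pts X. j x \<in> W}),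
     fs_reg = (\<lambda>W. {h. (\<lambda>x. h (j x)) \<in> fs_reg X {x \<in> pts X. j x \<in> W}})\<rparr>"

lemma openin_transport:
  "openin (fs_top (transport j X)) W \<longleftrightarrow> W \<subseteq> j ` pts X \<and> openin (fs_top X) {x \<in> pts X. j x \<in> W}"
proof -
  have "istopology (\<lambda>W. W \<subseteq> j ` pts X \<and> openin (fs_top X) {x \<in> pts X. j x \<in> W})"
    unfolding istopology_def
  proof (intro conjI allI impI)
    fix S T assume *: "S \<subseteq> j ` pts X \<and> openin (fs_top X) {x \<in> pts X. j x \<in> S}"
      "T \<subseteq> j ` pts X \<and> openin (fs_top X) {x \<in> pts X. j x \<in> T}"
    have "{x \<in> pts X. j x \<in> S \<inter> T} = {x \<in> pts X. j x \<in> S} \<inter> {x \<in> pts X. j x \<in> T}" by blast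
    then show "openin (fs_top X) {x \<in> pts X. j x \<in> S \<inter> T}" using * by (simp add: openin_Int)
    show "S \<inter> T \<subseteq> j ` pts X" using * by blast
  next
    fix K assume *: "\<forall>W\<in>K. W \<subseteq> j ` pts X \<and> openin (fs_top X) {x \<in> pts X. j x \<in> W}"
    have "{x \<in> pts X. j x \<in> \<Union>K} = (\<Union>W\<in>K. {x \<in> pts X. j x \<in> W})" by blast
    then show "openin (fs_top X) {x \<in> pts X. j x \<in> \<Union>K}" using * by auto
    show "\<Union>K \<subseteq> j ` pts X" using * by blast
  qed
  then show ?thesis by (simp add: transport_def topology_inverse')
qed

lemma fs_reg_transport:
  "h \<in> fs_reg (transport j X) W \<longleftrightarrow> (\<lambda>x. h (j x)) \<in> fs_reg X {x \<in> pts X. j x \<in> W}"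
  by (simp add: transport_def)

lemma pts_transport: "pts (transport j X) = j ` pts X"
proof -
  have "{x \<in> pts X. j x \<in> j ` pts X} = pts X" by blast
  then have "openin (fs_top (transport j X)) (j ` pts X)" unfolding openin_transport by simp
  then have "j ` pts X \<subseteq> pts (transport j X)" by (rule openin_subset)
  moreover have "pts (transport j X) \<subseteq> j ` pts X"
    using openin_topspace[of "fs_top (transport j X)"] unfolding openin_transport by (rule conjunct1)
  ultimately show ?thesis by blast
qed

lemma space_with_functions_transport:
  assumes X: "space_with_functions X"
  shows "space_with_functions (transport j X)"
  unfolding space_with_functions_def openin_transport fs_reg_transport
proof (intro allI impI conjI ballI)
  fix W assume W: "W \<subseteq> j ` pts X \<and> openin (fs_top X) {x \<in> pts X. j x \<in> W}"
  let ?W = "{x \<in> pts X. j x \<in> W}"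
  have op: "openin (fs_top X) ?W" using W by blast
  show "(\<lambda>x. c) \<in> fs_reg X ?W" for c using swf_const[OF X op] .
  fix h assume h: "h \<in> fs_reg (transport j X) W"
  then have h': "(\<lambda>x. h (j x)) \<in> fs_reg X ?W" unfolding fs_reg_transport .
  show "(\<lambda>x. h (j x) + k (j x)) \<in> fs_reg X ?W" if "k \<in> fs_reg (transport j X) W" for k
    using swf_add[OF X op h' that[unfolded fs_reg_transport]] .
  show "(\<lambda>x. h (j x) * k (j x)) \<in> fs_reg X ?W" if "k \<in> fs_reg (transport j X) W" for k
    using swf_mult[OF X op h' that[unfolded fs_reg_transport]] .
  show "(\<lambda>x. k (j x)) \<in> fs_reg X ?W" if "\<forall>x\<in>W. k x = h x" for k
    using swf_cong[OF X op h'] that by simp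
  show "(\<lambda>x. h (j x)) \<in> fs_reg X {x \<in> pts X. j x \<in> V}"
    if "(V \<subseteq> j ` pts X \<and> openin (fs_top X) {x \<in> pts X. j x \<in> V}) \<and> V \<subseteq> W" for V
    using that by (intro swf_restrict[OF X op h']) auto
next
  fix W h assume W: "W \<subseteq> j ` pts X \<and> openin (fs_top X) {x \<in> pts X. j x \<in> W}"
    and loc: "\<forall>x\<in>W. \<exists>V. (V \<subseteq> j ` pts X \<and> openin (fs_top X) {x \<in> pts X. j x \<in> V}) \<and> x \<in> V \<and> V \<subseteq> W \<and>
               (\<lambda>x. h (j x)) \<in> fs_reg X {x \<in> pts X. j x \<in> V}"
  let ?W = "{x \<in> pts X. j x \<in> W}"
  show "(\<lambda>x. h (j x)) \<in> fs_reg X ?W"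
  proof (rule swf_local[OF X])
    fix x assume x: "x \<in> ?W"
    then have "j x \<in> W" by simp
    from bspec[OF loc this] obtain V where V: "openin (fs_top X) {x \<in> pts X. j x \<in> V}" "j x \<in> V" "V \<subseteq> W"
      "(\<lambda>x. h (j x)) \<in> fs_reg X {x \<in> pts X. j x \<in> V}"
      by (elim exE conjE)
    then show "\<exists>V. openin (fs_top X) V \<and> x \<in> V \<and> V \<subseteq> ?W \<and> (\<lambda>x. h (j x)) \<in> fs_reg X V"
      using x by (intro exI[of _ "{x \<in> pts X. j x \<in> V}"]) auto
  qed (use W in blast)
qed

lemma
  assumes X: "space_with_functions X" and inj: "inj_on j (pts X)"
  shows morphism_to_transport: "morphism X (transport j X) j"
    and morphism_from_transport: "morphism (transport j X) X (inv_into (pts X) j)"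
proof -
  show "morphism X (transport j X) j"
    by (rule morphismI) (auto simp: pts_transport openin_transport fs_reg_transport)
  have inv: "inv_into (pts X) j (j x) = x" if "x \<in> pts X" for x using inj that by simp
  show "morphism (transport j X) X (inv_into (pts X) j)"
  proof (rule morphismI)
    show "inv_into (pts X) j y \<in> pts X" if "y \<in> pts (transport j X)" for y
      using that inv by (auto simp: pts_transport)
    fix V assume V: "openin (fs_top X) V"
    let ?V = "{y \<in> pts (transport j X). inv_into (pts X) j y \<in> V}"
    have "j x \<in> ?V \<longleftrightarrow> x \<in> V" if "x \<in> pts X" for x using that inv by (simp add: pts_transport)
    then have eq: "{x \<in> pts X. j x \<in> ?V} = V" using openin_subset[OF V] by blast
    show "openin (fs_top (transport j X)) ?V"
      unfolding openin_transport eq using V by (simp add: pts_transport subset_iff)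
    fix h assume h: "h \<in> fs_reg X V"
    show "(\<lambda>y. h (inv_into (pts X) j y)) \<in> fs_reg (transport j X) ?V"
      unfolding fs_reg_transport eq
      using openin_subset[OF V] inv by (intro swf_cong[OF X V h]) auto
  qed
qed

text \<open>Stated with explicit morphisms, as the space \<open>Y\<close> carries no affine cover yet: its cover is pulled
  back from that of \<open>X\<close>.\<close>

lemma prevariety_isomorphic:
  assumes X: "prevariety X" and Y: "space_with_functions Y" and f: "morphism X Y f" and g: "morphism Y X g"
    and gf: "\<And>x. x \<in> pts X \<Longrightarrow> g (f x) = x" and fg: "\<And>y. y \<in> pts Y \<Longrightarrow> f (g y) = y"
  shows "prevariety Y"
proof -
  have sX: "space_with_functions X" using X unfolding prevariety_def by blast
  obtain \<U> where U: "finite \<U>" "\<Union>\<U> = pts X" "\<And>W. W \<in> \<U> \<Longrightarrow> openin (fs_top X) W"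
    "\<And>W. W \<in> \<U> \<Longrightarrow> affine_variety (open_sub X W)"
    using X unfolding prevariety_def by blast
  let ?P = "\<lambda>W. {y \<in> pts Y. g y \<in> W}"
  have op: "openin (fs_top Y) (?P W)" if "W \<in> \<U>" for W using morphism_open[OF g U(3)[OF that]] .
  have "affine_variety (open_sub Y (?P W))" if W: "W \<in> \<U>" for W
  proof (rule affine_variety_isomorphic[OF _ U(4)[OF W]])
    have f': "morphism (open_sub X W) (open_sub Y (?P W)) f"
      using openin_subset[OF U(3)[OF W]] gf morphism_pts[OF f]
      by (intro morphism_restrict f sX U(3) W op) auto
    have g': "morphism (open_sub Y (?P W)) (open_sub X W) g"
      by (intro morphism_restrict g Y U(3) W op) auto
    show "isomorphic (open_sub Y (?P W)) (open_sub X W)"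
      unfolding isomorphic_def
      using f' g' fg gf openin_subset[OF U(3)[OF W]] by (intro exI[of _ g] exI[of _ f])
        (auto simp: pts_open_sub op[OF W] U(3)[OF W])
  qed
  moreover have "(\<Union>W\<in>\<U>. ?P W) = pts Y" using U(2) morphism_pts[OF g] by auto
  ultimately show ?thesis unfolding prevariety_def
    using Y U(1) op by (intro conjI exI[of _ "?P ` \<U>"]) auto
qed

text \<open>A point is recorded by the number of an affine piece that contains it together with its
  coordinates there; transporting along this injection realises any prevariety on the type
  \<^typ>\<open>test_point\<close> over which the universal property quantifies.\<close>

lemma prevariety_test_model:
  assumes X: "prevariety X"
  obtains Z :: "test_point fspace" and \<alpha> \<beta>
  where "prevariety Z" "morphism X Z \<alpha>" "morphism Z X \<beta>"
    "\<And>x. x \<in> pts X \<Longrightarrow> \<beta> (\<alpha> x) = x" "\<And>z. z \<in> pts Z \<Longrightarrow> \<alpha> (\<beta> z) = z"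
proof -
  have sX: "space_with_functions X" using X unfolding prevariety_def by blast
  obtain \<U> where U: "finite \<U>" "\<Union>\<U> = pts X" "\<And>W. W \<in> \<U> \<Longrightarrow> openin (fs_top X) W"
    "\<And>W. W \<in> \<U> \<Longrightarrow> affine_variety (open_sub X W)"
    using X unfolding prevariety_def by blast
  have "\<exists>c :: 'a \<Rightarrow> nat \<Rightarrow> complex. inj_on c W" if W: "W \<in> \<U>" for W
  proof -
    obtain n P and c :: "'a \<Rightarrow> nat \<Rightarrow> complex" and d
      where "P \<subseteq> polyfun n"
        "morphism (open_sub X W) (zariski {z \<in> affine_space n. \<forall>p\<in>P. p z = 0} (polyfun n)) c"
        "morphism (zariski {z \<in> affine_space n. \<forall>p\<in>P. p z = 0} (polyfun n)) (open_sub X W) d"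
      and dc: "\<forall>x\<in>pts (open_sub X W). d (c x) = x"
      and "\<forall>y\<in>pts (zariski {z \<in> affine_space n. \<forall>p\<in>P. p z = 0} (polyfun n)). c (d y) = y"
      using U(4)[OF W] unfolding affine_variety_def isomorphic_def by (elim exE conjE)
    have "inj_on c W" using dc unfolding pts_open_sub[OF U(3)[OF W]] by (metis inj_onI)
    then show ?thesis by blast
  qed
  then obtain c :: "'a set \<Rightarrow> 'a \<Rightarrow> nat \<Rightarrow> complex" where c: "\<And>W. W \<in> \<U> \<Longrightarrow> inj_on (c W) W"
    by metis
  obtain e :: "'a set \<Rightarrow> nat" where e: "inj_on e \<U>" using finite_imp_inj_to_nat_seg[OF U(1)] by auto
  have "\<exists>W. \<forall>x\<in>pts X. W x \<in> \<U> \<and> x \<in> W x" using U(2) by (intro bchoice) blast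
  then obtain w where w: "\<And>x. x \<in> pts X \<Longrightarrow> w x \<in> \<U> \<and> x \<in> w x" by blast
  define j where "j x = (e (w x), c (w x) x)" for x
  have inj: "inj_on j (pts X)"
  proof (rule inj_onI)
    fix x y assume xy: "x \<in> pts X" "y \<in> pts X" "j x = j y"
    then have ww: "w x = w y" using w e by (auto simp: j_def inj_on_def)
    have "c (w x) x = c (w x) y" using xy(3) ww by (simp add: j_def)
    then show "x = y" using inj_onD[OF c, of "w x" x y] w[OF xy(1)] w[OF xy(2)] ww by simp
  qed
  note m = morphism_to_transport[OF sX inj] morphism_from_transport[OF sX inj]
  have i: "inv_into (pts X) j (j x) = x" if "x \<in> pts X" for x using that inj by simp
  have i': "j (inv_into (pts X) j y) = y" if "y \<in> pts (transport j X)" for y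
    using that i by (auto simp: pts_transport)
  have "prevariety (transport j X)"
    using prevariety_isomorphic[OF X space_with_functions_transport[OF sX] m] i i' by blast
  then show ?thesis using that[OF _ m] i i' by blast
qed

section \<open>Lattices and characters\<close>

text \<open>Integral multiples in an abelian group, which make it a module over \<open>\<int>\<close>.\<close>

definition zmul :: "int \<Rightarrow> 'm::ab_group_add \<Rightarrow> 'm" where
  "zmul k m = (if 0 \<le> k then (\<Sum>i<nat k. m) else - (\<Sum>i<nat (- k). m))"

lemma zmul_diff: "zmul (int a - int b) m = (\<Sum>i<a. m) - (\<Sum>i<b. m)"
proof -
  have plus: "(\<Sum>i<x + y. m) = (\<Sum>i<x. m) + (\<Sum>i<y. m)" for x y :: nat
    by (induction y) (simp_all add: algebra_simps)
  show ?thesis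
  proof (cases "b \<le> a")
    case True
    then obtain c where "a = b + c" using le_Suc_ex by blast
    then show ?thesis by (simp add: zmul_def plus)
  next
    case False
    then obtain c where "b = a + c" using le_Suc_ex by (metis nle_le)
    then show ?thesis by (simp add: zmul_def plus)
  qed
qed

interpretation zm: module "zmul :: int \<Rightarrow> 'm::ab_group_add \<Rightarrow> 'm"
proof
  have plus: "(\<Sum>i<x + y. m) = (\<Sum>i<x. m) + (\<Sum>i<y. m)" for x y :: nat and m :: 'm
    by (induction y) (simp_all add: algebra_simps)
  show left: "zmul (k + l) x = zmul k x + zmul l x" for k l and x :: 'm
  proof -
    obtain a b where k: "k = int a - int b" by (rule int_diff_cases)
    obtain c d where l: "l = int c - int d" by (rule int_diff_cases)
    have "k + l = int (a + c) - int (b + d)" using k l by simp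
    then show ?thesis unfolding k l by (simp only: zmul_diff plus) (simp add: algebra_simps)
  qed
  show "zmul k (x + y) = zmul k x + zmul k y" for k and x y :: 'm
  proof -
    obtain a b where k: "k = int a - int b" by (rule int_diff_cases)
    show ?thesis unfolding k zmul_diff by (simp add: sum.distrib algebra_simps)
  qed
  have zero: "zmul 0 x = 0" and minus: "zmul (- k) x = - zmul k x" for x :: 'm and k
    using left[of k "- k" x] by (simp_all add: zmul_def)
  show "zmul k (zmul l x) = zmul (k * l) x" for k l and x :: 'm
  proof (induction k rule: int_induct[where k = 0])
    case base
    then show ?case by (simp add: zero)
  next
    case (step1 i)
    have "zmul 1 y = y" for y :: 'm by (simp add: zmul_def)
    then show ?case using step1 by (simp add: left distrib_right)
  next
    case (step2 i)
    have 1: "zmul 1 y = y" for y :: 'm by (simp add: zmul_def)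
    have "zmul (i - 1) (zmul l x) = zmul i (zmul l x) - zmul l x"
      using left[of "i - 1" 1 "zmul l x"] 1 by (simp add: algebra_simps)
    moreover have "zmul ((i - 1) * l) x = zmul (i * l) x - zmul l x"
      using left[of "(i - 1) * l" l x] by (simp add: algebra_simps)
    ultimately show ?case using step2 by simp
  qed
  show "zmul 1 x = x" for x :: 'm by (simp add: zmul_def)
qed

lemma
  assumes L: "sublattice L M"
  shows sublattice_subset: "L \<subseteq> M"
    and sublattice_zero: "0 \<in> L"
    and sublattice_diff: "a \<in> L \<Longrightarrow> b \<in> L \<Longrightarrow> a - b \<in> L"
    and sublattice_minus: "a \<in> L \<Longrightarrow> - a \<in> L"
    and sublattice_add: "a \<in> L \<Longrightarrow> b \<in> L \<Longrightarrow> a + b \<in> L"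
    and sublattice_zmul: "a \<in> L \<Longrightarrow> zmul k a \<in> L"
    and sublattice_sum: "(\<And>i. i \<in> I \<Longrightarrow> g i \<in> L) \<Longrightarrow> sum g I \<in> L"
proof -
  show "L \<subseteq> M" and zero: "0 \<in> L" and diff: "a \<in> L \<Longrightarrow> b \<in> L \<Longrightarrow> a - b \<in> L" for a b
    using L unfolding sublattice_def by auto
  show minus: "- a \<in> L" if "a \<in> L" for a using diff[OF zero that] by simp
  show add: "a + b \<in> L" if "a \<in> L" "b \<in> L" for a b using diff[OF that(1) minus[OF that(2)]] by simp
  have nat: "(\<Sum>i<n. a) \<in> L" if "a \<in> L" for n :: nat and a
    by (induction n) (use zero add that in auto)
  show "zmul k a \<in> L" if "a \<in> L" for a k using nat[OF that] minus by (auto simp: zmul_def)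
  show "sum g I \<in> L" if "\<And>i. i \<in> I \<Longrightarrow> g i \<in> L" for g and I :: "'b set"
    using that by (induction I rule: infinite_finite_induct) (auto intro: zero add)
qed

lemma lattice_coordinates:
  assumes "lattice_set M"
  obtains d :: nat and e co where "\<forall>i<d. e i \<in> M" "sublattice M M"
    "\<forall>a\<in>M. a = (\<Sum>i<d. zmul (co a i) (e i))"
    "\<forall>a\<in>M. \<forall>b\<in>M. \<forall>i. co (a + b) i = co a i + co b i"
    "\<forall>j<d. \<forall>i. co (e j) i = (if i = j then 1 else 0)"
proof -
  obtain d \<phi> where bij: "bij_betw \<phi> {c :: nat \<Rightarrow> int. \<forall>i\<ge>d. c i = 0} M"
    and add: "\<And>a b. (\<forall>i\<ge>d. a i = 0) \<Longrightarrow> (\<forall>i\<ge>d. b i = 0) \<Longrightarrow> \<phi> (a + b) = \<phi> a + \<phi> b"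
    using assms unfolding lattice_set_def by blast
  define C where "C = {c :: nat \<Rightarrow> int. \<forall>i\<ge>d. c i = 0}"
  have addC: "\<phi> (a + b) = \<phi> a + \<phi> b" if "a \<in> C" "b \<in> C" for a b using add that by (simp add: C_def)
  have bijC: "bij_betw \<phi> C M" using bij by (simp add: C_def)
  have im: "\<phi> c \<in> M" if "c \<in> C" for c using bijC that by (rule bij_betw_apply)
  define co where "co = inv_into C \<phi>"
  have coC: "co a \<in> C" and phico: "\<phi> (co a) = a" if "a \<in> M" for a
    using that bijC unfolding co_def bij_betw_def by (auto intro: inv_into_into f_inv_into_f)
  have cophi: "co (\<phi> c) = c" if "c \<in> C" for c
    using that bijC unfolding co_def bij_betw_def by (auto intro: inv_into_f_f)
  have C0: "0 \<in> C" and Cadd: "a + b \<in> C" and Cminus: "- a \<in> C" if "a \<in> C" "b \<in> C" for a b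
    using that by (auto simp: C_def fun_Compl_def)
  have zeroC: "(0::nat \<Rightarrow> int) \<in> C" by (simp add: C_def)
  have phi0: "\<phi> 0 = 0" using addC[OF zeroC zeroC] by simp
  have phiminus: "\<phi> (- c) = - \<phi> c" if "c \<in> C" for c
    using addC[OF that Cminus[OF that that]] phi0 by (simp add: eq_neg_iff_add_eq_0 add.commute)
  \<comment> \<open>the unit vectors of the coordinate space\<close>
  define u :: "nat \<Rightarrow> nat \<Rightarrow> int" where "u i = (\<lambda>j. if j = i then 1 else 0)" for i
  have uC: "u i \<in> C" if "i < d" for i using that by (simp add: C_def u_def)
  have ku: "(\<lambda>j. k * u i j) \<in> C" if "i < d" for i k using uC[OF that] by (simp add: C_def)
  have phik: "\<phi> (\<lambda>j. k * u i j) = zmul k (\<phi> (u i))" if i: "i < d" for i k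
  proof (induction k rule: int_induct[where k = 0])
    case base
    have "(\<lambda>j. 0 * u i j) = 0" by (simp add: fun_eq_iff)
    then show ?case using phi0 by simp
  next
    case (step1 k)
    have "(\<lambda>j. (k + 1) * u i j) = (\<lambda>j. k * u i j) + u i" by (simp add: fun_eq_iff algebra_simps)
    then show ?case using step1 addC[OF ku[OF i] uC[OF i]] by (simp add: zm.scale_left_distrib)
  next
    case (step2 k)
    have "(\<lambda>j. (k - 1) * u i j) = (\<lambda>j. k * u i j) + - u i"
      by (simp add: fun_eq_iff fun_Compl_def algebra_simps)
    then show ?case using step2 addC[OF ku[OF i] Cminus[OF uC[OF i] uC[OF i]]] phiminus[OF uC[OF i]]
      by (simp add: zm.scale_left_diff_distrib)
  qed
  have part: "\<phi> (\<lambda>j. if j < n then c j else 0) = (\<Sum>i<n. zmul (c i) (\<phi> (u i)))" if "n \<le> d" for n c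
    using that
  proof (induction n)
    case 0
    have "(\<lambda>j. if j < 0 then c j else 0) = 0" by (simp add: fun_eq_iff)
    then show ?case using phi0 by simp
  next
    case (Suc n)
    have C1: "(\<lambda>j. if j < n then c j else 0) \<in> C" using Suc.prems by (simp add: C_def)
    have "(\<lambda>j. if j < Suc n then c j else 0) = (\<lambda>j. if j < n then c j else 0) + (\<lambda>j. c n * u n j)"
      by (auto simp: fun_eq_iff u_def less_Suc_eq)
    then show ?case using Suc addC[OF C1 ku[of n "c n"]] phik[of n "c n"] by simp
  qed
  show thesis
  proof (rule that[of d "\<lambda>i. \<phi> (u i)" co]; (intro allI ballI impI)?)
    show "\<phi> (u i) \<in> M" if "i < d" for i using im uC that by blast
    show "sublattice M M" unfolding sublattice_def
    proof (intro conjI ballI)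
      show "0 \<in> M" using im[OF zeroC] phi0 by simp
      fix a b assume ab: "a \<in> M" "b \<in> M"
      have "\<phi> (co a + - co b) = a - b"
        using addC[OF coC[OF ab(1)] Cminus[OF coC[OF ab(2)] coC[OF ab(2)]]] phiminus[OF coC[OF ab(2)]] phico ab
        by simp
      then show "a - b \<in> M" using im[OF Cadd[OF coC[OF ab(1)] Cminus[OF coC[OF ab(2)] coC[OF ab(2)]]]] by simp
    qed simp
    show "a = (\<Sum>i<d. zmul (co a i) (\<phi> (u i)))" if a: "a \<in> M" for a
    proof -
      have "(\<lambda>j. if j < d then co a j else 0) = co a"
        using coC[OF a] by (auto simp: fun_eq_iff C_def not_less)
      then show ?thesis using part[of d "co a"] phico[OF a] by simp
    qed
    show "co (a + b) i = co a i + co b i" if "a \<in> M" "b \<in> M" for a b i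
    proof -
      have "\<phi> (co a + co b) = a + b" using addC coC phico that by simp
      then have "co (a + b) = co a + co b" using cophi[OF Cadd[OF coC[OF that(1)] coC[OF that(2)]]] by simp
      then show ?thesis by simp
    qed
    show "co (\<phi> (u j)) i = (if i = j then 1 else 0)" if "j < d" for i j
      using cophi[OF uC[OF that]] by (simp add: u_def)
  qed
qed

lemma lattice_sublattice_self: "lattice_set M \<Longrightarrow> sublattice M M"
  by (rule lattice_coordinates)

lemma subgroup_int_principal:
  fixes P :: "int \<Rightarrow> bool"
  assumes P0: "P 0" and diff: "\<And>a b. P a \<Longrightarrow> P b \<Longrightarrow> P (a - b)"
  obtains n :: nat where "\<And>k. P k \<longleftrightarrow> int n dvd k"
proof -
  have minus: "P (- a)" if "P a" for a using diff[OF P0 that] by simp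
  have add: "P (a + b)" if "P a" "P b" for a b using diff[OF that(1) minus[OF that(2)]] by simp
  have mult: "P (k * a)" if "P a" for k a
  proof (induction k rule: int_induct[where k = 0])
    case (step1 i)
    then show ?case using add[OF step1(2) that] by (simp add: distrib_right)
  next
    case (step2 i)
    then show ?case using diff[OF step2(2) that] by (simp add: left_diff_distrib)
  qed (use P0 in simp)
  show thesis
  proof (cases "\<exists>n. 0 < n \<and> P (int n)")
    case True
    define n where "n = (LEAST n. 0 < n \<and> P (int n))"
    have n: "0 < n" "P (int n)" using LeastI_ex[OF True] by (simp_all add: n_def)
    have "int n dvd k" if "P k" for k
    proof -
      have "P (k mod int n)"
        using diff[OF that mult[OF n(2), of "k div int n"]] by (simp add: minus_div_mult_eq_mod)
      moreover have "0 \<le> k mod int n" "k mod int n < int n" using n(1) by simp_all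
      ultimately have "k mod int n = 0"
        using not_less_Least[of "nat (k mod int n)" "\<lambda>n. 0 < n \<and> P (int n)", folded n_def]
        by (smt (verit) int_nat_eq nat_less_iff zero_less_nat_eq)
      then show ?thesis by blast
    qed
    then show ?thesis using mult[OF n(2)] by (intro that[of n]) (auto simp: dvd_def mult.commute)
  next
    case False
    have "k = 0" if "P k" for k
    proof (rule ccontr)
      assume "k \<noteq> 0"
      have "P \<bar>k\<bar>" using that minus by (simp add: abs_if)
      then show False using False \<open>k \<noteq> 0\<close> by (metis int_nat_eq abs_ge_zero zero_less_abs_iff zero_less_nat_eq)
    qed
    then show ?thesis using P0 by (intro that[of 0]) auto
  qed
qed

text \<open>The graph of a homomorphism from a subgroup of \<open>M\<close> to \<open>\<complex>\<^sup>*\<close>. A graph can be enlarged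
  without first computing the subgroup on which the homomorphism lives; the last clause says that
  the relation is single-valued.\<close>

definition partial_character :: "'m::ab_group_add set \<Rightarrow> ('m \<times> complex) set \<Rightarrow> bool" where
  "partial_character M R \<longleftrightarrow> (0, 1) \<in> R \<and>
     (\<forall>a x. (a, x) \<in> R \<longrightarrow> a \<in> M \<and> x \<noteq> 0) \<and>
     (\<forall>a x b y. (a, x) \<in> R \<longrightarrow> (b, y) \<in> R \<longrightarrow> (a - b, x / y) \<in> R) \<and>
     (\<forall>z. (0, z) \<in> R \<longrightarrow> z = 1)"

lemma
  assumes R: "partial_character M R"
  shows pchar_zero: "(0, 1) \<in> R"
    and pchar_mem: "(a, x) \<in> R \<Longrightarrow> a \<in> M"
    and pchar_nz: "(a, x) \<in> R \<Longrightarrow> x \<noteq> 0"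
    and pchar_diff: "(a, x) \<in> R \<Longrightarrow> (b, y) \<in> R \<Longrightarrow> (a - b, x / y) \<in> R"
    and pchar_add: "(a, x) \<in> R \<Longrightarrow> (b, y) \<in> R \<Longrightarrow> (a + b, x * y) \<in> R"
    and pchar_unique: "(a, x) \<in> R \<Longrightarrow> (a, y) \<in> R \<Longrightarrow> x = y"
    and pchar_zmul: "(a, x) \<in> R \<Longrightarrow> (zmul k a, x powi k) \<in> R"
proof -
  show zero: "(0, 1) \<in> R" and mem: "(a, x) \<in> R \<Longrightarrow> a \<in> M" and nz: "(a, x) \<in> R \<Longrightarrow> x \<noteq> 0"
    and diff: "(a, x) \<in> R \<Longrightarrow> (b, y) \<in> R \<Longrightarrow> (a - b, x / y) \<in> R" for a x b y
    using R unfolding partial_character_def by blast+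
  show add: "(a + b, x * y) \<in> R" if "(a, x) \<in> R" "(b, y) \<in> R" for a x b y
    using diff[OF that(1) diff[OF zero that(2)]] by simp
  show "x = y" if "(a, x) \<in> R" "(a, y) \<in> R" for a x y
  proof -
    have "(0, x / y) \<in> R" using diff[OF that] by simp
    then have "x / y = 1" using R unfolding partial_character_def by blast
    then show ?thesis using nz[OF that(2)] by simp
  qed
  show "(zmul k a, x powi k) \<in> R" if "(a, x) \<in> R" for a x k
  proof (induction k rule: int_induct[where k = 0])
    case base
    then show ?case using zero by simp
  next
    case (step1 i)
    then show ?case using add[OF step1(2) that] nz[OF that]
      by (simp add: zm.scale_left_distrib power_int_add)
  next
    case (step2 i)
    then show ?case using diff[OF step2(2) that] nz[OF that]
      by (simp add: zm.scale_left_diff_distrib power_int_diff)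
  qed
qed

text \<open>A value \<open>z\<close> may be prescribed at \<open>x\<close> as soon as it is consistent on the multiples of \<open>x\<close> at which
  the character is already defined.\<close>

lemma pchar_adjoin:
  assumes R: "partial_character M R" and M: "sublattice M M" and x: "x \<in> M" and z: "z \<noteq> 0"
    and zk: "\<And>k w. (zmul k x, w) \<in> R \<Longrightarrow> z powi k = w"
  obtains R' where "partial_character M R'" "R \<subseteq> R'" "(x, z) \<in> R'"
proof (rule that)
  let ?R = "{(a + zmul k x, w * z powi k) |a w k. (a, w) \<in> R}"
  show "R \<subseteq> ?R"
  proof
    fix p assume "p \<in> R"
    then show "p \<in> ?R"
      by (cases p) (simp, intro exI[of _ "fst p"] exI[of _ "snd p"] conjI exI[of _ "0::int"], auto)
  qed
  show "(x, z) \<in> ?R" using pchar_zero[OF R] by (force intro!: exI[of _ "1::int"])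
  show "partial_character M ?R" unfolding partial_character_def
  proof (intro conjI allI impI)
    show "(0, 1) \<in> ?R" using \<open>R \<subseteq> ?R\<close> pchar_zero[OF R] by blast
    fix a' v' assume a': "(a', v') \<in> ?R"
    then obtain a v k where a: "(a, v) \<in> R" "a' = a + zmul k x" "v' = v * z powi k" by blast
    show "a' \<in> M" unfolding a(2)
      using pchar_mem[OF R a(1)] x by (intro sublattice_add[OF M] sublattice_zmul[OF M])
    show "v' \<noteq> 0" using pchar_nz[OF R a(1)] z a(3) by simp
    fix b' w' assume "(b', w') \<in> ?R"
    then obtain b w l where b: "(b, w) \<in> R" "b' = b + zmul l x" "w' = w * z powi l" by blast
    have "a' - b' = (a - b) + zmul (k - l) x" using a b by (simp add: algebra_simps)
    moreover have "v' / w' = v / w * z powi (k - l)" using a b z by (simp add: power_int_diff)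
    ultimately show "(a' - b', v' / w') \<in> ?R" using pchar_diff[OF R a(1) b(1)] by blast
  next
    fix v' assume "(0, v') \<in> ?R"
    then obtain a v k where a: "(a, v) \<in> R" "0 = a + zmul k x" "v' = v * z powi k" by blast
    have "a = zmul (- k) x" using a(2) by (simp add: eq_neg_iff_add_eq_0)
    then have "v = z powi (- k)" using zk a(1) by metis
    then show "v' = 1" using a(3) z by (simp add: power_int_minus)
  qed
qed

lemma exists_complex_nth_root:
  assumes "w \<noteq> (0::complex)" "0 < n"
  obtains z where "z \<noteq> 0" "z ^ n = w"
proof (rule that)
  show "exp (Ln w / of_nat n) \<noteq> 0" by simp
  show "exp (Ln w / of_nat n) ^ n = w"
    using assms by (simp add: exp_of_nat_mult[symmetric])
qed

text \<open>\<open>\<complex>\<^sup>*\<close> is divisible, so a partial character extends, one generator of \<open>M\<close> at a time.\<close>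

lemma pchar_extend:
  assumes lat: "lattice_set M" and R: "partial_character M R"
  obtains t where "t \<in> torus M" "\<And>a x. (a, x) \<in> R \<Longrightarrow> t a = x"
proof -
  obtain d :: nat and e co where e': "\<forall>i<d. e i \<in> M" and M: "sublattice M M"
    and gen': "\<forall>a\<in>M. a = (\<Sum>i<d. zmul (co a i) (e i))"
    by (rule lattice_coordinates[OF lat])
  note e = mp[OF spec[OF e']] and gen = bspec[OF gen']
  have step: "\<exists>R'. partial_character M R' \<and> R \<subseteq> R' \<and> (\<exists>z. (x, z) \<in> R')"
    if R: "partial_character M R" and x: "x \<in> M" for R x
  proof -
    obtain n :: nat where n: "\<And>k. (\<exists>w. (zmul k x, w) \<in> R) \<longleftrightarrow> int n dvd k"
    proof (rule subgroup_int_principal[of "\<lambda>k. \<exists>w. (zmul k x, w) \<in> R"])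
      show "\<exists>w. (zmul 0 x, w) \<in> R" using pchar_zero[OF R] by auto
      show "\<exists>w. (zmul (a - b) x, w) \<in> R" if "\<exists>w. (zmul a x, w) \<in> R" "\<exists>w. (zmul b x, w) \<in> R" for a b
        using that pchar_diff[OF R] unfolding zm.scale_left_diff_distrib by blast
    qed blast
    obtain w0 where w0: "(zmul (int n) x, w0) \<in> R" using n[of "int n"] by auto
    obtain z where z: "z \<noteq> 0" "\<And>k w. (zmul k x, w) \<in> R \<Longrightarrow> z powi k = w"
    proof (cases "n = 0")
      case True
      have "1 powi k = w" if "(zmul k x, w) \<in> R" for k w
      proof -
        have "k = 0" using n[of k] that True by auto
        then show ?thesis using that pchar_unique[OF R _ pchar_zero[OF R]] by simp
      qed
      then show thesis by (intro that[of 1]) auto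
    next
      case False
      obtain z where z: "z \<noteq> 0" "z ^ n = w0"
        using exists_complex_nth_root[OF pchar_nz[OF R w0], of n] False by blast
      have "z powi k = w" if kw: "(zmul k x, w) \<in> R" for k w
      proof -
        obtain j where j: "k = int n * j" using n[of k] kw by (auto simp: dvd_def)
        have "(zmul j (zmul (int n) x), w0 powi j) \<in> R" by (rule pchar_zmul[OF R w0])
        then have "(zmul k x, w0 powi j) \<in> R" unfolding j by (simp add: mult.commute)
        then have "w = w0 powi j" using pchar_unique[OF R kw] by blast
        then show ?thesis unfolding j z(2)[symmetric] by (simp add: power_int_mult)
      qed
      then show thesis using z(1) by (intro that)
    qed
    show ?thesis using pchar_adjoin[OF R M x z] by metis
  qed
  have "\<exists>R'. partial_character M R' \<and> R \<subseteq> R' \<and> (\<forall>i<n. \<exists>z. (e i, z) \<in> R')" if "n \<le> d" for n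
    using that
  proof (induction n)
    case 0
    show ?case using R by blast
  next
    case (Suc n)
    then obtain R' where R': "partial_character M R'" "R \<subseteq> R'" "\<forall>i<n. \<exists>z. (e i, z) \<in> R'" by auto
    obtain R'' where R'': "partial_character M R''" "R' \<subseteq> R''" "\<exists>z. (e n, z) \<in> R''"
      using step[OF R'(1) e[of n]] Suc.prems by auto
    have "\<exists>z. (e i, z) \<in> R''" if "i < Suc n" for i
      using R'(3) R''(2,3) that by (cases "i = n") (auto simp: less_Suc_eq)
    then show ?case using R''(1,2) R'(2) by (intro exI[of _ R'']) auto
  qed
  from this[of d] obtain R' where R': "partial_character M R'" "R \<subseteq> R'"
    and eR: "\<And>i. i < d \<Longrightarrow> \<exists>z. (e i, z) \<in> R'" by auto
  have sums: "\<exists>z. (\<Sum>i<n. zmul (c i) (e i), z) \<in> R'" if "n \<le> d" for n c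
    using that
  proof (induction n)
    case 0
    then show ?case using pchar_zero[OF R'(1)] by auto
  next
    case (Suc n)
    then obtain z where z: "(\<Sum>i<n. zmul (c i) (e i), z) \<in> R'" by auto
    obtain y where y: "(e n, y) \<in> R'" using eR[of n] Suc.prems by auto
    show ?case using pchar_add[OF R'(1) z pchar_zmul[OF R'(1) y]] by auto
  qed
  have dom: "\<exists>z. (a, z) \<in> R'" if "a \<in> M" for a
    using sums[of d "co a"] gen[OF that] by auto
  define t where "t a = (if a \<in> M then (THE z. (a, z) \<in> R') else 1)" for a
  have t: "t a = z" if "(a, z) \<in> R'" for a z
    using that pchar_unique[OF R'(1)] pchar_mem[OF R'(1) that] by (auto simp: t_def intro!: the_equality)
  have tR: "(a, t a) \<in> R'" if "a \<in> M" for a using dom[OF that] t by auto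
  have "t \<in> torus M" unfolding torus_def
    using pchar_nz[OF R'(1) tR] t[OF pchar_add[OF R'(1) tR tR]] by (auto simp: t_def)
  then show thesis using t R'(2) by (intro that) auto
qed

lemma torus_nonzero: "t \<in> torus M \<Longrightarrow> t a \<noteq> 0"
  unfolding torus_def by (cases "a \<in> M") auto

lemma torus_add: "t \<in> torus M \<Longrightarrow> a \<in> M \<Longrightarrow> b \<in> M \<Longrightarrow> t (a + b) = t a * t b"
  unfolding torus_def by auto

lemma torus_zero: "t \<in> torus M \<Longrightarrow> 0 \<in> M \<Longrightarrow> t 0 = 1"
  using torus_add[of t M 0 0] torus_nonzero[of t M 0] by simp

lemma quotient_group_one: "(\<lambda>_. 1) \<in> quotient_group M L"
  unfolding quotient_group_def torus_def by simp

lemma quotient_group_mult: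
  "s \<in> quotient_group M L \<Longrightarrow> t \<in> quotient_group M L \<Longrightarrow> (\<lambda>a. s a * t a) \<in> quotient_group M L"
  unfolding quotient_group_def torus_def by auto

text \<open>The multiples of \<open>m\<close> that lie in \<open>L\<close> are the multiples of \<open>n m\<close> for some \<open>n \<noteq> 1\<close>, so an \<open>n\<close>-th root of
  unity other than \<open>1\<close> may be prescribed at \<open>m\<close>, together with the value \<open>1\<close> on \<open>L\<close>. If \<open>n = 0\<close>, any
  nonzero value will do.\<close>

lemma quotient_group_separates:
  assumes lat: "lattice_set M" and L: "sublattice L M" and m: "m \<in> M" "m \<notin> L"
  obtains t where "t \<in> quotient_group M L" "t m \<noteq> 1"
proof -
  have M: "sublattice M M" using lattice_sublattice_self[OF lat] .
  let ?R = "{(c, 1::complex) |c. c \<in> L}"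
  have R: "partial_character M ?R" unfolding partial_character_def
    using sublattice_subset[OF L] sublattice_zero[OF L] sublattice_diff[OF L] by auto
  obtain n :: nat where n: "\<And>k. zmul k m \<in> L \<longleftrightarrow> int n dvd k"
    using subgroup_int_principal[of "\<lambda>k. zmul k m \<in> L"] sublattice_zero[OF L] sublattice_diff[OF L]
    by (metis zm.scale_zero_left zm.scale_left_diff_distrib)
  have n1: "n \<noteq> 1" using n[of 1] m(2) by auto
  obtain z :: complex where z: "z \<noteq> 0" "z \<noteq> 1" "z ^ n = 1"
  proof (cases "n = 0")
    case True
    then show thesis by (intro that[of 2]) auto
  next
    case False
    then have "card {z::complex. z ^ n = 1} = n" by (intro card_roots_unity_eq) simp
    then have "\<not> {z::complex. z ^ n = 1} \<subseteq> {1}"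
      using card_mono[of "{1::complex}" "{z. z ^ n = 1}"] n1 False by auto
    then obtain z :: complex where "z ^ n = 1" "z \<noteq> 1" by blast
    moreover have "z \<noteq> 0" using \<open>z ^ n = 1\<close> False by (auto simp: power_0_left)
    ultimately show thesis by (intro that)
  qed
  have zk: "z powi k = w" if "(zmul k m, w) \<in> ?R" for k w
  proof -
    have "int n dvd k" using n[of k] that by blast
    then obtain j where "k = int n * j" by (auto simp: dvd_def)
    then have "z powi k = (z ^ n) powi j" by (simp add: power_int_mult)
    then show ?thesis using that z(3) by simp
  qed
  obtain R' where R': "partial_character M R'" "?R \<subseteq> R'" "(m, z) \<in> R'"
    by (rule pchar_adjoin[OF R M m(1) z(1) zk])
  obtain t where t: "t \<in> torus M" "\<And>a x. (a, x) \<in> R' \<Longrightarrow> t a = x"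
    by (rule pchar_extend[OF lat R'(1)]) blast
  have "t \<in> quotient_group M L" using t R'(2) unfolding quotient_group_def by blast
  moreover have "t m \<noteq> 1" using t(2)[OF R'(3)] z(2) by simp
  ultimately show thesis by (rule that)
qed

text \<open>Averaging over \<open>G\<close> is done without integration: for a character \<open>e i\<close> outside \<open>L\<close> choose
  \<open>s \<in> G\<close> with \<open>s (e i) \<noteq> 1\<close>; applying \<open>(s - s (e i)) / (1 - s (e i))\<close> to the identity removes
  the term of \<open>i\<close> and fixes the terms of \<open>L\<close>.\<close>

lemma quotient_group_projection:
  fixes d :: "'i \<Rightarrow> complex"
  assumes lat: "lattice_set M" and L: "sublattice L M"
    and K: "finite K" "\<And>i. i \<in> K \<Longrightarrow> e i \<in> M"
    and sum0: "\<And>t. t \<in> quotient_group M L \<Longrightarrow> (\<Sum>i\<in>K. t (e i) * d i) = 0"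
  shows "(\<Sum>i | i \<in> K \<and> e i \<in> L. d i) = 0"
  using K sum0
proof (induction K arbitrary: d rule: finite_psubset_induct)
  case (psubset K)
  show ?case
  proof (cases "\<exists>i\<in>K. e i \<notin> L")
    case False
    then have "{i \<in> K. e i \<in> L} = K" by blast
    then show ?thesis using psubset.prems(2)[OF quotient_group_one] by simp
  next
    case True
    then obtain j where j: "j \<in> K" "e j \<notin> L" by blast
    obtain s where s: "s \<in> quotient_group M L" "s (e j) \<noteq> 1"
      using quotient_group_separates[OF lat L psubset.prems(1)[OF j(1)] j(2)] by blast
    \<comment> \<open>the term of \<open>j\<close> gets coefficient \<open>0\<close>; where \<open>s (e i) = 1\<close> the coefficient is unchanged\<close>
    define d' where "d' i = (s (e i) - s (e j)) / (1 - s (e j)) * d i" for i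
    have "(\<Sum>i\<in>K - {j}. t (e i) * d' i) = 0" if t: "t \<in> quotient_group M L" for t
    proof -
      have "(\<Sum>i\<in>K - {j}. t (e i) * d' i) = (\<Sum>i\<in>K. t (e i) * d' i)"
        using psubset.hyps j(1) by (simp add: sum.remove d'_def)
      also have "\<dots> = ((\<Sum>i\<in>K. (t (e i) * s (e i)) * d i) - s (e j) * (\<Sum>i\<in>K. t (e i) * d i)) / (1 - s (e j))"
        unfolding d'_def sum_distrib_left sum_subtractf[symmetric] sum_divide_distrib
        by (intro sum.cong) (simp_all add: algebra_simps)
      also have "\<dots> = 0"
        using psubset.prems(2)[OF t] psubset.prems(2)[OF quotient_group_mult[OF t s(1)]] by simp
      finally show ?thesis .
    qed
    from psubset.IH[OF _ _ this] have "(\<Sum>i | i \<in> K - {j} \<and> e i \<in> L. d' i) = 0"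
      using j(1) psubset.prems(1) by auto
    moreover have "(\<Sum>i | i \<in> K - {j} \<and> e i \<in> L. d' i) = (\<Sum>i | i \<in> K \<and> e i \<in> L. d i)"
    proof (rule sum.cong)
      show "{i. i \<in> K - {j} \<and> e i \<in> L} = {i. i \<in> K \<and> e i \<in> L}" using j(2) by auto
      show "d' i = d i" if "i \<in> {i. i \<in> K \<and> e i \<in> L}" for i
        using that s by (auto simp: d'_def quotient_group_def)
    qed
    ultimately show ?thesis by simp
  qed
qed

section \<open>Points of the spectrum of a monoid algebra\<close>

definition submonoid :: "'m::ab_group_add set \<Rightarrow> bool" where
  "submonoid S \<longleftrightarrow> 0 \<in> S \<and> (\<forall>a\<in>S. \<forall>b\<in>S. a + b \<in> S)"

text \<open>A point of \<open>Spec \<complex>[S]\<close> amounts to a monoid homomorphism \<open>S \<rightarrow> \<complex>\<close>: \<open>ev\<close> passes from points to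
  homomorphisms, \<open>mpoint\<close> from homomorphisms to points.\<close>

definition ev :: "'m alg_point \<Rightarrow> 'm \<Rightarrow> complex" where
  "ev \<phi> m = \<phi> (Poly_Mapping.single m 1)"

definition lincomb :: "('m \<Rightarrow> complex) \<Rightarrow> ('m \<Rightarrow>\<^sub>0 complex) \<Rightarrow> complex" where
  "lincomb \<kappa> f = (\<Sum>m\<in>Poly_Mapping.keys f. Poly_Mapping.lookup f m * \<kappa> m)"

definition mpoint :: "'m set \<Rightarrow> ('m \<Rightarrow> complex) \<Rightarrow> 'm alg_point" where
  "mpoint S \<kappa> = (\<lambda>f. if f \<in> monoid_algebra S then lincomb \<kappa> f else 0)"

lemma submonoid_zero: "submonoid S \<Longrightarrow> 0 \<in> S"
  and submonoid_add: "submonoid S \<Longrightarrow> a \<in> S \<Longrightarrow> b \<in> S \<Longrightarrow> a + b \<in> S"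
  unfolding submonoid_def by auto

lemma submonoid_zmul: "submonoid S \<Longrightarrow> a \<in> S \<Longrightarrow> zmul (int n) a \<in> S"
  by (induction n) (simp_all add: zm.scale_left_distrib submonoid_zero submonoid_add)

lemma lincomb_add: "lincomb \<kappa> (f + g) = lincomb \<kappa> f + lincomb \<kappa> g"
  unfolding lincomb_def by (rule setsum_keys_plus_distrib) (simp_all add: algebra_simps)

lemma lincomb_zero: "lincomb \<kappa> 0 = 0"
  by (simp add: lincomb_def)

lemma lincomb_single: "lincomb \<kappa> (Poly_Mapping.single m c) = c * \<kappa> m"
  by (simp add: lincomb_def)

lemma lincomb_sum: "lincomb \<kappa> (sum g I) = (\<Sum>i\<in>I. lincomb \<kappa> (g i))"
  by (induction I rule: infinite_finite_induct) (simp_all add: lincomb_add lincomb_zero)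

lemma poly_mapping_expand:
  "f = (\<Sum>m\<in>Poly_Mapping.keys f. Poly_Mapping.single m (Poly_Mapping.lookup f m))"
proof (rule poly_mapping_eqI)
  fix k
  have "(\<Sum>m\<in>Poly_Mapping.keys f. Poly_Mapping.lookup (Poly_Mapping.single m (Poly_Mapping.lookup f m)) k)
    = (\<Sum>m\<in>Poly_Mapping.keys f. if m = k then Poly_Mapping.lookup f k else 0)"
    by (intro sum.cong) (auto simp: lookup_single when_def)
  then show "Poly_Mapping.lookup f k =
    Poly_Mapping.lookup (\<Sum>m\<in>Poly_Mapping.keys f. Poly_Mapping.single m (Poly_Mapping.lookup f m)) k"
    by (simp add: lookup_sum in_keys_iff)
qed

lemma lincomb_mult:
  assumes "\<And>a b. a \<in> S \<Longrightarrow> b \<in> S \<Longrightarrow> \<kappa> (a + b) = \<kappa> a * \<kappa> b"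
    and "f \<in> monoid_algebra S" "g \<in> monoid_algebra S"
  shows "lincomb \<kappa> (f * g) = lincomb \<kappa> f * lincomb \<kappa> g"
proof -
  let ?k = Poly_Mapping.keys and ?l = Poly_Mapping.lookup and ?s = Poly_Mapping.single
  have "f * g = (\<Sum>a\<in>?k f. \<Sum>b\<in>?k g. ?s a (?l f a) * ?s b (?l g b))"
    by (subst poly_mapping_expand[of f], subst poly_mapping_expand[of g]) (simp add: sum_product)
  then have "lincomb \<kappa> (f * g) = (\<Sum>a\<in>?k f. \<Sum>b\<in>?k g. (?l f a * ?l g b) * \<kappa> (a + b))"
    by (simp add: lincomb_sum mult_single lincomb_single)
  also have "\<dots> = (\<Sum>a\<in>?k f. \<Sum>b\<in>?k g. (?l f a * \<kappa> a) * (?l g b * \<kappa> b))"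
    using assms by (intro sum.cong refl) (auto simp: monoid_algebra_def subset_iff)
  also have "\<dots> = lincomb \<kappa> f * lincomb \<kappa> g" by (simp add: lincomb_def sum_product)
  finally show ?thesis .
qed

lemma monoid_algebra_single: "m \<in> S \<Longrightarrow> Poly_Mapping.single m c \<in> monoid_algebra S"
  by (simp add: monoid_algebra_def)

lemma monoid_algebra_zero: "0 \<in> monoid_algebra S"
  by (simp add: monoid_algebra_def)

lemma monoid_algebra_add: "f \<in> monoid_algebra S \<Longrightarrow> g \<in> monoid_algebra S \<Longrightarrow> f + g \<in> monoid_algebra S"
  unfolding monoid_algebra_def using keys_add[of f g] by auto

lemma monoid_algebra_sum:
  "(\<And>i. i \<in> I \<Longrightarrow> g i \<in> monoid_algebra S) \<Longrightarrow> sum g I \<in> monoid_algebra S"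
  by (induction I rule: infinite_finite_induct) (simp_all add: monoid_algebra_add monoid_algebra_zero)

lemma monoid_algebra_mult:
  assumes S: "submonoid S" and f: "f \<in> monoid_algebra S" and g: "g \<in> monoid_algebra S"
  shows "f * g \<in> monoid_algebra S"
  unfolding monoid_algebra_def mem_Collect_eq
proof
  fix k assume "k \<in> Poly_Mapping.keys (f * g)"
  then obtain a b where "a \<in> Poly_Mapping.keys f" "b \<in> Poly_Mapping.keys g" "k = a + b"
    using keys_mult[of f g] by blast
  then show "k \<in> S" using f g submonoid_add[OF S] by (auto simp: monoid_algebra_def)
qed

lemma monoid_algebra_mono: "S \<subseteq> S' \<Longrightarrow> f \<in> monoid_algebra S \<Longrightarrow> f \<in> monoid_algebra S'"
  by (auto simp: monoid_algebra_def)

lemma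
  assumes phi: "\<phi> \<in> spec_points S"
  shows spec_add: "f \<in> monoid_algebra S \<Longrightarrow> g \<in> monoid_algebra S \<Longrightarrow> \<phi> (f + g) = \<phi> f + \<phi> g"
    and spec_mult: "f \<in> monoid_algebra S \<Longrightarrow> g \<in> monoid_algebra S \<Longrightarrow> \<phi> (f * g) = \<phi> f * \<phi> g"
    and spec_const: "\<phi> (Poly_Mapping.single 0 c) = c"
    and spec_outside: "f \<notin> monoid_algebra S \<Longrightarrow> \<phi> f = 0"
proof -
  have "(\<forall>f\<in>monoid_algebra S. \<forall>g\<in>monoid_algebra S.
        \<phi> (f + g) = \<phi> f + \<phi> g \<and> \<phi> (f * g) = \<phi> f * \<phi> g) \<and>
     (\<forall>c. \<phi> (Poly_Mapping.single 0 c) = c) \<and> (\<forall>f. f \<notin> monoid_algebra S \<longrightarrow> \<phi> f = 0)"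
    using phi unfolding spec_points_def by (rule CollectD)
  note sp = this
  show "\<phi> (f + g) = \<phi> f + \<phi> g" if "f \<in> monoid_algebra S" "g \<in> monoid_algebra S"
    by (rule conjunct1[OF bspec[OF bspec[OF conjunct1[OF sp]]]]) fact+
  show "\<phi> (f * g) = \<phi> f * \<phi> g" if "f \<in> monoid_algebra S" "g \<in> monoid_algebra S"
    by (rule conjunct2[OF bspec[OF bspec[OF conjunct1[OF sp]]]]) fact+
  show "\<phi> (Poly_Mapping.single 0 c) = c" by (rule spec[OF conjunct1[OF conjunct2[OF sp]]])
  show "\<phi> f = 0" if "f \<notin> monoid_algebra S"
    by (rule mp[OF spec[OF conjunct2[OF conjunct2[OF sp]]] that])
qed

lemma spec_zero: "\<phi> \<in> spec_points S \<Longrightarrow> \<phi> 0 = 0"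
  using spec_const[of \<phi> S 0] by simp

lemma ev_zero: "\<phi> \<in> spec_points S \<Longrightarrow> ev \<phi> 0 = 1"
  using spec_const[of \<phi> S 1] by (simp add: ev_def)

lemma ev_add: "\<phi> \<in> spec_points S \<Longrightarrow> a \<in> S \<Longrightarrow> b \<in> S \<Longrightarrow> ev \<phi> (a + b) = ev \<phi> a * ev \<phi> b"
  using spec_mult[of \<phi> S "Poly_Mapping.single a 1" "Poly_Mapping.single b 1"]
  by (simp add: ev_def mult_single monoid_algebra_single)

lemma ev_zmul:
  "\<phi> \<in> spec_points S \<Longrightarrow> submonoid S \<Longrightarrow> a \<in> S \<Longrightarrow> ev \<phi> (zmul (int n) a) = ev \<phi> a ^ n"
  by (induction n) (simp_all add: zm.scale_left_distrib ev_zero ev_add submonoid_zmul)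

lemma spec_sum:
  assumes "\<phi> \<in> spec_points S" "\<And>i. i \<in> I \<Longrightarrow> g i \<in> monoid_algebra S"
  shows "\<phi> (sum g I) = (\<Sum>i\<in>I. \<phi> (g i))"
  using assms(2)
  by (induction I rule: infinite_finite_induct)
    (simp_all add: spec_zero[OF assms(1)] spec_add[OF assms(1)] monoid_algebra_sum)

lemma spec_single:
  assumes "\<phi> \<in> spec_points S" "submonoid S" "m \<in> S"
  shows "\<phi> (Poly_Mapping.single m c) = c * ev \<phi> m"
  using spec_mult[OF assms(1), of "Poly_Mapping.single 0 c" "Poly_Mapping.single m 1"] assms
  by (simp add: mult_single ev_def monoid_algebra_single submonoid_zero spec_const)

lemma spec_expand:
  assumes "\<phi> \<in> spec_points S" "submonoid S" "f \<in> monoid_algebra S"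
  shows "\<phi> f = lincomb (ev \<phi>) f"
proof -
  have k: "m \<in> S" if "m \<in> Poly_Mapping.keys f" for m using that assms(3) by (auto simp: monoid_algebra_def)
  have "\<phi> f = \<phi> (\<Sum>m\<in>Poly_Mapping.keys f. Poly_Mapping.single m (Poly_Mapping.lookup f m))"
    using poly_mapping_expand[of f] by simp
  also have "\<dots> = (\<Sum>m\<in>Poly_Mapping.keys f. \<phi> (Poly_Mapping.single m (Poly_Mapping.lookup f m)))"
    using k by (intro spec_sum[OF assms(1)] monoid_algebra_single) auto
  also have "\<dots> = lincomb (ev \<phi>) f"
    unfolding lincomb_def using k by (intro sum.cong refl) (simp add: spec_single[OF assms(1,2)])
  finally show ?thesis .
qed

lemma lincomb_cong: "f \<in> monoid_algebra S \<Longrightarrow> (\<And>m. m \<in> S \<Longrightarrow> \<kappa> m = \<kappa>' m) \<Longrightarrow> lincomb \<kappa> f = lincomb \<kappa>' f"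
  unfolding lincomb_def monoid_algebra_def by (intro sum.cong) auto

lemma spec_eqI:
  assumes "\<phi> \<in> spec_points S" "\<psi> \<in> spec_points S" "submonoid S" "\<And>m. m \<in> S \<Longrightarrow> ev \<phi> m = ev \<psi> m"
  shows "\<phi> = \<psi>"
proof
  fix f
  show "\<phi> f = \<psi> f"
  proof (cases "f \<in> monoid_algebra S")
    case True
    then show ?thesis using assms lincomb_cong[OF True, of "ev \<phi>" "ev \<psi>"] by (simp add: spec_expand)
  next
    case False
    then show ?thesis using assms by (simp add: spec_outside)
  qed
qed

lemma mpoint_spec:
  assumes "submonoid S" "\<kappa> 0 = 1" "\<And>a b. a \<in> S \<Longrightarrow> b \<in> S \<Longrightarrow> \<kappa> (a + b) = \<kappa> a * \<kappa> b"
  shows "mpoint S \<kappa> \<in> spec_points S"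
  unfolding spec_points_def mpoint_def using assms
  by (auto simp: lincomb_add lincomb_mult[OF assms(3)] monoid_algebra_add monoid_algebra_mult
      monoid_algebra_single submonoid_zero lincomb_single)

lemma ev_mpoint: "m \<in> S \<Longrightarrow> ev (mpoint S \<kappa>) m = \<kappa> m"
  by (simp add: ev_def mpoint_def monoid_algebra_single lincomb_single)

lemma restrict_apply: "f \<in> monoid_algebra S \<Longrightarrow> restrict_point S \<phi> f = \<phi> f"
  by (simp add: restrict_point_def)

lemma ev_restrict: "m \<in> S \<Longrightarrow> ev (restrict_point S \<phi>) m = ev \<phi> m"
  by (simp add: ev_def restrict_point_def monoid_algebra_single)

lemma restrict_spec:
  assumes "submonoid S" "S \<subseteq> S'" "\<phi> \<in> spec_points S'"
  shows "restrict_point S \<phi> \<in> spec_points S"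
  unfolding spec_points_def mem_Collect_eq
proof (intro conjI ballI allI impI)
  note up = monoid_algebra_mono[OF assms(2)]
  fix f g assume fg: "f \<in> monoid_algebra S" "g \<in> monoid_algebra S"
  show "restrict_point S \<phi> (f + g) = restrict_point S \<phi> f + restrict_point S \<phi> g"
    using spec_add[OF assms(3) up up] fg by (simp add: restrict_point_def monoid_algebra_add)
  show "restrict_point S \<phi> (f * g) = restrict_point S \<phi> f * restrict_point S \<phi> g"
    using spec_mult[OF assms(3) up up] fg assms(1) by (simp add: restrict_point_def monoid_algebra_mult)
next
  show "restrict_point S \<phi> (Poly_Mapping.single 0 c) = c" for c
    using assms(1) by (simp add: restrict_point_def monoid_algebra_single submonoid_zero spec_const[OF assms(3)])
  show "restrict_point S \<phi> f = 0" if "f \<notin> monoid_algebra S" for f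
    using that by (simp add: restrict_point_def)
qed

lemma restrict_self: "\<phi> \<in> spec_points S \<Longrightarrow> restrict_point S \<phi> = \<phi>"
  by (auto simp: restrict_point_def spec_outside)

lemma restrict_restrict: "S \<subseteq> S' \<Longrightarrow> restrict_point S (restrict_point S' \<phi>) = restrict_point S \<phi>"
  using monoid_algebra_mono[of S S'] by (auto simp: restrict_point_def)

definition evals :: "'m set \<Rightarrow> ('m alg_point \<Rightarrow> complex) set" where
  "evals S = (\<lambda>f \<phi>. \<phi> f) ` monoid_algebra S"

lemma evalsI: "f \<in> monoid_algebra S \<Longrightarrow> (\<lambda>\<phi>. \<phi> f) \<in> evals S"
  by (simp add: evals_def)

lemma function_algebra_evals:
  assumes "submonoid S"
  shows "function_algebra (spec_points S) (evals S)"
  unfolding function_algebra_def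
proof (intro conjI allI ballI)
  show "\<exists>h\<in>evals S. \<forall>\<phi>\<in>spec_points S. h \<phi> = c" for c
    using assms by (intro bexI[OF _ evalsI[of "Poly_Mapping.single 0 c"]])
      (auto simp: spec_const monoid_algebra_single submonoid_zero)
  fix u v assume "u \<in> evals S" "v \<in> evals S"
  then obtain f g where f: "f \<in> monoid_algebra S" "u = (\<lambda>\<phi>. \<phi> f)" and g: "g \<in> monoid_algebra S" "v = (\<lambda>\<phi>. \<phi> g)"
    unfolding evals_def by blast
  show "\<exists>h\<in>evals S. \<forall>x\<in>spec_points S. h x = u x + v x"
    using f g by (intro bexI[OF _ evalsI[of "f + g"]]) (auto simp: spec_add monoid_algebra_add)
  show "\<exists>h\<in>evals S. \<forall>x\<in>spec_points S. h x = u x * v x"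
    using f g assms by (intro bexI[OF _ evalsI[of "f * g"]]) (auto simp: spec_mult monoid_algebra_mult)
qed

abbreviation spec_space :: "'m::ab_group_add set \<Rightarrow> 'm alg_point fspace" where
  "spec_space S \<equiv> zariski (spec_points S) (evals S)"

lemma openin_spec:
  assumes "submonoid S"
  shows "openin (fs_top (spec_space S)) W \<longleftrightarrow> W \<subseteq> spec_points S \<and>
    (\<forall>\<phi>\<in>W. \<exists>f\<in>monoid_algebra S. \<phi> f \<noteq> 0 \<and> (\<forall>\<psi>\<in>spec_points S. \<psi> f \<noteq> 0 \<longrightarrow> \<psi> \<in> W))"
  unfolding openin_zariski[OF function_algebra_evals[OF assms]] by (simp add: evals_def)

lemma fs_reg_spec:
  assumes "submonoid S" "openin (fs_top (spec_space S)) W"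
  shows "h \<in> fs_reg (spec_space S) W \<longleftrightarrow>
    (\<forall>\<phi>\<in>W. \<exists>a\<in>monoid_algebra S. \<exists>b\<in>monoid_algebra S. \<phi> b \<noteq> 0 \<and> (\<forall>\<psi>\<in>W. \<psi> b * h \<psi> = \<psi> a))"
  unfolding fs_reg_zariski[OF function_algebra_evals[OF assms(1)] assms(2)] by (simp add: evals_def)

lemma pts_spec: "submonoid S \<Longrightarrow> pts (spec_space S) = spec_points S"
  by (rule pts_zariski[OF function_algebra_evals])

subsection \<open>The torus action\<close>

lemma lookup_twist: "Poly_Mapping.lookup (twist t f) m = t m * Poly_Mapping.lookup f m"
proof -
  have "Poly_Mapping.lookup (twist t f) m = (\<Sum>k\<in>Poly_Mapping.keys f. if k = m then t m * Poly_Mapping.lookup f m else 0)"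
    unfolding twist_def lookup_sum by (intro sum.cong) (auto simp: lookup_single when_def)
  then show ?thesis by (simp add: in_keys_iff)
qed

lemma keys_twist: "(\<And>a. t a \<noteq> 0) \<Longrightarrow> Poly_Mapping.keys (twist t f) = Poly_Mapping.keys f"
  by (auto simp: in_keys_iff lookup_twist)

lemma twist_point:
  assumes phi: "\<phi> \<in> spec_points S" and S: "submonoid S" and t: "t \<in> torus M"
  shows "(\<lambda>f. \<phi> (twist t f)) = mpoint S (\<lambda>m. t m * ev \<phi> m)"
proof
  fix f
  note nz = torus_nonzero[OF t]
  have in_iff: "twist t f \<in> monoid_algebra S \<longleftrightarrow> f \<in> monoid_algebra S"
    by (simp add: monoid_algebra_def keys_twist nz)
  show "\<phi> (twist t f) = mpoint S (\<lambda>m. t m * ev \<phi> m) f"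
  proof (cases "f \<in> monoid_algebra S")
    case True
    then have "\<phi> (twist t f) = lincomb (ev \<phi>) (twist t f)" by (simp add: spec_expand[OF phi S] in_iff)
    then show ?thesis using True by (simp add: mpoint_def lincomb_def keys_twist nz lookup_twist mult_ac)
  next
    case False
    then show ?thesis by (simp add: mpoint_def spec_outside[OF phi] in_iff)
  qed
qed

lemma
  assumes phi: "\<phi> \<in> spec_points S" and S: "submonoid S" and SM: "S \<subseteq> M" and t: "t \<in> torus M"
  shows twist_spec: "(\<lambda>f. \<phi> (twist t f)) \<in> spec_points S"
    and ev_twist: "m \<in> S \<Longrightarrow> ev (\<lambda>f. \<phi> (twist t f)) m = t m * ev \<phi> m"
proof -
  have "t 0 = 1" using SM submonoid_zero[OF S] by (intro torus_zero[OF t]) auto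
  then show "(\<lambda>f. \<phi> (twist t f)) \<in> spec_points S" unfolding twist_point[OF phi S t]
    using SM by (intro mpoint_spec[OF S])
      (auto simp: ev_zero[OF phi] ev_add[OF phi] torus_add[OF t] subset_iff)
  show "ev (\<lambda>f. \<phi> (twist t f)) m = t m * ev \<phi> m" if "m \<in> S"
    unfolding twist_point[OF phi S t] using that by (simp add: ev_mpoint)
qed

subsection \<open>Localisation\<close>

text \<open>\<open>S'\<close> arises from \<open>S\<close> by inverting \<open>m\<close>. On spectra, restriction from \<open>S'\<close> to \<open>S\<close> is then the
  inclusion of the principal open set \<open>{m \<noteq> 0}\<close>.\<close>

definition localises :: "'m::ab_group_add set \<Rightarrow> 'm set \<Rightarrow> 'm \<Rightarrow> bool" where
  "localises S S' m \<longleftrightarrow> submonoid S \<and> submonoid S' \<and> S \<subseteq> S' \<and> m \<in> S \<and> - m \<in> S' \<and>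
     (\<forall>a\<in>S'. \<exists>n. a + zmul (int n) m \<in> S)"

lemma localises_nonzero:
  assumes "localises S S' m" "\<omega> \<in> spec_points S'"
  shows "ev \<omega> m \<noteq> 0"
proof -
  have "ev \<omega> (m + - m) = ev \<omega> m * ev \<omega> (- m)"
    using assms unfolding localises_def by (intro ev_add[OF assms(2)]) auto
  then show ?thesis using ev_zero[OF assms(2)] by auto
qed

lemma localises_inj:
  assumes loc: "localises S S' m" and w: "\<omega> \<in> spec_points S'" "\<omega>' \<in> spec_points S'"
    and eq: "restrict_point S \<omega> = restrict_point S \<omega>'"
  shows "\<omega> = \<omega>'"
proof (rule spec_eqI[OF w])
  have S: "submonoid S" "submonoid S'" "S \<subseteq> S'" "m \<in> S" using loc unfolding localises_def by auto
  show "submonoid S'" by fact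
  have evS: "ev \<omega> a = ev \<omega>' a" if "a \<in> S" for a using ev_restrict[OF that] eq by metis
  fix a assume a: "a \<in> S'"
  then obtain n where n: "a + zmul (int n) m \<in> S" using loc unfolding localises_def by auto
  have nm: "zmul (int n) m \<in> S" "zmul (int n) m \<in> S'" using submonoid_zmul[OF S(1,4)] S(3) by auto
  have "ev \<omega> a * ev \<omega> (zmul (int n) m) = ev \<omega>' a * ev \<omega>' (zmul (int n) m)"
    using evS[OF n] ev_add[OF w(1) a nm(2)] ev_add[OF w(2) a nm(2)] by simp
  moreover have "ev \<omega> (zmul (int n) m) \<noteq> 0"
    using localises_nonzero[OF loc w(1)] S by (subst ev_zmul[OF w(1)]) auto
  ultimately show "ev \<omega> a = ev \<omega>' a" using evS[OF nm(1)] by simp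
qed

text \<open>The value at \<open>a\<close> has to be \<open>\<phi> (a + n m) / \<phi> (m)\<^sup>n\<close> for any \<open>n\<close> with \<open>a + n m \<in> S\<close>; the choice of \<open>n\<close>
  does not matter.\<close>

lemma localises_extend:
  assumes loc: "localises S S' m" and phi: "\<phi> \<in> spec_points S" and nz: "ev \<phi> m \<noteq> 0"
  obtains \<omega> where "\<omega> \<in> spec_points S'" "restrict_point S \<omega> = \<phi>"
proof -
  have S: "submonoid S" "submonoid S'" "S \<subseteq> S'" "m \<in> S" using loc unfolding localises_def by auto
  have "\<exists>N. \<forall>a\<in>S'. a + zmul (int (N a)) m \<in> S" using loc unfolding localises_def by (metis bchoice)
  then obtain N where N: "\<And>a. a \<in> S' \<Longrightarrow> a + zmul (int (N a)) m \<in> S" by blast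
  define \<kappa> where "\<kappa> a = ev \<phi> (a + zmul (int (N a)) m) / ev \<phi> m ^ N a" for a
  have evm: "ev \<phi> (b + zmul (int n) m) = ev \<phi> b * ev \<phi> m ^ n" if "b \<in> S" for b n
    using ev_add[OF phi that submonoid_zmul[OF S(1,4)]] ev_zmul[OF phi S(1,4)] by simp
  have chi: "ev \<phi> (a + zmul (int n) m) = \<kappa> a * ev \<phi> m ^ n" if a: "a \<in> S'" and n: "a + zmul (int n) m \<in> S" for a n
  proof -
    have "ev \<phi> ((a + zmul (int n) m) + zmul (int (N a)) m) = ev \<phi> ((a + zmul (int (N a)) m) + zmul (int n) m)"
      by (simp add: algebra_simps)
    then have "ev \<phi> (a + zmul (int n) m) * ev \<phi> m ^ N a = ev \<phi> (a + zmul (int (N a)) m) * ev \<phi> m ^ n"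
      unfolding evm[OF n] evm[OF N[OF a]] .
    then show ?thesis using nz by (simp add: \<kappa>_def field_simps)
  qed
  have chiS: "\<kappa> a = ev \<phi> a" if "a \<in> S" for a using chi[of a 0] that S(3) by auto
  have "mpoint S' \<kappa> \<in> spec_points S'"
  proof (rule mpoint_spec[OF S(2)])
    show "\<kappa> 0 = 1" using chiS[OF submonoid_zero[OF S(1)]] ev_zero[OF phi] by simp
    fix a b assume ab: "a \<in> S'" "b \<in> S'"
    have eq: "(a + b) + zmul (int (N a + N b)) m = (a + zmul (int (N a)) m) + (b + zmul (int (N b)) m)"
      by (simp add: zm.scale_left_distrib algebra_simps)
    then have "\<kappa> (a + b) * ev \<phi> m ^ (N a + N b) = ev \<phi> (a + zmul (int (N a)) m) * ev \<phi> (b + zmul (int (N b)) m)"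
      using chi[of "a + b" "N a + N b"] ab N submonoid_add[OF S(2)] submonoid_add[OF S(1)] ev_add[OF phi]
      by (metis (no_types, lifting))
    also have "\<dots> = \<kappa> a * \<kappa> b * ev \<phi> m ^ (N a + N b)"
      using chi[OF ab(1) N[OF ab(1)]] chi[OF ab(2) N[OF ab(2)]] by (simp add: power_add)
    finally show "\<kappa> (a + b) = \<kappa> a * \<kappa> b" using nz by simp
  qed
  moreover from this have "restrict_point S (mpoint S' \<kappa>) = \<phi>"
    using S chiS by (intro spec_eqI[OF restrict_spec[OF S(1,3)] phi S(1)])
      (auto simp: ev_restrict ev_mpoint subset_iff)
  ultimately show thesis by (rule that)
qed

lemma localises_clear:
  assumes loc: "localises S S' m" and f: "f \<in> monoid_algebra S'"
  obtains N where "\<forall>n\<ge>N. Poly_Mapping.single (zmul (int n) m) 1 * f \<in> monoid_algebra S"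
proof -
  have S: "submonoid S" "submonoid S'" "S \<subseteq> S'" "m \<in> S" using loc unfolding localises_def by auto
  have "\<forall>a\<in>Poly_Mapping.keys f. \<exists>n. a + zmul (int n) m \<in> S"
    using loc f unfolding localises_def monoid_algebra_def by blast
  then obtain k where k: "\<And>a. a \<in> Poly_Mapping.keys f \<Longrightarrow> a + zmul (int (k a)) m \<in> S" by metis
  define N where "N = Max (insert 0 (k ` Poly_Mapping.keys f))"
  have "Poly_Mapping.single (zmul (int n) m) 1 * f \<in> monoid_algebra S" if n: "N \<le> n" for n
    unfolding monoid_algebra_def mem_Collect_eq
  proof
    fix b assume "b \<in> Poly_Mapping.keys (Poly_Mapping.single (zmul (int n) m) 1 * f)"
    then obtain a where a: "a \<in> Poly_Mapping.keys f" "b = zmul (int n) m + a"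
      using keys_mult[of "Poly_Mapping.single (zmul (int n) m) 1" f] by auto
    have "k a \<le> N" using a by (simp add: N_def)
    then obtain r where r: "n = k a + r" using n le_Suc_ex le_trans by blast
    have "b = (a + zmul (int (k a)) m) + zmul (int r) m"
      using a(2) unfolding r by (simp add: zm.scale_left_distrib algebra_simps)
    then show "b \<in> S" using k[OF a(1)] submonoid_add[OF S(1)] submonoid_zmul[OF S(1,4)] by simp
  qed
  then show thesis by (intro that[of N]) simp
qed

section \<open>The affine quotient\<close>

text \<open>\<open>S\<close> consists of the exponents of a chart and \<open>S \<inter> L\<close> of the \<open>G\<close>-invariant ones; the quotient map of
  the chart is restriction of points from \<open>S\<close> to \<open>S \<inter> L\<close>.\<close>

locale monoid_quotient =
  fixes M L S :: "'m::ab_group_add set"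
  assumes lattice: "lattice_set M" and sub: "sublattice L M"
    and mon: "submonoid S" and SM: "S \<subseteq> M"
begin

lemma lattice_self: "sublattice M M"
  by (rule lattice_sublattice_self[OF lattice])

lemma mon_inter: "submonoid (S \<inter> L)"
  using mon sublattice_zero[OF sub] sublattice_add[OF sub] unfolding submonoid_def by auto

text \<open>Points with a closed orbit: no exponent of the support can be dropped without changing the
  restriction to \<open>L\<close>, as each has a multiple of its monomial that lies in \<open>L\<close> and is nonzero.\<close>

definition polystable :: "'m alg_point \<Rightarrow> bool" where
  "polystable \<phi> \<longleftrightarrow> \<phi> \<in> spec_points S \<and>
     (\<forall>m\<in>S. ev \<phi> m \<noteq> 0 \<longrightarrow> (\<exists>n\<in>S. m + n \<in> L \<and> ev \<phi> (m + n) \<noteq> 0))"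

text \<open>Let \<open>F\<close> be the support of \<open>\<psi>\<close>. Every extension of \<open>\<psi>\<close> is nonzero on the face \<open>F'\<close> of \<open>S\<close> that \<open>F\<close>
  generates. Extend the character of the group of \<open>F\<close> to \<open>M\<close>, use it on \<open>F'\<close>, and put \<open>0\<close> elsewhere;
  this is multiplicative because \<open>F'\<close> is a face, and it restricts to \<open>\<psi>\<close> because \<open>F' \<inter> L = F\<close>.\<close>

lemma polystable_lift:
  assumes psi: "\<psi> \<in> spec_points (S \<inter> L)"
  obtains \<phi> where "polystable \<phi>" "restrict_point (S \<inter> L) \<phi> = \<psi>"
proof -
  define F where "F = {m \<in> S \<inter> L. ev \<psi> m \<noteq> 0}"
  define F' where "F' = {m \<in> S. \<exists>n\<in>S. m + n \<in> F}"
  have evadd: "ev \<psi> (a + b) = ev \<psi> a * ev \<psi> b" if "a \<in> S \<inter> L" "b \<in> S \<inter> L" for a b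
    using ev_add[OF psi that] .
  have F0: "0 \<in> F" using ev_zero[OF psi] submonoid_zero[OF mon_inter] by (simp add: F_def)
  have Fadd: "a + b \<in> F" if "a \<in> F" "b \<in> F" for a b
    using that evadd[of a b] submonoid_add[OF mon_inter, of a b] by (auto simp: F_def)
  have Fev: "ev \<psi> (a + b) = ev \<psi> a * ev \<psi> b" if "a \<in> F" "b \<in> F" for a b
    using that evadd by (auto simp: F_def)
  have FM: "a \<in> M" if "a \<in> F" for a using that SM by (auto simp: F_def)
  have Fnz: "ev \<psi> a \<noteq> 0" if "a \<in> F" for a using that by (simp add: F_def)
  let ?R = "{(a - b, ev \<psi> a / ev \<psi> b) |a b. a \<in> F \<and> b \<in> F}"
  have "partial_character M ?R" unfolding partial_character_def
  proof (intro conjI allI impI)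
    show "(0, 1) \<in> ?R" using F0 Fnz[OF F0] by force
    show "a \<in> M" "x \<noteq> 0" if "(a, x) \<in> ?R" for a x
      using that FM Fnz by (auto intro: sublattice_diff[OF lattice_self])
    show "z = 1" if "(0, z) \<in> ?R" for z using that Fnz by auto
    fix a x b y assume "(a, x) \<in> ?R" "(b, y) \<in> ?R"
    then obtain a1 a2 b1 b2 where *: "a = a1 - a2" "x = ev \<psi> a1 / ev \<psi> a2" "a1 \<in> F" "a2 \<in> F"
      "b = b1 - b2" "y = ev \<psi> b1 / ev \<psi> b2" "b1 \<in> F" "b2 \<in> F" by blast
    have "a - b = (a1 + b2) - (a2 + b1)" using * by (simp add: algebra_simps)
    moreover have "x / y = ev \<psi> (a1 + b2) / ev \<psi> (a2 + b1)" using * by (simp add: Fev)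
    ultimately show "(a - b, x / y) \<in> ?R" using Fadd * by blast
  qed
  then obtain t where t: "t \<in> torus M" "\<And>a x. (a, x) \<in> ?R \<Longrightarrow> t a = x"
    by (rule pchar_extend[OF lattice]) blast
  have tF: "t a = ev \<psi> a" if "a \<in> F" for a
  proof (rule t(2))
    have "a = a - 0" "ev \<psi> a = ev \<psi> a / ev \<psi> 0" using ev_zero[OF psi] by simp_all
    then show "(a, ev \<psi> a) \<in> ?R" using that F0 by blast
  qed
  have F'iff: "a + b \<in> F' \<longleftrightarrow> a \<in> F' \<and> b \<in> F'" if "a \<in> S" "b \<in> S" for a b
  proof
    assume "a + b \<in> F'"
    then obtain n where n: "n \<in> S" "a + b + n \<in> F" unfolding F'_def by blast
    have "a + (b + n) \<in> F" "b + (a + n) \<in> F" using n(2) by (simp_all add: algebra_simps)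
    then show "a \<in> F' \<and> b \<in> F'" using that n(1) submonoid_add[OF mon] unfolding F'_def by blast
  next
    assume "a \<in> F' \<and> b \<in> F'"
    then obtain n k where n: "n \<in> S" "a + n \<in> F" "k \<in> S" "b + k \<in> F" unfolding F'_def by blast
    have "(a + b) + (n + k) = (a + n) + (b + k)" by (simp add: algebra_simps)
    then have "(a + b) + (n + k) \<in> F" using Fadd n by metis
    then show "a + b \<in> F'" using that n submonoid_add[OF mon] unfolding F'_def by blast
  qed
  have F'L: "m \<in> F' \<longleftrightarrow> m \<in> F" if m: "m \<in> S \<inter> L" for m
  proof
    assume "m \<in> F'"
    then obtain n where n: "n \<in> S" "m + n \<in> F" unfolding F'_def by blast
    have "n \<in> L" using sublattice_diff[OF sub, of "m + n" m] n(2) m by (simp add: F_def)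
    then have "ev \<psi> m * ev \<psi> n \<noteq> 0" using evadd[OF m, of n] n Fnz[OF n(2)] by simp
    then show "m \<in> F" using m by (simp add: F_def)
  next
    assume "m \<in> F"
    then show "m \<in> F'" using m submonoid_zero[OF mon] unfolding F'_def by (auto intro: bexI[of _ 0])
  qed
  define \<kappa> where "\<kappa> m = (if m \<in> F' then t m else 0)" for m
  let ?p = "mpoint S \<kappa>"
  have p: "?p \<in> spec_points S"
  proof (rule mpoint_spec[OF mon])
    show "\<kappa> 0 = 1"
      using F'L[OF submonoid_zero[OF mon_inter]] F0 tF[OF F0] ev_zero[OF psi] by (simp add: \<kappa>_def)
    show "\<kappa> (a + b) = \<kappa> a * \<kappa> b" if "a \<in> S" "b \<in> S" for a b
      using that F'iff[OF that] SM by (auto simp: \<kappa>_def torus_add[OF t(1)] subset_iff)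
  qed
  have pev: "ev ?p m = \<kappa> m" if "m \<in> S" for m using ev_mpoint[OF that] .
  show thesis
  proof (rule that)
    show "restrict_point (S \<inter> L) ?p = \<psi>"
    proof (rule spec_eqI[OF restrict_spec[OF mon_inter _ p] psi mon_inter])
      show "ev (restrict_point (S \<inter> L) ?p) m = ev \<psi> m" if m: "m \<in> S \<inter> L" for m
        using pev[of m] m F'L[OF m] tF[of m] by (auto simp: ev_restrict[OF m] \<kappa>_def F_def)
    qed simp
    show "polystable ?p" unfolding polystable_def
    proof (intro conjI ballI impI p)
      fix m assume m: "m \<in> S" "ev ?p m \<noteq> 0"
      then have "\<kappa> m \<noteq> 0" using pev by simp
      then have "m \<in> F'" by (simp add: \<kappa>_def split: if_splits)
      then obtain n where n: "n \<in> S" "m + n \<in> F" unfolding F'_def by blast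
      have "m + n \<in> F'" using F'L[of "m + n"] n(2) by (simp add: F_def)
      then have "ev ?p (m + n) \<noteq> 0"
        using pev[OF submonoid_add[OF mon m(1) n(1)]] torus_nonzero[OF t(1)] by (simp add: \<kappa>_def)
      then show "\<exists>n\<in>S. m + n \<in> L \<and> ev ?p (m + n) \<noteq> 0" using n by (auto simp: F_def)
    qed
  qed
qed

text \<open>The support of a polystable point is the least face of \<open>S\<close> containing the support of its
  restriction to \<open>S \<inter> L\<close>. So two polystable points with the same restriction have the same support,
  and their quotient is a character of the group generated by it, trivial on \<open>L\<close>.\<close>

lemma polystable_orbit:
  assumes s: "polystable \<phi>" "polystable \<phi>'" and eq: "restrict_point (S \<inter> L) \<phi> = restrict_point (S \<inter> L) \<phi>'"
  obtains t where "t \<in> quotient_group M L" "\<phi>' = (\<lambda>f. \<phi> (twist t f))"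
proof -
  have phi: "\<phi> \<in> spec_points S" "\<phi>' \<in> spec_points S" using s unfolding polystable_def by auto
  have evL: "ev \<phi> m = ev \<phi>' m" if "m \<in> S" "m \<in> L" for m
    using ev_restrict[of m "S \<inter> L"] eq that by (metis IntI)
  have half: "ev \<phi>2 m \<noteq> 0" if st: "polystable \<phi>1" "polystable \<phi>2"
    and e: "\<And>m. m \<in> S \<Longrightarrow> m \<in> L \<Longrightarrow> ev \<phi>1 m = ev \<phi>2 m" and m: "m \<in> S" "ev \<phi>1 m \<noteq> 0" for \<phi>1 \<phi>2 m
  proof -
    obtain n where n: "n \<in> S" "m + n \<in> L" "ev \<phi>1 (m + n) \<noteq> 0" using st(1) m unfolding polystable_def by blast
    have "ev \<phi>2 (m + n) \<noteq> 0" using n e submonoid_add[OF mon m(1) n(1)] by simp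
    moreover have "ev \<phi>2 (m + n) = ev \<phi>2 m * ev \<phi>2 n"
      using st(2) m(1) n(1) unfolding polystable_def by (intro ev_add) auto
    ultimately show ?thesis by simp
  qed
  define A where "A = {m \<in> S. ev \<phi> m \<noteq> 0}"
  have A': "m \<in> A \<longleftrightarrow> ev \<phi>' m \<noteq> 0" if "m \<in> S" for m
  proof -
    have "ev \<phi> m \<noteq> 0 \<Longrightarrow> ev \<phi>' m \<noteq> 0" by (rule half[OF s evL that])
    moreover have "ev \<phi>' m \<noteq> 0 \<Longrightarrow> ev \<phi> m \<noteq> 0" by (rule half[OF s(2,1) evL[symmetric] that])
    ultimately show ?thesis using that by (auto simp: A_def)
  qed
  define r where "r m = ev \<phi>' m / ev \<phi> m" for m
  have A0: "0 \<in> A" using submonoid_zero[OF mon] ev_zero[OF phi(1)] by (simp add: A_def)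
  have Aadd: "a + b \<in> A" if "a \<in> A" "b \<in> A" for a b
    using that submonoid_add[OF mon] ev_add[OF phi(1)] by (auto simp: A_def)
  have AS: "a \<in> S" if "a \<in> A" for a using that by (simp add: A_def)
  have rnz: "r a \<noteq> 0" if "a \<in> A" for a using that A'[OF AS[OF that]] by (auto simp: A_def r_def)
  have radd: "r (a + b) = r a * r b" if "a \<in> A" "b \<in> A" for a b
    using that AS by (simp add: r_def ev_add[OF phi(1)] ev_add[OF phi(2)])
  have r0: "r 0 = 1" by (simp add: r_def ev_zero[OF phi(1)] ev_zero[OF phi(2)])
  have rL: "r a = 1" if "a \<in> A" "a \<in> L" for a
  proof -
    have "ev \<phi> a = ev \<phi>' a" by (rule evL[OF AS]) fact+
    moreover have "ev \<phi> a \<noteq> 0" using that(1) by (simp add: A_def)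
    ultimately show ?thesis by (simp add: r_def)
  qed
  have rcong: "r a = r b" if ab: "a \<in> A" "b \<in> A" "a - b \<in> L" for a b
  proof -
    obtain n where n: "n \<in> S" "b + n \<in> L" "ev \<phi> (b + n) \<noteq> 0"
      using s(1) ab(2) unfolding polystable_def A_def by blast
    have "ev \<phi> (b + n) = ev \<phi> b * ev \<phi> n" by (rule ev_add[OF phi(1) AS[OF ab(2)] n(1)])
    then have nA: "n \<in> A" using n by (simp add: A_def)
    have "a + n = (a - b) + (b + n)" by simp
    then have "a + n \<in> L" using sublattice_add[OF sub ab(3) n(2)] by simp
    then have "r (a + n) = 1" "r (b + n) = 1" by (intro rL Aadd ab nA n(2); assumption)+
    then have "r a * r n = r b * r n" using radd[OF ab(1) nA] radd[OF ab(2) nA] by simp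
    then show ?thesis using rnz[OF nA] by simp
  qed
  let ?R = "{(a - b + c, r a / r b) |a b c. a \<in> A \<and> b \<in> A \<and> c \<in> L}"
  have "partial_character M ?R" unfolding partial_character_def
  proof (intro conjI allI impI)
    have "(0::'m) = 0 - 0 + 0" "(1::complex) = r 0 / r 0" using r0 by simp_all
    then show "(0, 1) \<in> ?R" using A0 sublattice_zero[OF sub] by blast
    show "a \<in> M" "x \<noteq> 0" if "(a, x) \<in> ?R" for a x
      using that AS SM rnz sublattice_subset[OF sub] by (auto intro!: sublattice_diff[OF lattice_self] sublattice_add[OF lattice_self])
    show "z = 1" if "(0, z) \<in> ?R" for z
    proof -
      obtain a b c where *: "0 = a - b + c" "z = r a / r b" "a \<in> A" "b \<in> A" "c \<in> L" using \<open>(0, z) \<in> ?R\<close> by blast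
      have "a - b = - c" using *(1) by (simp add: eq_neg_iff_add_eq_0)
      then have "a - b \<in> L" using sublattice_minus[OF sub *(5)] by simp
      then show ?thesis using rcong * rnz by simp
    qed
    fix a x b y assume "(a, x) \<in> ?R" "(b, y) \<in> ?R"
    then obtain a1 a2 a3 b1 b2 b3 where *: "a = a1 - a2 + a3" "x = r a1 / r a2" "a1 \<in> A" "a2 \<in> A" "a3 \<in> L"
      "b = b1 - b2 + b3" "y = r b1 / r b2" "b1 \<in> A" "b2 \<in> A" "b3 \<in> L" by blast
    have "a - b = (a1 + b2) - (a2 + b1) + (a3 - b3)" using * by (simp add: algebra_simps)
    moreover have "x / y = r (a1 + b2) / r (a2 + b1)" using * by (simp add: radd)
    ultimately show "(a - b, x / y) \<in> ?R" using Aadd * sublattice_diff[OF sub] by blast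
  qed
  then obtain t where t: "t \<in> torus M" "\<And>a x. (a, x) \<in> ?R \<Longrightarrow> t a = x"
    by (rule pchar_extend[OF lattice]) blast
  have "t c = 1" if c: "c \<in> L" for c
  proof (rule t(2))
    have "c = 0 - 0 + c" "(1::complex) = r 0 / r 0" using r0 by simp_all
    then show "(c, 1) \<in> ?R" using A0 c by blast
  qed
  then have tG: "t \<in> quotient_group M L" using t(1) by (simp add: quotient_group_def)
  have tA: "t a = r a" if a: "a \<in> A" for a
  proof (rule t(2))
    have "a = a - 0 + 0" "r a = r a / r 0" using r0 by simp_all
    then show "(a, r a) \<in> ?R" using A0 a sublattice_zero[OF sub] by blast
  qed
  have "\<phi>' = (\<lambda>f. \<phi> (twist t f))"
  proof (rule spec_eqI[OF phi(2) twist_spec[OF phi(1) mon SM t(1)] mon])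
    fix m assume m: "m \<in> S"
    show "ev \<phi>' m = ev (\<lambda>f. \<phi> (twist t f)) m"
      using tA[of m] A'[OF m] m by (cases "m \<in> A") (auto simp: ev_twist[OF phi(1) mon SM t(1) m] r_def A_def)
  qed
  with tG show thesis by (rule that)
qed

text \<open>The product of \<open>c\<close> with the monomial of \<open>n\<close>, reduced to its \<open>G\<close>-invariant part, that is, to the
  exponents in \<open>L\<close>.\<close>

definition shift_part :: "'m \<Rightarrow> ('m \<Rightarrow>\<^sub>0 complex) \<Rightarrow> ('m \<Rightarrow>\<^sub>0 complex)" where
  "shift_part n c = (\<Sum>m | m \<in> Poly_Mapping.keys c \<and> m + n \<in> L. Poly_Mapping.single (m + n) (Poly_Mapping.lookup c m))"

lemma shift_part_mem:
  assumes "c \<in> monoid_algebra S" "n \<in> S"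
  shows "shift_part n c \<in> monoid_algebra (S \<inter> L)"
  unfolding shift_part_def
proof (intro monoid_algebra_sum monoid_algebra_single)
  fix m assume "m \<in> {m. m \<in> Poly_Mapping.keys c \<and> m + n \<in> L}"
  then show "m + n \<in> S \<inter> L" using assms submonoid_add[OF mon] by (auto simp: monoid_algebra_def)
qed

lemma shift_part_eval:
  assumes phi: "\<phi> \<in> spec_points S" and c: "c \<in> monoid_algebra S" and n: "n \<in> S"
  shows "\<phi> (shift_part n c) = (\<Sum>m | m \<in> Poly_Mapping.keys c \<and> m + n \<in> L. Poly_Mapping.lookup c m * ev \<phi> (m + n))"
proof -
  have S: "m + n \<in> S" if "m \<in> Poly_Mapping.keys c" for m
    using that c n submonoid_add[OF mon] by (auto simp: monoid_algebra_def)
  show ?thesis unfolding shift_part_def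
    using S by (subst spec_sum[OF phi]) (auto intro!: sum.cong monoid_algebra_single simp: spec_single[OF phi mon])
qed

text \<open>Twisting by \<open>t\<close> multiplies the term of exponent \<open>m\<close> by \<open>t m\<close>, so the hypothesis is a family of
  relations between characters of \<open>G\<close>; their trivial part is the conclusion.\<close>

lemma shift_part_relation:
  assumes phi: "\<phi> \<in> spec_points S" and c: "c \<in> monoid_algebra S" and a: "a \<in> monoid_algebra S" and n: "n \<in> S"
    and rel: "\<And>t. t \<in> quotient_group M L \<Longrightarrow> \<phi> (twist t c) * k = \<phi> (twist t a)"
  shows "\<phi> (shift_part n c) * k = \<phi> (shift_part n a)"
proof -
  let ?l = Poly_Mapping.lookup
  define K where "K = Poly_Mapping.keys c \<union> Poly_Mapping.keys a"
  have K: "finite K" "K \<subseteq> S" using a c by (auto simp: K_def monoid_algebra_def)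
  have ext: "lincomb \<kappa> f = (\<Sum>m\<in>K. ?l f m * \<kappa> m)" if "f = c \<or> f = a" for f \<kappa>
    unfolding lincomb_def using that K(1)
    by (intro sum.mono_neutral_left) (auto simp: K_def in_keys_iff)
  define d where "d m = (?l c m * k - ?l a m) * ev \<phi> (m + n)" for m
  have "(\<Sum>m\<in>K. t (m + n) * d m) = 0" if t: "t \<in> quotient_group M L" for t
  proof -
    have tT: "t \<in> torus M" using t by (simp add: quotient_group_def)
    have nz: "\<And>a. t a \<noteq> 0" using torus_nonzero[OF tT] .
    have tw: "\<phi> (twist t f) = (\<Sum>m\<in>K. ?l f m * (t m * ev \<phi> m))" if f: "f = c \<or> f = a" for f
    proof -
      have "f \<in> monoid_algebra S" using f a c by auto
      then have "\<phi> (twist t f) = lincomb (\<lambda>m. t m * ev \<phi> m) f"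
        using fun_cong[OF twist_point[OF phi mon tT], of f] by (simp add: mpoint_def)
      then show ?thesis using ext[OF f] by simp
    qed
    have "t (m + n) * d m = (t n * ev \<phi> n) * ((?l c m * (t m * ev \<phi> m)) * k - ?l a m * (t m * ev \<phi> m))"
      if "m \<in> K" for m
    proof -
      have m: "m \<in> S" using that K(2) by auto
      have "t (m + n) = t m * t n" using torus_add[OF tT] m n SM by auto
      then show ?thesis using ev_add[OF phi m n] by (simp add: d_def algebra_simps)
    qed
    then have "(\<Sum>m\<in>K. t (m + n) * d m)
      = (\<Sum>m\<in>K. (t n * ev \<phi> n) * ((?l c m * (t m * ev \<phi> m)) * k - ?l a m * (t m * ev \<phi> m)))"
      by (rule sum.cong[OF refl])
    also have "\<dots>
      = (t n * ev \<phi> n) * ((\<Sum>m\<in>K. ?l c m * (t m * ev \<phi> m)) * k - (\<Sum>m\<in>K. ?l a m * (t m * ev \<phi> m)))"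
      by (simp only: sum_distrib_left[symmetric] sum_distrib_right[symmetric] sum_subtractf)
    also have "\<dots> = 0" using rel[OF t] tw[of c] tw[of a] by simp
    finally show ?thesis .
  qed
  then have 0: "(\<Sum>m | m \<in> K \<and> m + n \<in> L. d m) = 0"
    using K n SM by (intro quotient_group_projection[OF lattice sub] sublattice_add[OF lattice_self]) auto
  have ev: "\<phi> (shift_part n f) = (\<Sum>m | m \<in> K \<and> m + n \<in> L. ?l f m * ev \<phi> (m + n))" if f: "f = c \<or> f = a" for f
  proof -
    have "f \<in> monoid_algebra S" using f a c by auto
    moreover have "(\<Sum>m | m \<in> Poly_Mapping.keys f \<and> m + n \<in> L. ?l f m * ev \<phi> (m + n))
      = (\<Sum>m | m \<in> K \<and> m + n \<in> L. ?l f m * ev \<phi> (m + n))"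
    proof (rule sum.mono_neutral_left)
      show "finite {m. m \<in> K \<and> m + n \<in> L}" using K(1) by simp
      show "{m. m \<in> Poly_Mapping.keys f \<and> m + n \<in> L} \<subseteq> {m. m \<in> K \<and> m + n \<in> L}"
        using f by (auto simp: K_def)
    qed (auto simp: in_keys_iff)
    ultimately show ?thesis by (simp add: shift_part_eval[OF phi _ n])
  qed
  have "\<phi> (shift_part n c) * k - \<phi> (shift_part n a) = (\<Sum>m | m \<in> K \<and> m + n \<in> L. d m)"
    unfolding ev[of c, simplified] ev[of a, simplified] sum_distrib_right sum_subtractf[symmetric] d_def
    by (intro sum.cong refl) (simp add: algebra_simps)
  then show ?thesis using 0 by simp
qed

text \<open>Group the terms of \<open>c\<close> by their class modulo \<open>L\<close>. Some class has a nonzero sum at \<open>\<phi>\<close>, and some term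
  \<open>m\<close> in it is nonzero there. Polystability provides \<open>n\<close> that moves \<open>m\<close>, and with it the whole class, into
  \<open>L\<close> and is itself nonzero at \<open>\<phi>\<close>.\<close>

lemma shift_part_nonzero:
  assumes st: "polystable \<phi>" and c: "c \<in> monoid_algebra S" and nz: "\<phi> c \<noteq> 0"
  obtains n where "n \<in> S" "\<phi> (shift_part n c) \<noteq> 0"
proof -
  have phi: "\<phi> \<in> spec_points S" using st by (simp add: polystable_def)
  let ?K = "Poly_Mapping.keys c" and ?g = "\<lambda>m. Poly_Mapping.lookup c m * ev \<phi> m"
  let ?cl = "\<lambda>m. {x \<in> ?K. x - m \<in> L}"
  have KS: "m \<in> S" if "m \<in> ?K" for m using that c by (auto simp: monoid_algebra_def)
  have cl: "x - m \<in> L \<longleftrightarrow> ?cl x = ?cl m" if "x \<in> ?K" "m \<in> ?K" for x m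
  proof
    assume xm: "x - m \<in> L"
    have "y - x \<in> L \<longleftrightarrow> y - m \<in> L" for y
      using sublattice_add[OF sub _ xm, of "y - x"] sublattice_diff[OF sub _ xm, of "y - m"] by auto
    then show "?cl x = ?cl m" by blast
  next
    assume "?cl x = ?cl m"
    moreover have "x \<in> ?cl x" using that sublattice_zero[OF sub] by simp
    ultimately show "x - m \<in> L" by blast
  qed
  have "(\<Sum>m\<in>?K. ?g m) \<noteq> 0" using nz spec_expand[OF phi mon c] by (simp add: lincomb_def)
  moreover have "(\<Sum>m\<in>?K. ?g m) = (\<Sum>y\<in>?cl ` ?K. \<Sum>x | x \<in> ?K \<and> ?cl x = y. ?g x)"
    by (rule sum.image_gen) simp
  ultimately obtain y where y: "y \<in> ?cl ` ?K" "(\<Sum>x | x \<in> ?K \<and> ?cl x = y. ?g x) \<noteq> 0"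
    by (metis (no_types, lifting) sum.neutral)
  then obtain m1 where m1: "m1 \<in> ?K" "y = ?cl m1" by blast
  have "{x. x \<in> ?K \<and> ?cl x = y} = {x. x \<in> ?K \<and> x - m1 \<in> L}" unfolding m1(2) using cl m1(1) by blast
  then have s: "(\<Sum>x | x \<in> ?K \<and> x - m1 \<in> L. ?g x) \<noteq> 0" using y(2) by simp
  then obtain m where m: "m \<in> ?K" "m - m1 \<in> L" "?g m \<noteq> 0"
    by (metis (no_types, lifting) mem_Collect_eq sum.neutral)
  then obtain n where n: "n \<in> S" "m + n \<in> L" "ev \<phi> (m + n) \<noteq> 0"
  proof -
    have "ev \<phi> m \<noteq> 0" using m(3) by simp
    then show thesis using st KS[OF m(1)] that unfolding polystable_def by blast
  qed
  have nnz: "ev \<phi> n \<noteq> 0" using n ev_add[OF phi KS[OF m(1)] n(1)] by auto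
  \<comment> \<open>adding \<open>n\<close> moves exactly the class of \<open>m1\<close> into \<open>L\<close>\<close>
  have "x - m1 \<in> L \<longleftrightarrow> x + n \<in> L" for x
  proof -
    have e: "x + n = (x - m1) + ((m + n) - (m - m1))" by simp
    have l: "(m + n) - (m - m1) \<in> L" by (rule sublattice_diff[OF sub n(2) m(2)])
    show ?thesis
    proof
      show "x + n \<in> L" if "x - m1 \<in> L" unfolding e by (rule sublattice_add[OF sub that l])
      have "x - m1 = (x + n) - ((m + n) - (m - m1))" by simp
      then show "x - m1 \<in> L" if "x + n \<in> L" using sublattice_diff[OF sub that l] by simp
    qed
  qed
  then have "\<phi> (shift_part n c) = (\<Sum>x | x \<in> ?K \<and> x - m1 \<in> L. ?g x) * ev \<phi> n"
    using KS n(1) unfolding shift_part_eval[OF phi c n(1)] sum_distrib_right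
    by (intro sum.cong) (auto simp: ev_add[OF phi])
  then show thesis using that n(1) nnz s by simp
qed

text \<open>A function \<open>c\<close> that vanishes off \<open>W\<close> satisfies \<open>c * 1 = 0\<close> there, and this relation passes to
  invariant parts.\<close>

lemma saturated_neighbourhood:
  assumes W: "openin (fs_top (spec_space S)) W"
    and inv: "\<And>\<phi> t. \<phi> \<in> spec_points S \<Longrightarrow> t \<in> quotient_group M L \<Longrightarrow> (\<lambda>f. \<phi> (twist t f)) \<in> W \<Longrightarrow> \<phi> \<in> W"
    and st: "polystable \<phi>" "\<phi> \<in> W"
  obtains b where "b \<in> monoid_algebra (S \<inter> L)" "\<phi> b \<noteq> 0" "\<And>\<psi>. \<psi> \<in> spec_points S \<Longrightarrow> \<psi> b \<noteq> 0 \<Longrightarrow> \<psi> \<in> W"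
proof -
  from conjunct2[OF W[unfolded openin_spec[OF mon]]] st(2) obtain c
    where c: "c \<in> monoid_algebra S" "\<phi> c \<noteq> 0" "\<And>\<psi>. \<psi> \<in> spec_points S \<Longrightarrow> \<psi> c \<noteq> 0 \<Longrightarrow> \<psi> \<in> W"
    by blast
  obtain n where n: "n \<in> S" "\<phi> (shift_part n c) \<noteq> 0" by (rule shift_part_nonzero[OF st(1) c(1,2)])
  have "\<psi> (shift_part n c) = 0" if psi: "\<psi> \<in> spec_points S" "\<psi> \<notin> W" for \<psi>
  proof -
    have "\<psi> (twist t c) * 1 = \<psi> (twist t 0)" if t: "t \<in> quotient_group M L" for t
    proof -
      have tT: "t \<in> torus M" using t by (simp add: quotient_group_def)
      have "(\<lambda>f. \<psi> (twist t f)) \<notin> W" using inv[OF psi(1) t] psi(2) by blast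
      then have "\<psi> (twist t c) = 0" using c(3)[OF twist_spec[OF psi(1) mon SM tT]] by blast
      moreover have "\<psi> (twist t 0) = 0" by (simp add: twist_def spec_zero[OF psi(1)])
      ultimately show ?thesis by simp
    qed
    from shift_part_relation[OF psi(1) c(1) monoid_algebra_zero n(1) this]
    show ?thesis by (simp add: shift_part_def spec_zero[OF psi(1)])
  qed
  then show thesis using shift_part_mem[OF c(1) n(1)] n(2) by (intro that) blast+
qed

text \<open>The same for the relation \<open>c k = a\<close> on \<open>W\<close> that expresses \<open>k\<close> near \<open>\<phi>\<close> as a quotient.\<close>

lemma invariant_fraction:
  assumes W: "openin (fs_top (spec_space S)) W" and k: "k \<in> fs_reg (spec_space S) W"
    and inv: "\<And>\<phi> t. \<phi> \<in> W \<Longrightarrow> t \<in> quotient_group M L \<Longrightarrow>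
      (\<lambda>f. \<phi> (twist t f)) \<in> W \<and> k (\<lambda>f. \<phi> (twist t f)) = k \<phi>"
    and st: "polystable \<phi>" "\<phi> \<in> W"
  obtains a b where "a \<in> monoid_algebra (S \<inter> L)" "b \<in> monoid_algebra (S \<inter> L)" "\<phi> b \<noteq> 0"
    "\<And>\<psi>. \<psi> \<in> W \<Longrightarrow> \<psi> b * k \<psi> = \<psi> a"
proof -
  from bspec[OF k[unfolded fs_reg_spec[OF mon W]] st(2)] obtain a c
    where ac: "a \<in> monoid_algebra S" "c \<in> monoid_algebra S" "\<phi> c \<noteq> 0" "\<forall>\<psi>\<in>W. \<psi> c * k \<psi> = \<psi> a"
    by (elim bexE conjE)
  obtain n where n: "n \<in> S" "\<phi> (shift_part n c) \<noteq> 0" by (rule shift_part_nonzero[OF st(1) ac(2,3)])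
  have "\<psi> (shift_part n c) * k \<psi> = \<psi> (shift_part n a)" if psi: "\<psi> \<in> W" for \<psi>
  proof (rule shift_part_relation[OF _ ac(2,1) n(1)])
    show "\<psi> \<in> spec_points S" using conjunct1[OF W[unfolded openin_spec[OF mon]]] psi by blast
    fix t assume t: "t \<in> quotient_group M L"
    show "\<psi> (twist t c) * k \<psi> = \<psi> (twist t a)"
      using bspec[OF ac(4) conjunct1[OF inv[OF psi t]]] conjunct2[OF inv[OF psi t]] by simp
  qed
  then show thesis using shift_part_mem[OF ac(1) n(1)] shift_part_mem[OF ac(2) n(1)] n(2) by (intro that) auto
qed

end

section \<open>Rational cones\<close>

lemma
  assumes u: "u \<in> N_real H" and H: "sublattice H M"
  shows N_real_add: "a \<in> H \<Longrightarrow> b \<in> H \<Longrightarrow> u (a + b) = u a + u b"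
    and N_real_zero: "u 0 = 0"
    and N_real_minus: "a \<in> H \<Longrightarrow> u (- a) = - u a"
    and N_real_diff: "a \<in> H \<Longrightarrow> b \<in> H \<Longrightarrow> u (a - b) = u a - u b"
    and N_real_zmul: "a \<in> H \<Longrightarrow> u (zmul k a) = of_int k * u a"
    and N_real_sum: "(\<And>i. i \<in> I \<Longrightarrow> g i \<in> H) \<Longrightarrow> u (sum g I) = (\<Sum>i\<in>I. u (g i))"
proof -
  show add: "u (a + b) = u a + u b" if "a \<in> H" "b \<in> H" for a b using u that by (simp add: N_real_def)
  note H0 = sublattice_zero[OF H] and Hm = sublattice_minus[OF H]
  show zero: "u 0 = 0" using add[OF H0 H0] by simp
  show minus: "u (- a) = - u a" if "a \<in> H" for a using add[OF that Hm[OF that]] zero by simp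
  show diff: "u (a - b) = u a - u b" if "a \<in> H" "b \<in> H" for a b
    using add[OF that(1) Hm[OF that(2)]] minus[OF that(2)] by simp
  show "u (zmul k a) = of_int k * u a" if "a \<in> H" for a k
  proof (induction k rule: int_induct[where k = 0])
    case base
    then show ?case using zero by simp
  next
    case (step1 i)
    then show ?case using add[OF sublattice_zmul[OF H that] that, of i]
      by (simp add: zm.scale_left_distrib distrib_right)
  next
    case (step2 i)
    then show ?case using diff[OF sublattice_zmul[OF H that] that, of i]
      by (simp add: zm.scale_left_diff_distrib left_diff_distrib)
  qed
  show "u (sum g I) = (\<Sum>i\<in>I. u (g i))" if "\<And>i. i \<in> I \<Longrightarrow> g i \<in> H" for g and I :: "'b set"
    using that
    by (induction I rule: infinite_finite_induct) (simp_all add: zero add sublattice_sum[OF H])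
qed

lemma fun_sum_apply: "(\<Sum>i\<in>I. g i) x = (\<Sum>i\<in>I. g i x)" for g :: "'i \<Rightarrow> 'x \<Rightarrow> real"
  by (induction I rule: infinite_finite_induct) simp_all

lemma cone_sum_apply:
  fixes c :: "('m \<Rightarrow> real) \<Rightarrow> real"
  shows "(\<Sum>s\<in>S. c s *\<^sub>R s) m = (\<Sum>s\<in>S. c s * s m)"
  by (simp add: fun_sum_apply scaleR_fun_def)

lemma N_int_real: "u \<in> N_int H \<Longrightarrow> u \<in> N_real H"
  by (simp add: N_int_def)

lemma N_real_cone_sum:
  assumes "\<And>s. s \<in> S \<Longrightarrow> s \<in> N_real H"
  shows "(\<Sum>s\<in>S. c s *\<^sub>R s) \<in> N_real H"
  unfolding N_real_def mem_Collect_eq cone_sum_apply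
proof (intro conjI ballI allI impI)
  fix a b assume ab: "a \<in> H" "b \<in> H"
  have "(\<Sum>s\<in>S. c s * s (a + b)) = (\<Sum>s\<in>S. c s * s a + c s * s b)"
  proof (rule sum.cong[OF refl])
    fix s assume "s \<in> S"
    then have "s (a + b) = s a + s b" using assms ab unfolding N_real_def by blast
    then show "c s * s (a + b) = c s * s a + c s * s b" by (simp add: distrib_left)
  qed
  then show "(\<Sum>s\<in>S. c s * s (a + b)) = (\<Sum>s\<in>S. c s * s a) + (\<Sum>s\<in>S. c s * s b)"
    by (simp add: sum.distrib)
next
  fix a assume a: "a \<notin> H"
  show "(\<Sum>s\<in>S. c s * s a) = 0"
  proof (intro sum.neutral ballI)
    fix s assume "s \<in> S"
    then have "s a = 0" using assms a unfolding N_real_def by blast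
    then show "c s * s a = 0" by simp
  qed
qed

lemma rational_cone_subset: "rational_cone H \<sigma> \<Longrightarrow> \<sigma> \<subseteq> N_real H"
  unfolding rational_cone_def by (auto intro!: N_real_cone_sum intro: N_int_real)

lemma submonoid_cone_monoid:
  assumes H: "sublattice H M" and s: "\<sigma> \<subseteq> N_real H"
  shows "submonoid (cone_monoid H \<sigma>)"
proof -
  show ?thesis unfolding submonoid_def cone_monoid_def
  proof (intro conjI ballI CollectI)
    show "0 \<in> H" by (rule sublattice_zero[OF H])
    show "0 \<le> u 0" if "u \<in> \<sigma>" for u using N_real_zero[OF subsetD[OF s that] H] by simp
    fix a b assume a: "a \<in> {m \<in> H. \<forall>u\<in>\<sigma>. 0 \<le> u m}" and b: "b \<in> {m \<in> H. \<forall>u\<in>\<sigma>. 0 \<le> u m}"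
    show "a + b \<in> H" using a b sublattice_add[OF H] by blast
    fix u assume u: "u \<in> \<sigma>"
    have "u (a + b) = u a + u b" using N_real_add[OF subsetD[OF s u] H] a b by blast
    moreover have "0 \<le> u a" "0 \<le> u b" using a b u by blast+
    ultimately show "0 \<le> u (a + b)" by simp
  qed
qed

lemma cone_monoid_antimono: "\<sigma> \<subseteq> \<tau> \<Longrightarrow> cone_monoid H \<tau> \<subseteq> cone_monoid H \<sigma>"
  unfolding cone_monoid_def by auto

text \<open>Simultaneous Dirichlet approximation clears denominators of a real combination \<open>v\<close> of
  lattice points: a multiple of \<open>v\<close> is as close to a lattice point as desired, in the sense of
  finitely many linear forms.\<close>

lemma lattice_approximation:
  fixes v :: "'m::ab_group_add \<Rightarrow> real" and S :: "('m \<Rightarrow> real) set"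
  assumes H: "sublattice H M" and K: "finite K" "K \<subseteq> H" and S: "finite S" "S \<subseteq> N_real H" and eps: "\<epsilon> > 0"
  obtains q :: int and m where "q \<ge> 1" "m \<in> H"
    "\<And>u. u \<in> S \<Longrightarrow> \<bar>of_int q * (\<Sum>a\<in>K. v a * u a) - u m\<bar> < \<epsilon>"
proof -
  obtain n :: nat and g where g: "K = g ` {i. i < n}" "inj_on g {i. i < n}"
    using finite_imp_nat_seg_image_inj_on[OF K(1)] by metis
  define B where "B = (\<Sum>u\<in>S. \<Sum>a\<in>K. \<bar>u a\<bar>)"
  have B0: "B \<ge> 0" unfolding B_def by (intro sum_nonneg) auto
  \<comment> \<open>a rounding error \<open>1 / N\<close> in each coefficient changes the value of a form by at most \<open>B / N\<close>\<close>
  obtain N :: nat where N: "N > 0" "(B + 1) / \<epsilon> < real N"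
  proof -
    obtain N :: nat where "(B + 1) / \<epsilon> < real N" using reals_Archimedean2 by blast
    moreover have "0 < (B + 1) / \<epsilon>" using eps B0 by simp
    ultimately show ?thesis by (intro that[of N]) (simp_all add: order.strict_trans)
  qed
  obtain q p where q: "0 < q" and p: "\<And>i. i < n \<Longrightarrow> \<bar>of_int q * v (g i) - of_int (p i)\<bar> < 1 / N"
    using Dirichlet_approx_simult[OF N(1), of n "\<lambda>i. v (g i)"] by metis
  define p' where "p' a = p (inv_into {i. i < n} g a)" for a
  have p': "\<bar>of_int q * v a - of_int (p' a)\<bar> \<le> 1 / N" if a: "a \<in> K" for a
  proof -
    obtain i where i: "i < n" "a = g i" using a unfolding g(1) by blast
    have "inv_into {i. i < n} g (g i) = i" using g(2) i(1) by simp
    then show ?thesis using p[OF i(1)] i(2) by (simp add: p'_def)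
  qed
  define m where "m = (\<Sum>a\<in>K. zmul (p' a) a)"
  show thesis
  proof (rule that)
    show "q \<ge> 1" using q by simp
    show "m \<in> H" unfolding m_def using K(2) by (intro sublattice_sum[OF H] sublattice_zmul[OF H]) auto
    fix u assume u: "u \<in> S"
    have uN: "u \<in> N_real H" using S(2) u by auto
    have um: "u m = (\<Sum>a\<in>K. of_int (p' a) * u a)" unfolding m_def
      using K(2) by (subst N_real_sum[OF uN H])
        (auto intro!: sublattice_zmul[OF H] sum.cong simp: N_real_zmul[OF uN H] subset_iff)
    have "of_int q * (\<Sum>a\<in>K. v a * u a) - u m = (\<Sum>a\<in>K. (of_int q * v a - of_int (p' a)) * u a)"
      unfolding um by (simp add: sum_distrib_left sum_subtractf algebra_simps)
    also have "\<bar>\<dots>\<bar> \<le> (\<Sum>a\<in>K. \<bar>(of_int q * v a - of_int (p' a)) * u a\<bar>)" by (rule sum_abs)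
    also have "\<dots> \<le> (\<Sum>a\<in>K. 1 / N * \<bar>u a\<bar>)"
      unfolding abs_mult by (intro sum_mono mult_right_mono p') auto
    also have "\<dots> = 1 / N * (\<Sum>a\<in>K. \<bar>u a\<bar>)" by (simp add: sum_distrib_left)
    also have "\<dots> \<le> 1 / N * B"
      unfolding B_def using S(1) u by (intro mult_left_mono member_le_sum) (auto intro: sum_nonneg)
    also have "\<dots> < \<epsilon>"
    proof -
      have "B + 1 < \<epsilon> * N" using N(2) eps by (simp add: field_simps)
      then show ?thesis using N(1) by (simp add: field_simps)
    qed
    finally show "\<bar>of_int q * (\<Sum>a\<in>K. v a * u a) - u m\<bar> < \<epsilon>" .
  qed
qed

lemma Ints_abs_less_one: "x \<in> \<int> \<Longrightarrow> \<bar>x\<bar> < (1::real) \<Longrightarrow> x = 0"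
  by (elim Ints_cases) (simp flip: of_int_abs)

lemma N_int_Ints: "u \<in> N_int H \<Longrightarrow> m \<in> H \<Longrightarrow> u m \<in> \<int>"
  by (simp add: N_int_def)

lemma cone_generator_mem:
  fixes S :: "('m \<Rightarrow> real) set"
  assumes "finite S" "s \<in> S"
  shows "s \<in> {(\<Sum>u\<in>S. c u *\<^sub>R u) |c. \<forall>u\<in>S. 0 \<le> c u}"
proof -
  have "(\<Sum>u\<in>S. (if u = s then 1 else 0) *\<^sub>R u) = (\<Sum>u\<in>S. if u = s then u else 0)"
    by (intro sum.cong) auto
  then have "s = (\<Sum>u\<in>S. (if u = s then 1 else 0) *\<^sub>R u)" using assms by simp
  then show ?thesis by (intro CollectI exI[of _ "\<lambda>u. if u = s then 1 else 0"]) auto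
qed

text \<open>The real form \<open>v\<close> is replaced by a lattice point so close to a multiple of it that the generators of
  \<open>\<sigma>\<close> keep their signs: zero values stay zero because they become integers smaller than \<open>1\<close>, and
  \<open>\<epsilon>\<close> is below all positive values.\<close>

lemma face_by_lattice_point:
  assumes H: "sublattice H M" and rat: "rational_cone H \<sigma>" and face: "cone_face H \<tau> \<sigma>"
  obtains m where "m \<in> cone_monoid H \<sigma>" "\<tau> = {u \<in> \<sigma>. u m = 0}"
proof -
  obtain v where v: "Poly_Mapping.keys v \<subseteq> H" "\<And>u. u \<in> \<sigma> \<Longrightarrow> 0 \<le> pairing v u" "\<tau> = {u \<in> \<sigma>. pairing v u = 0}"
    using face unfolding cone_face_def dual_cone_def by blast
  obtain S where S: "finite S" "S \<subseteq> N_int H" "\<sigma> = {(\<Sum>u\<in>S. c u *\<^sub>R u) |c. \<forall>u\<in>S. 0 \<le> c u}"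
    using rat unfolding rational_cone_def by blast
  have S\<sigma>: "s \<in> \<sigma>" if "s \<in> S" for s unfolding S(3) by (rule cone_generator_mem[OF S(1) that])
  \<comment> \<open>the numbers that the error has to stay below: \<open>1\<close>, so that zero values survive, and the positive values\<close>
  define T where "T = insert 1 ((\<lambda>s. pairing v s) ` {s \<in> S. pairing v s > 0})"
  have T: "finite T" "T \<noteq> {}" "\<And>x. x \<in> T \<Longrightarrow> x > 0" using S(1) by (auto simp: T_def)
  define \<epsilon> where "\<epsilon> = Min T"
  have eps: "\<epsilon> > 0" "\<epsilon> \<le> 1" "\<And>s. s \<in> S \<Longrightarrow> pairing v s > 0 \<Longrightarrow> \<epsilon> \<le> pairing v s"
  proof -
    show "\<epsilon> > 0" unfolding \<epsilon>_def using T(3) Min_in[OF T(1,2)] by blast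
    show "\<epsilon> \<le> 1" unfolding \<epsilon>_def by (rule Min_le[OF T(1)]) (simp add: T_def)
    show "\<epsilon> \<le> pairing v s" if "s \<in> S" "pairing v s > 0" for s
      unfolding \<epsilon>_def by (rule Min_le[OF T(1)]) (use that in \<open>auto simp: T_def\<close>)
  qed
  obtain q :: int and m where q: "q \<ge> 1" and m: "m \<in> H"
    and ap: "\<And>u. u \<in> S \<Longrightarrow> \<bar>of_int q * (\<Sum>a\<in>Poly_Mapping.keys v. Poly_Mapping.lookup v a * u a) - u m\<bar> < \<epsilon>"
  proof -
    have "S \<subseteq> N_real H" using S(2) N_int_real by blast
    then show thesis
      by (rule lattice_approximation[OF H finite_keys v(1) S(1) _ eps(1), of "Poly_Mapping.lookup v"]) (rule that)
  qed
  have sm: "(pairing v s = 0 \<longrightarrow> s m = 0) \<and> (pairing v s > 0 \<longrightarrow> s m > 0)" if s: "s \<in> S" for s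
  proof (intro conjI impI)
    have ap': "\<bar>of_int q * pairing v s - s m\<bar> < \<epsilon>" using ap[OF s] by (simp add: pairing_def)
    { assume "pairing v s = 0"
      then have "\<bar>s m\<bar> < 1" using ap' eps(2) by simp
      then show "s m = 0" using N_int_Ints m s S(2) by (intro Ints_abs_less_one) auto }
    { assume pos: "pairing v s > 0"
      have "1 * pairing v s \<le> of_int q * pairing v s" using q pos by (intro mult_right_mono) auto
      then show "s m > 0" using ap' eps(3)[OF s pos] by linarith }
  qed
  have sv: "0 \<le> pairing v s" if "s \<in> S" for s using v(2)[OF S\<sigma>[OF that]] .
  have sm0: "0 \<le> s m" and smz: "s m = 0 \<longleftrightarrow> pairing v s = 0" if "s \<in> S" for s
    using sm[OF that] sv[OF that] by (auto simp: less_eq_real_def)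
  have pair: "pairing v (\<Sum>s\<in>S. c s *\<^sub>R s) = (\<Sum>s\<in>S. c s * pairing v s)" for c
  proof -
    have "pairing v (\<Sum>s\<in>S. c s *\<^sub>R s)
      = (\<Sum>a\<in>Poly_Mapping.keys v. \<Sum>s\<in>S. Poly_Mapping.lookup v a * (c s * s a))"
      by (simp add: pairing_def cone_sum_apply sum_distrib_left)
    also have "\<dots> = (\<Sum>s\<in>S. \<Sum>a\<in>Poly_Mapping.keys v. Poly_Mapping.lookup v a * (c s * s a))"
      by (rule sum.swap)
    also have "\<dots> = (\<Sum>s\<in>S. c s * pairing v s)" by (simp add: pairing_def sum_distrib_left mult_ac)
    finally show ?thesis .
  qed
  have um: "0 \<le> u m \<and> (u m = 0 \<longleftrightarrow> pairing v u = 0)" if "u \<in> \<sigma>" for u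
  proof -
    obtain c where c: "u = (\<Sum>s\<in>S. c s *\<^sub>R s)" "\<forall>s\<in>S. 0 \<le> c s" using \<open>u \<in> \<sigma>\<close> unfolding S(3) by blast
    have "(\<Sum>s\<in>S. c s * s m) = 0 \<longleftrightarrow> (\<forall>s\<in>S. c s * s m = 0)"
      using S(1) c(2) sm0 by (intro sum_nonneg_eq_0_iff) auto
    moreover have "(\<Sum>s\<in>S. c s * pairing v s) = 0 \<longleftrightarrow> (\<forall>s\<in>S. c s * pairing v s = 0)"
      using S(1) c(2) sv by (intro sum_nonneg_eq_0_iff) auto
    ultimately show ?thesis unfolding c(1) pair cone_sum_apply
      using c(2) sm0 smz by (auto intro!: sum_nonneg)
  qed
  have "m \<in> cone_monoid H \<sigma>" using m um by (auto simp: cone_monoid_def)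
  moreover have "\<tau> = {u \<in> \<sigma>. u m = 0}" unfolding v(3) using um by blast
  ultimately show thesis by (rule that)
qed

text \<open>On a generator of \<open>\<sigma>\<close> outside the face, \<open>m\<close> is a positive integer; hence a large multiple of \<open>m\<close>
  outweighs the negative values of an element that is only nonnegative on the face.\<close>

lemma localises_face:
  assumes H: "sublattice H M" and rat: "rational_cone H \<sigma>" and m: "m \<in> cone_monoid H \<sigma>"
  shows "localises (cone_monoid H \<sigma>) (cone_monoid H {u \<in> \<sigma>. u m = 0}) m"
proof -
  obtain S where S: "finite S" "S \<subseteq> N_int H" "\<sigma> = {(\<Sum>u\<in>S. c u *\<^sub>R u) |c. \<forall>u\<in>S. 0 \<le> c u}"
    using rat unfolding rational_cone_def by blast
  have S\<sigma>: "s \<in> \<sigma>" if "s \<in> S" for s unfolding S(3) by (rule cone_generator_mem[OF S(1) that])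
  note sN = rational_cone_subset[OF rat]
  have mH: "m \<in> H" using m by (simp add: cone_monoid_def)
  show ?thesis unfolding localises_def
  proof (intro conjI ballI)
    show "submonoid (cone_monoid H \<sigma>)" by (rule submonoid_cone_monoid[OF H sN])
    show "submonoid (cone_monoid H {u \<in> \<sigma>. u m = 0})" using sN by (intro submonoid_cone_monoid[OF H]) auto
    show "cone_monoid H \<sigma> \<subseteq> cone_monoid H {u \<in> \<sigma>. u m = 0}" by (rule cone_monoid_antimono) auto
    show "m \<in> cone_monoid H \<sigma>" by fact
    show "- m \<in> cone_monoid H {u \<in> \<sigma>. u m = 0}"
      using sN mH sublattice_minus[OF H mH] by (auto simp: cone_monoid_def N_real_minus[OF _ H])
    fix a assume a: "a \<in> cone_monoid H {u \<in> \<sigma>. u m = 0}"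
    have aH: "a \<in> H" using a by (simp add: cone_monoid_def)
    define B where "B = (\<Sum>s\<in>S. \<bar>s a\<bar>)"
    obtain n :: nat where n: "B \<le> real n" using real_arch_simple by blast
    have sa: "0 \<le> s a + real n * s m" if s: "s \<in> S" for s
    proof (cases "s m = 0")
      case True
      then show ?thesis using a S\<sigma>[OF s] by (simp add: cone_monoid_def)
    next
      case False
      have "s m \<in> \<int>" using N_int_Ints mH s S(2) by auto
      moreover have "0 \<le> s m" using m S\<sigma>[OF s] by (simp add: cone_monoid_def)
      ultimately have "1 \<le> s m" using False Ints_abs_less_one[of "s m"] by linarith
      then have "real n * 1 \<le> real n * s m" by (intro mult_left_mono) auto
      moreover have "\<bar>s a\<bar> \<le> B" unfolding B_def using s S(1) by (intro member_le_sum) auto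
      ultimately show ?thesis using n by linarith
    qed
    have "a + zmul (int n) m \<in> cone_monoid H \<sigma>"
    proof -
      have "0 \<le> u (a + zmul (int n) m)" if u: "u \<in> \<sigma>" for u
      proof -
        have uN: "u \<in> N_real H" using sN u by auto
        obtain c where c: "u = (\<Sum>s\<in>S. c s *\<^sub>R s)" "\<forall>s\<in>S. 0 \<le> c s" using u unfolding S(3) by blast
        have "u (a + zmul (int n) m) = u a + real n * u m"
          using N_real_add[OF uN H aH sublattice_zmul[OF H mH]] N_real_zmul[OF uN H mH] by simp
        also have "\<dots> = (\<Sum>s\<in>S. c s * (s a + real n * s m))"
          unfolding c(1) cone_sum_apply by (simp add: sum_distrib_left sum.distrib algebra_simps)
        also have "\<dots> \<ge> 0" using c(2) sa by (intro sum_nonneg mult_nonneg_nonneg) auto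
        finally show ?thesis .
      qed
      then show ?thesis
        using sublattice_add[OF H aH sublattice_zmul[OF H mH]] by (simp add: cone_monoid_def)
    qed
    then show "\<exists>n. a + zmul (int n) m \<in> cone_monoid H \<sigma>" by blast
  qed
qed

section \<open>Gordan's lemma and affine toric varieties\<close>

text \<open>A vector is dominated in the last coordinate as well, unless that coordinate is one of finitely
  many small values; for each of these the induction hypothesis applies to a slice.\<close>

lemma dickson:
  fixes A :: "(nat \<Rightarrow> nat) set"
  shows "\<exists>B. finite B \<and> B \<subseteq> A \<and> (\<forall>x\<in>A. \<exists>y\<in>B. \<forall>i<r. y i \<le> x i)"
proof (induction r arbitrary: A)
  case 0
  show ?case
  proof (cases "A = {}")
    case False
    then obtain a where "a \<in> A" by blast
    then show ?thesis by (intro exI[of _ "{a}"]) auto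
  qed auto
next
  case (Suc r)
  obtain B0 where B0: "finite B0" "B0 \<subseteq> A" "\<forall>x\<in>A. \<exists>y\<in>B0. \<forall>i<r. y i \<le> x i"
    using Suc.IH[of A] by (elim exE conjE)
  define N where "N = Max (insert 0 ((\<lambda>y. y r) ` B0))"
  have N: "y r \<le> N" if "y \<in> B0" for y unfolding N_def using B0(1) that by (intro Max_ge) auto
  have "\<forall>k. \<exists>B. finite B \<and> B \<subseteq> {x \<in> A. x r = k} \<and> (\<forall>x\<in>{x \<in> A. x r = k}. \<exists>y\<in>B. \<forall>i<r. y i \<le> x i)"
    by (intro allI Suc.IH)
  from choice[OF this] obtain B
    where all: "\<forall>k. finite (B k) \<and> B k \<subseteq> {x \<in> A. x r = k} \<and> (\<forall>x\<in>{x \<in> A. x r = k}. \<exists>y\<in>B k. \<forall>i<r. y i \<le> x i)"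
    by (elim exE)
  note B = conjunct1[OF spec[OF all]] conjunct1[OF conjunct2[OF spec[OF all]]]
    conjunct2[OF conjunct2[OF spec[OF all]]]
  show ?case
  proof (intro exI[of _ "B0 \<union> (\<Union>k\<le>N. B k)"] conjI ballI)
    show "finite (B0 \<union> (\<Union>k\<le>N. B k))" using B0(1) B(1) by auto
    show "B0 \<union> (\<Union>k\<le>N. B k) \<subseteq> A" using B0(2) B(2) by blast
    fix x assume x: "x \<in> A"
    show "\<exists>y\<in>B0 \<union> (\<Union>k\<le>N. B k). \<forall>i<Suc r. y i \<le> x i"
    proof (cases "x r \<le> N")
      case True
      have "x \<in> {x' \<in> A. x' r = x r}" using x by simp
      from bspec[OF B(3) this] obtain y where y: "y \<in> B (x r)" "\<forall>i<r. y i \<le> x i" by (elim bexE)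
      then have "y r = x r" using B(2) by blast
      then have "\<forall>i<Suc r. y i \<le> x i" using y(2) by (auto simp: less_Suc_eq)
      then show ?thesis using y(1) True by blast
    next
      case False
      from bspec[OF B0(3) x] obtain y where y: "y \<in> B0" "\<forall>i<r. y i \<le> x i" by (elim bexE)
      then have "\<forall>i<Suc r. y i \<le> x i" using N[OF y(1)] False by (auto simp: less_Suc_eq)
      then show ?thesis using y(1) by blast
    qed
  qed
qed

text \<open>A lattice point of the dual cone is encoded by the positive and the negative parts of its
  coordinates and by its values on the generators of the cone. The encodings are closed under
  subtraction of a smaller one, so they are generated by their minimal nonzero elements.\<close>

lemma gordan:
  assumes lat: "lattice_set M" and H: "sublattice H M" and rat: "rational_cone H \<sigma>"
  obtains n :: nat and g where "\<And>i. i < n \<Longrightarrow> g i \<in> cone_monoid H \<sigma>"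
    "\<And>m. m \<in> cone_monoid H \<sigma> \<Longrightarrow> \<exists>c :: nat \<Rightarrow> nat. m = (\<Sum>i<n. zmul (int (c i)) (g i))"
proof -
  obtain d :: nat and e co where gen': "\<forall>a\<in>M. a = (\<Sum>i<d. zmul (co a i) (e i))"
    by (rule lattice_coordinates[OF lat])
  note gen = bspec[OF gen']
  obtain S where S: "finite S" "S \<subseteq> N_int H" "\<sigma> = {(\<Sum>u\<in>S. c u *\<^sub>R u) |c. \<forall>u\<in>S. 0 \<le> c u}"
    using rat unfolding rational_cone_def by blast
  have S\<sigma>: "s \<in> \<sigma>" if "s \<in> S" for s unfolding S(3) by (rule cone_generator_mem[OF S(1) that])
  obtain k :: nat and s where s: "S = s ` {i. i < k}"
    using finite_imp_nat_seg_image_inj_on[OF S(1)] by metis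
  have sN: "s j \<in> N_real H" "s j \<in> N_int H" if "j < k" for j
    using that S(2) s N_int_real by blast+
  \<comment> \<open>the lattice point with encoding \<open>x\<close>: entries \<open>i < d\<close> are positive parts, entries \<open>d + i\<close> negative parts\<close>
  define \<theta> where "\<theta> x = (\<Sum>i<d. zmul (int (x i) - int (x (d + i))) (e i))" for x :: "nat \<Rightarrow> nat"
  define r where "r = 2 * d + k"
  define A0 where "A0 = {x. \<theta> x \<in> H \<and> (\<forall>j<k. real (x (2 * d + j)) = s j (\<theta> x))}"
  obtain B where B: "finite B" "B \<subseteq> {x \<in> A0. \<exists>i<r. x i \<noteq> 0}"
    "\<forall>x\<in>{x \<in> A0. \<exists>i<r. x i \<noteq> 0}. \<exists>y\<in>B. \<forall>i<r. y i \<le> x i"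
    using dickson[of "{x \<in> A0. \<exists>i<r. x i \<noteq> 0}" r] by (elim exE conjE)
  have thmem: "\<theta> x \<in> cone_monoid H \<sigma>" if x: "x \<in> A0" for x
  proof -
    have t: "0 \<le> t (\<theta> x)" if "t \<in> S" for t
    proof -
      obtain j where "j < k" "t = s j" using s \<open>t \<in> S\<close> by blast
      then have "t (\<theta> x) = real (x (2 * d + j))" using x by (simp add: A0_def)
      then show ?thesis by simp
    qed
    have "0 \<le> u (\<theta> x)" if "u \<in> \<sigma>" for u
    proof -
      obtain c where "u = (\<Sum>s\<in>S. c s *\<^sub>R s)" "\<forall>s\<in>S. 0 \<le> c s" using \<open>u \<in> \<sigma>\<close> unfolding S(3) by blast
      then show ?thesis using t by (auto simp: cone_sum_apply intro!: sum_nonneg)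
    qed
    then show ?thesis using x by (simp add: cone_monoid_def A0_def)
  qed
  have diff: "(\<lambda>i. x i - y i) \<in> A0 \<and> \<theta> x = \<theta> (\<lambda>i. x i - y i) + \<theta> y"
    if x: "x \<in> A0" and y: "y \<in> A0" and le: "\<forall>i<r. y i \<le> x i" for x y
  proof -
    have "\<theta> (\<lambda>i. x i - y i) = (\<Sum>i<d. zmul (int (x i) - int (x (d + i))) (e i) - zmul (int (y i) - int (y (d + i))) (e i))"
      unfolding \<theta>_def
    proof (rule sum.cong[OF refl])
      fix i assume i: "i \<in> {..<d}"
      have "y i \<le> x i" "y (d + i) \<le> x (d + i)" using le i by (simp_all add: r_def)
      then have "int (x i - y i) - int (x (d + i) - y (d + i)) = (int (x i) - int (x (d + i))) - (int (y i) - int (y (d + i)))"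
        by (simp add: of_nat_diff)
      then show "zmul (int (x i - y i) - int (x (d + i) - y (d + i))) (e i)
        = zmul (int (x i) - int (x (d + i))) (e i) - zmul (int (y i) - int (y (d + i))) (e i)"
        by (simp only: zm.scale_left_diff_distrib)
    qed
    then have eq: "\<theta> (\<lambda>i. x i - y i) = \<theta> x - \<theta> y" by (simp add: \<theta>_def sum_subtractf)
    have xH: "\<theta> x \<in> H" and yH: "\<theta> y \<in> H" using x y by (simp_all add: A0_def)
    have "real (x (2 * d + j) - y (2 * d + j)) = s j (\<theta> x - \<theta> y)" if j: "j < k" for j
    proof -
      have "s j (\<theta> x - \<theta> y) = s j (\<theta> x) - s j (\<theta> y)" by (rule N_real_diff[OF sN(1)[OF j] H xH yH])
      moreover have "y (2 * d + j) \<le> x (2 * d + j)" using le j by (simp add: r_def)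
      ultimately show ?thesis using x y j by (simp add: A0_def of_nat_diff)
    qed
    then show ?thesis using eq sublattice_diff[OF H xH yH] by (simp add: A0_def)
  qed
  have comb: "\<exists>c :: (nat \<Rightarrow> nat) \<Rightarrow> nat. \<theta> x = (\<Sum>b\<in>B. zmul (int (c b)) (\<theta> b))" if "x \<in> A0" for x
    using that
  proof (induction "\<Sum>i<r. x i" arbitrary: x rule: less_induct)
    case less
    show ?case
    proof (cases "\<exists>i<r. x i \<noteq> 0")
      case False
      then have "\<theta> x = 0" unfolding \<theta>_def by (intro sum.neutral) (simp add: r_def)
      then show ?thesis by (intro exI[of _ "\<lambda>_. 0"]) simp
    next
      case True
      then have "x \<in> {x \<in> A0. \<exists>i<r. x i \<noteq> 0}" using less.prems by blast
      from bspec[OF B(3) this] obtain y where y: "y \<in> B" "\<forall>i<r. y i \<le> x i" by (elim bexE)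
      then obtain i where i: "i < r" "y i \<noteq> 0" and yA: "y \<in> A0" using B(2) by blast
      let ?z = "\<lambda>i. x i - y i"
      note z = diff[OF less.prems yA y(2)]
      have "(\<Sum>i<r. ?z i) < (\<Sum>i<r. x i)"
      proof (rule sum_strict_mono_ex1)
        show "\<exists>a\<in>{..<r}. x a - y a < x a" using i y(2) by (intro bexI[of _ i]) auto
      qed auto
      from less.hyps[OF this conjunct1[OF z]] obtain c :: "(nat \<Rightarrow> nat) \<Rightarrow> nat"
        where c: "\<theta> ?z = (\<Sum>b\<in>B. zmul (int (c b)) (\<theta> b))" by blast
      have "(\<Sum>b\<in>B. zmul (int ((c(y := c y + 1)) b)) (\<theta> b)) = (\<Sum>b\<in>B. zmul (int (c b)) (\<theta> b) + (if b = y then \<theta> b else 0))"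
        by (intro sum.cong) (auto simp: zm.scale_left_distrib)
      also have "\<dots> = \<theta> ?z + \<theta> y" using B(1) y(1) by (simp add: sum.distrib c)
      also have "\<dots> = \<theta> x" using z by simp
      finally show ?thesis by (intro exI[of _ "c(y := c y + 1)"]) simp
    qed
  qed
  obtain n :: nat and b where b: "B = b ` {i. i < n}" "inj_on b {i. i < n}"
    using finite_imp_nat_seg_image_inj_on[OF B(1)] by metis
  show thesis
  proof (rule that[of n "\<lambda>i. \<theta> (b i)"])
    show "\<theta> (b i) \<in> cone_monoid H \<sigma>" if "i < n" for i using that b(1) B(2) by (intro thmem) blast
    fix m assume m: "m \<in> cone_monoid H \<sigma>"
    have mH: "m \<in> H" and mM: "m \<in> M" using m sublattice_subset[OF H] by (auto simp: cone_monoid_def)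
    define x where "x i = (if i < d then nat (co m i) else if i < 2 * d then nat (- co m (i - d))
      else nat \<lfloor>s (i - 2 * d) m\<rfloor>)" for i
    have "\<theta> x = (\<Sum>i<d. zmul (co m i) (e i))"
      unfolding \<theta>_def by (intro sum.cong) (auto simp: x_def)
    then have thx: "\<theta> x = m" using gen[OF mM] by simp
    have "real (x (2 * d + j)) = s j m" if j: "j < k" for j
    proof -
      have "s j m \<in> \<int>" by (rule N_int_Ints[OF sN(2)[OF j] mH])
      moreover have "0 \<le> s j m" using m S\<sigma>[of "s j"] s j by (auto simp: cone_monoid_def)
      ultimately show ?thesis by (auto simp: x_def elim!: Ints_cases)
    qed
    then have "x \<in> A0" using thx mH by (simp add: A0_def)
    from comb[OF this] obtain c :: "(nat \<Rightarrow> nat) \<Rightarrow> nat" where c: "m = (\<Sum>b\<in>B. zmul (int (c b)) (\<theta> b))"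
      unfolding thx by blast
    have "m = (\<Sum>i | i < n. zmul (int (c (b i))) (\<theta> (b i)))"
      using c unfolding b(1) sum.reindex[OF b(2)] by (simp add: o_def)
    then have "m = (\<Sum>i<n. zmul (int (c (b i))) (\<theta> (b i)))" by (simp only: lessThan_def)
    then show "\<exists>c :: nat \<Rightarrow> nat. m = (\<Sum>i<n. zmul (int (c i)) (\<theta> (b i)))"
      by (rule exI[of _ "\<lambda>i. c (b i)"])
  qed
qed

lemma polyfun_power: "p \<in> polyfun n \<Longrightarrow> (\<lambda>z. p z ^ k) \<in> polyfun n"
  by (induction k) (simp_all add: polyfun.const polyfun.mult)

lemma polyfun_prod:
  assumes "finite I" "\<And>i. i \<in> I \<Longrightarrow> p i \<in> polyfun n"
  shows "(\<lambda>z. \<Prod>i\<in>I. p i z) \<in> polyfun n"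
  using assms
proof (induction I rule: finite_induct)
  case empty
  show ?case using polyfun.const[of 1 n] by simp
next
  case (insert x F)
  have "p x \<in> polyfun n" "(\<lambda>z. \<Prod>i\<in>F. p i z) \<in> polyfun n" using insert by blast+
  from polyfun.mult[OF this] show ?case using insert.hyps by simp
qed

lemma polyfun_sum:
  assumes "finite I" "\<And>i. i \<in> I \<Longrightarrow> p i \<in> polyfun n"
  shows "(\<lambda>z. \<Sum>i\<in>I. p i z) \<in> polyfun n"
  using assms
proof (induction I rule: finite_induct)
  case empty
  show ?case using polyfun.const[of 0 n] by simp
next
  case (insert x F)
  have "p x \<in> polyfun n" "(\<lambda>z. \<Sum>i\<in>F. p i z) \<in> polyfun n" using insert by blast+
  from polyfun.add[OF this] show ?case using insert.hyps by simp
qed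

lemma function_algebra_polyfun: "function_algebra X (polyfun n)"
  unfolding function_algebra_def
proof (intro conjI allI ballI)
  show "\<exists>h\<in>polyfun n. \<forall>x\<in>X. h x = c" for c
    by (rule bexI[OF _ polyfun.const[of c]]) simp
  fix f g assume fg: "f \<in> polyfun n" "g \<in> polyfun n"
  show "\<exists>h\<in>polyfun n. \<forall>x\<in>X. h x = f x + g x" by (rule bexI[OF _ polyfun.add[OF fg]]) simp
  show "\<exists>h\<in>polyfun n. \<forall>x\<in>X. h x = f x * g x" by (rule bexI[OF _ polyfun.mult[OF fg]]) simp
qed

text \<open>The generators are coordinates on the spectrum. Its equations are the binomials
  \<open>z\<^sup>a = z\<^sup>b\<close>, one for each pair of exponent vectors that represent the same element of \<open>S\<close>: on a
  solution \<open>z\<close>, the value of a monomial depends on the element only.\<close>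

lemma affine_variety_spec:
  assumes S: "submonoid S" and g: "\<And>i. i < n \<Longrightarrow> g i \<in> S"
    and gen: "\<And>m. m \<in> S \<Longrightarrow> \<exists>c :: nat \<Rightarrow> nat. m = (\<Sum>i<n. zmul (int (c i)) (g i))"
  shows "affine_variety (spec_space S)"
proof -
  define \<theta> where "\<theta> c = (\<Sum>i<n. zmul (int (c i)) (g i))" for c :: "nat \<Rightarrow> nat"
  define mono where "mono c = (\<lambda>z :: nat \<Rightarrow> complex. \<Prod>i<n. z i ^ c i)" for c :: "nat \<Rightarrow> nat"
  have mono: "mono c \<in> polyfun n" for c
    unfolding mono_def by (intro polyfun_prod polyfun_power polyfun.coord) simp_all
  define P where "P = {\<lambda>z. mono a z + (- 1) * mono b z |a b. \<theta> a = \<theta> b}"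
  have P: "P \<subseteq> polyfun n"
  proof
    fix p assume "p \<in> P"
    then obtain a b where "p = (\<lambda>z. mono a z + (- 1) * mono b z)" unfolding P_def by blast
    then show "p \<in> polyfun n" by (simp only:) (intro polyfun.add polyfun.mult polyfun.const mono)
  qed
  define X where "X = {z \<in> affine_space n. \<forall>p\<in>P. p z = 0}"
  have XP: "mono a z = mono b z" if "z \<in> X" "\<theta> a = \<theta> b" for a b z
  proof -
    have "(\<lambda>z. mono a z + (- 1) * mono b z) \<in> P" using that(2) unfolding P_def by blast
    from bspec[OF _ this, of "\<lambda>p. p z = 0"] that(1) have "mono a z + (- 1) * mono b z = 0"
      unfolding X_def by simp
    then show ?thesis by simp
  qed
  define F where "F \<phi> = (\<lambda>i. if i < n then ev \<phi> (g i) else 0)" for \<phi>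
  have evth: "ev \<phi> (\<theta> c) = mono c (F \<phi>)" if phi: "\<phi> \<in> spec_points S" for \<phi> c
  proof -
    have "(\<Sum>i<j. zmul (int (c i)) (g i)) \<in> S \<and> ev \<phi> (\<Sum>i<j. zmul (int (c i)) (g i)) = (\<Prod>i<j. ev \<phi> (g i) ^ c i)"
      if "j \<le> n" for j using that
    proof (induction j)
      case 0
      then show ?case using submonoid_zero[OF S] ev_zero[OF phi] by simp
    next
      case (Suc j)
      have gj: "g j \<in> S" using g Suc.prems by simp
      note zj = submonoid_zmul[OF S gj]
      from Suc have IH: "(\<Sum>i<j. zmul (int (c i)) (g i)) \<in> S"
        "ev \<phi> (\<Sum>i<j. zmul (int (c i)) (g i)) = (\<Prod>i<j. ev \<phi> (g i) ^ c i)" by simp_all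
      show ?case using submonoid_add[OF S IH(1) zj] ev_add[OF phi IH(1) zj] ev_zmul[OF phi S gj] IH(2)
        by simp
    qed
    from conjunct2[OF this[of n]] show ?thesis unfolding \<theta>_def mono_def F_def by simp
  qed
  have "\<forall>m\<in>S. \<exists>c. m = \<theta> c" unfolding \<theta>_def by (intro ballI gen)
  from bchoice[OF this] obtain E where E': "\<forall>m\<in>S. m = \<theta> (E m)" by (elim exE)
  note E = bspec[OF E']
  define Fi where "Fi z = mpoint S (\<lambda>m. mono (E m) z)" for z
  have th_add: "\<theta> (\<lambda>i. a i + b i) = \<theta> a + \<theta> b" for a b
    by (simp add: \<theta>_def zm.scale_left_distrib sum.distrib)
  have mono_add: "mono (\<lambda>i. a i + b i) z = mono a z * mono b z" for a b z
    by (simp add: mono_def power_add prod.distrib)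
  have Fi: "Fi z \<in> spec_points S" if z: "z \<in> X" for z
    unfolding Fi_def
  proof (rule mpoint_spec[OF S])
    have "\<theta> (\<lambda>_. 0) = 0" by (simp add: \<theta>_def)
    then have "\<theta> (E 0) = \<theta> (\<lambda>_. 0)" unfolding E[OF submonoid_zero[OF S], symmetric] ..
    then have "mono (E 0) z = mono (\<lambda>_. 0) z" by (rule XP[OF z])
    then show "mono (E 0) z = 1" by (simp add: mono_def)
    fix a b assume ab: "a \<in> S" "b \<in> S"
    have "\<theta> (E (a + b)) = \<theta> (\<lambda>i. E a i + E b i)"
      unfolding th_add E[OF ab(1), symmetric] E[OF ab(2), symmetric] E[OF submonoid_add[OF S ab], symmetric] ..
    then show "mono (E (a + b)) z = mono (E a) z * mono (E b) z"
      unfolding mono_add[symmetric] by (rule XP[OF z])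
  qed
  have FX: "F \<phi> \<in> X" if phi: "\<phi> \<in> spec_points S" for \<phi>
  proof -
    have "p (F \<phi>) = 0" if "p \<in> P" for p
    proof -
      obtain a b where p: "p = (\<lambda>z. mono a z + (- 1) * mono b z)" "\<theta> a = \<theta> b" using \<open>p \<in> P\<close> unfolding P_def by blast
      have "mono a (F \<phi>) = mono b (F \<phi>)" using evth[OF phi, of a] evth[OF phi, of b] p(2) by simp
      then show ?thesis unfolding p(1) by simp
    qed
    then show ?thesis by (simp add: X_def affine_space_def F_def)
  qed
  have FiF: "Fi (F \<phi>) = \<phi>" if phi: "\<phi> \<in> spec_points S" for \<phi>
  proof (rule spec_eqI[OF Fi[OF FX[OF phi]] phi S])
    fix m assume m: "m \<in> S"
    have "ev (Fi (F \<phi>)) m = mono (E m) (F \<phi>)" unfolding Fi_def by (rule ev_mpoint[OF m])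
    also have "\<dots> = ev \<phi> (\<theta> (E m))" using evth[OF phi] by simp
    also have "\<dots> = ev \<phi> m" unfolding E[OF m, symmetric] ..
    finally show "ev (Fi (F \<phi>)) m = ev \<phi> m" .
  qed
  have FFi: "F (Fi z) = z" if z: "z \<in> X" for z
  proof
    fix i
    show "F (Fi z) i = z i"
    proof (cases "i < n")
      case True
      let ?u = "\<lambda>j. if j = i then 1 else 0 :: nat"
      have "\<theta> ?u = (\<Sum>j<n. if j = i then g j else 0)" unfolding \<theta>_def by (intro sum.cong) auto
      then have "\<theta> ?u = g i" using True by simp
      then have "\<theta> (E (g i)) = \<theta> ?u" unfolding E[OF g[OF True], symmetric] ..
      then have "mono (E (g i)) z = mono ?u z" by (rule XP[OF z])
      also have "\<dots> = (\<Prod>j<n. if j = i then z j else 1)" unfolding mono_def by (intro prod.cong) auto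
      also have "\<dots> = z i" using True by simp
      finally show ?thesis using True g by (simp add: F_def Fi_def ev_mpoint)
    next
      case False
      then show ?thesis using z by (simp add: F_def X_def affine_space_def)
    qed
  qed
  note alg = function_algebra_evals[OF S] and alg' = function_algebra_polyfun[of X n]
  have m1: "morphism (spec_space S) (zariski X (polyfun n)) F"
  proof (rule morphism_zariski[OF alg alg' FX])
    fix b assume "b \<in> polyfun n"
    then show "\<exists>a\<in>evals S. \<forall>\<phi>\<in>spec_points S. a \<phi> = b (F \<phi>)"
    proof induction
      case (const c)
      show ?case by (rule function_algebra_const[OF alg])
    next
      case (coord i)
      then show ?case
        by (intro bexI[OF _ evalsI[OF monoid_algebra_single[OF g[OF coord], of 1]]]) (simp add: F_def ev_def)
    next
      case (add p q)
      from \<open>\<exists>a\<in>evals S. \<forall>\<phi>\<in>spec_points S. a \<phi> = p (F \<phi>)\<close> obtain a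
        where a: "a \<in> evals S" "\<forall>\<phi>\<in>spec_points S. a \<phi> = p (F \<phi>)" by (elim bexE)
      from \<open>\<exists>a\<in>evals S. \<forall>\<phi>\<in>spec_points S. a \<phi> = q (F \<phi>)\<close> obtain b
        where b: "b \<in> evals S" "\<forall>\<phi>\<in>spec_points S. b \<phi> = q (F \<phi>)" by (elim bexE)
      from function_algebra_add[OF alg a(1) b(1)] obtain h
        where h: "h \<in> evals S" "\<forall>\<phi>\<in>spec_points S. h \<phi> = a \<phi> + b \<phi>" by (elim bexE)
      show ?case by (rule bexI[OF _ h(1)]) (simp add: a(2) b(2) h(2))
    next
      case (mult p q)
      from \<open>\<exists>a\<in>evals S. \<forall>\<phi>\<in>spec_points S. a \<phi> = p (F \<phi>)\<close> obtain a
        where a: "a \<in> evals S" "\<forall>\<phi>\<in>spec_points S. a \<phi> = p (F \<phi>)" by (elim bexE)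
      from \<open>\<exists>a\<in>evals S. \<forall>\<phi>\<in>spec_points S. a \<phi> = q (F \<phi>)\<close> obtain b
        where b: "b \<in> evals S" "\<forall>\<phi>\<in>spec_points S. b \<phi> = q (F \<phi>)" by (elim bexE)
      from function_algebra_mult[OF alg a(1) b(1)] obtain h
        where h: "h \<in> evals S" "\<forall>\<phi>\<in>spec_points S. h \<phi> = a \<phi> * b \<phi>" by (elim bexE)
      show ?case by (rule bexI[OF _ h(1)]) (simp add: a(2) b(2) h(2))
    qed
  qed
  have m2: "morphism (zariski X (polyfun n)) (spec_space S) Fi"
  proof (rule morphism_zariski[OF alg' alg Fi])
    fix b assume "b \<in> evals S"
    then obtain f where f: "f \<in> monoid_algebra S" "b = (\<lambda>\<phi>. \<phi> f)" unfolding evals_def by blast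
    have "(\<lambda>z. \<Sum>m\<in>Poly_Mapping.keys f. Poly_Mapping.lookup f m * mono (E m) z) \<in> polyfun n"
      by (intro polyfun_sum polyfun.mult polyfun.const mono finite_keys)
    then show "\<exists>a\<in>polyfun n. \<forall>z\<in>X. a z = b (Fi z)"
      by (rule bexI[rotated]) (simp add: f Fi_def mpoint_def lincomb_def)
  qed
  have "isomorphic (spec_space S) (zariski X (polyfun n))"
    unfolding isomorphic_def pts_spec[OF S] pts_zariski[OF alg']
    by (intro exI[of _ F] exI[of _ Fi] conjI ballI m1 m2 FiF FFi)
  then show ?thesis unfolding affine_variety_def X_def using P by blast
qed

section \<open>Gluing affine toric varieties\<close>

text \<open>What gluing needs of a fan: two members meet in a face, and it is cut out by a lattice point of
  the dual cone. The lattice \<open>H\<close> is a subgroup of \<open>M\<close>, so that \<open>M\<close> itself and \<open>L\<close> are both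
  covered.\<close>

locale toric_gluing =
  fixes M H :: "'m::ab_group_add set" and \<Delta> :: "('m \<Rightarrow> real) set set"
  assumes lattice: "lattice_set M" and sub: "sublattice H M" and fin: "finite \<Delta>"
    and rat: "\<sigma> \<in> \<Delta> \<Longrightarrow> rational_cone H \<sigma>"
    and meet: "\<sigma> \<in> \<Delta> \<Longrightarrow> \<tau> \<in> \<Delta> \<Longrightarrow> \<exists>m\<in>cone_monoid H \<tau>. \<sigma> \<inter> \<tau> = {u \<in> \<tau>. u m = 0}"

lemma toric_gluing_generalized_fan:
  assumes "lattice_set M" "sublattice H M" "generalized_fan H \<Delta>"
  shows "toric_gluing M H \<Delta>"
proof
  show rat: "rational_cone H \<sigma>" if "\<sigma> \<in> \<Delta>" for \<sigma> using assms(3) that by (simp add: generalized_fan_def)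
  show "\<exists>m\<in>cone_monoid H \<tau>. \<sigma> \<inter> \<tau> = {u \<in> \<tau>. u m = 0}" if s: "\<sigma> \<in> \<Delta>" and t: "\<tau> \<in> \<Delta>" for \<sigma> \<tau>
  proof -
    have "cone_face H (\<sigma> \<inter> \<tau>) \<tau>" using assms(3) s t by (simp add: generalized_fan_def)
    then obtain m where "m \<in> cone_monoid H \<tau>" "\<sigma> \<inter> \<tau> = {u \<in> \<tau>. u m = 0}"
      by (rule face_by_lattice_point[OF assms(2) rat[OF t]])
    then show ?thesis by (rule bexI[rotated])
  qed
qed (use assms in \<open>simp_all add: generalized_fan_def\<close>)

context toric_gluing
begin

abbreviation S :: "('m \<Rightarrow> real) set \<Rightarrow> 'm set" where
  "S \<equiv> cone_monoid H"

abbreviation pre :: "('m \<Rightarrow> real) set \<Rightarrow> 'm toric_point set \<Rightarrow> 'm alg_point set" where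
  "pre \<equiv> chart_preimage H \<Delta>"

abbreviation X :: "'m toric_point fspace" where
  "X \<equiv> toric_variety H \<Delta>"

definition piece :: "('m \<Rightarrow> real) set \<Rightarrow> 'm toric_point set" where
  "piece \<sigma> = chart H \<Delta> \<sigma> ` spec_points (S \<sigma>)"

lemma mon: "\<sigma> \<in> \<Delta> \<Longrightarrow> \<tau> \<subseteq> \<sigma> \<Longrightarrow> submonoid (S \<tau>)"
  using submonoid_cone_monoid[OF sub] rational_cone_subset[OF rat] by (metis order_trans)

lemma affine_toric_eq: "affine_toric H \<sigma> = spec_space (S \<sigma>)"
  by (simp add: affine_toric_def evals_def)

lemma glue_rel_iff:
  "((\<sigma>, \<phi>), (\<tau>, \<psi>)) \<in> glue_rel H \<Delta> \<longleftrightarrow> \<sigma> \<in> \<Delta> \<and> \<tau> \<in> \<Delta> \<and> \<phi> \<in> spec_points (S \<sigma>) \<and> \<psi> \<in> spec_points (S \<tau>) \<and>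
    (\<exists>\<omega>\<in>spec_points (S (\<sigma> \<inter> \<tau>)). \<phi> = restrict_point (S \<sigma>) \<omega> \<and> \<psi> = restrict_point (S \<tau>) \<omega>)"
  unfolding glue_rel_def chart_points_def by auto

lemma localises_meet:
  assumes "\<sigma> \<in> \<Delta>" "\<tau> \<in> \<Delta>"
  obtains m where "m \<in> S \<tau>" "\<sigma> \<inter> \<tau> = {u \<in> \<tau>. u m = 0}" "localises (S \<tau>) (S (\<sigma> \<inter> \<tau>)) m"
proof -
  obtain m where m: "m \<in> S \<tau>" "\<sigma> \<inter> \<tau> = {u \<in> \<tau>. u m = 0}" using meet[OF assms] by (elim bexE)
  have "localises (S \<tau>) (S (\<sigma> \<inter> \<tau>)) m" unfolding m(2) by (rule localises_face[OF sub rat[OF assms(2)] m(1)])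
  with m show thesis by (rule that)
qed

lemma S_mono: "\<tau> \<subseteq> \<sigma> \<Longrightarrow> S \<sigma> \<subseteq> S \<tau>"
  by (rule cone_monoid_antimono)

text \<open>Transitivity: if \<open>\<psi>\<close> extends to the charts of \<open>\<sigma> \<inter> \<tau>\<close> and of \<open>\<tau> \<inter> \<rho>\<close>, the two
  monomials that cut out these faces are invertible at \<open>\<psi>\<close>, hence so is their product, which cuts
  out the triple intersection.\<close>

lemma glue_trans:
  assumes 1: "((\<sigma>, \<phi>), (\<tau>, \<psi>)) \<in> glue_rel H \<Delta>" and 2: "((\<tau>, \<psi>), (\<rho>, \<theta>)) \<in> glue_rel H \<Delta>"
  shows "((\<sigma>, \<phi>), (\<rho>, \<theta>)) \<in> glue_rel H \<Delta>"
proof -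
  have D: "\<sigma> \<in> \<Delta>" "\<tau> \<in> \<Delta>" "\<rho> \<in> \<Delta>" and sp: "\<phi> \<in> spec_points (S \<sigma>)" "\<psi> \<in> spec_points (S \<tau>)" "\<theta> \<in> spec_points (S \<rho>)"
    using 1 2 unfolding glue_rel_iff by simp_all
  obtain \<omega>1 where w1: "\<omega>1 \<in> spec_points (S (\<sigma> \<inter> \<tau>))" "\<phi> = restrict_point (S \<sigma>) \<omega>1" "\<psi> = restrict_point (S \<tau>) \<omega>1"
    using 1 unfolding glue_rel_iff by (elim conjE bexE)
  obtain \<omega>2 where w2: "\<omega>2 \<in> spec_points (S (\<tau> \<inter> \<rho>))" "\<psi> = restrict_point (S \<tau>) \<omega>2" "\<theta> = restrict_point (S \<rho>) \<omega>2"
    using 2 unfolding glue_rel_iff by (elim conjE bexE)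
  obtain m1 where m1: "m1 \<in> S \<tau>" "\<sigma> \<inter> \<tau> = {u \<in> \<tau>. u m1 = 0}" "localises (S \<tau>) (S (\<sigma> \<inter> \<tau>)) m1"
    by (rule localises_meet[OF D(1,2)])
  obtain m2 where m2: "m2 \<in> S \<tau>" "\<rho> \<inter> \<tau> = {u \<in> \<tau>. u m2 = 0}" "localises (S \<tau>) (S (\<rho> \<inter> \<tau>)) m2"
    by (rule localises_meet[OF D(3,2)])
  have w2': "\<omega>2 \<in> spec_points (S (\<rho> \<inter> \<tau>))" using w2(1) by (simp add: Int_commute)
  have St: "submonoid (S \<tau>)" using mon[OF D(2)] by blast
  have m12: "m1 + m2 \<in> S \<tau>" by (rule submonoid_add[OF St m1(1) m2(1)])
  have "u (m1 + m2) = 0 \<longleftrightarrow> u m1 = 0 \<and> u m2 = 0" if u: "u \<in> \<tau>" for u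
  proof -
    have "u (m1 + m2) = u m1 + u m2"
      using N_real_add[OF subsetD[OF rational_cone_subset[OF rat[OF D(2)]] u] sub] m1(1) m2(1)
      by (simp add: cone_monoid_def)
    moreover have "0 \<le> u m1" "0 \<le> u m2" using m1(1) m2(1) u by (simp_all add: cone_monoid_def)
    ultimately show ?thesis by auto
  qed
  then have cut: "{u \<in> \<tau>. u (m1 + m2) = 0} = \<sigma> \<inter> \<tau> \<inter> \<rho>" using m1(2) m2(2) by blast
  have loc: "localises (S \<tau>) (S (\<sigma> \<inter> \<tau> \<inter> \<rho>)) (m1 + m2)"
    using localises_face[OF sub rat[OF D(2)] m12] unfolding cut .
  have "ev \<psi> m1 \<noteq> 0" unfolding w1(3) ev_restrict[OF m1(1)] by (rule localises_nonzero[OF m1(3) w1(1)])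
  moreover have "ev \<psi> m2 \<noteq> 0" unfolding w2(2) ev_restrict[OF m2(1)] by (rule localises_nonzero[OF m2(3) w2'])
  ultimately have "ev \<psi> (m1 + m2) \<noteq> 0" using ev_add[OF sp(2) m1(1) m2(1)] by simp
  then obtain \<omega> where w: "\<omega> \<in> spec_points (S (\<sigma> \<inter> \<tau> \<inter> \<rho>))" "restrict_point (S \<tau>) \<omega> = \<psi>"
    by (rule localises_extend[OF loc sp(2)])
  have sm: "submonoid (S (\<sigma> \<inter> \<tau>))" "submonoid (S (\<rho> \<inter> \<tau>))" "submonoid (S (\<sigma> \<inter> \<rho>))"
    using mon[OF D(1)] mon[OF D(2)] by (metis inf_le1, metis inf_le2, metis inf_le1)
  have "restrict_point (S (\<sigma> \<inter> \<tau>)) \<omega> = \<omega>1"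
  proof (rule localises_inj[OF m1(3) restrict_spec[OF sm(1) S_mono w(1)] w1(1)])
    show "restrict_point (S \<tau>) (restrict_point (S (\<sigma> \<inter> \<tau>)) \<omega>) = restrict_point (S \<tau>) \<omega>1"
      using w(2) w1(3) by (subst restrict_restrict) (auto intro: S_mono[THEN subsetD])
  qed blast
  moreover have "restrict_point (S (\<rho> \<inter> \<tau>)) \<omega> = \<omega>2"
  proof (rule localises_inj[OF m2(3) restrict_spec[OF sm(2) S_mono w(1)] w2'])
    show "restrict_point (S \<tau>) (restrict_point (S (\<rho> \<inter> \<tau>)) \<omega>) = restrict_point (S \<tau>) \<omega>2"
      using w(2) w2(2) by (subst restrict_restrict) (auto intro: S_mono[THEN subsetD])
  qed blast
  moreover have "restrict_point (S \<sigma>) (restrict_point (S (\<sigma> \<inter> \<tau>)) \<omega>) = restrict_point (S \<sigma>) \<omega>"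
    "restrict_point (S \<rho>) (restrict_point (S (\<rho> \<inter> \<tau>)) \<omega>) = restrict_point (S \<rho>) \<omega>"
    "restrict_point (S \<sigma>) (restrict_point (S (\<sigma> \<inter> \<rho>)) \<omega>) = restrict_point (S \<sigma>) \<omega>"
    "restrict_point (S \<rho>) (restrict_point (S (\<sigma> \<inter> \<rho>)) \<omega>) = restrict_point (S \<rho>) \<omega>"
    by (rule restrict_restrict, rule S_mono, blast)+
  ultimately have "\<phi> = restrict_point (S \<sigma>) (restrict_point (S (\<sigma> \<inter> \<rho>)) \<omega>)"
    "\<theta> = restrict_point (S \<rho>) (restrict_point (S (\<sigma> \<inter> \<rho>)) \<omega>)"
    using w1(2) w2(3) by simp_all
  moreover have "restrict_point (S (\<sigma> \<inter> \<rho>)) \<omega> \<in> spec_points (S (\<sigma> \<inter> \<rho>))"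
    by (rule restrict_spec[OF sm(3) S_mono w(1)]) blast
  ultimately show ?thesis unfolding glue_rel_iff using D sp by blast
qed

lemma equiv_glue: "equiv (chart_points H \<Delta>) (glue_rel H \<Delta>)"
proof (rule equivI)
  show "glue_rel H \<Delta> \<subseteq> chart_points H \<Delta> \<times> chart_points H \<Delta>" unfolding glue_rel_def by blast
  show "refl_on (chart_points H \<Delta>) (glue_rel H \<Delta>)"
  proof (rule refl_onI)
    fix x assume "x \<in> chart_points H \<Delta>"
    then obtain \<sigma> \<phi> where x: "x = (\<sigma>, \<phi>)" "\<sigma> \<in> \<Delta>" "\<phi> \<in> spec_points (S \<sigma>)" unfolding chart_points_def by blast
    then show "(x, x) \<in> glue_rel H \<Delta>" unfolding x(1) glue_rel_iff
      by (intro conjI bexI[of _ \<phi>]) (simp_all add: restrict_self)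
  qed
  show "sym (glue_rel H \<Delta>)"
  proof (rule symI)
    fix x y assume xy: "(x, y) \<in> glue_rel H \<Delta>"
    obtain \<sigma> \<phi> \<tau> \<psi> where e: "x = (\<sigma>, \<phi>)" "y = (\<tau>, \<psi>)" by (cases x, cases y)
    show "(y, x) \<in> glue_rel H \<Delta>" using xy unfolding e glue_rel_iff by (metis Int_commute)
  qed
  show "trans (glue_rel H \<Delta>)"
  proof (rule transI)
    fix x y z assume "(x, y) \<in> glue_rel H \<Delta>" "(y, z) \<in> glue_rel H \<Delta>"
    then show "(x, z) \<in> glue_rel H \<Delta>" by (cases x, cases y, cases z) (simp, rule glue_trans)
  qed
qed

lemma chart_eq_iff:
  assumes "\<sigma> \<in> \<Delta>" "\<tau> \<in> \<Delta>" "\<phi> \<in> spec_points (S \<sigma>)" "\<psi> \<in> spec_points (S \<tau>)"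
  shows "chart H \<Delta> \<sigma> \<phi> = chart H \<Delta> \<tau> \<psi> \<longleftrightarrow>
    (\<exists>\<omega>\<in>spec_points (S (\<sigma> \<inter> \<tau>)). \<phi> = restrict_point (S \<sigma>) \<omega> \<and> \<psi> = restrict_point (S \<tau>) \<omega>)"
proof -
  have "(\<sigma>, \<phi>) \<in> chart_points H \<Delta>" "(\<tau>, \<psi>) \<in> chart_points H \<Delta>"
    using assms by (auto simp: chart_points_def)
  from eq_equiv_class_iff[OF equiv_glue this] show ?thesis
    unfolding chart_def glue_rel_iff using assms by simp
qed

lemma chart_inj:
  assumes "\<sigma> \<in> \<Delta>" "\<phi> \<in> spec_points (S \<sigma>)" "\<psi> \<in> spec_points (S \<sigma>)" "chart H \<Delta> \<sigma> \<phi> = chart H \<Delta> \<sigma> \<psi>"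
  shows "\<phi> = \<psi>"
  using assms(4) unfolding chart_eq_iff[OF assms(1,1,2,3)] by (elim bexE conjE) simp

lemma chart_mem: "\<phi> \<in> spec_points (S \<sigma>) \<Longrightarrow> chart H \<Delta> \<sigma> \<phi> \<in> piece \<sigma>"
  by (simp add: piece_def)

lemma classes_eq: "chart_points H \<Delta> // glue_rel H \<Delta> = (\<Union>\<sigma>\<in>\<Delta>. piece \<sigma>)"
  unfolding quotient_def chart_points_def piece_def chart_def by auto

text \<open>\<open>g\<close> is the function \<open>f\<close> of the chart of \<open>\<sigma>\<close>, multiplied by the \<open>n\<close>-th power of \<open>m\<close> and extended by
  zero to the chart of \<open>\<tau>\<close>.\<close>

definition clears where
  "clears \<sigma> \<tau> m n f g \<longleftrightarrow> g \<in> monoid_algebra (S \<tau>) \<and>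
     (\<forall>\<psi>\<in>spec_points (S \<tau>). chart H \<Delta> \<tau> \<psi> \<notin> piece \<sigma> \<longrightarrow> \<psi> g = 0) \<and>
     (\<forall>\<psi>\<in>spec_points (S \<tau>). \<forall>\<phi>\<in>spec_points (S \<sigma>).
        chart H \<Delta> \<tau> \<psi> = chart H \<Delta> \<sigma> \<phi> \<longrightarrow> \<psi> g = ev \<psi> m ^ n * \<phi> f)"

text \<open>The change of charts: with \<open>m\<close> cutting out the face \<open>\<sigma> \<inter> \<tau>\<close> of \<open>\<tau>\<close>, the overlap in the
  chart of \<open>\<tau>\<close> is \<open>{m \<noteq> 0}\<close>, and a power of \<open>m\<close> clears the denominators of a function on the chart
  of \<open>\<sigma>\<close>; one further factor \<open>m\<close> makes the result vanish off the overlap.\<close>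

lemma chart_transition:
  assumes D: "\<sigma> \<in> \<Delta>" "\<tau> \<in> \<Delta>"
  obtains m where "m \<in> S \<tau>"
    "\<forall>\<psi>\<in>spec_points (S \<tau>). chart H \<Delta> \<tau> \<psi> \<in> piece \<sigma> \<longleftrightarrow> ev \<psi> m \<noteq> 0"
    "\<forall>f\<in>monoid_algebra (S \<sigma>). \<exists>N. \<forall>n>N. \<exists>g. clears \<sigma> \<tau> m n f g"
proof -
  obtain m where m: "m \<in> S \<tau>" "\<sigma> \<inter> \<tau> = {u \<in> \<tau>. u m = 0}" and loc: "localises (S \<tau>) (S (\<sigma> \<inter> \<tau>)) m"
    by (rule localises_meet[OF D])
  have Sm: "submonoid (S \<sigma>)" "submonoid (S \<tau>)" "submonoid (S (\<sigma> \<inter> \<tau>))"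
    using mon[OF D(1)] mon[OF D(2)] by blast+
  have sub': "S \<sigma> \<subseteq> S (\<sigma> \<inter> \<tau>)" "S \<tau> \<subseteq> S (\<sigma> \<inter> \<tau>)" by (rule S_mono, blast)+
  have rel: thesis if "\<psi> \<in> spec_points (S \<tau>)" "\<phi> \<in> spec_points (S \<sigma>)" "chart H \<Delta> \<tau> \<psi> = chart H \<Delta> \<sigma> \<phi>"
    and w: "\<And>\<omega>. \<omega> \<in> spec_points (S (\<sigma> \<inter> \<tau>)) \<Longrightarrow> \<phi> = restrict_point (S \<sigma>) \<omega> \<Longrightarrow> \<psi> = restrict_point (S \<tau>) \<omega> \<Longrightarrow> thesis"
    for \<psi> \<phi> thesis
    using that(3)[symmetric] unfolding chart_eq_iff[OF D that(2,1)] by (elim bexE conjE) (rule w)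
  have iff: "chart H \<Delta> \<tau> \<psi> \<in> piece \<sigma> \<longleftrightarrow> ev \<psi> m \<noteq> 0" if psi: "\<psi> \<in> spec_points (S \<tau>)" for \<psi>
  proof
    assume "chart H \<Delta> \<tau> \<psi> \<in> piece \<sigma>"
    then obtain \<phi> where phi: "\<phi> \<in> spec_points (S \<sigma>)" "chart H \<Delta> \<tau> \<psi> = chart H \<Delta> \<sigma> \<phi>" unfolding piece_def by blast
    obtain \<omega> where "\<omega> \<in> spec_points (S (\<sigma> \<inter> \<tau>))" "\<psi> = restrict_point (S \<tau>) \<omega>" by (rule rel[OF psi phi])
    then show "ev \<psi> m \<noteq> 0" using localises_nonzero[OF loc] ev_restrict[OF m(1)] by simp
  next
    assume "ev \<psi> m \<noteq> 0"
    then obtain \<omega> where w: "\<omega> \<in> spec_points (S (\<sigma> \<inter> \<tau>))" "restrict_point (S \<tau>) \<omega> = \<psi>"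
      by (rule localises_extend[OF loc psi])
    have r: "restrict_point (S \<sigma>) \<omega> \<in> spec_points (S \<sigma>)" by (rule restrict_spec[OF Sm(1) sub'(1) w(1)])
    have "chart H \<Delta> \<sigma> (restrict_point (S \<sigma>) \<omega>) = chart H \<Delta> \<tau> \<psi>"
      unfolding chart_eq_iff[OF D r psi] using w by (intro bexI[of _ \<omega>]) simp_all
    then show "chart H \<Delta> \<tau> \<psi> \<in> piece \<sigma>" using chart_mem[OF r] by simp
  qed
  show thesis
  proof (rule that[OF m(1)], intro ballI iff, assumption, intro ballI)
    fix f assume f: "f \<in> monoid_algebra (S \<sigma>)"
    have f': "f \<in> monoid_algebra (S (\<sigma> \<inter> \<tau>))" by (rule monoid_algebra_mono[OF sub'(1) f])
    obtain N where N: "\<forall>n\<ge>N. Poly_Mapping.single (zmul (int n) m) 1 * f \<in> monoid_algebra (S \<tau>)"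
      by (rule localises_clear[OF loc f'])
    show "\<exists>N. \<forall>n>N. \<exists>g. clears \<sigma> \<tau> m n f g"
    proof (intro exI[of _ N] allI impI)
      fix n assume "N < n"
      then obtain k where k: "n = Suc k" "N \<le> k" by (cases n) auto
      let ?h = "Poly_Mapping.single (zmul (int k) m) 1 * f" and ?s = "Poly_Mapping.single m 1"
      have h: "?h \<in> monoid_algebra (S \<tau>)" and s: "?s \<in> monoid_algebra (S \<tau>)"
        using N k(2) m(1) by (simp_all add: monoid_algebra_single)
      have val: "\<psi> (?s * ?h) = ev \<psi> m * \<psi> ?h" if "\<psi> \<in> spec_points (S \<tau>)" for \<psi>
        using spec_mult[OF that s h] by (simp add: ev_def)
      show "\<exists>g. clears \<sigma> \<tau> m n f g" unfolding clears_def
      proof (intro exI[of _ "?s * ?h"] conjI ballI impI)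
        show "?s * ?h \<in> monoid_algebra (S \<tau>)" by (rule monoid_algebra_mult[OF Sm(2) s h])
        show "\<psi> (?s * ?h) = 0" if "\<psi> \<in> spec_points (S \<tau>)" "chart H \<Delta> \<tau> \<psi> \<notin> piece \<sigma>" for \<psi>
          using val[OF that(1)] iff[OF that(1)] that(2) by simp
        fix \<psi> \<phi> assume psi: "\<psi> \<in> spec_points (S \<tau>)" and phi: "\<phi> \<in> spec_points (S \<sigma>)"
          and eq: "chart H \<Delta> \<tau> \<psi> = chart H \<Delta> \<sigma> \<phi>"
        obtain \<omega> where w: "\<omega> \<in> spec_points (S (\<sigma> \<inter> \<tau>))" "\<phi> = restrict_point (S \<sigma>) \<omega>" "\<psi> = restrict_point (S \<tau>) \<omega>"
          by (rule rel[OF psi phi eq])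
        have mm: "m \<in> S (\<sigma> \<inter> \<tau>)" using m(1) sub'(2) by blast
        have "\<psi> ?h = \<omega> ?h" unfolding w(3) by (rule restrict_apply[OF h])
        also have "\<dots> = \<omega> (Poly_Mapping.single (zmul (int k) m) 1) * \<omega> f"
          by (rule spec_mult[OF w(1) monoid_algebra_single[OF submonoid_zmul[OF Sm(3) mm]] f'])
        also have "\<dots> = ev \<omega> m ^ k * \<phi> f"
          using ev_zmul[OF w(1) Sm(3) mm] restrict_apply[OF f] w(2) by (simp add: ev_def)
        also have "ev \<omega> m = ev \<psi> m" unfolding w(3) by (simp add: ev_restrict[OF m(1)])
        finally show "\<psi> (?s * ?h) = ev \<psi> m ^ n * \<phi> f" using val[OF psi] k(1) by simp
      qed
    qed
  qed
qed

lemma pre_subset: "pre \<sigma> W \<subseteq> spec_points (S \<sigma>)"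
  by (auto simp: chart_preimage_def)

lemma mem_pre: "\<phi> \<in> pre \<sigma> W \<longleftrightarrow> \<phi> \<in> spec_points (S \<sigma>) \<and> chart H \<Delta> \<sigma> \<phi> \<in> W"
  by (simp add: chart_preimage_def)

lemma openin_X:
  "openin (fs_top X) W \<longleftrightarrow> W \<subseteq> (\<Union>\<sigma>\<in>\<Delta>. piece \<sigma>) \<and> (\<forall>\<sigma>\<in>\<Delta>. openin (fs_top (spec_space (S \<sigma>))) (pre \<sigma> W))"
  unfolding toric_variety_def using istopology_toric_open_set[of H \<Delta>]
  by (simp add: topology_inverse' toric_open_set_def classes_eq affine_toric_eq)

lemma fs_reg_X:
  "h \<in> fs_reg X W \<longleftrightarrow> (\<forall>\<sigma>\<in>\<Delta>. (\<lambda>\<phi>. h (chart H \<Delta> \<sigma> \<phi>)) \<in> fs_reg (spec_space (S \<sigma>)) (pre \<sigma> W))"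
  by (simp add: toric_variety_def affine_toric_eq)

lemma swf_spec: "\<sigma> \<in> \<Delta> \<Longrightarrow> space_with_functions (spec_space (S \<sigma>))"
  by (intro space_with_functions_zariski function_algebra_evals mon) auto

lemma pts_X: "pts X = (\<Union>\<sigma>\<in>\<Delta>. piece \<sigma>)"
proof -
  have "openin (fs_top X) (\<Union>\<sigma>\<in>\<Delta>. piece \<sigma>)" unfolding openin_X
  proof (intro conjI ballI)
    fix \<sigma> assume s: "\<sigma> \<in> \<Delta>"
    have "pre \<sigma> (\<Union>\<sigma>\<in>\<Delta>. piece \<sigma>) = pts (spec_space (S \<sigma>))"
      using s by (auto simp: mem_pre pts_spec[OF mon[OF s order_refl]] intro!: bexI[of _ \<sigma>] chart_mem)
    then show "openin (fs_top (spec_space (S \<sigma>))) (pre \<sigma> (\<Union>\<sigma>\<in>\<Delta>. piece \<sigma>))"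
      by (simp only: openin_topspace)
  qed simp
  then have "(\<Union>\<sigma>\<in>\<Delta>. piece \<sigma>) \<subseteq> pts X" by (rule openin_subset)
  moreover have "pts X \<subseteq> (\<Union>\<sigma>\<in>\<Delta>. piece \<sigma>)"
    using openin_topspace[of "fs_top X"] unfolding openin_X by (rule conjunct1)
  ultimately show ?thesis by blast
qed

lemma openin_pre: "openin (fs_top X) W \<Longrightarrow> \<sigma> \<in> \<Delta> \<Longrightarrow> openin (fs_top (spec_space (S \<sigma>))) (pre \<sigma> W)"
  unfolding openin_X by blast

text \<open>The inclusion of a piece is open: if \<open>f\<close> exhibits a neighbourhood in the chart of \<open>\<sigma>\<close>, the function
  that \<open>f\<close> becomes in the chart of \<open>\<tau>\<close> exhibits one there.\<close>

lemma openin_in_piece: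
  assumes s: "\<sigma> \<in> \<Delta>" and W: "W \<subseteq> piece \<sigma>" and op: "openin (fs_top (spec_space (S \<sigma>))) (pre \<sigma> W)"
  shows "openin (fs_top X) W"
  unfolding openin_X
proof (intro conjI ballI)
  show "W \<subseteq> (\<Union>\<sigma>\<in>\<Delta>. piece \<sigma>)" using W s by blast
  fix \<tau> assume t: "\<tau> \<in> \<Delta>"
  have St: "submonoid (S \<tau>)" and Ss: "submonoid (S \<sigma>)" using mon t s by blast+
  obtain m where m: "m \<in> S \<tau>"
    and iff': "\<forall>\<psi>\<in>spec_points (S \<tau>). chart H \<Delta> \<tau> \<psi> \<in> piece \<sigma> \<longleftrightarrow> ev \<psi> m \<noteq> 0"
    and clear': "\<forall>f\<in>monoid_algebra (S \<sigma>). \<exists>N. \<forall>n>N. \<exists>g. clears \<sigma> \<tau> m n f g"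
    by (rule chart_transition[OF s t])
  note iff = bspec[OF iff'] and clear = bspec[OF clear']
  show "openin (fs_top (spec_space (S \<tau>))) (pre \<tau> W)" unfolding openin_spec[OF St]
  proof (intro conjI ballI pre_subset)
    fix \<psi> assume "\<psi> \<in> pre \<tau> W"
    then have psi: "\<psi> \<in> spec_points (S \<tau>)" "chart H \<Delta> \<tau> \<psi> \<in> W" by (simp_all add: mem_pre)
    then have pp: "chart H \<Delta> \<tau> \<psi> \<in> piece \<sigma>" using W by blast
    then obtain \<phi> where phi: "\<phi> \<in> spec_points (S \<sigma>)" "chart H \<Delta> \<tau> \<psi> = chart H \<Delta> \<sigma> \<phi>" unfolding piece_def by blast
    have "\<phi> \<in> pre \<sigma> W" using phi psi by (simp add: mem_pre)
    from bspec[OF conjunct2[OF op[unfolded openin_spec[OF Ss]]] this] obtain f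
      where f: "f \<in> monoid_algebra (S \<sigma>)" "\<phi> f \<noteq> 0" "\<forall>\<phi>'\<in>spec_points (S \<sigma>). \<phi>' f \<noteq> 0 \<longrightarrow> \<phi>' \<in> pre \<sigma> W"
      by (elim bexE conjE)
    obtain n g where g: "g \<in> monoid_algebra (S \<tau>)"
      "\<forall>\<psi>\<in>spec_points (S \<tau>). chart H \<Delta> \<tau> \<psi> \<notin> piece \<sigma> \<longrightarrow> \<psi> g = 0"
      "\<forall>\<psi>\<in>spec_points (S \<tau>). \<forall>\<phi>\<in>spec_points (S \<sigma>). chart H \<Delta> \<tau> \<psi> = chart H \<Delta> \<sigma> \<phi> \<longrightarrow> \<psi> g = ev \<psi> m ^ n * \<phi> f"
    proof -
      obtain N where "\<forall>n>N. \<exists>g. clears \<sigma> \<tau> m n f g"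
        using clear[OF f(1)] by (elim exE)
      from mp[OF spec[OF this] lessI] show thesis unfolding clears_def by (elim exE conjE) (rule that)
    qed
    have "\<psi> g \<noteq> 0" using mp[OF bspec[OF bspec[OF g(3) psi(1)] phi(1)] phi(2)] iff[OF psi(1)] pp f(2) by simp
    moreover have "\<psi>' \<in> pre \<tau> W" if p': "\<psi>' \<in> spec_points (S \<tau>)" "\<psi>' g \<noteq> 0" for \<psi>'
    proof -
      have "chart H \<Delta> \<tau> \<psi>' \<in> piece \<sigma>" using bspec[OF g(2) p'(1)] p'(2) by blast
      then obtain \<phi>' where phi': "\<phi>' \<in> spec_points (S \<sigma>)" "chart H \<Delta> \<tau> \<psi>' = chart H \<Delta> \<sigma> \<phi>'" unfolding piece_def by blast
      have "\<phi>' f \<noteq> 0" using mp[OF bspec[OF bspec[OF g(3) p'(1)] phi'(1)] phi'(2)] p'(2) by auto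
      then have "\<phi>' \<in> pre \<sigma> W" using bspec[OF f(3) phi'(1)] by blast
      then show ?thesis using p'(1) phi'(2) by (simp add: mem_pre)
    qed
    ultimately show "\<exists>f\<in>monoid_algebra (S \<tau>). \<psi> f \<noteq> 0 \<and> (\<forall>\<psi>\<in>spec_points (S \<tau>). \<psi> f \<noteq> 0 \<longrightarrow> \<psi> \<in> pre \<tau> W)"
      by (intro bexI[OF _ g(1)] conjI ballI impI)
  qed
qed

text \<open>Likewise for regular functions; numerator and denominator are multiplied by the same power
  of \<open>m\<close>.\<close>

lemma fs_reg_in_piece:
  assumes s: "\<sigma> \<in> \<Delta>" and W: "W \<subseteq> piece \<sigma>" and op: "openin (fs_top X) W"
    and h: "(\<lambda>\<phi>. h (chart H \<Delta> \<sigma> \<phi>)) \<in> fs_reg (spec_space (S \<sigma>)) (pre \<sigma> W)"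
  shows "h \<in> fs_reg X W"
  unfolding fs_reg_X
proof
  fix \<tau> assume t: "\<tau> \<in> \<Delta>"
  have St: "submonoid (S \<tau>)" and Ss: "submonoid (S \<sigma>)" using mon t s by blast+
  obtain m where m: "m \<in> S \<tau>"
    and iff': "\<forall>\<psi>\<in>spec_points (S \<tau>). chart H \<Delta> \<tau> \<psi> \<in> piece \<sigma> \<longleftrightarrow> ev \<psi> m \<noteq> 0"
    and clear': "\<forall>f\<in>monoid_algebra (S \<sigma>). \<exists>N. \<forall>n>N. \<exists>g. clears \<sigma> \<tau> m n f g"
    by (rule chart_transition[OF s t])
  note iff = bspec[OF iff'] and clear = bspec[OF clear']
  show "(\<lambda>\<psi>. h (chart H \<Delta> \<tau> \<psi>)) \<in> fs_reg (spec_space (S \<tau>)) (pre \<tau> W)"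
    unfolding fs_reg_spec[OF St openin_pre[OF op t]]
  proof
    fix \<psi> assume "\<psi> \<in> pre \<tau> W"
    then have psi: "\<psi> \<in> spec_points (S \<tau>)" "chart H \<Delta> \<tau> \<psi> \<in> W" by (simp_all add: mem_pre)
    then have pp: "chart H \<Delta> \<tau> \<psi> \<in> piece \<sigma>" using W by blast
    then obtain \<phi> where phi: "\<phi> \<in> spec_points (S \<sigma>)" "chart H \<Delta> \<tau> \<psi> = chart H \<Delta> \<sigma> \<phi>" unfolding piece_def by blast
    have "\<phi> \<in> pre \<sigma> W" using phi psi by (simp add: mem_pre)
    from bspec[OF h[unfolded fs_reg_spec[OF Ss openin_pre[OF op s]]] this] obtain a b
      where ab: "a \<in> monoid_algebra (S \<sigma>)" "b \<in> monoid_algebra (S \<sigma>)" "\<phi> b \<noteq> 0"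
        "\<forall>\<phi>'\<in>pre \<sigma> W. \<phi>' b * h (chart H \<Delta> \<sigma> \<phi>') = \<phi>' a"
      by (elim bexE conjE)
    obtain Na where Na: "\<forall>n>Na. \<exists>g. clears \<sigma> \<tau> m n a g"
      using clear[OF ab(1)] by (elim exE)
    obtain Nb where Nb: "\<forall>n>Nb. \<exists>g. clears \<sigma> \<tau> m n b g"
      using clear[OF ab(2)] by (elim exE)
    \<comment> \<open>one exponent that serves both \<open>a\<close> and \<open>b\<close>\<close>
    define n where "n = Suc (Na + Nb)"
    have n: "Na < n" "Nb < n" by (simp_all add: n_def)
    from mp[OF spec[OF Na] n(1)] obtain a' where a': "a' \<in> monoid_algebra (S \<tau>)"
      "\<forall>\<psi>\<in>spec_points (S \<tau>). \<forall>\<phi>\<in>spec_points (S \<sigma>). chart H \<Delta> \<tau> \<psi> = chart H \<Delta> \<sigma> \<phi> \<longrightarrow> \<psi> a' = ev \<psi> m ^ n * \<phi> a"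
      unfolding clears_def by (elim exE conjE)
    from mp[OF spec[OF Nb] n(2)] obtain b' where b': "b' \<in> monoid_algebra (S \<tau>)"
      "\<forall>\<psi>\<in>spec_points (S \<tau>). \<forall>\<phi>\<in>spec_points (S \<sigma>). chart H \<Delta> \<tau> \<psi> = chart H \<Delta> \<sigma> \<phi> \<longrightarrow> \<psi> b' = ev \<psi> m ^ n * \<phi> b"
      unfolding clears_def by (elim exE conjE)
    have "\<psi> b' \<noteq> 0" using mp[OF bspec[OF bspec[OF b'(2) psi(1)] phi(1)] phi(2)] iff[OF psi(1)] pp ab(3) by simp
    moreover have "\<psi>' b' * h (chart H \<Delta> \<tau> \<psi>') = \<psi>' a'" if p': "\<psi>' \<in> pre \<tau> W" for \<psi>'
    proof -
      have q: "\<psi>' \<in> spec_points (S \<tau>)" "chart H \<Delta> \<tau> \<psi>' \<in> W" using p' by (simp_all add: mem_pre)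
      then have "chart H \<Delta> \<tau> \<psi>' \<in> piece \<sigma>" using W by blast
      then obtain \<phi>' where phi': "\<phi>' \<in> spec_points (S \<sigma>)" "chart H \<Delta> \<tau> \<psi>' = chart H \<Delta> \<sigma> \<phi>'" unfolding piece_def by blast
      have "\<phi>' \<in> pre \<sigma> W" using phi' q by (simp add: mem_pre)
      from bspec[OF ab(4) this] have "\<phi>' b * h (chart H \<Delta> \<tau> \<psi>') = \<phi>' a" using phi'(2) by simp
      moreover have "\<psi>' a' = ev \<psi>' m ^ n * \<phi>' a" "\<psi>' b' = ev \<psi>' m ^ n * \<phi>' b"
        using mp[OF bspec[OF bspec[OF a'(2) q(1)] phi'(1)] phi'(2)] mp[OF bspec[OF bspec[OF b'(2) q(1)] phi'(1)] phi'(2)]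
        by simp_all
      ultimately show ?thesis by (simp add: mult.assoc)
    qed
    ultimately show "\<exists>a\<in>monoid_algebra (S \<tau>). \<exists>b\<in>monoid_algebra (S \<tau>). \<psi> b \<noteq> 0 \<and>
        (\<forall>\<psi>\<in>pre \<tau> W. \<psi> b * h (chart H \<Delta> \<tau> \<psi>) = \<psi> a)"
      by (intro bexI[OF _ a'(1)] bexI[OF _ b'(1)] conjI ballI)
  qed
qed

lemma space_with_functions_X: "space_with_functions X"
  unfolding space_with_functions_def
proof (intro allI impI conjI ballI)
  fix W assume W: "openin (fs_top X) W"
  note op = openin_pre[OF W] and sw = swf_spec
  show "(\<lambda>_. c) \<in> fs_reg X W" for c unfolding fs_reg_X
    by (intro ballI swf_const[OF sw op])
  show "(\<lambda>x. h x + k x) \<in> fs_reg X W" if h: "h \<in> fs_reg X W" and k: "k \<in> fs_reg X W" for h k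
    unfolding fs_reg_X
    by (intro ballI swf_add[OF sw op] bspec[OF h[unfolded fs_reg_X]] bspec[OF k[unfolded fs_reg_X]])
  show "(\<lambda>x. h x * k x) \<in> fs_reg X W" if h: "h \<in> fs_reg X W" and k: "k \<in> fs_reg X W" for h k
    unfolding fs_reg_X
    by (intro ballI swf_mult[OF sw op] bspec[OF h[unfolded fs_reg_X]] bspec[OF k[unfolded fs_reg_X]])
  show "k \<in> fs_reg X W" if h: "h \<in> fs_reg X W" and k: "\<forall>x\<in>W. k x = h x" for h k
    unfolding fs_reg_X
  proof
    fix \<sigma> assume s: "\<sigma> \<in> \<Delta>"
    show "(\<lambda>\<phi>. k (chart H \<Delta> \<sigma> \<phi>)) \<in> fs_reg (spec_space (S \<sigma>)) (pre \<sigma> W)"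
      by (rule swf_cong[OF sw[OF s] op[OF s] bspec[OF h[unfolded fs_reg_X] s]]) (simp add: mem_pre k)
  qed
  show "h \<in> fs_reg X V" if h: "h \<in> fs_reg X W" and V: "openin (fs_top X) V \<and> V \<subseteq> W" for h V
    unfolding fs_reg_X
  proof
    fix \<sigma> assume s: "\<sigma> \<in> \<Delta>"
    show "(\<lambda>\<phi>. h (chart H \<Delta> \<sigma> \<phi>)) \<in> fs_reg (spec_space (S \<sigma>)) (pre \<sigma> V)"
      by (rule swf_restrict[OF sw[OF s] op[OF s] bspec[OF h[unfolded fs_reg_X] s] openin_pre[OF conjunct1[OF V] s]])
        (use V in \<open>auto simp: mem_pre\<close>)
  qed
  show "h \<in> fs_reg X W"
    if loc: "\<forall>x\<in>W. \<exists>V. openin (fs_top X) V \<and> x \<in> V \<and> V \<subseteq> W \<and> h \<in> fs_reg X V" for h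
    unfolding fs_reg_X
  proof
    fix \<sigma> assume s: "\<sigma> \<in> \<Delta>"
    show "(\<lambda>\<phi>. h (chart H \<Delta> \<sigma> \<phi>)) \<in> fs_reg (spec_space (S \<sigma>)) (pre \<sigma> W)"
    proof (rule swf_local[OF sw[OF s] op[OF s]])
      fix \<phi> assume phi: "\<phi> \<in> pre \<sigma> W"
      then have "chart H \<Delta> \<sigma> \<phi> \<in> W" by (simp add: mem_pre)
      from bspec[OF loc this] obtain V where V: "openin (fs_top X) V" "chart H \<Delta> \<sigma> \<phi> \<in> V" "V \<subseteq> W" "h \<in> fs_reg X V"
        by (elim exE conjE)
      show "\<exists>V. openin (fs_top (spec_space (S \<sigma>))) V \<and> \<phi> \<in> V \<and> V \<subseteq> pre \<sigma> W \<and>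
          (\<lambda>\<phi>. h (chart H \<Delta> \<sigma> \<phi>)) \<in> fs_reg (spec_space (S \<sigma>)) V"
      proof (intro exI[of _ "pre \<sigma> V"] conjI)
        show "openin (fs_top (spec_space (S \<sigma>))) (pre \<sigma> V)" by (rule openin_pre[OF V(1) s])
        show "\<phi> \<in> pre \<sigma> V" using phi V(2) by (simp add: mem_pre)
        show "pre \<sigma> V \<subseteq> pre \<sigma> W" using V(3) by (auto simp: mem_pre)
        show "(\<lambda>\<phi>. h (chart H \<Delta> \<sigma> \<phi>)) \<in> fs_reg (spec_space (S \<sigma>)) (pre \<sigma> V)"
          by (rule bspec[OF V(4)[unfolded fs_reg_X] s])
      qed
    qed
  qed
qed

lemma pre_piece: "pre \<sigma> (piece \<sigma>) = spec_points (S \<sigma>)"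
  using chart_mem by (auto simp: mem_pre)

lemma openin_piece: "\<sigma> \<in> \<Delta> \<Longrightarrow> openin (fs_top X) (piece \<sigma>)"
proof (rule openin_in_piece)
  assume s: "\<sigma> \<in> \<Delta>"
  show "openin (fs_top (spec_space (S \<sigma>))) (pre \<sigma> (piece \<sigma>))"
    using openin_topspace[of "fs_top (spec_space (S \<sigma>))"]
    unfolding pre_piece pts_spec[OF mon[OF s order_refl]] .
qed simp_all

lemma isomorphic_piece:
  assumes s: "\<sigma> \<in> \<Delta>"
  shows "isomorphic (open_sub X (piece \<sigma>)) (spec_space (S \<sigma>))"
proof -
  let ?c = "chart H \<Delta> \<sigma>" and ?P = "spec_points (S \<sigma>)"
  have Ss: "submonoid (S \<sigma>)" using mon[OF s] by blast
  have inj: "inj_on ?c ?P" by (rule inj_onI) (rule chart_inj[OF s])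
  define i where "i = inv_into ?P ?c"
  have ic: "i (?c \<phi>) = \<phi>" if "\<phi> \<in> ?P" for \<phi> unfolding i_def by (rule inv_into_f_f[OF inj that])
  have ci: "?c (i x) = x" "i x \<in> ?P" if "x \<in> piece \<sigma>" for x
    using that ic unfolding piece_def by auto
  note pO = pts_open_sub[OF openin_piece[OF s]] and oO = openin_open_sub[OF openin_piece[OF s]]
    and pS = pts_spec[OF Ss]
  have "morphism (open_sub X (piece \<sigma>)) (spec_space (S \<sigma>)) i"
  proof (rule morphismI)
    show "i x \<in> pts (spec_space (S \<sigma>))" if "x \<in> pts (open_sub X (piece \<sigma>))" for x
      using that ci by (simp add: pO pS)
    fix V assume V: "openin (fs_top (spec_space (S \<sigma>))) V"
    have VP: "V \<subseteq> ?P" using openin_subset[OF V] by (simp add: pS)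
    let ?W = "{x \<in> pts (open_sub X (piece \<sigma>)). i x \<in> V}"
    have W: "?W \<subseteq> piece \<sigma>" by (auto simp: pO)
    have "\<phi> \<in> pre \<sigma> ?W \<longleftrightarrow> \<phi> \<in> V" for \<phi>
      using VP ic[of \<phi>] chart_mem[of \<phi> \<sigma>] by (cases "\<phi> \<in> ?P") (auto simp: mem_pre pO)
    then have preW: "pre \<sigma> ?W = V" by blast
    have opW: "openin (fs_top X) ?W" by (rule openin_in_piece[OF s W]) (simp add: preW V)
    then show "openin (fs_top (open_sub X (piece \<sigma>))) ?W" unfolding oO using W by blast
    fix h assume h: "h \<in> fs_reg (spec_space (S \<sigma>)) V"
    show "(\<lambda>x. h (i x)) \<in> fs_reg (open_sub X (piece \<sigma>)) ?W" unfolding fs_reg_open_sub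
    proof (rule fs_reg_in_piece[OF s W opW], unfold preW)
      show "(\<lambda>\<phi>. h (i (?c \<phi>))) \<in> fs_reg (spec_space (S \<sigma>)) V"
        by (rule swf_cong[OF swf_spec[OF s] V h]) (use VP ic in auto)
    qed
  qed
  moreover have "morphism (spec_space (S \<sigma>)) (open_sub X (piece \<sigma>)) ?c"
  proof (rule morphismI)
    show "?c \<phi> \<in> pts (open_sub X (piece \<sigma>))" if "\<phi> \<in> pts (spec_space (S \<sigma>))" for \<phi>
      using that chart_mem by (simp add: pO pS)
    fix V assume "openin (fs_top (open_sub X (piece \<sigma>))) V"
    then have V: "openin (fs_top X) V" unfolding oO by blast
    have eq: "{\<phi> \<in> pts (spec_space (S \<sigma>)). ?c \<phi> \<in> V} = pre \<sigma> V" by (auto simp: mem_pre pS)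
    show "openin (fs_top (spec_space (S \<sigma>))) {\<phi> \<in> pts (spec_space (S \<sigma>)). ?c \<phi> \<in> V}"
      unfolding eq by (rule openin_pre[OF V s])
    fix h assume "h \<in> fs_reg (open_sub X (piece \<sigma>)) V"
    then have h: "h \<in> fs_reg X V" unfolding fs_reg_open_sub .
    show "(\<lambda>\<phi>. h (?c \<phi>)) \<in> fs_reg (spec_space (S \<sigma>)) {\<phi> \<in> pts (spec_space (S \<sigma>)). ?c \<phi> \<in> V}"
      unfolding eq by (rule bspec[OF h[unfolded fs_reg_X] s])
  qed
  ultimately show ?thesis unfolding isomorphic_def pO pS
    using ic ci by (intro exI[of _ i] exI[of _ ?c]) simp
qed

lemma affine_variety_piece:
  assumes s: "\<sigma> \<in> \<Delta>"
  shows "affine_variety (open_sub X (piece \<sigma>))"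
proof -
  obtain n :: nat and g where g: "\<And>i. i < n \<Longrightarrow> g i \<in> S \<sigma>"
    "\<And>m. m \<in> S \<sigma> \<Longrightarrow> \<exists>c :: nat \<Rightarrow> nat. m = (\<Sum>i<n. zmul (int (c i)) (g i))"
    by (rule gordan[OF lattice sub rat[OF s]]) blast
  have "submonoid (S \<sigma>)" using mon[OF s] by blast
  from affine_variety_isomorphic[OF isomorphic_piece[OF s] affine_variety_spec[OF this g]]
  show ?thesis .
qed

text \<open>The intersections of \<open>W\<close> with the pieces of \<open>\<Delta>'\<close> cover it, and each of them is governed by a single
  chart; so the other charts need not be tested.\<close>

lemma openin_by_pieces:
  assumes D: "\<Delta>' \<subseteq> \<Delta>" and W: "W \<subseteq> (\<Union>\<sigma>\<in>\<Delta>'. piece \<sigma>)"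
    and op: "\<And>\<sigma>. \<sigma> \<in> \<Delta>' \<Longrightarrow> openin (fs_top (spec_space (S \<sigma>))) (pre \<sigma> W)"
  shows "openin (fs_top X) W"
proof -
  have "openin (fs_top X) (W \<inter> piece \<sigma>)" if s: "\<sigma> \<in> \<Delta>'" for \<sigma>
  proof (rule openin_in_piece)
    show "\<sigma> \<in> \<Delta>" using D s by blast
    have "pre \<sigma> (W \<inter> piece \<sigma>) = pre \<sigma> W" using chart_mem by (auto simp: mem_pre)
    then show "openin (fs_top (spec_space (S \<sigma>))) (pre \<sigma> (W \<inter> piece \<sigma>))" using op[OF s] by simp
  qed blast
  then have "openin (fs_top X) (\<Union>\<sigma>\<in>\<Delta>'. W \<inter> piece \<sigma>)" by blast
  moreover have "(\<Union>\<sigma>\<in>\<Delta>'. W \<inter> piece \<sigma>) = W" using W by blast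
  ultimately show ?thesis by simp
qed

lemma fs_reg_by_pieces:
  assumes D: "\<Delta>' \<subseteq> \<Delta>" and W: "W \<subseteq> (\<Union>\<sigma>\<in>\<Delta>'. piece \<sigma>)" and op: "openin (fs_top X) W"
    and h: "\<And>\<sigma>. \<sigma> \<in> \<Delta>' \<Longrightarrow> (\<lambda>\<phi>. h (chart H \<Delta> \<sigma> \<phi>)) \<in> fs_reg (spec_space (S \<sigma>)) (pre \<sigma> W)"
  shows "h \<in> fs_reg X W"
proof (rule swf_local[OF space_with_functions_X op])
  fix x assume x: "x \<in> W"
  then obtain \<sigma> where s: "\<sigma> \<in> \<Delta>'" "x \<in> piece \<sigma>" using W by blast
  have sD: "\<sigma> \<in> \<Delta>" using D s by blast
  have opp: "openin (fs_top X) (W \<inter> piece \<sigma>)" using op openin_piece[OF sD] by blast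
  have "pre \<sigma> (W \<inter> piece \<sigma>) = pre \<sigma> W" using chart_mem by (auto simp: mem_pre)
  then have "h \<in> fs_reg X (W \<inter> piece \<sigma>)"
    using h[OF s(1)] by (intro fs_reg_in_piece[OF sD _ opp]) auto
  then show "\<exists>V. openin (fs_top X) V \<and> x \<in> V \<and> V \<subseteq> W \<and> h \<in> fs_reg X V"
    using opp x s(2) by (intro exI[of _ "W \<inter> piece \<sigma>"]) simp
qed

lemma prevariety_by_pieces:
  assumes D: "\<Delta>' \<subseteq> \<Delta>"
  shows "openin (fs_top X) (\<Union>\<sigma>\<in>\<Delta>'. piece \<sigma>)" "prevariety (open_sub X (\<Union>\<sigma>\<in>\<Delta>'. piece \<sigma>))"
proof -
  show op: "openin (fs_top X) (\<Union>\<sigma>\<in>\<Delta>'. piece \<sigma>)" using D openin_piece by blast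
  show "prevariety (open_sub X (\<Union>\<sigma>\<in>\<Delta>'. piece \<sigma>))"
    unfolding prevariety_def pts_open_sub[OF op]
  proof (intro conjI exI[of _ "piece ` \<Delta>'"] ballI space_with_functions_open_sub space_with_functions_X op)
    show "finite (piece ` \<Delta>')" using finite_subset[OF D fin] by simp
    fix W assume "W \<in> piece ` \<Delta>'"
    then obtain \<sigma> where s: "\<sigma> \<in> \<Delta>'" "W = piece \<sigma>" by blast
    have sD: "\<sigma> \<in> \<Delta>" using D s by blast
    have sub: "piece \<sigma> \<subseteq> (\<Union>\<sigma>\<in>\<Delta>'. piece \<sigma>)" using s by blast
    show "openin (fs_top (open_sub X (\<Union>\<sigma>\<in>\<Delta>'. piece \<sigma>))) W"
      unfolding openin_open_sub[OF op] s(2) using openin_piece[OF sD] sub by blast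
    show "affine_variety (open_sub (open_sub X (\<Union>\<sigma>\<in>\<Delta>'. piece \<sigma>)) W)"
      unfolding s(2) open_sub_open_sub[OF sub] by (rule affine_variety_piece[OF sD])
  qed simp
qed

lemma prevariety_X: "prevariety X"
proof -
  have "open_sub X (\<Union>\<sigma>\<in>\<Delta>. piece \<sigma>) = X"
    unfolding open_sub_def pts_X[symmetric] by (simp add: subtopology_topspace)
  then show ?thesis using prevariety_by_pieces(2)[of \<Delta>] by simp
qed

end

section \<open>The quotient morphism\<close>

lemma restrict_twist:
  assumes "\<And>a. t a \<noteq> 0"
  shows "restrict_point S (\<lambda>f. \<omega> (twist t f)) = (\<lambda>f. restrict_point S \<omega> (twist t f))"
  by (simp add: restrict_point_def monoid_algebra_def keys_twist assms)

lemma twist_inverse: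
  assumes "\<And>a. t a \<noteq> 0"
  shows "twist t (twist (\<lambda>a. inverse (t a)) f) = f" "twist (\<lambda>a. inverse (t a)) (twist t f) = f"
  using assms by (auto intro!: poly_mapping_eqI simp: lookup_twist)

lemma torus_inverse: "t \<in> torus M \<Longrightarrow> (\<lambda>a. inverse (t a)) \<in> torus M"
  by (simp add: torus_def)

lemma (in toric_gluing) torus_act_chart:
  assumes s: "\<sigma> \<in> \<Delta>" and phi: "\<phi> \<in> spec_points (S \<sigma>)" and t: "t \<in> torus H"
  shows "torus_act t (chart H \<Delta> \<sigma> \<phi>) = chart H \<Delta> \<sigma> (\<lambda>f. \<phi> (twist t f))"
proof -
  have SH: "S \<tau> \<subseteq> H" for \<tau> by (auto simp: cone_monoid_def)
  have act: "((\<sigma>, \<lambda>f. \<phi> (twist t f)), (\<tau>, \<lambda>f. \<psi> (twist t f))) \<in> glue_rel H \<Delta>"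
    if r: "((\<sigma>, \<phi>), (\<tau>, \<psi>)) \<in> glue_rel H \<Delta>" and t: "t \<in> torus H" for \<phi> \<tau> \<psi> t
  proof -
    have D: "\<sigma> \<in> \<Delta>" "\<tau> \<in> \<Delta>" "\<phi> \<in> spec_points (S \<sigma>)" "\<psi> \<in> spec_points (S \<tau>)"
      using r unfolding glue_rel_iff by simp_all
    obtain \<omega> where w: "\<omega> \<in> spec_points (S (\<sigma> \<inter> \<tau>))" "\<phi> = restrict_point (S \<sigma>) \<omega>" "\<psi> = restrict_point (S \<tau>) \<omega>"
      using r unfolding glue_rel_iff by (elim conjE bexE)
    note nz = torus_nonzero[OF t]
    have "(\<lambda>f. \<omega> (twist t f)) \<in> spec_points (S (\<sigma> \<inter> \<tau>))"
      by (rule twist_spec[OF w(1) mon[OF D(1) Int_lower1] SH t])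
    moreover have "(\<lambda>f. \<phi> (twist t f)) \<in> spec_points (S \<sigma>)" "(\<lambda>f. \<psi> (twist t f)) \<in> spec_points (S \<tau>)"
      by (rule twist_spec[OF D(3) mon[OF D(1) order_refl] SH t] twist_spec[OF D(4) mon[OF D(2) order_refl] SH t])+
    ultimately show ?thesis unfolding glue_rel_iff using D(1,2) restrict_twist[OF nz, of _ \<omega>] w(2,3)
      by (intro conjI bexI[of _ "\<lambda>f. \<omega> (twist t f)"]) simp_all
  qed
  show ?thesis
  proof (intro equalityI subsetI)
    fix y assume "y \<in> torus_act t (chart H \<Delta> \<sigma> \<phi>)"
    then obtain \<tau> \<psi> where "y = (\<tau>, \<lambda>f. \<psi> (twist t f))" "((\<sigma>, \<phi>), (\<tau>, \<psi>)) \<in> glue_rel H \<Delta>"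
      unfolding torus_act_def chart_def by auto
    then show "y \<in> chart H \<Delta> \<sigma> (\<lambda>f. \<phi> (twist t f))" using act[OF _ t] by (simp add: chart_def)
  next
    fix y assume y: "y \<in> chart H \<Delta> \<sigma> (\<lambda>f. \<phi> (twist t f))"
    obtain \<tau> \<psi> where e: "y = (\<tau>, \<psi>)" by (cases y)
    have "((\<sigma>, \<lambda>f. \<phi> (twist t f)), (\<tau>, \<psi>)) \<in> glue_rel H \<Delta>" using y by (simp add: chart_def e)
    from act[OF this torus_inverse[OF t]]
    have "(\<tau>, \<lambda>f. \<psi> (twist (\<lambda>a. inverse (t a)) f)) \<in> chart H \<Delta> \<sigma> \<phi>"
      by (simp add: twist_inverse(1)[OF torus_nonzero[OF t]] chart_def)
    moreover have "y = (\<lambda>(\<sigma>, \<phi>). (\<sigma>, \<lambda>f. \<phi> (twist t f))) (\<tau>, \<lambda>f. \<psi> (twist (\<lambda>a. inverse (t a)) f))"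
      by (simp add: e twist_inverse(2)[OF torus_nonzero[OF t]])
    ultimately show "y \<in> torus_act t (chart H \<Delta> \<sigma> \<phi>)" unfolding torus_act_def by (rule rev_image_eqI)
  qed
qed

locale toric_quotient =
  fixes M L :: "'m::ab_group_add set" and \<Delta>\<^sub>0 \<Delta> :: "('m \<Rightarrow> real) set set"
  assumes lattice: "lattice_set M" and sub: "sublattice L M" and fan: "fan M \<Delta>\<^sub>0"
    and \<Delta>: "\<Delta> \<subseteq> \<Delta>\<^sub>0" and costring: "locally_coherent_costring M L \<Delta>\<^sub>0 \<Delta>"

sublocale toric_quotient \<subseteq> src: toric_gluing M M "\<Delta>\<^sub>0"
  using lattice lattice_sublattice_self[OF lattice] fan
  by (intro toric_gluing_generalized_fan) (simp_all add: fan_def)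

sublocale toric_quotient \<subseteq> tgt: toric_gluing M L "image_cones L \<Delta>"
  using lattice sub costring
  by (intro toric_gluing_generalized_fan) (simp_all add: locally_coherent_costring_def)

context toric_quotient
begin

abbreviation \<pi> :: "('m \<Rightarrow> real) set \<Rightarrow> ('m \<Rightarrow> real) set" where
  "\<pi> \<sigma> \<equiv> dual_proj L ` \<sigma>"

abbreviation U :: "'m toric_point set" where
  "U \<equiv> chart_union M \<Delta>\<^sub>0 \<Delta>"

abbreviation X :: "'m toric_point fspace" where
  "X \<equiv> open_sub (toric_variety M \<Delta>\<^sub>0) U"

abbreviation Y :: "'m toric_point fspace" where
  "Y \<equiv> toric_variety L (image_cones L \<Delta>)"

abbreviation G :: "('m \<Rightarrow> complex) set" where
  "G \<equiv> quotient_group M L"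

abbreviation ch :: "('m \<Rightarrow> real) set \<Rightarrow> 'm alg_point \<Rightarrow> 'm toric_point" where
  "ch \<equiv> chart M \<Delta>\<^sub>0"

abbreviation ch' :: "('m \<Rightarrow> real) set \<Rightarrow> 'm alg_point \<Rightarrow> 'm toric_point" where
  "ch' \<equiv> chart L (image_cones L \<Delta>)"

abbreviation S :: "('m \<Rightarrow> real) set \<Rightarrow> 'm set" where
  "S \<equiv> cone_monoid M"

lemma in0: "\<sigma> \<in> \<Delta> \<Longrightarrow> \<sigma> \<in> \<Delta>\<^sub>0"
  using \<Delta> by blast

lemma img: "\<sigma> \<in> \<Delta> \<Longrightarrow> \<pi> \<sigma> \<in> image_cones L \<Delta>"
  by (simp add: image_cones_def)

lemma LM: "L \<subseteq> M"
  by (rule sublattice_subset[OF sub])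

lemma dual_proj_apply: "m \<in> L \<Longrightarrow> dual_proj L u m = u m"
  by (simp add: dual_proj_def)

lemma cone_monoid_image: "cone_monoid L (\<pi> \<sigma>) = S \<sigma> \<inter> L"
  using LM by (auto simp: cone_monoid_def dual_proj_def)

lemma monS: "\<sigma> \<in> \<Delta> \<Longrightarrow> submonoid (S \<sigma>)"
  by (rule src.mon[OF in0 order_refl])

lemma SM: "S \<sigma> \<subseteq> M"
  by (auto simp: cone_monoid_def)

lemma monSL: "\<sigma> \<in> \<Delta> \<Longrightarrow> submonoid (S \<sigma> \<inter> L)"
  using tgt.mon[OF img order_refl] unfolding cone_monoid_image .

lemma quotient: "\<sigma> \<in> \<Delta> \<Longrightarrow> monoid_quotient M L (S \<sigma>)"
  using lattice sub monS SM by unfold_locales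

lemma U_eq: "U = (\<Union>\<sigma>\<in>\<Delta>. src.piece \<sigma>)"
  by (simp add: chart_union_def src.piece_def)

lemma openU: "openin (fs_top (toric_variety M \<Delta>\<^sub>0)) U"
  unfolding U_eq by (rule src.prevariety_by_pieces(1)[OF \<Delta>])

lemma prevariety_X: "prevariety X"
  unfolding U_eq by (rule src.prevariety_by_pieces(2)[OF \<Delta>])

lemma swf_X: "space_with_functions X" and swf_Y: "space_with_functions Y"
  using prevariety_X tgt.prevariety_X by (simp_all add: prevariety_def)

lemma pts_X: "pts X = U"
  by (rule pts_open_sub[OF openU])

lemma pts_Y: "pts Y = (\<Union>\<sigma>\<in>\<Delta>. tgt.piece (\<pi> \<sigma>))"
  unfolding tgt.pts_X by (simp add: image_cones_def)

lemma chU: "\<sigma> \<in> \<Delta> \<Longrightarrow> \<phi> \<in> spec_points (S \<sigma>) \<Longrightarrow> ch \<sigma> \<phi> \<in> U"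
  unfolding U_eq using src.chart_mem by blast

lemma U_cases:
  assumes "x \<in> U"
  obtains \<sigma> \<phi> where "\<sigma> \<in> \<Delta>" "\<phi> \<in> spec_points (S \<sigma>)" "x = ch \<sigma> \<phi>"
  using assms unfolding chart_union_def by blast

lemma openin_U:
  assumes "W \<subseteq> U" "\<And>\<sigma>. \<sigma> \<in> \<Delta> \<Longrightarrow> openin (fs_top (spec_space (S \<sigma>))) (src.pre \<sigma> W)"
  shows "openin (fs_top X) W"
  unfolding openin_open_sub[OF openU]
  using src.openin_by_pieces[OF \<Delta>, of W] assms unfolding U_eq by blast

lemma openin_U_pre:
  "openin (fs_top X) W \<Longrightarrow> \<sigma> \<in> \<Delta> \<Longrightarrow> openin (fs_top (spec_space (S \<sigma>))) (src.pre \<sigma> W)"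
  unfolding openin_open_sub[OF openU] using src.openin_pre[OF _ in0] by blast

lemma fs_reg_U:
  assumes "openin (fs_top X) W"
    "\<And>\<sigma>. \<sigma> \<in> \<Delta> \<Longrightarrow> (\<lambda>\<phi>. h (ch \<sigma> \<phi>)) \<in> fs_reg (spec_space (S \<sigma>)) (src.pre \<sigma> W)"
  shows "h \<in> fs_reg X W"
  unfolding fs_reg_open_sub
proof (rule src.fs_reg_by_pieces[OF \<Delta>])
  have "openin (fs_top (toric_variety M \<Delta>\<^sub>0)) W \<and> W \<subseteq> U" using assms(1) unfolding openin_open_sub[OF openU] .
  then show "openin (fs_top (toric_variety M \<Delta>\<^sub>0)) W" "W \<subseteq> (\<Union>\<sigma>\<in>\<Delta>. src.piece \<sigma>)" unfolding U_eq by simp_all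
qed (rule assms(2))

lemma fs_reg_U_pre:
  "h \<in> fs_reg X W \<Longrightarrow> \<sigma> \<in> \<Delta> \<Longrightarrow> (\<lambda>\<phi>. h (ch \<sigma> \<phi>)) \<in> fs_reg (spec_space (S \<sigma>)) (src.pre \<sigma> W)"
  unfolding fs_reg_open_sub src.fs_reg_X using in0 by blast

text \<open>Coherence makes \<open>\<pi>\<close> compatible with intersections: the common face \<open>\<pi> \<sigma> \<inter> \<pi> \<sigma>'\<close> is
  \<open>\<pi> \<rho>\<close> for a member \<open>\<rho>\<close>, which is the part of \<open>\<sigma>\<close> and also the part of \<open>\<sigma>'\<close> above it. Hence
  \<open>\<rho> = \<sigma> \<inter> \<sigma>'\<close>, and a point of \<open>L\<close> that cuts out the face of \<open>\<pi> \<sigma>'\<close> also cuts out the face of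
  \<open>\<sigma>'\<close>.\<close>

lemma coherent_meet:
  assumes s: "\<sigma> \<in> \<Delta>" "\<sigma>' \<in> \<Delta>"
  obtains m where "m \<in> S \<sigma>'" "m \<in> L" "\<pi> \<sigma> \<inter> \<pi> \<sigma>' = {v \<in> \<pi> \<sigma>'. v m = 0}" "\<sigma> \<inter> \<sigma>' = {u \<in> \<sigma>'. u m = 0}"
proof -
  have gf: "generalized_fan L (image_cones L \<Delta>)" using costring by (simp add: locally_coherent_costring_def)
  have "cone_face L (\<pi> \<sigma> \<inter> \<pi> \<sigma>') (\<pi> \<sigma>)" using gf img[OF s(1)] img[OF s(2)] by (simp add: generalized_fan_def)
  then have "\<pi> \<sigma> \<inter> \<pi> \<sigma>' \<in> image_cones L \<Delta>" using gf img[OF s(1)] by (simp add: generalized_fan_def)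
  then obtain \<rho> where r: "\<rho> \<in> \<Delta>" "\<pi> \<sigma> \<inter> \<pi> \<sigma>' = \<pi> \<rho>" by (auto simp: image_cones_def)
  have coh: "\<rho> = {u \<in> N_real M. dual_proj L u \<in> \<pi> \<rho>} \<inter> \<tau>" if "\<tau> \<in> \<Delta>" "\<pi> \<rho> \<subseteq> \<pi> \<tau>" for \<tau>
    using costring r(1) that by (simp add: locally_coherent_costring_def)
  have "\<pi> \<rho> \<subseteq> \<pi> \<sigma>" "\<pi> \<rho> \<subseteq> \<pi> \<sigma>'" using r(2) by (metis Int_lower1, metis Int_lower2)
  then have rs: "\<rho> = {u \<in> N_real M. dual_proj L u \<in> \<pi> \<rho>} \<inter> \<sigma>" "\<rho> = {u \<in> N_real M. dual_proj L u \<in> \<pi> \<rho>} \<inter> \<sigma>'"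
    using coh s by simp_all
  have N: "\<sigma>' \<subseteq> N_real M" by (rule rational_cone_subset[OF src.rat[OF in0[OF s(2)]]])
  obtain m where m: "m \<in> cone_monoid L (\<pi> \<sigma>')" "\<pi> \<sigma> \<inter> \<pi> \<sigma>' = {v \<in> \<pi> \<sigma>'. v m = 0}"
    using tgt.meet[OF img[OF s(1)] img[OF s(2)]] by (elim bexE)
  have mL: "m \<in> S \<sigma>'" "m \<in> L" using m(1) unfolding cone_monoid_image by blast+
  have "u \<in> \<sigma> \<longleftrightarrow> u m = 0" if u: "u \<in> \<sigma>'" for u
  proof -
    have "u m = 0 \<longleftrightarrow> dual_proj L u \<in> \<pi> \<sigma> \<inter> \<pi> \<sigma>'"
      unfolding m(2) using u mL(2) by (simp add: dual_proj_apply)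
    also have "\<dots> \<longleftrightarrow> u \<in> \<rho>" unfolding r(2) using rs(2) u N by blast
    also have "\<dots> \<longleftrightarrow> u \<in> \<sigma>"
    proof
      show "u \<in> \<sigma>" if "u \<in> \<rho>" using that rs(1) by blast
      show "u \<in> \<rho>" if "u \<in> \<sigma>"
      proof -
        have "dual_proj L u \<in> \<pi> \<rho>" unfolding r(2)[symmetric] using that u by blast
        then show ?thesis using rs(2) u N by blast
      qed
    qed
    finally show ?thesis ..
  qed
  then have "\<sigma> \<inter> \<sigma>' = {u \<in> \<sigma>'. u m = 0}" by blast
  with mL m(2) show thesis by (rule that)
qed

text \<open>The quotient map on the chart of \<open>\<sigma>\<close>.\<close>

definition res :: "('m \<Rightarrow> real) set \<Rightarrow> 'm alg_point \<Rightarrow> 'm alg_point" where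
  "res \<sigma> = restrict_point (S \<sigma> \<inter> L)"

lemma res_spec: "\<sigma> \<in> \<Delta> \<Longrightarrow> \<phi> \<in> spec_points (S \<sigma>) \<Longrightarrow> res \<sigma> \<phi> \<in> spec_points (S \<sigma> \<inter> L)"
  unfolding res_def by (rule restrict_spec[OF monSL]) auto

lemma res_apply: "f \<in> monoid_algebra (S \<sigma> \<inter> L) \<Longrightarrow> res \<sigma> \<phi> f = \<phi> f"
  unfolding res_def by (rule restrict_apply)

lemma res_image_spec: "\<sigma> \<in> \<Delta> \<Longrightarrow> \<phi> \<in> spec_points (S \<sigma>) \<Longrightarrow> res \<sigma> \<phi> \<in> spec_points (cone_monoid L (\<pi> \<sigma>))"
  unfolding cone_monoid_image by (rule res_spec)

lemma res_lift:
  assumes "\<sigma> \<in> \<Delta>" "\<psi> \<in> spec_points (S \<sigma> \<inter> L)"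
  obtains \<phi> where "monoid_quotient.polystable L (S \<sigma>) \<phi>" "\<phi> \<in> spec_points (S \<sigma>)" "res \<sigma> \<phi> = \<psi>"
proof -
  interpret q: monoid_quotient M L "S \<sigma>" by (rule quotient[OF assms(1)])
  obtain \<phi> where "q.polystable \<phi>" "restrict_point (S \<sigma> \<inter> L) \<phi> = \<psi>" by (rule q.polystable_lift[OF assms(2)])
  then show thesis by (intro that) (simp_all add: res_def q.polystable_def)
qed

lemma res_twist:
  assumes s: "\<sigma> \<in> \<Delta>" and phi: "\<phi> \<in> spec_points (S \<sigma>)" and t: "t \<in> G"
  shows "res \<sigma> (\<lambda>f. \<phi> (twist t f)) = res \<sigma> \<phi>"
proof -
  have tT: "t \<in> torus M" and tL: "\<And>a. a \<in> L \<Longrightarrow> t a = 1" using t by (simp_all add: quotient_group_def)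
  have tw: "(\<lambda>f. \<phi> (twist t f)) \<in> spec_points (S \<sigma>)" by (rule twist_spec[OF phi monS[OF s] SM tT])
  show ?thesis
  proof (rule spec_eqI[OF res_spec[OF s tw] res_spec[OF s phi] monSL[OF s]])
    fix m assume m: "m \<in> S \<sigma> \<inter> L"
    then show "ev (res \<sigma> (\<lambda>f. \<phi> (twist t f))) m = ev (res \<sigma> \<phi>) m"
      unfolding res_def ev_restrict[OF m]
      using ev_twist[OF phi monS[OF s] SM tT, of m] tL[of m] by simp
  qed
qed

text \<open>A point lies in several charts; the choice is harmless by the next lemma.\<close>

definition quot :: "'m toric_point \<Rightarrow> 'm toric_point" where
  "quot x = (SOME y. \<exists>\<sigma>\<in>\<Delta>. \<exists>\<phi>\<in>spec_points (S \<sigma>). x = ch \<sigma> \<phi> \<and> y = ch' (\<pi> \<sigma>) (res \<sigma> \<phi>))"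

lemma quot_well_defined:
  assumes s: "\<sigma> \<in> \<Delta>" "\<sigma>' \<in> \<Delta>" and phi: "\<phi> \<in> spec_points (S \<sigma>)" "\<phi>' \<in> spec_points (S \<sigma>')"
    and eq: "ch \<sigma> \<phi> = ch \<sigma>' \<phi>'"
  shows "ch' (\<pi> \<sigma>) (res \<sigma> \<phi>) = ch' (\<pi> \<sigma>') (res \<sigma>' \<phi>')"
proof -
  obtain \<omega> where w: "\<omega> \<in> spec_points (S (\<sigma> \<inter> \<sigma>'))" "\<phi> = restrict_point (S \<sigma>) \<omega>" "\<phi>' = restrict_point (S \<sigma>') \<omega>"
    using eq unfolding src.chart_eq_iff[OF in0[OF s(1)] in0[OF s(2)] phi] by (elim bexE conjE)
  let ?T = "cone_monoid L (\<pi> \<sigma> \<inter> \<pi> \<sigma>')"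
  have T: "?T \<subseteq> S (\<sigma> \<inter> \<sigma>')"
  proof
    fix m assume "m \<in> ?T"
    then have m: "m \<in> L" "\<forall>v\<in>\<pi> \<sigma> \<inter> \<pi> \<sigma>'. 0 \<le> v m" by (simp_all add: cone_monoid_def)
    have "0 \<le> u m" if "u \<in> \<sigma> \<inter> \<sigma>'" for u
    proof -
      have "dual_proj L u \<in> \<pi> \<sigma> \<inter> \<pi> \<sigma>'" using that by blast
      from bspec[OF m(2) this] show ?thesis by (simp add: dual_proj_apply[OF m(1)])
    qed
    then show "m \<in> S (\<sigma> \<inter> \<sigma>')" using m(1) LM by (auto simp: cone_monoid_def)
  qed
  have mT: "submonoid ?T" by (rule tgt.mon[OF img[OF s(1)]]) blast
  have sub': "S \<sigma> \<inter> L \<subseteq> ?T" "S \<sigma>' \<inter> L \<subseteq> ?T"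
    unfolding cone_monoid_image[symmetric] by (rule tgt.S_mono, blast)+
  have "res \<sigma> \<phi> = restrict_point (S \<sigma> \<inter> L) (restrict_point ?T \<omega>)"
    "res \<sigma>' \<phi>' = restrict_point (S \<sigma>' \<inter> L) (restrict_point ?T \<omega>)"
    unfolding res_def w(2,3) restrict_restrict[OF Int_lower1] restrict_restrict[OF sub'(1)] restrict_restrict[OF sub'(2)]
    by (rule refl)+
  then show ?thesis
    unfolding tgt.chart_eq_iff[OF img[OF s(1)] img[OF s(2)] res_image_spec[OF s(1) phi(1)] res_image_spec[OF s(2) phi(2)]]
    using restrict_spec[OF mT T w(1)] unfolding cone_monoid_image by (rule_tac bexI) (rule conjI)
qed

lemma quot_chart:
  assumes "\<sigma> \<in> \<Delta>" "\<phi> \<in> spec_points (S \<sigma>)"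
  shows "quot (ch \<sigma> \<phi>) = ch' (\<pi> \<sigma>) (res \<sigma> \<phi>)"
  unfolding quot_def
proof (rule someI2_ex)
  show "\<exists>y. \<exists>\<sigma>'\<in>\<Delta>. \<exists>\<phi>'\<in>spec_points (S \<sigma>'). ch \<sigma> \<phi> = ch \<sigma>' \<phi>' \<and> y = ch' (\<pi> \<sigma>') (res \<sigma>' \<phi>')"
    using assms by blast
  fix y assume "\<exists>\<sigma>'\<in>\<Delta>. \<exists>\<phi>'\<in>spec_points (S \<sigma>'). ch \<sigma> \<phi> = ch \<sigma>' \<phi>' \<and> y = ch' (\<pi> \<sigma>') (res \<sigma>' \<phi>')"
  then obtain \<sigma>' \<phi>' where *: "\<sigma>' \<in> \<Delta>" "\<phi>' \<in> spec_points (S \<sigma>')" "ch \<sigma> \<phi> = ch \<sigma>' \<phi>'" "y = ch' (\<pi> \<sigma>') (res \<sigma>' \<phi>')"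
    by (elim bexE conjE)
  show "y = ch' (\<pi> \<sigma>) (res \<sigma> \<phi>)" unfolding *(4) by (rule quot_well_defined[OF assms(1) *(1) assms(2) *(2,3), symmetric])
qed

lemma quot_eq_iff:
  assumes "\<sigma> \<in> \<Delta>" "\<phi> \<in> spec_points (S \<sigma>)" "\<psi> \<in> spec_points (S \<sigma>)"
  shows "quot (ch \<sigma> \<phi>) = quot (ch \<sigma> \<psi>) \<longleftrightarrow> res \<sigma> \<phi> = res \<sigma> \<psi>"
  unfolding quot_chart[OF assms(1,2)] quot_chart[OF assms(1,3)]
  by (rule iffI, erule tgt.chart_inj[OF img[OF assms(1)] res_image_spec[OF assms(1,2)] res_image_spec[OF assms(1,3)]], simp)

lemma quot_mem: "x \<in> U \<Longrightarrow> quot x \<in> pts Y"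
  by (erule U_cases) (auto simp: pts_Y quot_chart intro!: tgt.chart_mem res_image_spec)

text \<open>The preimage of a chart is a chart: the monomial of \<open>L\<close> that cuts out \<open>\<pi> \<sigma> \<inter> \<pi> \<sigma>'\<close> is
  nonzero at the image point, so it is nonzero at the point itself, where it cuts out
  \<open>\<sigma> \<inter> \<sigma>'\<close>.\<close>

lemma quot_preimage_piece:
  assumes s: "\<sigma> \<in> \<Delta>" and x: "x \<in> U" and q: "quot x \<in> tgt.piece (\<pi> \<sigma>)"
  obtains \<phi> where "\<phi> \<in> spec_points (S \<sigma>)" "x = ch \<sigma> \<phi>"
proof -
  obtain \<sigma>' \<phi>' where s': "\<sigma>' \<in> \<Delta>" and phi': "\<phi>' \<in> spec_points (S \<sigma>')" and xe: "x = ch \<sigma>' \<phi>'"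
    by (rule U_cases[OF x])
  obtain m where m: "m \<in> S \<sigma>'" "m \<in> L" "\<pi> \<sigma> \<inter> \<pi> \<sigma>' = {v \<in> \<pi> \<sigma>'. v m = 0}" "\<sigma> \<inter> \<sigma>' = {u \<in> \<sigma>'. u m = 0}"
    by (rule coherent_meet[OF s s'])
  have mi: "m \<in> cone_monoid L (\<pi> \<sigma>')" unfolding cone_monoid_image using m by blast
  have loc': "localises (cone_monoid L (\<pi> \<sigma>')) (cone_monoid L (\<pi> \<sigma> \<inter> \<pi> \<sigma>')) m"
    unfolding m(3) by (rule localises_face[OF sub tgt.rat[OF img[OF s']] mi])
  have loc: "localises (S \<sigma>') (S (\<sigma> \<inter> \<sigma>')) m"
    unfolding m(4) by (rule localises_face[OF src.sub src.rat[OF in0[OF s']] m(1)])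
  obtain \<psi> where psi: "\<psi> \<in> spec_points (cone_monoid L (\<pi> \<sigma>))" "quot x = ch' (\<pi> \<sigma>) \<psi>"
    using q unfolding tgt.piece_def by blast
  have "ch' (\<pi> \<sigma>) \<psi> = ch' (\<pi> \<sigma>') (res \<sigma>' \<phi>')" using psi(2) unfolding xe quot_chart[OF s' phi'] by simp
  then obtain \<omega> where w: "\<omega> \<in> spec_points (cone_monoid L (\<pi> \<sigma> \<inter> \<pi> \<sigma>'))"
    "res \<sigma>' \<phi>' = restrict_point (cone_monoid L (\<pi> \<sigma>')) \<omega>"
    unfolding tgt.chart_eq_iff[OF img[OF s] img[OF s'] psi(1) res_image_spec[OF s' phi']] by (elim bexE conjE)
  have "ev \<omega> m \<noteq> 0" by (rule localises_nonzero[OF loc' w(1)])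
  then have "ev (res \<sigma>' \<phi>') m \<noteq> 0" unfolding w(2) ev_restrict[OF mi] .
  then have "ev \<phi>' m \<noteq> 0" unfolding res_def using ev_restrict[of m "S \<sigma>' \<inter> L"] m by simp
  then obtain \<omega>' where w': "\<omega>' \<in> spec_points (S (\<sigma> \<inter> \<sigma>'))" "restrict_point (S \<sigma>') \<omega>' = \<phi>'"
    by (rule localises_extend[OF loc phi'])
  let ?p = "restrict_point (S \<sigma>) \<omega>'"
  have p: "?p \<in> spec_points (S \<sigma>)"
    by (rule restrict_spec[OF monS[OF s] src.S_mono w'(1)]) blast
  have "ch \<sigma> ?p = ch \<sigma>' \<phi>'"
    unfolding src.chart_eq_iff[OF in0[OF s] in0[OF s'] p phi'] using w' by (intro bexI[of _ \<omega>']) simp_all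
  then have "x = ch \<sigma> ?p" unfolding xe by (rule sym)
  with p show thesis by (rule that)
qed

lemma quot_polystable_lift:
  assumes "y \<in> pts Y"
  obtains \<sigma> \<phi> where "\<sigma> \<in> \<Delta>" "monoid_quotient.polystable L (S \<sigma>) \<phi>" "\<phi> \<in> spec_points (S \<sigma>)" "quot (ch \<sigma> \<phi>) = y"
proof -
  obtain \<sigma> where s: "\<sigma> \<in> \<Delta>" "y \<in> tgt.piece (\<pi> \<sigma>)" using assms unfolding pts_Y by blast
  then obtain \<psi> where psi: "\<psi> \<in> spec_points (S \<sigma> \<inter> L)" "y = ch' (\<pi> \<sigma>) \<psi>"
    unfolding tgt.piece_def cone_monoid_image by blast
  obtain \<phi> where "monoid_quotient.polystable L (S \<sigma>) \<phi>" "\<phi> \<in> spec_points (S \<sigma>)" "res \<sigma> \<phi> = \<psi>"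
    by (rule res_lift[OF s(1) psi(1)])
  note phi = this
  have "quot (ch \<sigma> \<phi>) = y" unfolding quot_chart[OF s(1) phi(2)] phi(3) psi(2) ..
  with s(1) phi(1,2) show thesis by (rule that)
qed

lemma quot_image: "quot ` U = pts Y"
proof
  show "quot ` U \<subseteq> pts Y" using quot_mem by blast
  show "pts Y \<subseteq> quot ` U"
  proof
    fix y assume "y \<in> pts Y"
    then obtain \<sigma> \<phi> where "\<sigma> \<in> \<Delta>" "\<phi> \<in> spec_points (S \<sigma>)" "quot (ch \<sigma> \<phi>) = y"
      by (rule quot_polystable_lift)
    then show "y \<in> quot ` U" using chU by blast
  qed
qed

lemma fibre_in_chart:
  assumes s: "\<sigma> \<in> \<Delta>" and phi: "\<phi> \<in> spec_points (S \<sigma>)" and x: "x \<in> U" "quot x = quot (ch \<sigma> \<phi>)"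
  obtains \<psi> where "\<psi> \<in> spec_points (S \<sigma>)" "x = ch \<sigma> \<psi>" "res \<sigma> \<psi> = res \<sigma> \<phi>"
proof -
  have "quot x \<in> tgt.piece (\<pi> \<sigma>)" unfolding x(2) quot_chart[OF s phi]
    by (rule tgt.chart_mem[OF res_image_spec[OF s phi]])
  then obtain \<psi> where psi: "\<psi> \<in> spec_points (S \<sigma>)" "x = ch \<sigma> \<psi>" by (rule quot_preimage_piece[OF s x(1)])
  have "res \<sigma> \<psi> = res \<sigma> \<phi>" using x(2) quot_eq_iff[OF s psi(1) phi] unfolding psi(2) by blast
  with psi show thesis by (rule that)
qed

lemma act_chart:
  "\<sigma> \<in> \<Delta> \<Longrightarrow> \<phi> \<in> spec_points (S \<sigma>) \<Longrightarrow> t \<in> G \<Longrightarrow> torus_act t (ch \<sigma> \<phi>) = ch \<sigma> (\<lambda>f. \<phi> (twist t f))"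
  by (rule src.torus_act_chart[OF in0]) (simp_all add: quotient_group_def)

lemma twist_S: "\<sigma> \<in> \<Delta> \<Longrightarrow> \<phi> \<in> spec_points (S \<sigma>) \<Longrightarrow> t \<in> G \<Longrightarrow> (\<lambda>f. \<phi> (twist t f)) \<in> spec_points (S \<sigma>)"
  by (rule twist_spec[OF _ monS SM, of _ _ t]) (simp_all add: quotient_group_def)

lemma act_U: "x \<in> U \<Longrightarrow> t \<in> G \<Longrightarrow> torus_act t x \<in> U"
  by (erule U_cases) (simp add: act_chart chU twist_S)

lemma quot_act: "x \<in> U \<Longrightarrow> t \<in> G \<Longrightarrow> quot (torus_act t x) = quot x"
  by (erule U_cases) (simp add: act_chart quot_eq_iff twist_S res_twist)

lemma pre_quot:
  assumes s: "\<sigma> \<in> \<Delta>"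
  shows "src.pre \<sigma> {x \<in> U. quot x \<in> V} = {\<phi> \<in> spec_points (S \<sigma>). res \<sigma> \<phi> \<in> tgt.pre (\<pi> \<sigma>) V}"
  using s by (auto simp: src.mem_pre tgt.mem_pre quot_chart chU res_image_spec)

lemma morphism_res:
  assumes s: "\<sigma> \<in> \<Delta>"
  shows "morphism (spec_space (S \<sigma>)) (spec_space (S \<sigma> \<inter> L)) (res \<sigma>)"
proof (rule morphism_zariski[OF function_algebra_evals[OF monS[OF s]] function_algebra_evals[OF monSL[OF s]] res_spec[OF s]])
  fix b assume "b \<in> evals (S \<sigma> \<inter> L)"
  then obtain f where f: "f \<in> monoid_algebra (S \<sigma> \<inter> L)" "b = (\<lambda>\<phi>. \<phi> f)" unfolding evals_def by blast
  have "f \<in> monoid_algebra (S \<sigma>)" by (rule monoid_algebra_mono[OF Int_lower1 f(1)])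
  from evalsI[OF this] show "\<exists>a\<in>evals (S \<sigma>). \<forall>\<phi>\<in>spec_points (S \<sigma>). a \<phi> = b (res \<sigma> \<phi>)"
    by (rule bexI[rotated]) (simp add: f(2) res_apply[OF f(1)])
qed

lemma morphism_quot: "morphism X Y quot"
proof (rule morphismI)
  show "quot x \<in> pts Y" if "x \<in> pts X" for x using that quot_mem by (simp add: pts_X)
  fix V assume V: "openin (fs_top Y) V"
  let ?W = "{x \<in> U. quot x \<in> V}"
  have preV: "openin (fs_top (spec_space (S \<sigma> \<inter> L))) (tgt.pre (\<pi> \<sigma>) V)" if "\<sigma> \<in> \<Delta>" for \<sigma>
    using tgt.openin_pre[OF V img[OF that]] unfolding cone_monoid_image .
  have pre: "src.pre \<sigma> ?W = {\<phi> \<in> pts (spec_space (S \<sigma>)). res \<sigma> \<phi> \<in> tgt.pre (\<pi> \<sigma>) V}" if "\<sigma> \<in> \<Delta>" for \<sigma>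
    unfolding pre_quot[OF that] pts_spec[OF monS[OF that]] ..
  have W: "openin (fs_top X) ?W"
  proof (rule openin_U)
    fix \<sigma> assume s: "\<sigma> \<in> \<Delta>"
    show "openin (fs_top (spec_space (S \<sigma>))) (src.pre \<sigma> ?W)"
      unfolding pre[OF s] by (rule morphism_open[OF morphism_res[OF s] preV[OF s]])
  qed blast
  then show "openin (fs_top X) {x \<in> pts X. quot x \<in> V}" unfolding pts_X .
  fix h assume h: "h \<in> fs_reg Y V"
  show "(\<lambda>x. h (quot x)) \<in> fs_reg X {x \<in> pts X. quot x \<in> V}" unfolding pts_X
  proof (rule fs_reg_U[OF W])
    fix \<sigma> assume s: "\<sigma> \<in> \<Delta>"
    have hs: "(\<lambda>\<psi>. h (ch' (\<pi> \<sigma>) \<psi>)) \<in> fs_reg (spec_space (S \<sigma> \<inter> L)) (tgt.pre (\<pi> \<sigma>) V)"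
      using bspec[OF h[unfolded tgt.fs_reg_X] img[OF s]] unfolding cone_monoid_image .
    have r: "(\<lambda>\<phi>. h (ch' (\<pi> \<sigma>) (res \<sigma> \<phi>))) \<in> fs_reg (spec_space (S \<sigma>)) (src.pre \<sigma> ?W)"
      unfolding pre[OF s] by (rule morphism_reg[OF morphism_res[OF s] preV[OF s] hs])
    show "(\<lambda>\<phi>. h (quot (ch \<sigma> \<phi>))) \<in> fs_reg (spec_space (S \<sigma>)) (src.pre \<sigma> ?W)"
      by (rule swf_cong[OF src.swf_spec[OF in0[OF s]] openin_U_pre[OF W s] r])
        (simp add: src.mem_pre quot_chart[OF s])
  qed
qed

text \<open>Over a neighbourhood of the image of a polystable point, an invariant open set is saturated and
  an invariant regular function is a quotient of functions pulled back from \<open>Y\<close>.\<close>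

lemma invariant_local_form:
  assumes W: "openin (fs_top X) W" and k: "k \<in> fs_reg X W"
    and inv: "\<forall>x\<in>U. \<forall>t\<in>G. torus_act t x \<in> W \<longleftrightarrow> x \<in> W"
    and kinv: "\<forall>x\<in>W. \<forall>t\<in>G. k (torus_act t x) = k x"
    and s: "\<sigma> \<in> \<Delta>" and st: "monoid_quotient.polystable L (S \<sigma>) \<phi>" "\<phi> \<in> spec_points (S \<sigma>)" "ch \<sigma> \<phi> \<in> W"
  obtains a b where "a \<in> monoid_algebra (S \<sigma> \<inter> L)" "b \<in> monoid_algebra (S \<sigma> \<inter> L)" "res \<sigma> \<phi> b \<noteq> 0"
    "\<forall>\<psi>\<in>spec_points (S \<sigma>). res \<sigma> \<psi> b \<noteq> 0 \<longrightarrow> ch \<sigma> \<psi> \<in> W"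
    "\<forall>\<psi>\<in>spec_points (S \<sigma>). ch \<sigma> \<psi> \<in> W \<longrightarrow> res \<sigma> \<psi> b * k (ch \<sigma> \<psi>) = res \<sigma> \<psi> a"
proof -
  interpret q: monoid_quotient M L "S \<sigma>" by (rule quotient[OF s])
  note op = openin_U_pre[OF W s] and kr = fs_reg_U_pre[OF k s]
  have tw: "(\<lambda>f. \<psi> (twist t f)) \<in> src.pre \<sigma> W \<longleftrightarrow> \<psi> \<in> src.pre \<sigma> W" if "\<psi> \<in> spec_points (S \<sigma>)" "t \<in> G" for \<psi> t
    using bspec[OF bspec[OF inv chU[OF s that(1)]] that(2)] that
    by (simp add: src.mem_pre act_chart[OF s that] twist_S[OF s that])
  have tk: "k (ch \<sigma> (\<lambda>f. \<psi> (twist t f))) = k (ch \<sigma> \<psi>)" if "\<psi> \<in> src.pre \<sigma> W" "t \<in> G" for \<psi> t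
    using that bspec[OF bspec[OF kinv, of "ch \<sigma> \<psi>"], of t] by (simp add: src.mem_pre act_chart[OF s])
  have mem: "\<phi> \<in> src.pre \<sigma> W" using st by (simp add: src.mem_pre)
  \<comment> \<open>\<open>b1\<close> keeps the neighbourhood inside \<open>W\<close>, \<open>a / b2\<close> represents \<open>k\<close>\<close>
  obtain b1 where b1: "b1 \<in> monoid_algebra (S \<sigma> \<inter> L)" "\<phi> b1 \<noteq> 0"
    and b1W: "\<And>\<psi>. \<psi> \<in> spec_points (S \<sigma>) \<Longrightarrow> \<psi> b1 \<noteq> 0 \<Longrightarrow> \<psi> \<in> src.pre \<sigma> W"
    using q.saturated_neighbourhood[OF op _ st(1) mem] tw by metis
  have kinv': "(\<lambda>f. \<psi> (twist t f)) \<in> src.pre \<sigma> W \<and> k (ch \<sigma> (\<lambda>f. \<psi> (twist t f))) = k (ch \<sigma> \<psi>)"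
    if "\<psi> \<in> src.pre \<sigma> W" "t \<in> G" for \<psi> t
    using tw[OF _ that(2), of \<psi>] tk[OF that] that(1) by (simp add: src.mem_pre)
  obtain a b2 where ab: "a \<in> monoid_algebra (S \<sigma> \<inter> L)" "b2 \<in> monoid_algebra (S \<sigma> \<inter> L)" "\<phi> b2 \<noteq> 0"
    and rel: "\<And>\<psi>. \<psi> \<in> src.pre \<sigma> W \<Longrightarrow> \<psi> b2 * k (ch \<sigma> \<psi>) = \<psi> a"
    using q.invariant_fraction[OF op kr kinv' st(1) mem] by metis
  have val: "res \<sigma> \<psi> (b1 * f) = \<psi> b1 * \<psi> f" if "\<psi> \<in> spec_points (S \<sigma>)" "f \<in> monoid_algebra (S \<sigma> \<inter> L)" for \<psi> f
    using spec_mult[OF res_spec[OF s that(1)] b1(1) that(2)] res_apply[OF b1(1)] res_apply[OF that(2)] by simp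
  show thesis
  proof (rule that[of "b1 * a" "b1 * b2"])
    show "b1 * a \<in> monoid_algebra (S \<sigma> \<inter> L)" "b1 * b2 \<in> monoid_algebra (S \<sigma> \<inter> L)"
      by (rule monoid_algebra_mult[OF monSL[OF s] b1(1)], rule ab)+
    show "res \<sigma> \<phi> (b1 * b2) \<noteq> 0" using val[OF st(2) ab(2)] b1(2) ab(3) by simp
    show "\<forall>\<psi>\<in>spec_points (S \<sigma>). res \<sigma> \<psi> (b1 * b2) \<noteq> 0 \<longrightarrow> ch \<sigma> \<psi> \<in> W"
      using val[OF _ ab(2)] b1W by (simp add: src.mem_pre)
    show "\<forall>\<psi>\<in>spec_points (S \<sigma>). ch \<sigma> \<psi> \<in> W \<longrightarrow> res \<sigma> \<psi> (b1 * b2) * k (ch \<sigma> \<psi>) = res \<sigma> \<psi> (b1 * a)"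
    proof (intro ballI impI)
      fix \<psi> assume psi: "\<psi> \<in> spec_points (S \<sigma>)" "ch \<sigma> \<psi> \<in> W"
      have "\<psi> b2 * k (ch \<sigma> \<psi>) = \<psi> a" using rel psi by (simp add: src.mem_pre)
      then show "res \<sigma> \<psi> (b1 * b2) * k (ch \<sigma> \<psi>) = res \<sigma> \<psi> (b1 * a)"
        unfolding val[OF psi(1) ab(2)] val[OF psi(1) ab(1)] by (simp add: mult.assoc)
    qed
  qed
qed

lemma invariant_constant_on_fibre:
  assumes W: "openin (fs_top X) W" and k: "k \<in> fs_reg X W"
    and inv: "\<forall>x\<in>U. \<forall>t\<in>G. torus_act t x \<in> W \<longleftrightarrow> x \<in> W"
    and kinv: "\<forall>x\<in>W. \<forall>t\<in>G. k (torus_act t x) = k x"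
    and s: "\<sigma> \<in> \<Delta>" and st: "monoid_quotient.polystable L (S \<sigma>) \<phi>" "\<phi> \<in> spec_points (S \<sigma>)" "ch \<sigma> \<phi> \<in> W"
    and x: "x \<in> U" "quot x = quot (ch \<sigma> \<phi>)"
  shows "x \<in> W \<and> k x = k (ch \<sigma> \<phi>)"
proof -
  obtain a b where ab: "res \<sigma> \<phi> b \<noteq> 0"
    "\<forall>\<psi>\<in>spec_points (S \<sigma>). res \<sigma> \<psi> b \<noteq> 0 \<longrightarrow> ch \<sigma> \<psi> \<in> W"
    "\<forall>\<psi>\<in>spec_points (S \<sigma>). ch \<sigma> \<psi> \<in> W \<longrightarrow> res \<sigma> \<psi> b * k (ch \<sigma> \<psi>) = res \<sigma> \<psi> a"
    by (rule invariant_local_form[OF W k inv kinv s st])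
  obtain \<psi> where psi: "\<psi> \<in> spec_points (S \<sigma>)" "x = ch \<sigma> \<psi>" "res \<sigma> \<psi> = res \<sigma> \<phi>"
    by (rule fibre_in_chart[OF s st(2) x])
  have xW: "ch \<sigma> \<psi> \<in> W" using bspec[OF ab(2) psi(1)] ab(1) psi(3) by simp
  have "res \<sigma> \<phi> b * k (ch \<sigma> \<psi>) = res \<sigma> \<phi> a" using bspec[OF ab(3) psi(1)] xW psi(3) by simp
  moreover have "res \<sigma> \<phi> b * k (ch \<sigma> \<phi>) = res \<sigma> \<phi> a" using bspec[OF ab(3) st(2)] st(3) by simp
  ultimately have "res \<sigma> \<phi> b * k (ch \<sigma> \<psi>) = res \<sigma> \<phi> b * k (ch \<sigma> \<phi>)" by simp
  then have "k (ch \<sigma> \<psi>) = k (ch \<sigma> \<phi>)" using ab(1) by simp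
  then show ?thesis using xW psi(2) by simp
qed

text \<open>An invariant open set contains, with the polystable point of a fibre, the preimage of a
  neighbourhood of its image.\<close>

lemma quot_submersive:
  assumes V: "V \<subseteq> pts Y" and op: "openin (fs_top X) {x \<in> U. quot x \<in> V}"
  shows "openin (fs_top Y) V"
  unfolding tgt.openin_X
proof (intro conjI ballI)
  show "V \<subseteq> (\<Union>\<sigma>\<in>image_cones L \<Delta>. tgt.piece \<sigma>)" using V unfolding tgt.pts_X .
  fix \<tau> assume "\<tau> \<in> image_cones L \<Delta>"
  then obtain \<sigma> where s: "\<sigma> \<in> \<Delta>" and t: "\<tau> = \<pi> \<sigma>" unfolding image_cones_def by blast
  let ?W = "{x \<in> U. quot x \<in> V}"
  have inv: "\<forall>x\<in>U. \<forall>t\<in>G. torus_act t x \<in> ?W \<longleftrightarrow> x \<in> ?W" by (simp add: act_U quot_act)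
  show "openin (fs_top (spec_space (cone_monoid L \<tau>))) (tgt.pre \<tau> V)"
    unfolding t cone_monoid_image openin_spec[OF monSL[OF s]]
  proof (intro conjI ballI)
    show "tgt.pre (\<pi> \<sigma>) V \<subseteq> spec_points (S \<sigma> \<inter> L)" using tgt.pre_subset[of "\<pi> \<sigma>" V] unfolding cone_monoid_image .
    fix \<psi> assume "\<psi> \<in> tgt.pre (\<pi> \<sigma>) V"
    then have psi: "\<psi> \<in> spec_points (S \<sigma> \<inter> L)" "ch' (\<pi> \<sigma>) \<psi> \<in> V" by (simp_all add: tgt.mem_pre cone_monoid_image)
    obtain \<phi> where phi: "monoid_quotient.polystable L (S \<sigma>) \<phi>" "\<phi> \<in> spec_points (S \<sigma>)" "res \<sigma> \<phi> = \<psi>"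
      by (rule res_lift[OF s psi(1)])
    have W: "ch \<sigma> \<phi> \<in> ?W" using psi(2) by (simp add: chU[OF s phi(2)] quot_chart[OF s phi(2)] phi(3))
    obtain b where b: "b \<in> monoid_algebra (S \<sigma> \<inter> L)" "res \<sigma> \<phi> b \<noteq> 0"
      "\<forall>\<psi>\<in>spec_points (S \<sigma>). res \<sigma> \<psi> b \<noteq> 0 \<longrightarrow> ch \<sigma> \<psi> \<in> ?W"
      by (rule invariant_local_form[OF op swf_const[OF swf_X op, of 0] inv _ s phi(1,2) W]) simp
    have "\<psi>' \<in> tgt.pre (\<pi> \<sigma>) V" if p': "\<psi>' \<in> spec_points (S \<sigma> \<inter> L)" "\<psi>' b \<noteq> 0" for \<psi>'
    proof -
      obtain \<phi>' where phi': "\<phi>' \<in> spec_points (S \<sigma>)" "res \<sigma> \<phi>' = \<psi>'" by (rule res_lift[OF s p'(1)])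
      have "ch \<sigma> \<phi>' \<in> ?W" using bspec[OF b(3) phi'(1)] phi'(2) p'(2) by simp
      then show ?thesis using p'(1) by (simp add: tgt.mem_pre cone_monoid_image quot_chart[OF s phi'(1)] phi'(2))
    qed
    then show "\<exists>f\<in>monoid_algebra (S \<sigma> \<inter> L). \<psi> f \<noteq> 0 \<and>
        (\<forall>\<psi>'\<in>spec_points (S \<sigma> \<inter> L). \<psi>' f \<noteq> 0 \<longrightarrow> \<psi>' \<in> tgt.pre (\<pi> \<sigma>) V)"
      using b(2) unfolding phi(3) by (intro bexI[OF _ b(1)] conjI ballI impI)
  qed
qed

lemma quot_open_iff:
  "V \<subseteq> pts Y \<Longrightarrow> openin (fs_top Y) V \<longleftrightarrow> openin (fs_top X) {x \<in> pts X. quot x \<in> V}"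
  using quot_submersive morphism_open[OF morphism_quot] unfolding pts_X by blast

text \<open>By \<open>invariant_local_form\<close> an invariant function is constant on the fibres, and the function that it
  induces on \<open>Y\<close> is locally a quotient.\<close>

lemma quot_invariant_functions:
  assumes V: "openin (fs_top Y) V" and k: "k \<in> fs_reg X {x \<in> U. quot x \<in> V}"
    and inv: "invariant_on G torus_act {x \<in> U. quot x \<in> V} k"
  obtains h where "h \<in> fs_reg Y V" "\<forall>x\<in>U. quot x \<in> V \<longrightarrow> k x = h (quot x)"
proof -
  let ?W = "{x \<in> U. quot x \<in> V}"
  have W: "openin (fs_top X) ?W" using morphism_open[OF morphism_quot V] unfolding pts_X .
  have act: "\<forall>x\<in>U. \<forall>t\<in>G. torus_act t x \<in> ?W \<longleftrightarrow> x \<in> ?W" by (simp add: act_U quot_act)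
  have kinv: "\<forall>x\<in>?W. \<forall>t\<in>G. k (torus_act t x) = k x" using inv unfolding invariant_on_def by blast
  note const = invariant_constant_on_fibre[OF W k act kinv]
  have fib: "k x = k x'" if x: "x \<in> U" "x' \<in> U" "quot x = quot x'" "quot x \<in> V" for x x'
  proof -
    obtain \<sigma> \<phi> where s: "\<sigma> \<in> \<Delta>" and phi: "monoid_quotient.polystable L (S \<sigma>) \<phi>" "\<phi> \<in> spec_points (S \<sigma>)" "quot (ch \<sigma> \<phi>) = quot x"
      by (rule quot_polystable_lift[OF quot_mem[OF x(1)]])
    have "ch \<sigma> \<phi> \<in> ?W" using chU[OF s phi(2)] phi(3) x(4) by simp
    note c = const[OF s phi(1,2) this]
    have "k x = k (ch \<sigma> \<phi>)" using c[OF x(1)] phi(3) by simp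
    moreover have "k x' = k (ch \<sigma> \<phi>)" using c[OF x(2)] phi(3) x(3) by simp
    ultimately show ?thesis by simp
  qed
  define h where "h y = k (SOME x. x \<in> U \<and> quot x = y)" for y
  have hk: "k x = h (quot x)" if x: "x \<in> U" "quot x \<in> V" for x
    unfolding h_def
  proof (rule someI2[where a = x and Q = "\<lambda>z. k x = k z"])
    show "x \<in> U \<and> quot x = quot x" using x by simp
    show "k x = k z" if "z \<in> U \<and> quot z = quot x" for z using fib[OF x(1) _ _ x(2)] that by simp
  qed
  have "h \<in> fs_reg Y V" unfolding tgt.fs_reg_X
  proof
    fix \<tau> assume tau: "\<tau> \<in> image_cones L \<Delta>"
    then obtain \<sigma> where s: "\<sigma> \<in> \<Delta>" and t: "\<tau> = \<pi> \<sigma>" unfolding image_cones_def by blast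
    have op: "openin (fs_top (spec_space (S \<sigma> \<inter> L))) (tgt.pre (\<pi> \<sigma>) V)"
      using tgt.openin_pre[OF V img[OF s]] unfolding cone_monoid_image .
    show "(\<lambda>\<psi>. h (ch' \<tau> \<psi>)) \<in> fs_reg (spec_space (cone_monoid L \<tau>)) (tgt.pre \<tau> V)"
      unfolding t cone_monoid_image fs_reg_spec[OF monSL[OF s] op]
    proof
      fix \<psi> assume "\<psi> \<in> tgt.pre (\<pi> \<sigma>) V"
      then have psi: "\<psi> \<in> spec_points (S \<sigma> \<inter> L)" "ch' (\<pi> \<sigma>) \<psi> \<in> V" by (simp_all add: tgt.mem_pre cone_monoid_image)
      obtain \<phi> where phi: "monoid_quotient.polystable L (S \<sigma>) \<phi>" "\<phi> \<in> spec_points (S \<sigma>)" "res \<sigma> \<phi> = \<psi>"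
        by (rule res_lift[OF s psi(1)])
      have phiW: "ch \<sigma> \<phi> \<in> ?W" using psi(2) by (simp add: chU[OF s phi(2)] quot_chart[OF s phi(2)] phi(3))
      obtain a b where ab: "a \<in> monoid_algebra (S \<sigma> \<inter> L)" "b \<in> monoid_algebra (S \<sigma> \<inter> L)" "res \<sigma> \<phi> b \<noteq> 0"
        "\<forall>\<psi>\<in>spec_points (S \<sigma>). ch \<sigma> \<psi> \<in> ?W \<longrightarrow> res \<sigma> \<psi> b * k (ch \<sigma> \<psi>) = res \<sigma> \<psi> a"
        by (rule invariant_local_form[OF W k act kinv s phi(1,2) phiW])
      have "\<psi>' b * h (ch' (\<pi> \<sigma>) \<psi>') = \<psi>' a" if p': "\<psi>' \<in> tgt.pre (\<pi> \<sigma>) V" for \<psi>'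
      proof -
        have p'': "\<psi>' \<in> spec_points (S \<sigma> \<inter> L)" "ch' (\<pi> \<sigma>) \<psi>' \<in> V" using p' by (simp_all add: tgt.mem_pre cone_monoid_image)
        obtain \<phi>' where phi': "\<phi>' \<in> spec_points (S \<sigma>)" "res \<sigma> \<phi>' = \<psi>'" by (rule res_lift[OF s p''(1)])
        have q: "quot (ch \<sigma> \<phi>') = ch' (\<pi> \<sigma>) \<psi>'" using quot_chart[OF s phi'(1)] phi'(2) by simp
        have "ch \<sigma> \<phi>' \<in> ?W" using chU[OF s phi'(1)] q p''(2) by simp
        then have "\<psi>' b * k (ch \<sigma> \<phi>') = \<psi>' a" using bspec[OF ab(4) phi'(1)] phi'(2) by simp
        then show ?thesis using hk[OF chU[OF s phi'(1)]] q p''(2) by simp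
      qed
      then show "\<exists>a\<in>monoid_algebra (S \<sigma> \<inter> L). \<exists>b\<in>monoid_algebra (S \<sigma> \<inter> L). \<psi> b \<noteq> 0 \<and>
          (\<forall>\<psi>\<in>tgt.pre (\<pi> \<sigma>) V. \<psi> b * h (ch' (\<pi> \<sigma>) \<psi>) = \<psi> a)"
        using ab(3) unfolding phi(3) by (intro bexI[OF _ ab(1)] bexI[OF _ ab(2)] conjI ballI)
    qed
  qed
  then show thesis using hk by (intro that[of h]) blast+
qed

text \<open>An invariant morphism to a prevariety maps a polystable point into an affine piece; its
  coordinates are invariant functions near the fibre of that point, so they are constant on it.\<close>

lemma invariant_morphism_constant:
  assumes Z: "prevariety Z" and f: "morphism X Z f" and inv: "invariant_on G torus_act U f"
    and x: "x \<in> U" "x' \<in> U" "quot x = quot x'"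
  shows "f x = f x'"
proof -
  have sZ: "space_with_functions Z" using Z by (simp add: prevariety_def)
  obtain \<sigma> \<phi> where s: "\<sigma> \<in> \<Delta>" and phi: "monoid_quotient.polystable L (S \<sigma>) \<phi>" "\<phi> \<in> spec_points (S \<sigma>)" "quot (ch \<sigma> \<phi>) = quot x"
    by (rule quot_polystable_lift[OF quot_mem[OF x(1)]])
  define x0 where "x0 = ch \<sigma> \<phi>"
  have x0: "x0 \<in> U" unfolding x0_def by (rule chU[OF s phi(2)])
  obtain \<U> where cover: "\<Union>\<U> = pts Z" "\<forall>W\<in>\<U>. openin (fs_top Z) W \<and> affine_variety (open_sub Z W)"
    using Z unfolding prevariety_def by (elim conjE exE)
  have "f x0 \<in> pts Z" using morphism_pts[OF f] x0 by (simp add: pts_X)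
  then obtain Zi where Zi: "Zi \<in> \<U>" "f x0 \<in> Zi" using cover(1) by blast
  have oZ: "openin (fs_top Z) Zi" and aff: "affine_variety (open_sub Z Zi)" using bspec[OF cover(2) Zi(1)] by simp_all
  obtain n P c d where "P \<subseteq> polyfun n"
    and c: "morphism (open_sub Z Zi) (zariski {z \<in> affine_space n. \<forall>p\<in>P. p z = 0} (polyfun n)) c"
    and "morphism (zariski {z \<in> affine_space n. \<forall>p\<in>P. p z = 0} (polyfun n)) (open_sub Z Zi) d"
    and dc: "\<forall>z\<in>pts (open_sub Z Zi). d (c z) = z"
    and "\<forall>y\<in>pts (zariski {z \<in> affine_space n. \<forall>p\<in>P. p z = 0} (polyfun n)). c (d y) = y"
    using aff unfolding affine_variety_def isomorphic_def by (elim exE conjE)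
  define A where "A = {z \<in> affine_space n. \<forall>p\<in>P. p z = 0}"
  note alg = function_algebra_polyfun[of A n]
  note c = c[folded A_def]
  have cA: "c z \<in> A" if "z \<in> Zi" for z
    using morphism_pts[OF c] that unfolding pts_open_sub[OF oZ] pts_zariski[OF alg] by blast
  let ?W = "{x \<in> U. f x \<in> Zi}"
  have W: "openin (fs_top X) ?W" using morphism_open[OF f oZ] unfolding pts_X .
  have finv: "f (torus_act t x) = f x" if "x \<in> U" "t \<in> G" for x t using inv that unfolding invariant_on_def by blast
  have act: "\<forall>x\<in>U. \<forall>t\<in>G. torus_act t x \<in> ?W \<longleftrightarrow> x \<in> ?W" by (simp add: act_U finv)
  have x0W: "ch \<sigma> \<phi> \<in> ?W" using x0 Zi(2) by (simp add: x0_def)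
  have coord: "(\<lambda>x. c (f x) i) \<in> fs_reg X ?W" if i: "i < n" for i
  proof -
    have oA: "openin (fs_top (zariski A (polyfun n))) A"
      using openin_topspace[of "fs_top (zariski A (polyfun n))"] unfolding pts_zariski[OF alg] .
    have "(\<lambda>z. z i) \<in> fs_reg (zariski A (polyfun n)) A"
      unfolding fs_reg_zariski[OF alg oA]
      by (intro ballI bexI[OF _ polyfun.coord[OF i]] bexI[OF _ polyfun.const[of 1]]) simp
    from morphism_reg[OF c oA this]
    have "(\<lambda>z. c z i) \<in> fs_reg Z {z \<in> Zi. c z \<in> A}" unfolding pts_open_sub[OF oZ] fs_reg_open_sub .
    moreover have "{z \<in> Zi. c z \<in> A} = Zi" using cA by blast
    ultimately have "(\<lambda>z. c z i) \<in> fs_reg Z Zi" by simp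
    from morphism_reg[OF f oZ this] show ?thesis unfolding pts_X .
  qed
  have key: "f y = f x0" if y: "y \<in> U" "quot y = quot x" for y
  proof -
    have q: "quot y = quot (ch \<sigma> \<phi>)" using y(2) phi(3) by simp
    have yW: "y \<in> ?W"
      using invariant_constant_on_fibre[OF W swf_const[OF swf_X W, of 0] act _ s phi(1,2) x0W y(1) q] by blast
    have ci: "c (f y) i = c (f x0) i" for i
    proof (cases "i < n")
      case True
      have "\<forall>z\<in>?W. \<forall>t\<in>G. c (f (torus_act t z)) i = c (f z) i" by (simp add: finv)
      from invariant_constant_on_fibre[OF W coord[OF True] act this s phi(1,2) x0W y(1) q]
      show ?thesis unfolding x0_def by blast
    next
      case False
      have "c (f y) \<in> affine_space n" "c (f x0) \<in> affine_space n"
        using cA[of "f y"] cA[of "f x0"] yW Zi(2) by (simp_all add: A_def)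
      then show ?thesis using False by (simp add: affine_space_def)
    qed
    then have "c (f y) = c (f x0)" by (rule ext)
    moreover have "d (c (f y)) = f y" "d (c (f x0)) = f x0"
      using dc yW Zi(2) unfolding pts_open_sub[OF oZ] by blast+
    ultimately show ?thesis by metis
  qed
  show ?thesis using key[OF x(1) refl] key[OF x(2)] x(3) by simp
qed

lemma invariant_quot: "invariant_on G torus_act U quot"
  unfolding invariant_on_def using quot_act by blast

text \<open>An invariant morphism is constant on the fibres, so it factors as a map. The factor is continuous
  because \<open>quot\<close> is submersive and pulls regular functions back to regular ones because invariant
  functions descend; it is unique because \<open>quot\<close> is surjective.\<close>

lemma categorical_quotient_quot: "categorical_quotient G torus_act X Y quot"
  unfolding categorical_quotient_def pts_X
proof (intro conjI allI impI prevariety_X tgt.prevariety_X morphism_quot invariant_quot)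
  fix Z :: "test_point fspace" and f
  assume "prevariety Z \<and> morphism X Z f \<and> invariant_on G torus_act U f"
  then have Z: "prevariety Z" and f: "morphism X Z f" and inv: "invariant_on G torus_act U f" by simp_all
  note const = invariant_morphism_constant[OF Z f inv]
  define h where "h = restrict (\<lambda>y. f (SOME x. x \<in> U \<and> quot x = y)) (pts Y)"
  have hf: "h (quot x) = f x" if x: "x \<in> U" for x
  proof -
    have "f (SOME z. z \<in> U \<and> quot z = quot x) = f x"
    proof (rule someI2[where a = x and Q = "\<lambda>z. f z = f x"])
      show "x \<in> U \<and> quot x = quot x" using x by simp
      show "f z = f x" if "z \<in> U \<and> quot z = quot x" for z using const[of z x] that x by simp
    qed
    then show ?thesis using quot_mem[OF x] by (simp add: h_def)
  qed
  show "\<exists>!h. h \<in> extensional (pts Y) \<and> morphism Y Z h \<and> (\<forall>x\<in>U. h (quot x) = f x)"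
  proof (rule ex1I[of _ h])
    have "morphism Y Z h"
    proof (rule morphismI)
      show "h y \<in> pts Z" if y: "y \<in> pts Y" for y
      proof -
        obtain x where x: "x \<in> U" "y = quot x" using y unfolding quot_image[symmetric] by (elim imageE)
        show ?thesis using morphism_pts[OF f, of x] x(1) unfolding x(2) hf[OF x(1)] pts_X by blast
      qed
      fix V assume V: "openin (fs_top Z) V"
      let ?V = "{y \<in> pts Y. h y \<in> V}"
      have eq: "{x \<in> U. quot x \<in> ?V} = {x \<in> U. f x \<in> V}" using hf quot_mem by auto
      have opf: "openin (fs_top X) {x \<in> U. f x \<in> V}" using morphism_open[OF f V] unfolding pts_X .
      show op: "openin (fs_top Y) ?V" by (rule quot_submersive) (simp_all only: eq opf, blast)
      fix r assume "r \<in> fs_reg Z V"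
      then have r: "(\<lambda>x. r (f x)) \<in> fs_reg X {x \<in> U. quot x \<in> ?V}"
        using morphism_reg[OF f V] unfolding pts_X eq by blast
      have "invariant_on G torus_act {x \<in> U. quot x \<in> ?V} (\<lambda>x. r (f x))"
        using inv unfolding invariant_on_def by simp
      then obtain h' where h': "h' \<in> fs_reg Y ?V" "\<forall>x\<in>U. quot x \<in> ?V \<longrightarrow> r (f x) = h' (quot x)"
        by (rule quot_invariant_functions[OF op r])
      show "(\<lambda>y. r (h y)) \<in> fs_reg Y ?V"
      proof (rule swf_cong[OF swf_Y op h'(1)])
        fix y assume y: "y \<in> ?V"
        then have "y \<in> quot ` U" unfolding quot_image by blast
        then obtain x where x: "x \<in> U" "y = quot x" by (elim imageE)
        then show "r (h y) = h' y" using bspec[OF h'(2) x(1)] y hf[OF x(1)] by simp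
      qed
    qed
    then show "h \<in> extensional (pts Y) \<and> morphism Y Z h \<and> (\<forall>x\<in>U. h (quot x) = f x)"
      using hf by (simp add: h_def)
    fix h' assume h': "h' \<in> extensional (pts Y) \<and> morphism Y Z h' \<and> (\<forall>x\<in>U. h' (quot x) = f x)"
    show "h' = h"
    proof (rule extensionalityI[of _ "pts Y"])
      show "h' \<in> extensional (pts Y)" using h' by blast
      show "h \<in> extensional (pts Y)" by (simp add: h_def)
      fix y assume "y \<in> pts Y"
      then obtain x where "x \<in> U" "y = quot x" unfolding quot_image[symmetric] by (elim imageE)
      then show "h' y = h y" using h' hf by simp
    qed
  qed
qed

lemma geometric_quotient_iff_orbits:
  "geometric_quotient G torus_act X Y quot \<longleftrightarrow>
     (\<forall>x\<in>U. \<forall>x'\<in>U. quot x = quot x' \<longrightarrow> (\<exists>g\<in>G. x' = torus_act g x))" (is "_ \<longleftrightarrow> ?orb")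
proof
  assume "geometric_quotient G torus_act X Y quot"
  then have "\<forall>x\<in>pts X. \<forall>x'\<in>pts X. quot x = quot x' \<longleftrightarrow> (\<exists>g\<in>G. x' = torus_act g x)"
    unfolding geometric_quotient_def by (elim conjE)
  then show ?orb unfolding pts_X by simp
next
  assume orb: ?orb
  show "geometric_quotient G torus_act X Y quot"
    unfolding geometric_quotient_def
  proof (intro conjI prevariety_X tgt.prevariety_X morphism_quot allI impI ballI quot_open_iff)
    show "invariant_on G torus_act (pts X) quot" unfolding pts_X by (rule invariant_quot)
    show "quot ` pts X = pts Y" unfolding pts_X by (rule quot_image)
    show "quot x = quot x' \<longleftrightarrow> (\<exists>g\<in>G. x' = torus_act g x)" if "x \<in> pts X" "x' \<in> pts X" for x x'
      using orb that quot_act unfolding pts_X by metis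
    fix V k assume V: "openin (fs_top Y) V" and k: "k \<in> fs_reg X {x \<in> pts X. quot x \<in> V}"
      and inv: "invariant_on G torus_act {x \<in> pts X. quot x \<in> V} k"
    obtain h where "h \<in> fs_reg Y V" "\<forall>x\<in>U. quot x \<in> V \<longrightarrow> k x = h (quot x)"
      by (rule quot_invariant_functions[OF V k[unfolded pts_X] inv[unfolded pts_X]])
    note h = this
    show "\<exists>h\<in>fs_reg Y V. \<forall>x\<in>pts X. quot x \<in> V \<longrightarrow> k x = h (quot x)"
      unfolding pts_X by (rule bexI[of _ h]) (rule h)+
  qed
qed

end

section \<open>Linear algebra of cones\<close>

lemma separating_form:
  fixes x :: "'v::real_vector"
  assumes "x \<notin> span V"
  obtains f :: "'v \<Rightarrow> real" where "linear f" "\<And>v. v \<in> V \<Longrightarrow> f v = 0" "f x = 1"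
proof -
  obtain B where B: "B \<subseteq> V" "independent B" "V \<subseteq> span B" by (rule real_vector.maximal_independent_subset)
  have "span B \<subseteq> span V" by (rule real_vector.span_mono[OF B(1)])
  then have xB: "x \<notin> span B" using assms by blast
  have "independent (insert x B)" by (rule real_vector.independent_insertI[OF xB B(2)])
  from real_vector.linear_independent_extend[OF this, of "\<lambda>y. if y = x then 1 else (0::real)"]
  obtain f :: "'v \<Rightarrow> real" where f: "linear f" "\<forall>y\<in>insert x B. f y = (if y = x then 1 else 0)" by (elim exE conjE)
  have fB: "f b = 0" if "b \<in> B" for b
  proof -
    have "b \<noteq> x" using that xB real_vector.span_base by blast
    then show ?thesis using f(2) that by simp
  qed
  have "f v = 0" if "v \<in> V" for v
  proof (rule real_vector.linear_eq_0_on_span[OF f(1)])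
    show "f b = 0" if "b \<in> B" for b by (rule fB[OF that])
    show "v \<in> span B" using B(3) that by blast
  qed
  then show thesis using f by (intro that[of f]) simp_all
qed

text \<open>Farkas' lemma, by induction on the number of generators: a form \<open>f\<close> that separates \<open>c\<close> from
  the cone of the old generators and is negative on the new generator \<open>a j\<close> is used to project
  along \<open>a j\<close> to the kernel of \<open>f\<close>; a form separating the projections is pulled back.\<close>

lemma farkas:
  fixes a :: "'i \<Rightarrow> 'v::real_vector"
  assumes "finite I" "\<forall>l. (\<forall>i\<in>I. 0 \<le> l i) \<longrightarrow> c \<noteq> (\<Sum>i\<in>I. l i *\<^sub>R a i)"
  obtains f :: "'v \<Rightarrow> real" where "linear f" "\<forall>i\<in>I. 0 \<le> f (a i)" "f c < 0"
proof -
  have "\<exists>f :: 'v \<Rightarrow> real. linear f \<and> (\<forall>i\<in>I. 0 \<le> f (a i)) \<and> f c < 0"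
    using assms
  proof (induction I arbitrary: a c rule: finite_induct)
    case empty
    have "c \<notin> span {}" using empty.prems by simp
    then obtain f :: "'v \<Rightarrow> real" where f: "linear f" "f c = 1" by (rule separating_form) blast
    have "linear (\<lambda>x. - f x)" by (rule real_vector.linear_compose_neg[OF f(1)])
    then show ?case using f(2) by (intro exI[of _ "\<lambda>x. - f x"]) simp
  next
    case (insert j I)
    have "\<forall>l. (\<forall>i\<in>I. 0 \<le> l i) \<longrightarrow> c \<noteq> (\<Sum>i\<in>I. l i *\<^sub>R a i)"
    proof (intro allI impI)
      fix l :: "'i \<Rightarrow> real" assume l: "\<forall>i\<in>I. 0 \<le> l i"
      have "(\<Sum>i\<in>I. (l(j := 0)) i *\<^sub>R a i) = (\<Sum>i\<in>I. l i *\<^sub>R a i)"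
        using insert.hyps by (intro sum.cong) auto
      then have "(\<Sum>i\<in>insert j I. (l(j := 0)) i *\<^sub>R a i) = (\<Sum>i\<in>I. l i *\<^sub>R a i)" using insert.hyps by simp
      moreover have "\<forall>i\<in>insert j I. 0 \<le> (l(j := 0)) i" using l by simp
      ultimately show "c \<noteq> (\<Sum>i\<in>I. l i *\<^sub>R a i)" using spec[OF insert.prems, of "l(j := 0)"] by simp
    qed
    from insert.IH[OF this] obtain f :: "'v \<Rightarrow> real" where f: "linear f" "\<forall>i\<in>I. 0 \<le> f (a i)" "f c < 0"
      by (elim exE conjE)
    show ?case
    proof (cases "0 \<le> f (a j)")
      case True
      then show ?thesis using f by (intro exI[of _ f]) simp
    next
      case False
      \<comment> \<open>\<open>P\<close> projects along \<open>a j\<close> to the kernel of \<open>f\<close>\<close>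
      define s where "s x = f x / f (a j)" for x
      define P where "P x = x - s x *\<^sub>R a j" for x
      have s_add: "s (x + y) = s x + s y" and s_scale: "s (r *\<^sub>R x) = r * s x" for x y r
        using f(1) by (simp_all add: s_def linear_add linear_cmul add_divide_distrib)
      have P_add: "P (x + y) = P x + P y" and P_scale: "P (r *\<^sub>R x) = r *\<^sub>R P x" for x y r
        by (simp_all add: P_def s_add s_scale algebra_simps)
      have Pj: "P (a j) = 0" using False by (simp add: P_def s_def)
      have "\<forall>l. (\<forall>i\<in>I. 0 \<le> l i) \<longrightarrow> P c \<noteq> (\<Sum>i\<in>I. l i *\<^sub>R P (a i))"
      proof (intro allI impI notI)
        fix l :: "'i \<Rightarrow> real" assume l: "\<forall>i\<in>I. 0 \<le> l i" and eq: "P c = (\<Sum>i\<in>I. l i *\<^sub>R P (a i))"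
        define lj where "lj = s c - (\<Sum>i\<in>I. l i * s (a i))"
        have "0 \<le> s c" using f(3) False by (simp add: s_def divide_nonpos_neg)
        moreover have "(\<Sum>i\<in>I. l i * s (a i)) \<le> 0"
          using l f(2) False by (intro sum_nonpos mult_nonneg_nonpos) (auto simp: s_def divide_nonneg_neg)
        ultimately have lj: "0 \<le> lj" by (simp add: lj_def)
        have "(\<Sum>i\<in>I. l i *\<^sub>R P (a i)) = (\<Sum>i\<in>I. l i *\<^sub>R a i) - (\<Sum>i\<in>I. l i * s (a i)) *\<^sub>R a j"
          by (simp add: P_def scaleR_diff_right sum_subtractf scaleR_sum_left)
        note sumP = this
        have "c = P c + s c *\<^sub>R a j" by (simp add: P_def)
        also have "P c = (\<Sum>i\<in>I. l i *\<^sub>R a i) - (\<Sum>i\<in>I. l i * s (a i)) *\<^sub>R a j"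
          using eq sumP by (rule trans)
        finally have "c = (\<Sum>i\<in>I. l i *\<^sub>R a i) + lj *\<^sub>R a j" by (simp add: lj_def algebra_simps)
        also have "\<dots> = (\<Sum>i\<in>insert j I. (l(j := lj)) i *\<^sub>R a i)"
        proof -
          have "(\<Sum>i\<in>I. (l(j := lj)) i *\<^sub>R a i) = (\<Sum>i\<in>I. l i *\<^sub>R a i)"
            using insert.hyps by (intro sum.cong) auto
          then show ?thesis using insert.hyps by (simp add: add.commute)
        qed
        finally have "c = (\<Sum>i\<in>insert j I. (l(j := lj)) i *\<^sub>R a i)" .
        moreover have "\<forall>i\<in>insert j I. 0 \<le> (l(j := lj)) i" using l lj by simp
        ultimately show False using mp[OF spec[OF insert.prems, of "l(j := lj)"]] by blast
      qed
      from insert.IH[OF this] obtain g :: "'v \<Rightarrow> real" where g: "linear g" "\<forall>i\<in>I. 0 \<le> g (P (a i))" "g (P c) < 0"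
        by (elim exE conjE)
      have "linear (\<lambda>x. g (P x))"
        by (rule linearI) (simp_all add: P_add P_scale linear_add[OF g(1)] linear_cmul[OF g(1)])
      then show ?thesis using g(2,3) Pj linear_0[OF g(1)] by (intro exI[of _ "\<lambda>x. g (P x)"]) simp
    qed
  qed
  then show thesis by (elim exE conjE) (rule that)
qed

lemma dim_image_eq_iff_inj:
  fixes f :: "'v::real_vector \<Rightarrow> 'w::real_vector"
  assumes f: "linear f" and S: "finite S" "V \<subseteq> span S"
  shows "dim (f ` V) = dim V \<longleftrightarrow> inj_on f (span V)"
proof -
  obtain B where B: "B \<subseteq> V" "independent B" "V \<subseteq> span B" "card B = dim V" by (rule real_vector.basis_exists)
  have "B \<subseteq> span S" using B(1) S(2) by blast
  then have finB: "finite B" using real_vector.independent_span_bound[OF S(1) B(2)] by blast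
  have spanB: "span V = span B"
    by (rule subset_antisym) (simp_all add: real_vector.span_mono[OF B(1)] real_vector.span_minimal[OF B(3)])
  have imB: "f ` V \<subseteq> span (f ` B)" using B(3) linear_span_image[OF f, of B] by blast
  show ?thesis
  proof
    assume eq: "dim (f ` V) = dim V"
    have "dim V \<le> card (f ` B)" using real_vector.dim_le_card[OF imB] finB eq by simp
    then have cardB: "card (f ` B) = card B" using card_image_le[OF finB, of f] B(4) by simp
    then have injB: "inj_on f B" by (rule eq_card_imp_inj_on[OF finB])
    have "independent (f ` B)"
    proof
      assume "dependent (f ` B)"
      then obtain b where b: "b \<in> f ` B" "b \<in> span (f ` B - {b})" unfolding real_vector.dependent_def by blast
      have "f ` B \<subseteq> span (f ` B - {b})"
      proof
        fix y assume "y \<in> f ` B"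
        then show "y \<in> span (f ` B - {b})" using b(2) by (cases "y = b") (auto intro: real_vector.span_base)
      qed
      then have "span (f ` B) \<subseteq> span (f ` B - {b})" by (rule real_vector.span_minimal) simp
      then have "f ` V \<subseteq> span (f ` B - {b})" using imB by blast
      then have "dim (f ` V) \<le> card (f ` B - {b})" by (rule real_vector.dim_le_card) (simp add: finB)
      moreover have "card (f ` B - {b}) < card (f ` B)" using b(1) finB by (intro psubset_card_mono) auto
      ultimately show False using eq cardB B(4) by simp
    qed
    then show "inj_on f (span V)"
      unfolding spanB by (rule real_vector.linear_inj_on_span_independent_image[OF f _ injB])
  next
    assume inj: "inj_on f (span V)"
    then have injB: "inj_on f B" unfolding spanB by (rule inj_on_subset) (rule real_vector.span_superset)
    have "independent (f ` B)"
      using inj unfolding spanB by (rule real_vector.linear_independent_injective_image[OF f B(2)])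
    then show "dim (f ` V) = dim V"
    proof (rule real_vector.dim_unique[OF image_mono[OF B(1)] imB])
      show "card (f ` B) = dim V" using card_image[OF injB] B(4) by simp
    qed
  qed
qed

lemma cone_subset_span:
  fixes T :: "'v::real_vector set"
  assumes "\<sigma> = {(\<Sum>u\<in>T. c u *\<^sub>R u) |c. \<forall>u\<in>T. 0 \<le> c u}"
  shows "\<sigma> \<subseteq> span T"
proof
  fix v assume "v \<in> \<sigma>"
  then obtain c where v: "v = (\<Sum>u\<in>T. c u *\<^sub>R u)" unfolding assms by blast
  show "v \<in> span T"
    unfolding v by (rule real_vector.span_sum) (rule real_vector.span_scale, rule real_vector.span_base)
qed

lemma linear_dual_proj: "linear (dual_proj L :: ('m \<Rightarrow> real) \<Rightarrow> 'm \<Rightarrow> real)"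
  by (rule linearI) (simp_all add: dual_proj_def fun_eq_iff scaleR_fun_def)

lemma dual_proj_N_real: "u \<in> N_real M \<Longrightarrow> L \<subseteq> M \<Longrightarrow> sublattice L K \<Longrightarrow> dual_proj L u \<in> N_real L"
  unfolding N_real_def dual_proj_def using sublattice_add[of L K] by (auto simp: subset_iff)

lemma subspace_N_real: "subspace (N_real M)"
  unfolding real_vector.subspace_def N_real_def by (auto simp: scaleR_fun_def algebra_simps)

text \<open>The restrictions of \<open>L\<close> to the generators of the cone span the space of linear forms on it, as
  no nonzero vector of the span is killed by \<open>L\<close>; approximation turns a real combination into an
  integral multiple.\<close>

lemma multiple_in_sublattice:
  assumes M: "sublattice M M" and L: "sublattice L M" and rat: "rational_cone M \<sigma>"
    and inj: "inj_on (dual_proj L) (span \<sigma>)" and m: "m \<in> M"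
  obtains N :: nat and n where "N \<ge> 1" "n \<in> L" "\<forall>u\<in>\<sigma>. u n = real N * u m"
proof -
  obtain S where S: "finite S" "S \<subseteq> N_int M" "\<sigma> = {(\<Sum>u\<in>S. c u *\<^sub>R u) |c. \<forall>u\<in>S. 0 \<le> c u}"
    using rat unfolding rational_cone_def by blast
  have S\<sigma>: "s \<in> \<sigma>" if "s \<in> S" for s unfolding S(3) by (rule cone_generator_mem[OF S(1) that])
  note LM = sublattice_subset[OF L]
  \<comment> \<open>a lattice point seen as the family of its values at the generators\<close>
  define e :: "'a \<Rightarrow> ('a \<Rightarrow> real) \<Rightarrow> real" where "e a = (\<lambda>u. if u \<in> S then u a else 0)" for a
  have "e m \<in> span (e ` L)"
  proof (rule ccontr)
    assume "e m \<notin> span (e ` L)"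
    then obtain f :: "(('a \<Rightarrow> real) \<Rightarrow> real) \<Rightarrow> real"
      where f: "linear f" "\<And>v. v \<in> e ` L \<Longrightarrow> f v = 0" "f (e m) = 1" by (rule separating_form) blast
    define \<delta> :: "('a \<Rightarrow> real) \<Rightarrow> ('a \<Rightarrow> real) \<Rightarrow> real" where "\<delta> u = (\<lambda>v. if v = u then 1 else 0)" for u
    \<comment> \<open>\<open>f\<close> is evaluation at the vector \<open>w\<close> of the span, on which \<open>L\<close> vanishes but \<open>m\<close> does not\<close>
    define w where "w = (\<Sum>u\<in>S. f (\<delta> u) *\<^sub>R u)"
    have ew: "f (e a) = w a" for a
    proof -
      have "e a = (\<Sum>u\<in>S. u a *\<^sub>R \<delta> u)"
      proof
        fix v
        have "(\<Sum>u\<in>S. u a *\<^sub>R \<delta> u) v = (\<Sum>u\<in>S. if u = v then v a else 0)"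
          unfolding fun_sum_apply by (intro sum.cong) (auto simp: scaleR_fun_def \<delta>_def)
        then show "e a v = (\<Sum>u\<in>S. u a *\<^sub>R \<delta> u) v" using S(1) by (simp add: e_def)
      qed
      then have "f (e a) = (\<Sum>u\<in>S. u a * f (\<delta> u))" by (simp add: linear_sum[OF f(1)] linear_cmul[OF f(1)])
      then show ?thesis unfolding w_def cone_sum_apply by (simp add: mult.commute)
    qed
    have "w \<in> span \<sigma>" unfolding w_def
      by (intro real_vector.span_sum real_vector.span_scale real_vector.span_base S\<sigma>)
    moreover have "0 \<in> span \<sigma>" by (rule real_vector.span_zero)
    moreover have "dual_proj L w = dual_proj L 0"
    proof
      fix a show "dual_proj L w a = dual_proj L 0 a"
        using f(2)[of "e a"] ew[of a] by (cases "a \<in> L") (simp_all add: dual_proj_def)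
    qed
    ultimately have "w = 0" using inj by (metis inj_onD)
    then show False using ew[of m] f(3) by simp
  qed
  then obtain T r where T: "finite T" "T \<subseteq> e ` L" "e m = (\<Sum>v\<in>T. r v *\<^sub>R v)"
    unfolding real_vector.span_explicit by auto
  obtain K where K: "K \<subseteq> L" "inj_on e K" "T = e ` K" using T(2) by (auto simp: subset_image_inj)
  have finK: "finite K" using T(1) K by (simp add: finite_image_iff)
  have um: "u m = (\<Sum>a\<in>K. r (e a) * u a)" if u: "u \<in> S" for u
  proof -
    have "e m u = (\<Sum>a\<in>K. r (e a) *\<^sub>R e a) u" using T(3) unfolding K(3) by (simp add: sum.reindex[OF K(2)])
    then show ?thesis using u by (simp add: fun_sum_apply scaleR_fun_def e_def)
  qed
  have SN: "dual_proj L ` S \<subseteq> N_real L" using S(2) N_int_real dual_proj_N_real[OF _ LM L] by blast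
  obtain q :: int and n where q: "q \<ge> 1" and n: "n \<in> L"
    and ap: "\<And>u. u \<in> dual_proj L ` S \<Longrightarrow> \<bar>of_int q * (\<Sum>a\<in>K. r (e a) * u a) - u n\<bar> < 1"
    using lattice_approximation[OF L finK K(1) finite_imageI[OF S(1)] SN zero_less_one, of "\<lambda>a. r (e a)"] by metis
  have Sn: "u n = of_int q * u m" if u: "u \<in> S" for u
  proof -
    have dp: "dual_proj L u a = u a" if "a \<in> L" for a using that by (simp add: dual_proj_def)
    have "(\<Sum>a\<in>K. r (e a) * dual_proj L u a) = u m" using um[OF u] K(1) dp by (simp add: subset_iff)
    then have "\<bar>of_int q * u m - u n\<bar> < 1" using ap[of "dual_proj L u"] u dp[OF n] by simp
    moreover have "of_int q * u m - u n \<in> \<int>"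
      using N_int_Ints[of u M] u S(2) m n LM by (intro Ints_diff Ints_mult) auto
    ultimately have "of_int q * u m - u n = 0" by (intro Ints_abs_less_one)
    then show ?thesis by simp
  qed
  have \<sigma>n: "u n = real (nat q) * u m" if u: "u \<in> \<sigma>" for u
  proof -
    obtain c where c: "u = (\<Sum>s\<in>S. c s *\<^sub>R s)" using u unfolding S(3) by blast
    have "u n = (\<Sum>s\<in>S. c s * (of_int q * s m))" unfolding c cone_sum_apply using Sn by (intro sum.cong) simp_all
    also have "\<dots> = of_int q * u m" unfolding c cone_sum_apply by (simp add: sum_distrib_left mult_ac)
    finally show ?thesis using q by simp
  qed
  show thesis using q n \<sigma>n by (intro that[of "nat q" n]) auto
qed

text \<open>Farkas' lemma gives a real form that is nonnegative on \<open>\<sigma>\<close> and negative at a given \<open>u\<close> outside.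
  Coordinates turn it into a real combination of lattice points, and approximation into a lattice
  point: values above \<open>-1\<close> at the integral generators are nonnegative.\<close>

lemma cone_bipolar:
  assumes lat: "lattice_set M" and rat: "rational_cone M \<sigma>" and u: "u \<in> N_real M"
    and pos: "\<And>m. m \<in> cone_monoid M \<sigma> \<Longrightarrow> 0 \<le> u m"
  shows "u \<in> \<sigma>"
proof (rule ccontr)
  assume "u \<notin> \<sigma>"
  obtain S where S: "finite S" "S \<subseteq> N_int M" "\<sigma> = {(\<Sum>u\<in>S. c u *\<^sub>R u) |c. \<forall>u\<in>S. 0 \<le> c u}"
    using rat unfolding rational_cone_def by blast
  have "\<forall>l. (\<forall>s\<in>S. 0 \<le> l s) \<longrightarrow> u \<noteq> (\<Sum>s\<in>S. l s *\<^sub>R s)" using \<open>u \<notin> \<sigma>\<close> unfolding S(3) by blast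
  then obtain f :: "('a \<Rightarrow> real) \<Rightarrow> real" where f: "linear f" "\<forall>s\<in>S. 0 \<le> f s" "f u < 0"
    by (rule farkas[OF S(1)])
  obtain d :: nat and e co where e': "\<forall>i<d. e i \<in> M" and M: "sublattice M M"
    and gen': "\<forall>a\<in>M. a = (\<Sum>i<d. zmul (co a i) (e i))"
    and co': "\<forall>j<d. \<forall>i. co (e j) i = (if i = j then 1 else 0)"
    by (rule lattice_coordinates[OF lat])
  note e = mp[OF spec[OF e']] and gen = bspec[OF gen'] and co = spec[OF mp[OF spec[OF co']]]
  have inj: "inj_on e {..<d}"
  proof (rule inj_onI)
    fix i j assume ij: "i \<in> {..<d}" "j \<in> {..<d}" "e i = e j"
    then have "co (e i) i = co (e j) i" by simp
    then show "i = j" using co[of i i] co[of j i] ij by (simp split: if_splits)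
  qed
  \<comment> \<open>the dual basis of \<open>N \<otimes> \<real>\<close>\<close>
  define es where "es i = (\<lambda>a. if a \<in> M then real_of_int (co a i) else 0)" for i
  have expand: "w = (\<Sum>i<d. w (e i) *\<^sub>R es i)" if w: "w \<in> N_real M" for w
  proof
    fix a
    show "w a = (\<Sum>i<d. w (e i) *\<^sub>R es i) a"
    proof (cases "a \<in> M")
      case True
      have "w a = w (\<Sum>i<d. zmul (co a i) (e i))" using gen[OF True] by simp
      also have "\<dots> = (\<Sum>i<d. w (zmul (co a i) (e i)))"
        using e by (intro N_real_sum[OF w M] sublattice_zmul[OF M]) auto
      also have "\<dots> = (\<Sum>i<d. of_int (co a i) * w (e i))"
        using e by (intro sum.cong refl N_real_zmul[OF w M]) auto
      finally show ?thesis using True by (simp add: fun_sum_apply scaleR_fun_def es_def mult.commute)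
    next
      case False
      then have "w a = 0" using w unfolding N_real_def by blast
      then show ?thesis using False by (simp add: fun_sum_apply scaleR_fun_def es_def)
    qed
  qed
  define v where "v a = f (es (inv_into {..<d} e a))" for a
  have fv: "f w = (\<Sum>a\<in>e ` {..<d}. v a * w a)" if w: "w \<in> N_real M" for w
  proof -
    have "f w = f (\<Sum>i<d. w (e i) *\<^sub>R es i)" using expand[OF w] by (rule arg_cong)
    also have "\<dots> = (\<Sum>i<d. w (e i) * f (es i))" by (simp add: linear_sum[OF f(1)] linear_cmul[OF f(1)])
    also have "\<dots> = (\<Sum>i<d. v (e i) * w (e i))"
      using inj by (intro sum.cong) (simp_all add: v_def mult.commute)
    also have "\<dots> = (\<Sum>a\<in>e ` {..<d}. v a * w a)" by (simp add: sum.reindex[OF inj])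
    finally show ?thesis .
  qed
  define \<epsilon> where "\<epsilon> = min 1 (- f u)"
  have eps: "0 < \<epsilon>" "\<epsilon> \<le> 1" "\<epsilon> \<le> - f u" using f(3) by (simp_all add: \<epsilon>_def)
  have SN: "insert u S \<subseteq> N_real M" using u S(2) N_int_real by blast
  have KM: "e ` {..<d} \<subseteq> M" using e by auto
  obtain q :: int and m where q: "q \<ge> 1" and m: "m \<in> M"
    and ap: "\<And>w. w \<in> insert u S \<Longrightarrow> \<bar>of_int q * (\<Sum>a\<in>e ` {..<d}. v a * w a) - w m\<bar> < \<epsilon>"
  proof -
    have "finite (e ` {..<d})" "finite (insert u S)" using S(1) by simp_all
    then show thesis by (rule lattice_approximation[OF M _ KM _ SN eps(1), of v]) (rule that)
  qed
  have ap': "\<bar>of_int q * f w - w m\<bar> < \<epsilon>" if "w \<in> insert u S" for w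
  proof -
    have "w \<in> N_real M" using SN that by blast
    then show ?thesis using ap[OF that] fv[of w] by simp
  qed
  have sm: "0 \<le> s m" if s: "s \<in> S" for s
  proof -
    have "0 \<le> of_int q * f s" using q f(2) s by (intro mult_nonneg_nonneg) auto
    then have "- 1 < s m" using ap'[of s] s eps(2) by (simp add: abs_less_iff)
    moreover have "s m \<in> \<int>" using N_int_Ints m s S(2) by blast
    ultimately show ?thesis by (auto elim!: Ints_cases)
  qed
  have "m \<in> cone_monoid M \<sigma>"
    unfolding cone_monoid_def
  proof (intro CollectI conjI m ballI)
    fix w assume "w \<in> \<sigma>"
    then obtain c where c: "w = (\<Sum>s\<in>S. c s *\<^sub>R s)" "\<forall>s\<in>S. 0 \<le> c s" unfolding S(3) by blast
    show "0 \<le> w m" unfolding c(1) cone_sum_apply using c(2) sm by (intro sum_nonneg mult_nonneg_nonneg) simp_all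
  qed
  then have "0 \<le> u m" by (rule pos)
  moreover have "of_int q * f u \<le> 1 * f u" using q f(3) by (intro mult_right_mono_neg) auto
  ultimately show False using ap'[of u] eps(3) by (simp add: abs_less_iff)
qed

section \<open>Orbits and dimensions\<close>

context toric_quotient
begin

text \<open>Some multiple \<open>k m\<close> agrees with \<open>n \<in> L\<close> on \<open>\<sigma>\<close>. Then \<open>n - m\<close> lies in \<open>S \<sigma>\<close> and complements \<open>m\<close> to an
  element of \<open>L\<close>, which differs from \<open>k m\<close> by a unit and so is in the support of \<open>\<phi>\<close>.\<close>

lemma polystable_if_injective:
  assumes s: "\<sigma> \<in> \<Delta>" and inj: "inj_on (dual_proj L) (span \<sigma>)" and phi: "\<phi> \<in> spec_points (S \<sigma>)"
  shows "monoid_quotient.polystable L (S \<sigma>) \<phi>"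
proof -
  interpret q: monoid_quotient M L "S \<sigma>" by (rule quotient[OF s])
  note rat = src.rat[OF in0[OF s]]
  have N: "u \<in> N_real M" if "u \<in> \<sigma>" for u using rational_cone_subset[OF rat] that by blast
  show ?thesis unfolding q.polystable_def
  proof (intro conjI ballI impI phi)
    fix m assume m: "m \<in> S \<sigma>" "ev \<phi> m \<noteq> 0"
    have mM: "m \<in> M" using m(1) SM by blast
    obtain k :: nat and n where k: "k \<ge> 1" and n: "n \<in> L" and kn: "\<forall>u\<in>\<sigma>. u n = real k * u m"
      by (rule multiple_in_sublattice[OF src.sub sub rat inj mM])
    have nM: "n \<in> M" using n LM by blast
    note zM = sublattice_zmul[OF src.sub mM]
    have u1: "u (n - m) = (real k - 1) * u m" and u2: "u (n - zmul (int k) m) = 0" if "u \<in> \<sigma>" for u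
      using kn that N_real_diff[OF N[OF that] src.sub nM mM] N_real_diff[OF N[OF that] src.sub nM zM]
        N_real_zmul[OF N[OF that] src.sub mM] by (simp_all add: left_diff_distrib)
    have um: "0 \<le> u m" if "u \<in> \<sigma>" for u using m(1) that by (simp add: cone_monoid_def)
    have 1: "n - m \<in> S \<sigma>"
      unfolding cone_monoid_def
    proof (intro CollectI conjI ballI)
      show "n - m \<in> M" by (rule sublattice_diff[OF src.sub nM mM])
      show "0 \<le> u (n - m)" if "u \<in> \<sigma>" for u
        unfolding u1[OF that] using k um[OF that] by (intro mult_nonneg_nonneg) simp_all
    qed
    let ?r = "n - zmul (int k) m"
    have rM: "?r \<in> M" by (rule sublattice_diff[OF src.sub nM zM])
    have 2: "?r \<in> S \<sigma>" "- ?r \<in> S \<sigma>"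
    proof -
      have u3: "u (- ?r) = 0" if "u \<in> \<sigma>" for u using N_real_minus[OF N[OF that] src.sub rM] u2[OF that] by simp
      show "?r \<in> S \<sigma>" unfolding cone_monoid_def
        by (intro CollectI conjI ballI rM eq_refl[OF u2[symmetric]])
      show "- ?r \<in> S \<sigma>" unfolding cone_monoid_def
        by (intro CollectI conjI ballI sublattice_minus[OF src.sub rM] eq_refl[OF u3[symmetric]])
    qed
    have "ev \<phi> (?r + - ?r) = ev \<phi> ?r * ev \<phi> (- ?r)" by (rule ev_add[OF phi 2])
    then have "ev \<phi> ?r \<noteq> 0" using ev_zero[OF phi] by auto
    moreover have "ev \<phi> (?r + zmul (int k) m) = ev \<phi> ?r * ev \<phi> m ^ k"
      unfolding ev_add[OF phi 2(1) submonoid_zmul[OF monS[OF s] m(1)]] ev_zmul[OF phi monS[OF s] m(1)] ..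
    ultimately have "ev \<phi> n \<noteq> 0" using m(2) by simp
    then show "\<exists>n\<in>S \<sigma>. m + n \<in> L \<and> ev \<phi> (m + n) \<noteq> 0" using n by (intro bexI[OF _ 1]) simp
  qed
qed

lemma orbits_if_injective:
  assumes inj: "\<forall>\<sigma>\<in>\<Delta>. inj_on (dual_proj L) (span \<sigma>)"
    and x: "x \<in> U" "x' \<in> U" "quot x = quot x'"
  shows "\<exists>g\<in>G. x' = torus_act g x"
proof -
  obtain \<sigma> \<phi> where s: "\<sigma> \<in> \<Delta>" and phi: "\<phi> \<in> spec_points (S \<sigma>)" and xe: "x = ch \<sigma> \<phi>" by (rule U_cases[OF x(1)])
  obtain \<psi> where psi: "\<psi> \<in> spec_points (S \<sigma>)" "x' = ch \<sigma> \<psi>" "res \<sigma> \<psi> = res \<sigma> \<phi>"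
    by (rule fibre_in_chart[OF s phi x(2)]) (use x(3) xe in simp)
  interpret q: monoid_quotient M L "S \<sigma>" by (rule quotient[OF s])
  have "restrict_point (S \<sigma> \<inter> L) \<phi> = restrict_point (S \<sigma> \<inter> L) \<psi>" using psi(3) by (simp add: res_def)
  then obtain t where t: "t \<in> G" "\<psi> = (\<lambda>f. \<phi> (twist t f))"
    by (rule q.polystable_orbit[OF polystable_if_injective[OF s bspec[OF inj s] phi] polystable_if_injective[OF s bspec[OF inj s] psi(1)]])
  then have "x' = torus_act t x" unfolding psi(2) xe by (simp add: act_chart[OF s phi])
  then show ?thesis using t(1) by blast
qed

text \<open>The distinguished point of the face of \<open>\<sigma>\<close> with \<open>u\<close> in its relative interior.\<close>

definition face_point :: "('m \<Rightarrow> real) set \<Rightarrow> ('m \<Rightarrow> real) \<Rightarrow> 'm alg_point" where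
  "face_point \<sigma> u = mpoint (S \<sigma>) (\<lambda>m. if u m = 0 then 1 else 0)"

lemma face_point_spec:
  assumes s: "\<sigma> \<in> \<Delta>" and u: "u \<in> \<sigma>"
  shows "face_point \<sigma> u \<in> spec_points (S \<sigma>)"
  unfolding face_point_def
proof (rule mpoint_spec[OF monS[OF s]])
  have N: "u \<in> N_real M" using rational_cone_subset[OF src.rat[OF in0[OF s]]] u by blast
  show "(if u 0 = 0 then 1 else 0 :: complex) = 1" by (simp add: N_real_zero[OF N src.sub])
  fix a b assume ab: "a \<in> S \<sigma>" "b \<in> S \<sigma>"
  have "u (a + b) = u a + u b" using ab SM by (intro N_real_add[OF N src.sub]) auto
  moreover have "0 \<le> u a" "0 \<le> u b" using ab u by (simp_all add: cone_monoid_def)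
  ultimately show "(if u (a + b) = 0 then 1 else 0 :: complex) = (if u a = 0 then 1 else 0) * (if u b = 0 then 1 else 0)"
    by auto
qed

text \<open>If a nonzero vector \<open>w\<close> of the span of \<open>\<sigma>\<close> is killed by \<open>\<pi>\<close>, move from the interior point
  \<open>u\<^sub>0\<close> along \<open>w\<close> to a boundary point \<open>u\<^sub>1\<close>. The distinguished points of the faces
  of \<open>u\<^sub>0\<close> and of \<open>u\<^sub>1\<close> have the same image, since \<open>\<pi> u\<^sub>0 = \<pi> u\<^sub>1\<close>, but different supports.\<close>

lemma injective_if_orbits:
  assumes orb: "\<forall>x\<in>U. \<forall>x'\<in>U. quot x = quot x' \<longrightarrow> (\<exists>g\<in>G. x' = torus_act g x)"
    and s: "\<sigma> \<in> \<Delta>"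
  shows "inj_on (dual_proj L) (span \<sigma>)"
  unfolding real_vector.linear_inj_on_iff_eq_0[OF linear_dual_proj real_vector.subspace_span]
proof (intro ballI impI)
  fix w assume w: "w \<in> span \<sigma>" "dual_proj L w = 0"
  note rat = src.rat[OF in0[OF s]]
  have sc: "\<sigma> \<inter> uminus ` \<sigma> = {0}" using fan in0[OF s] by (simp add: fan_def strongly_convex_def)
  obtain T where T: "finite T" "T \<subseteq> N_int M" "\<sigma> = {(\<Sum>u\<in>T. c u *\<^sub>R u) |c. \<forall>u\<in>T. 0 \<le> c u}"
    using rat unfolding rational_cone_def by blast
  obtain n :: nat and g where g: "\<And>i. i < n \<Longrightarrow> g i \<in> S \<sigma>"
    and gen: "\<And>m. m \<in> S \<sigma> \<Longrightarrow> \<exists>c :: nat \<Rightarrow> nat. m = (\<Sum>i<n. zmul (int (c i)) (g i))"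
    by (rule gordan[OF lattice src.sub rat]) blast
  have gM: "g i \<in> M" if "i < n" for i using g[OF that] SM by blast
  have mem: "u \<in> \<sigma>" if u: "u \<in> N_real M" and pos: "\<And>i. i < n \<Longrightarrow> 0 \<le> u (g i)" for u
  proof (rule cone_bipolar[OF lattice rat u])
    fix m assume "m \<in> cone_monoid M \<sigma>"
    then obtain c :: "nat \<Rightarrow> nat" where c: "m = (\<Sum>i<n. zmul (int (c i)) (g i))" using gen by blast
    have "u m = (\<Sum>i<n. u (zmul (int (c i)) (g i)))"
      unfolding c using gM by (intro N_real_sum[OF u src.sub] sublattice_zmul[OF src.sub]) auto
    also have "\<dots> = (\<Sum>i<n. real (c i) * u (g i))"
      using gM by (intro sum.cong refl) (simp add: N_real_zmul[OF u src.sub])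
    also have "\<dots> \<ge> 0" using pos by (intro sum_nonneg mult_nonneg_nonneg) auto
    finally show "0 \<le> u m" .
  qed
  have T\<sigma>: "t \<in> \<sigma>" if "t \<in> T" for t unfolding T(3) by (rule cone_generator_mem[OF T(1) that])
  have \<sigma>N: "\<sigma> \<subseteq> N_real M" by (rule rational_cone_subset[OF rat])
  have spanN: "span \<sigma> \<subseteq> N_real M" by (rule real_vector.span_minimal[OF \<sigma>N subspace_N_real])
  have "\<sigma> \<subseteq> span T" by (rule cone_subset_span[OF T(3)])
  then have span\<sigma>: "span \<sigma> \<subseteq> span T" by (rule real_vector.span_minimal) simp
  \<comment> \<open>an interior point: an element of the dual cone that vanishes at \<open>u0\<close> vanishes on \<open>\<sigma>\<close>\<close>
  define u0 where "u0 = (\<Sum>t\<in>T. 1 *\<^sub>R t)"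
  have u0: "u0 \<in> \<sigma>" unfolding u0_def T(3) by (rule CollectI, rule exI[of _ "\<lambda>_. 1"]) simp
  have Tg: "0 \<le> t (g i)" if "t \<in> T" "i < n" for t i using g[OF that(2)] T\<sigma>[OF that(1)] by (simp add: cone_monoid_def)
  have u0_zero: "v (g i) = 0" if i: "i < n" "u0 (g i) = 0" and v: "v \<in> span \<sigma>" for v i
  proof -
    have "(\<Sum>t\<in>T. 1 * t (g i)) = 0" using i(2) unfolding u0_def cone_sum_apply .
    then have t0: "\<forall>t\<in>T. t (g i) = 0" using sum_nonneg_eq_0_iff[OF T(1), of "\<lambda>t. t (g i)"] Tg[OF _ i(1)] by simp
    have lin: "linear (\<lambda>v :: 'm \<Rightarrow> real. v (g i))" by (rule linearI) (simp_all add: scaleR_fun_def)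
    show ?thesis
    proof (rule real_vector.linear_eq_0_on_span[OF lin])
      show "v \<in> span T" using v span\<sigma> by blast
    qed (rule bspec[OF t0])
  qed
  have key: "False" if w: "w \<in> span \<sigma>" "dual_proj L w = 0" and neg: "\<exists>i<n. w (g i) < 0" for w
  proof -
    \<comment> \<open>the facets towards which \<open>w\<close> points; the line \<open>u0 + t w\<close> reaches the one of \<open>i\<close> at time \<open>ra i\<close>, so it leaves \<open>\<sigma>\<close> at the minimum \<open>r\<close>\<close>
    define J where "J = {i. i < n \<and> w (g i) < 0}"
    have J: "finite J" "J \<noteq> {}" using neg by (auto simp: J_def)
    define ra where "ra i = u0 (g i) / (- w (g i))" for i
    define r where "r = Min (ra ` J)"
    have "r \<in> ra ` J" unfolding r_def using J by (intro Min_in) auto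
    then obtain j where j: "j \<in> J" "r = ra j" by blast
    have u0g: "0 \<le> u0 (g i)" if "i < n" for i using g[OF that] u0 by (simp add: cone_monoid_def)
    have r0: "0 \<le> r" unfolding j(2) ra_def using j(1) u0g by (intro divide_nonneg_nonneg) (auto simp: J_def)
    define u1 where "u1 = u0 + r *\<^sub>R w"
    have u1a: "u1 a = u0 a + r * w a" for a by (simp add: u1_def scaleR_fun_def)
    have u1: "u1 \<in> \<sigma>"
    proof (rule mem)
      show "u1 \<in> N_real M" unfolding u1_def
        using subspace_N_real[of M] u0 \<sigma>N w(1) spanN
        by (intro real_vector.subspace_add real_vector.subspace_scale) auto
      fix i assume i: "i < n"
      show "0 \<le> u1 (g i)"
      proof (cases "w (g i) < 0")
        case True
        have "r \<le> ra i" unfolding r_def using J(1) True i by (intro Min_le) (auto simp: J_def)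
        moreover have "0 < - w (g i)" using True by simp
        ultimately have "r * (- w (g i)) \<le> u0 (g i)"
          unfolding ra_def using pos_le_divide_eq[of "- w (g i)" r "u0 (g i)"] by blast
        then show ?thesis by (simp add: u1a)
      next
        case False
        then show ?thesis using u0g[OF i] r0 by (simp add: u1a)
      qed
    qed
    have jn: "j < n" and wj: "w (g j) < 0" using j(1) by (simp_all add: J_def)
    have u1j: "u1 (g j) = 0" using wj unfolding u1a j(2) ra_def by (simp add: field_simps)
    have u0j: "u0 (g j) \<noteq> 0" using u0_zero[OF jn _ w(1)] wj by auto
    have eqL: "u1 a = u0 a" if "a \<in> L" for a using fun_cong[OF w(2), of a] that by (simp add: u1a dual_proj_def)
    note p0 = face_point_spec[OF s u0] and p1 = face_point_spec[OF s u1]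
    have "res \<sigma> (face_point \<sigma> u0) = res \<sigma> (face_point \<sigma> u1)"
    proof (rule spec_eqI[OF res_spec[OF s p0] res_spec[OF s p1] monSL[OF s]])
      fix m assume m: "m \<in> S \<sigma> \<inter> L"
      then show "ev (res \<sigma> (face_point \<sigma> u0)) m = ev (res \<sigma> (face_point \<sigma> u1)) m"
        unfolding res_def ev_restrict[OF m] face_point_def using eqL[of m] by (simp add: ev_mpoint)
    qed
    then have "quot (ch \<sigma> (face_point \<sigma> u0)) = quot (ch \<sigma> (face_point \<sigma> u1))"
      using quot_eq_iff[OF s p0 p1] by blast
    from mp[OF bspec[OF bspec[OF orb chU[OF s p0]] chU[OF s p1]] this]
    obtain t where t: "t \<in> G" "ch \<sigma> (face_point \<sigma> u1) = torus_act t (ch \<sigma> (face_point \<sigma> u0))" by blast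
    have "face_point \<sigma> u1 = (\<lambda>f. face_point \<sigma> u0 (twist t f))"
      using t(2) unfolding act_chart[OF s p0 t(1)] by (rule src.chart_inj[OF in0[OF s] p1 twist_S[OF s p0 t(1)]])
    then have "ev (face_point \<sigma> u1) (g j) = t (g j) * ev (face_point \<sigma> u0) (g j)"
      using ev_twist[OF p0 monS[OF s] SM, of t "g j"] t(1) g[OF jn] by (simp add: quotient_group_def)
    then show False using u1j u0j by (simp add: face_point_def ev_mpoint[OF g[OF jn]])
  qed
  have neg_w: "- w \<in> span \<sigma>" "dual_proj L (- w) = 0"
    using real_vector.span_neg[OF w(1)] linear_neg[OF linear_dual_proj[of L], of w] w(2) by simp_all
  have "0 \<le> w (g i)" if "i < n" for i using key[OF w] that by (meson not_less)
  moreover have "w (g i) \<le> 0" if "i < n" for i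
  proof (rule ccontr)
    assume "\<not> w (g i) \<le> 0"
    then have "(- w) (g i) < 0" by simp
    then show False using key[OF neg_w] that by blast
  qed
  ultimately have wg: "w (g i) = 0" if "i < n" for i using that by (meson order_antisym)
  have "w \<in> \<sigma>" using spanN w(1) wg by (intro mem) auto
  moreover have "- w \<in> \<sigma>" using spanN neg_w(1) wg by (intro mem) auto
  ultimately have "w \<in> \<sigma> \<inter> uminus ` \<sigma>" by (metis IntI imageI minus_minus)
  then show "w = 0" unfolding sc by simp
qed

lemma geometric_quotient_iff_dim:
  "geometric_quotient G torus_act X Y quot \<longleftrightarrow> (\<forall>\<sigma>\<in>\<Delta>. dim (\<pi> \<sigma>) = dim \<sigma>)"
proof -
  have dim: "dim (\<pi> \<sigma>) = dim \<sigma> \<longleftrightarrow> inj_on (dual_proj L) (span \<sigma>)" if s: "\<sigma> \<in> \<Delta>" for \<sigma>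
  proof -
    obtain T where T: "finite T" "\<sigma> = {(\<Sum>u\<in>T. c u *\<^sub>R u) |c. \<forall>u\<in>T. 0 \<le> c u}"
      using src.rat[OF in0[OF s]] unfolding rational_cone_def by blast
    have "\<sigma> \<subseteq> span T" by (rule cone_subset_span[OF T(2)])
    then show ?thesis by (rule dim_image_eq_iff_inj[OF linear_dual_proj T(1)])
  qed
  show ?thesis unfolding geometric_quotient_iff_orbits
  proof
    assume orb: "\<forall>x\<in>U. \<forall>x'\<in>U. quot x = quot x' \<longrightarrow> (\<exists>g\<in>G. x' = torus_act g x)"
    show "\<forall>\<sigma>\<in>\<Delta>. dim (\<pi> \<sigma>) = dim \<sigma>"
    proof
      fix \<sigma> assume s: "\<sigma> \<in> \<Delta>"
      show "dim (\<pi> \<sigma>) = dim \<sigma>" unfolding dim[OF s] by (rule injective_if_orbits[OF orb s])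
    qed
  next
    assume "\<forall>\<sigma>\<in>\<Delta>. dim (\<pi> \<sigma>) = dim \<sigma>"
    then have inj: "\<forall>\<sigma>\<in>\<Delta>. inj_on (dual_proj L) (span \<sigma>)" using dim by simp
    show "\<forall>x\<in>U. \<forall>x'\<in>U. quot x = quot x' \<longrightarrow> (\<exists>g\<in>G. x' = torus_act g x)"
      by (intro ballI impI orbits_if_injective[OF inj])
  qed
qed

end

section \<open>Uniqueness of categorical quotients\<close>

text \<open>The universal property speaks of test spaces of one fixed type only; every prevariety is
  isomorphic to one of these.\<close>

lemma
  assumes cq: "categorical_quotient G act X Y q" and Z: "prevariety (Z :: 'z fspace)"
  shows categorical_quotient_factor:
      "morphism X Z f \<Longrightarrow> invariant_on G act (pts X) f \<Longrightarrow> \<exists>h. morphism Y Z h \<and> (\<forall>x\<in>pts X. h (q x) = f x)"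
    and categorical_quotient_cancel:
      "morphism Y Z h \<Longrightarrow> morphism Y Z h' \<Longrightarrow> (\<forall>x\<in>pts X. h (q x) = h' (q x)) \<Longrightarrow> y \<in> pts Y \<Longrightarrow> h y = h' y"
proof -
  have q: "morphism X Y q" and qinv: "invariant_on G act (pts X) q" and sY: "space_with_functions Y"
    using cq by (simp_all add: categorical_quotient_def prevariety_def)
  have univ: "\<exists>!h. h \<in> extensional (pts Y) \<and> morphism Y Z' h \<and> (\<forall>x\<in>pts X. h (q x) = f x)"
    if "prevariety Z'" "morphism X Z' f" "invariant_on G act (pts X) f" for Z' :: "test_point fspace" and f
    using cq that unfolding categorical_quotient_def by simp
  obtain Z' :: "test_point fspace" and \<alpha> \<beta> where Z': "prevariety Z'" and \<alpha>: "morphism Z Z' \<alpha>" and \<beta>: "morphism Z' Z \<beta>"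
    and \<beta>\<alpha>: "\<And>z. z \<in> pts Z \<Longrightarrow> \<beta> (\<alpha> z) = z" and \<alpha>\<beta>: "\<And>z. z \<in> pts Z' \<Longrightarrow> \<alpha> (\<beta> z) = z"
    by (rule prevariety_test_model[OF Z]) blast
  show "\<exists>h. morphism Y Z h \<and> (\<forall>x\<in>pts X. h (q x) = f x)"
    if f: "morphism X Z f" and inv: "invariant_on G act (pts X) f"
  proof -
    have "invariant_on G act (pts X) (\<lambda>x. \<alpha> (f x))" using inv by (simp add: invariant_on_def)
    from ex1_implies_ex[OF univ[OF Z' morphism_comp[OF f \<alpha>] this]] obtain h
      where h: "morphism Y Z' h" "\<forall>x\<in>pts X. h (q x) = \<alpha> (f x)" by (elim exE conjE)
    show ?thesis
    proof (intro exI[of _ "\<lambda>y. \<beta> (h y)"] conjI ballI)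
      show "morphism Y Z (\<lambda>y. \<beta> (h y))" by (rule morphism_comp[OF h(1) \<beta>])
      show "\<beta> (h (q x)) = f x" if "x \<in> pts X" for x using bspec[OF h(2) that] \<beta>\<alpha>[OF morphism_pts[OF f that]] by simp
    qed
  qed
  show "h y = h' y" if h: "morphism Y Z h" and h': "morphism Y Z h'" and eq: "\<forall>x\<in>pts X. h (q x) = h' (q x)"
    and y: "y \<in> pts Y"
  proof -
    let ?F = "\<lambda>x. \<alpha> (h (q x))"
    have "invariant_on G act (pts X) ?F" using qinv by (simp add: invariant_on_def)
    note u = univ[OF Z' morphism_comp[OF q morphism_comp[OF h \<alpha>]] this]
    have mem: "restrict (\<lambda>y. \<alpha> (k y)) (pts Y) \<in> extensional (pts Y) \<and>
        morphism Y Z' (restrict (\<lambda>y. \<alpha> (k y)) (pts Y)) \<and>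
        (\<forall>x\<in>pts X. restrict (\<lambda>y. \<alpha> (k y)) (pts Y) (q x) = ?F x)"
      if k: "morphism Y Z k" "\<forall>x\<in>pts X. h (q x) = k (q x)" for k
    proof (intro conjI ballI)
      show "morphism Y Z' (restrict (\<lambda>y. \<alpha> (k y)) (pts Y))"
        by (rule morphism_cong[OF morphism_comp[OF k(1) \<alpha>] sY]) simp
      show "restrict (\<lambda>y. \<alpha> (k y)) (pts Y) (q x) = ?F x" if "x \<in> pts X" for x
        using bspec[OF k(2) that] morphism_pts[OF q that] by simp
    qed simp
    have "restrict (\<lambda>y. \<alpha> (h y)) (pts Y) = restrict (\<lambda>y. \<alpha> (h' y)) (pts Y)"
      by (rule ex1E[OF u]) (metis mem[OF h] mem[OF h' eq])
    then have "\<alpha> (h y) = \<alpha> (h' y)" using y by (metis restrict_apply')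
    then have "\<beta> (\<alpha> (h y)) = \<beta> (\<alpha> (h' y))" by (rule arg_cong)
    then show ?thesis unfolding \<beta>\<alpha>[OF morphism_pts[OF h y]] \<beta>\<alpha>[OF morphism_pts[OF h' y]] .
  qed
qed

lemma categorical_quotient_unique:
  assumes cq: "categorical_quotient G act X Y q" and cq': "categorical_quotient G act X Y' q'"
  obtains f g where "morphism Y Y' f" "morphism Y' Y g"
    "\<forall>x\<in>pts X. f (q x) = q' x" "\<forall>x\<in>pts X. g (q' x) = q x" "\<forall>y\<in>pts Y. g (f y) = y" "\<forall>y\<in>pts Y'. f (g y) = y"
proof -
  have Y: "prevariety Y" "morphism X Y q" "invariant_on G act (pts X) q"
    and Y': "prevariety Y'" "morphism X Y' q'" "invariant_on G act (pts X) q'"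
    using cq cq' by (simp_all add: categorical_quotient_def)
  obtain f where f: "morphism Y Y' f" "\<forall>x\<in>pts X. f (q x) = q' x"
    using categorical_quotient_factor[OF cq Y'] by (elim exE conjE)
  obtain g where g: "morphism Y' Y g" "\<forall>x\<in>pts X. g (q' x) = q x"
    using categorical_quotient_factor[OF cq' Y] by (elim exE conjE)
  have id: "morphism W W (\<lambda>y. y)" if "space_with_functions W" for W :: "'w fspace"
  proof (rule morphismI)
    have eq: "{x \<in> pts W. x \<in> V} = V" if "openin (fs_top W) V" for V using openin_subset[OF that] by blast
    show "openin (fs_top W) {x \<in> pts W. x \<in> V}" if "openin (fs_top W) V" for V using that eq[OF that] by simp
    show "(\<lambda>x. h x) \<in> fs_reg W {x \<in> pts W. x \<in> V}" if "openin (fs_top W) V" "h \<in> fs_reg W V" for V h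
      using that eq[OF that(1)] by simp
  qed
  have sw: "space_with_functions Y" "space_with_functions Y'" using Y(1) Y'(1) by (simp_all add: prevariety_def)
  have "g (f y) = y" if "y \<in> pts Y" for y
    by (rule categorical_quotient_cancel[OF cq Y(1) morphism_comp[OF f(1) g(1)] id[OF sw(1)] _ that]) (simp add: f(2) g(2))
  moreover have "f (g y) = y" if "y \<in> pts Y'" for y
    by (rule categorical_quotient_cancel[OF cq' Y'(1) morphism_comp[OF g(1) f(1)] id[OF sw(2)] _ that]) (simp add: f(2) g(2))
  ultimately show thesis using f g by (intro that[of f g]) simp_all
qed

lemma geometric_quotient_isomorphic:
  assumes gq: "geometric_quotient G act X Y q" and Y': "prevariety Y'" "morphism X Y' q'" "invariant_on G act (pts X) q'"
    and f: "morphism Y Y' f" and g: "morphism Y' Y g"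
    and fq: "\<forall>x\<in>pts X. f (q x) = q' x" and gq': "\<forall>x\<in>pts X. g (q' x) = q x"
    and gf: "\<forall>y\<in>pts Y. g (f y) = y" and fg: "\<forall>y\<in>pts Y'. f (g y) = y"
  shows "geometric_quotient G act X Y' q'"
proof -
  note gq = gq[unfolded geometric_quotient_def]
  note X = conjunct1[OF gq] and q = conjunct1[OF conjunct2[OF conjunct2[OF gq]]]
  note rest = conjunct2[OF conjunct2[OF conjunct2[OF conjunct2[OF gq]]]]
  note im = conjunct1[OF rest] and fib = conjunct1[OF conjunct2[OF rest]]
    and subm = conjunct1[OF conjunct2[OF conjunct2[OF rest]]] and desc = conjunct2[OF conjunct2[OF conjunct2[OF rest]]]
  have qY: "q x \<in> pts Y" and qY': "q' x \<in> pts Y'" if "x \<in> pts X" for x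
    using morphism_pts[OF q that] morphism_pts[OF Y'(2) that] .
  have qiff: "q' x = q' x' \<longleftrightarrow> q x = q x'" if "x \<in> pts X" "x' \<in> pts X" for x x'
    using bspec[OF fq that(1)] bspec[OF fq that(2)] bspec[OF gq' that(1)] bspec[OF gq' that(2)] by metis
  have fib': "q' x = q' x' \<longleftrightarrow> (\<exists>t\<in>G. x' = act t x)" if "x \<in> pts X" "x' \<in> pts X" for x x'
    unfolding qiff[OF that] by (rule bspec[OF bspec[OF fib that(1)] that(2)])
  have pre: "{x \<in> pts X. q x \<in> {y \<in> pts Y. f y \<in> V}} = {x \<in> pts X. q' x \<in> V}" for V using fq qY by auto
  show ?thesis unfolding geometric_quotient_def
  proof (intro conjI allI impI ballI X Y' fib')
    show "q' ` pts X = pts Y'"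
    proof
      show "q' ` pts X \<subseteq> pts Y'" using qY' by blast
      show "pts Y' \<subseteq> q' ` pts X"
      proof
        fix y assume y: "y \<in> pts Y'"
        have "g y \<in> q ` pts X" unfolding im by (rule morphism_pts[OF g y])
        then obtain x where x: "x \<in> pts X" "g y = q x" by (elim imageE)
        have "y = q' x" using bspec[OF fg y] bspec[OF fq x(1)] x(2) by simp
        then show "y \<in> q' ` pts X" using x(1) by blast
      qed
    qed
    fix V
    show "openin (fs_top Y') V \<longleftrightarrow> openin (fs_top X) {x \<in> pts X. q' x \<in> V}" if V: "V \<subseteq> pts Y'"
    proof
      show "openin (fs_top X) {x \<in> pts X. q' x \<in> V}" if "openin (fs_top Y') V" by (rule morphism_open[OF Y'(2) that])
      assume op: "openin (fs_top X) {x \<in> pts X. q' x \<in> V}"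
      have "{y \<in> pts Y. f y \<in> V} \<subseteq> pts Y" by blast
      from spec[OF subm] this op have "openin (fs_top Y) {y \<in> pts Y. f y \<in> V}" unfolding pre[symmetric, of V] by blast
      from morphism_open[OF g this] have "openin (fs_top Y') {y \<in> pts Y'. g y \<in> {y \<in> pts Y. f y \<in> V}}" .
      moreover have "{y \<in> pts Y'. g y \<in> {y \<in> pts Y. f y \<in> V}} = V" using V fg morphism_pts[OF g] by auto
      ultimately show "openin (fs_top Y') V" by simp
    qed
    fix k assume V: "openin (fs_top Y') V" and k: "k \<in> fs_reg X {x \<in> pts X. q' x \<in> V}"
      and kinv: "invariant_on G act {x \<in> pts X. q' x \<in> V} k"
    note oV = morphism_open[OF f V]
    from mp[OF bspec[OF mp[OF spec[OF desc] oV] k[folded pre]] kinv[folded pre]]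
    obtain h where h: "h \<in> fs_reg Y {y \<in> pts Y. f y \<in> V}"
      "\<forall>x\<in>pts X. q x \<in> {y \<in> pts Y. f y \<in> V} \<longrightarrow> k x = h (q x)" by (elim bexE)
    have "(\<lambda>y. h (g y)) \<in> fs_reg Y' {y \<in> pts Y'. g y \<in> {y \<in> pts Y. f y \<in> V}}" by (rule morphism_reg[OF g oV h(1)])
    moreover have "{y \<in> pts Y'. g y \<in> {y \<in> pts Y. f y \<in> V}} = V"
      using openin_subset[OF V] fg morphism_pts[OF g] by auto
    ultimately have "(\<lambda>y. h (g y)) \<in> fs_reg Y' V" by simp
    moreover have "k x = h (g (q' x))" if x: "x \<in> pts X" "q' x \<in> V" for x
    proof -
      have "q x \<in> {y \<in> pts Y. f y \<in> V}" using x fq qY by simp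
      then show ?thesis using h(2) gq' x(1) by simp
    qed
    ultimately show "\<exists>h\<in>fs_reg Y' V. \<forall>x\<in>pts X. q' x \<in> V \<longrightarrow> k x = h (q' x)"
      by (intro bexI[of _ "\<lambda>y. h (g y)"]) simp_all
  qed
qed

theorem theoremB:
  fixes M M2 :: "'m::ab_group_add set"
    and \<Delta>\<^sub>0 \<Delta> :: "('m \<Rightarrow> real) set set"
  assumes "lattice_set M"
    and "sublattice M2 M"
    and "fan M \<Delta>\<^sub>0"
    and "\<Delta> \<subseteq> \<Delta>\<^sub>0"
    and "openin (fs_top (toric_variety M \<Delta>\<^sub>0)) (chart_union M \<Delta>\<^sub>0 \<Delta>)"
    and "locally_coherent_costring M M2 \<Delta>\<^sub>0 \<Delta>"
    and "\<forall>\<sigma>\<in>\<Delta>. strongly_convex (dual_proj M2 ` \<sigma>)"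
  shows "(\<exists>p. categorical_quotient (quotient_group M M2) torus_act
                (open_sub (toric_variety M \<Delta>\<^sub>0) (chart_union M \<Delta>\<^sub>0 \<Delta>))
                (toric_variety M2 (image_cones M2 \<Delta>)) p)
       \<and> (\<forall>(Y :: 'y fspace) q.
            categorical_quotient (quotient_group M M2) torus_act
              (open_sub (toric_variety M \<Delta>\<^sub>0) (chart_union M \<Delta>\<^sub>0 \<Delta>)) Y q \<longrightarrow>
            isomorphic Y (toric_variety M2 (image_cones M2 \<Delta>)) \<and>
            (geometric_quotient (quotient_group M M2) torus_act
               (open_sub (toric_variety M \<Delta>\<^sub>0) (chart_union M \<Delta>\<^sub>0 \<Delta>)) Y q \<longleftrightarrow>
             (\<forall>\<sigma>\<in>\<Delta>. dim (dual_proj M2 ` \<sigma>) = dim \<sigma>)))"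
proof (intro conjI allI impI)
  interpret toric_quotient M M2 "\<Delta>\<^sub>0" \<Delta> by unfold_locales fact+
  note cq0 = categorical_quotient_quot
  show "\<exists>p. categorical_quotient (quotient_group M M2) torus_act X Y p" using cq0 by blast
  fix Y' :: "'y fspace" and q
  assume cq: "categorical_quotient (quotient_group M M2) torus_act X Y' q"
  obtain f g where f: "morphism Y' Y f" and g: "morphism Y Y' g"
    and fq: "\<forall>x\<in>pts X. f (q x) = quot x" and gq: "\<forall>x\<in>pts X. g (quot x) = q x"
    and gf: "\<forall>y\<in>pts Y'. g (f y) = y" and fg: "\<forall>y\<in>pts Y. f (g y) = y"
    by (rule categorical_quotient_unique[OF cq cq0])
  show "isomorphic Y' Y" unfolding isomorphic_def
    by (intro exI[of _ f] exI[of _ g] conjI f g gf fg)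
  note cqD = cq[unfolded categorical_quotient_def] and cqD0 = cq0[unfolded categorical_quotient_def]
  have Y': "prevariety Y'" "morphism X Y' q" "invariant_on G torus_act (pts X) q"
    by (rule conjunct1[OF conjunct2[OF cqD]] conjunct1[OF conjunct2[OF conjunct2[OF cqD]]]
        conjunct1[OF conjunct2[OF conjunct2[OF conjunct2[OF cqD]]]])+
  have Y: "prevariety Y" "morphism X Y quot" "invariant_on G torus_act (pts X) quot"
    by (rule conjunct1[OF conjunct2[OF cqD0]] conjunct1[OF conjunct2[OF conjunct2[OF cqD0]]]
        conjunct1[OF conjunct2[OF conjunct2[OF conjunct2[OF cqD0]]]])+
  have "geometric_quotient G torus_act X Y' q \<longleftrightarrow> geometric_quotient G torus_act X Y quot"
  proof
    assume "geometric_quotient G torus_act X Y' q"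
    then show "geometric_quotient G torus_act X Y quot"
      by (rule geometric_quotient_isomorphic[OF _ Y f g fq gq gf fg])
  next
    assume "geometric_quotient G torus_act X Y quot"
    then show "geometric_quotient G torus_act X Y' q"
      by (rule geometric_quotient_isomorphic[OF _ Y' g f gq fq fg gf])
  qed
  then show "geometric_quotient (quotient_group M M2) torus_act X Y' q \<longleftrightarrow>
      (\<forall>\<sigma>\<in>\<Delta>. dim (dual_proj M2 ` \<sigma>) = dim \<sigma>)"
    unfolding geometric_quotient_iff_dim .
qed

end
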